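(* Let $\mathcal{H}$ be a finite central real hyperplane arrangement of rank $2$ with $m$ hyperplanes (and $m\ge 3$), with base region $B$. Then the interval $[\mathbbm{1},\Delta^2]$ in the pure shard monoid $\mathbf{P}^+(\mathcal{H},B)$ is a planar lattice whose rank generating function is $1+\sum_{k=1}^{m-1}\left(2\binom{m}{k}-2\right)q^k+q^m$ and which has exactly $m2^{m-2}$ maximal chains.
   Context: Rank of $\mathcal{H}$ = codimension of the intersection of its hyperplanes. Regions are the connected components of $\mathbb{R}^n\setminus\bigcup\mathcal{H}$; $\mathrm{inv}(C,C')$ is the set of hyperplanes separating $C,C'$; $B$ is a fixed region, $\mathrm{inv}(C)=\mathrm{inv}(B,C)$, $-C$ the region with $\mathrm{inv}(C,-C)=\mathcal{H}$; $\mathrm{Weak}(\mathcal{H},B)$ orders regions by inclusion of $\mathrm{inv}$. Salvetti complex: vertices are regions; one directed edge $D\to D'$ for each ordered pair of regions separated by exactly one hyperplane; for a cover $C'\lessdot C$, $e$ denotes the edge $C'\to C$ and $e^*$ the edge $C\to C'$. Positive galleries are directed edge paths, minimal if of length $|\mathrm{inv}(D,D')|$. For every codimension-2 face $F$ and region $C$ with $F\subseteq\overline C$, a 2-cell is glued along the two positive minimal galleries from $C$ to the region opposite $C$ about $F$ through regions whose closures contain $F$. $\pi_1(\mathrm{Sal}(\mathcal{H}),B)$ is its fundamental group based at $B$; $\mathrm{gal}(D,D')$ denotes any positive minimal gallery (all homotopic). For a cover $C'\lessdot C$ with edge $e$, $\ell_e:=\mathrm{gal}(B,C')\,e\,e^*\,\mathrm{gal}(B,C')^{-1}$.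 The pure shard monoid $\mathbf{P}^+(\mathcal{H},B)$ is the submonoid of $\pi_1(\mathrm{Sal}(\mathcal{H}),B)$ generated by all $\ell_e$, ordered by $p\le p'$ iff $p'=pq$ for some $q$ in the monoid. The full twist is $\Delta^2:=\mathrm{gal}(B,-B)\cdot\mathrm{gal}(-B,B)$. The interval is graded by the length of any word in the generators $\ell_e$ representing an element (this length is well defined). A finite poset is planar if its Hasse diagram can be drawn in the plane with each cover relation a curve with strictly increasing $y$-coordinate and no two curves meeting except at common endpoints. *)

theory Defs
  imports
    "HOL-Analysis.Analysis"
    "HOL-Algebra.Group"
    "HOL-Algebra.Lattice"
    "HOL-Computational_Algebra.Polynomial"
begin

section \<open>Central real hyperplane arrangements\<close>

definition central_arrangement :: "'a::euclidean_space set set \<Rightarrow> bool" where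
  "central_arrangement H \<longleftrightarrow>
     finite H \<and> (\<forall>h\<in>H. \<exists>a. a \<noteq> 0 \<and> h = {x. a \<bullet> x = 0})"

definition arrangement_rank :: "'a::euclidean_space set set \<Rightarrow> nat" where
  "arrangement_rank H = DIM('a) - dim (\<Inter>H)"

definition regions :: "'a::euclidean_space set set \<Rightarrow> 'a set set" where
  "regions H = components (- \<Union>H)"

definition separates :: "'a::euclidean_space set \<Rightarrow> 'a set \<Rightarrow> 'a set \<Rightarrow> bool" where
  "separates h C D \<longleftrightarrow>
     (\<exists>a. h = {x. a \<bullet> x = 0} \<and> (\<forall>x\<in>C. a \<bullet> x < 0) \<and> (\<forall>x\<in>D. a \<bullet> x > 0))"

definition sep_set :: "'a::euclidean_space set set \<Rightarrow> 'a set \<Rightarrow> 'a set \<Rightarrow> 'a set set" where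
  "sep_set H C D = {h \<in> H. separates h C D}"

definition opposite :: "'a::euclidean_space set set \<Rightarrow> 'a set \<Rightarrow> 'a set" where
  "opposite H C = (THE D. D \<in> regions H \<and> sep_set H C D = H)"

definition weak_order :: "'a::euclidean_space set set \<Rightarrow> 'a set \<Rightarrow> 'a set gorder" where
  "weak_order H B =
     \<lparr>carrier = regions H, eq = (=), le = (\<lambda>C D. sep_set H B C \<subseteq> sep_set H B D)\<rparr>"

definition covers :: "('b, 'c) gorder_scheme \<Rightarrow> 'b \<Rightarrow> 'b \<Rightarrow> bool" where
  "covers L x y \<longleftrightarrow> x \<in> carrier L \<and> y \<in> carrier L \<and> x \<sqsubset>\<^bsub>L\<^esub> y \<and>
     \<not> (\<exists>z\<in>carrier L. x \<sqsubset>\<^bsub>L\<^esub> z \<and> z \<sqsubset>\<^bsub>L\<^esub> y)"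

text \<open>Faces are closed here. The condition \<open>F \<noteq> {}\<close> only matters in dimension 1, where
  the empty face has affine dimension \<open>-1\<close>.\<close>

definition codim2_faces :: "'a::euclidean_space set set \<Rightarrow> 'a set set" where
  "codim2_faces H =
     {F. F \<noteq> {} \<and> aff_dim F = int DIM('a) - 2 \<and> (\<exists>C\<in>regions H. F face_of closure C)}"

definition opposite_about ::
    "'a::euclidean_space set set \<Rightarrow> 'a set \<Rightarrow> 'a set \<Rightarrow> 'a set" where
  "opposite_about H F C =
     (THE D. D \<in> regions H \<and> F \<subseteq> closure D \<and> sep_set H C D = {h \<in> H. F \<subseteq> h})"


section \<open>Positive galleries\<close>

definition sal_edges :: "'a::euclidean_space set set \<Rightarrow> ('a set \<times> 'a set) set" where
  "sal_edges H = {(D, D'). D \<in> regions H \<and> D' \<in> regions H \<and> card (sep_set H D D') = 1}"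

text \<open>There is at most one directed edge from one region to another, so a directed edge path
  is given by the nonempty list of regions it visits; its length is the length of the list
  minus one.\<close>

definition pos_gallery ::
    "'a::euclidean_space set set \<Rightarrow> 'a set \<Rightarrow> 'a set \<Rightarrow> 'a set list \<Rightarrow> bool" where
  "pos_gallery H D D' g \<longleftrightarrow> g \<noteq> [] \<and> hd g = D \<and> last g = D' \<and> set g \<subseteq> regions H \<and>
     successively (\<lambda>E E'. (E, E') \<in> sal_edges H) g"

definition min_gallery ::
    "'a::euclidean_space set set \<Rightarrow> 'a set \<Rightarrow> 'a set \<Rightarrow> 'a set list \<Rightarrow> bool" where
  "min_gallery H D D' g \<longleftrightarrow> pos_gallery H D D' g \<and> length g - 1 = card (sep_set H D D')"

definition gal :: "'a::euclidean_space set set \<Rightarrow> 'a set \<Rightarrow> 'a set \<Rightarrow> 'a set list" where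
  "gal H D D' = (SOME g. min_gallery H D D' g)"


section \<open>The Salvetti complex as a CW complex\<close>

text \<open>Points of the complex, by the open cell containing them: vertices, points of the open
  edges (parameter strictly between 0 and 1) and points of the open 2-cells (parameter in the
  open unit disc of the complex plane). There is one 2-cell for each pair \<open>(F, C)\<close>.\<close>

datatype 'a sal_point =
    Vertex "'a set"
  | Edge "'a set" "'a set" real
  | Cell "'a set" "'a set" complex

definition sal_cells :: "'a::euclidean_space set set \<Rightarrow> ('a set \<times> 'a set) set" where
  "sal_cells H = {(F, C). F \<in> codim2_faces H \<and> C \<in> regions H \<and> F \<subseteq> closure C}"

definition sal_points :: "'a::euclidean_space set set \<Rightarrow> 'a sal_point set" where
  "sal_points H =
     Vertex ` regions H
     \<union> {Edge D D' t |D D' t. (D, D') \<in> sal_edges H \<and> 0 < t \<and> t < 1}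
     \<union> {Cell F C z |F C z. (F, C) \<in> sal_cells H \<and> norm z < 1}"

text \<open>Concatenation and reversal as in \<^const>\<open>joinpaths\<close> and \<^const>\<open>reversepath\<close>, which are
  only available for types of class \<^class>\<open>topological_space\<close>.\<close>

definition path_concat :: "(real \<Rightarrow> 'b) \<Rightarrow> (real \<Rightarrow> 'b) \<Rightarrow> real \<Rightarrow> 'b"  (infixr \<open>\<cdot>\<close> 75) where
  "p \<cdot> q = (\<lambda>t. if t \<le> 1/2 then p (2 * t) else q (2 * t - 1))"

definition path_reverse :: "(real \<Rightarrow> 'b) \<Rightarrow> real \<Rightarrow> 'b" where
  "path_reverse p = (\<lambda>t. p (1 - t))"

definition edge_path :: "'a set \<Rightarrow> 'a set \<Rightarrow> real \<Rightarrow> 'a sal_point" where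
  "edge_path D D' t = (if t \<le> 0 then Vertex D else if t \<ge> 1 then Vertex D' else Edge D D' t)"

fun gallery_path :: "'a set list \<Rightarrow> real \<Rightarrow> 'a sal_point" where
  "gallery_path [] = undefined"
| "gallery_path [D] = (\<lambda>_. Vertex D)"
| "gallery_path [D, D'] = edge_path D D'"
| "gallery_path (D # D' # D'' # g) = edge_path D D' \<cdot> gallery_path (D' # D'' # g)"

definition cell_galleries ::
    "'a::euclidean_space set set \<Rightarrow> 'a set \<Rightarrow> 'a set \<Rightarrow> 'a set list set" where
  "cell_galleries H F C =
     {g. min_gallery H C (opposite_about H F C) g \<and> (\<forall>D\<in>set g. F \<subseteq> closure D)}"

text \<open>The set \<^const>\<open>cell_galleries\<close> has exactly two elements. The choice below only decides
  which of them is attached to the upper half of the boundary circle and which to the lower.\<close>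

definition cell_gallery_pair ::
    "'a::euclidean_space set set \<Rightarrow> 'a set \<Rightarrow> 'a set \<Rightarrow> 'a set list \<times> 'a set list" where
  "cell_gallery_pair H F C =
     (SOME gg. fst gg \<noteq> snd gg \<and> {fst gg, snd gg} = cell_galleries H F C)"

text \<open>On either half circle from \<open>1\<close> to \<open>-1\<close> the number \<open>(1 - Re z) / 2\<close> increases from
  0 to 1; so both halves run from \<open>C\<close> to the region opposite to \<open>C\<close> about \<open>F\<close>.\<close>

definition attaching_map ::
    "'a::euclidean_space set set \<Rightarrow> 'a set \<Rightarrow> 'a set \<Rightarrow> complex \<Rightarrow> 'a sal_point" where
  "attaching_map H F C z =
     (if Im z \<ge> 0 then gallery_path (fst (cell_gallery_pair H F C)) ((1 - Re z) / 2)
      else gallery_path (snd (cell_gallery_pair H F C)) ((1 - Re z) / 2))"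

definition cell_map ::
    "'a::euclidean_space set set \<Rightarrow> 'a set \<Rightarrow> 'a set \<Rightarrow> complex \<Rightarrow> 'a sal_point" where
  "cell_map H F C z = (if norm z < 1 then Cell F C z else attaching_map H F C z)"

text \<open>The quotient topology of the disjoint union of all vertices, closed edges and closed
  discs: a set is open iff its preimages under all characteristic maps are.\<close>

definition salvetti_open :: "'a::euclidean_space set set \<Rightarrow> 'a sal_point set \<Rightarrow> bool" where
  "salvetti_open H U \<longleftrightarrow> U \<subseteq> sal_points H \<and>
     (\<forall>(D, D')\<in>sal_edges H.
        openin (top_of_set {0..1}) {t \<in> {0..1}. edge_path D D' t \<in> U}) \<and>
     (\<forall>(F, C)\<in>sal_cells H.
        openin (top_of_set (cball 0 1)) {z \<in> cball 0 1. cell_map H F C z \<in> U})"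

definition salvetti :: "'a::euclidean_space set set \<Rightarrow> 'a sal_point topology" where
  "salvetti H = topology (salvetti_open H)"

lemma istopology_salvetti_open: "istopology (salvetti_open H)"
  unfolding istopology_def
proof (intro conjI allI impI)
  have Int: "openin X {t \<in> A. f t \<in> S \<inter> T}"
    if "openin X {t \<in> A. f t \<in> S}" "openin X {t \<in> A. f t \<in> T}"
    for X :: "'x topology" and A S T and f :: "'x \<Rightarrow> 'a sal_point"
    using openin_Int[OF that] by (rule back_subst) blast
  show "salvetti_open H (S \<inter> T)" if "salvetti_open H S" "salvetti_open H T" for S T
    using that unfolding salvetti_open_def case_prod_beta by (intro conjI ballI Int) blast+
next
  have Union: "openin X {t \<in> A. f t \<in> \<Union>K}"
    if "\<And>S. S \<in> K \<Longrightarrow> openin X {t \<in> A. f t \<in> S}"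
    for X :: "'x topology" and A K and f :: "'x \<Rightarrow> 'a sal_point"
  proof -
    have "{t \<in> A. f t \<in> \<Union>K} = (\<Union>S\<in>K. {t \<in> A. f t \<in> S})" by blast
    with that show ?thesis by auto
  qed
  show "salvetti_open H (\<Union>K)" if "\<forall>S\<in>K. salvetti_open H S" for K
    using that unfolding salvetti_open_def case_prod_beta by (intro conjI ballI Union) blast+
qed

lemma openin_salvetti: "openin (salvetti H) U \<longleftrightarrow> salvetti_open H U"
  by (simp add: salvetti_def topology_inverse' istopology_salvetti_open)


section \<open>The fundamental group\<close>

text \<open>As in \<^const>\<open>pathin\<close>, a path is a function on the reals of which only the values on
  \<open>{0..1}\<close> matter. The product of two classes is the class of the concatenation of any
  representatives, the left factor being traversed first.\<close>

definition loops :: "'b topology \<Rightarrow> 'b \<Rightarrow> (real \<Rightarrow> 'b) set" where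
  "loops X x = {p. pathin X p \<and> p 0 = x \<and> p 1 = x}"

definition loop_class :: "'b topology \<Rightarrow> 'b \<Rightarrow> (real \<Rightarrow> 'b) \<Rightarrow> (real \<Rightarrow> 'b) set" where
  "loop_class X x p =
     {q \<in> loops X x. homotopic_with (\<lambda>r. r 0 = x \<and> r 1 = x) (top_of_set {0..1}) X p q}"

definition fundamental_group :: "'b topology \<Rightarrow> 'b \<Rightarrow> (real \<Rightarrow> 'b) set monoid" where
  "fundamental_group X x =
     \<lparr>carrier = loop_class X x ` loops X x,
      mult = (\<lambda>P Q. \<Union>p\<in>P. \<Union>q\<in>Q. loop_class X x (p \<cdot> q)),
      one = loop_class X x (\<lambda>_. x)\<rparr>"

abbreviation sal_group ::
    "'a::euclidean_space set set \<Rightarrow> 'a set \<Rightarrow> (real \<Rightarrow> 'a sal_point) set monoid" where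
  "sal_group H B \<equiv> fundamental_group (salvetti H) (Vertex B)"


section \<open>The pure shard monoid\<close>

inductive_set submonoid_generated :: "('b, 'c) monoid_scheme \<Rightarrow> 'b set \<Rightarrow> 'b set"
  for G (structure) and S where
  one: "\<one> \<in> submonoid_generated G S"
| incl: "s \<in> S \<Longrightarrow> s \<in> submonoid_generated G S"
| mult: "x \<in> submonoid_generated G S \<Longrightarrow> y \<in> submonoid_generated G S
    \<Longrightarrow> x \<otimes> y \<in> submonoid_generated G S"

text \<open>The loop \<open>\<ell>\<^sub>e\<close> for the edge \<open>e\<close> from \<open>C'\<close> to \<open>C\<close>.\<close>

definition edge_loop ::
    "'a::euclidean_space set set \<Rightarrow> 'a set \<Rightarrow> 'a set \<Rightarrow> 'a set \<Rightarrow> (real \<Rightarrow> 'a sal_point) set" where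
  "edge_loop H B C' C = loop_class (salvetti H) (Vertex B)
     (gallery_path (gal H B C') \<cdot> edge_path C' C \<cdot> edge_path C C' \<cdot>
      path_reverse (gallery_path (gal H B C')))"

definition shard_generators ::
    "'a::euclidean_space set set \<Rightarrow> 'a set \<Rightarrow> (real \<Rightarrow> 'a sal_point) set set" where
  "shard_generators H B = {edge_loop H B C' C |C' C. covers (weak_order H B) C' C}"

definition pure_shard_monoid ::
    "'a::euclidean_space set set \<Rightarrow> 'a set \<Rightarrow> (real \<Rightarrow> 'a sal_point) set set" where
  "pure_shard_monoid H B = submonoid_generated (sal_group H B) (shard_generators H B)"

definition pure_shard_order ::
    "'a::euclidean_space set set \<Rightarrow> 'a set \<Rightarrow> (real \<Rightarrow> 'a sal_point) set gorder" where
  "pure_shard_order H B =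
     \<lparr>carrier = pure_shard_monoid H B, eq = (=),
      le = (\<lambda>p p'. \<exists>q\<in>pure_shard_monoid H B. p' = p \<otimes>\<^bsub>sal_group H B\<^esub> q)\<rparr>"

definition full_twist ::
    "'a::euclidean_space set set \<Rightarrow> 'a set \<Rightarrow> (real \<Rightarrow> 'a sal_point) set" where
  "full_twist H B = loop_class (salvetti H) (Vertex B)
     (gallery_path (gal H B (opposite H B)) \<cdot> gallery_path (gal H (opposite H B) B))"

definition twist_interval ::
    "'a::euclidean_space set set \<Rightarrow> 'a set \<Rightarrow> (real \<Rightarrow> 'a sal_point) set gorder" where
  "twist_interval H B =
     (pure_shard_order H B)
       \<lparr>carrier := \<lbrace>\<one>\<^bsub>sal_group H B\<^esub>..full_twist H B\<rbrace>\<^bsub>pure_shard_order H B\<^esub>\<rparr>"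

definition is_word_length ::
    "'a::euclidean_space set set \<Rightarrow> 'a set \<Rightarrow> (real \<Rightarrow> 'a sal_point) set \<Rightarrow> nat \<Rightarrow> bool" where
  "is_word_length H B p k \<longleftrightarrow>
     (\<exists>ws. set ws \<subseteq> shard_generators H B \<and> length ws = k \<and>
        foldr (\<lambda>x y. x \<otimes>\<^bsub>sal_group H B\<^esub> y) ws \<one>\<^bsub>sal_group H B\<^esub> = p)"

definition shard_length ::
    "'a::euclidean_space set set \<Rightarrow> 'a set \<Rightarrow> (real \<Rightarrow> 'a sal_point) set \<Rightarrow> nat" where
  "shard_length H B p = (THE k. is_word_length H B p k)"


section \<open>Finite posets\<close>

definition rank_gen_fun :: "('b, 'c) gorder_scheme \<Rightarrow> ('b \<Rightarrow> nat) \<Rightarrow> int poly" where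
  "rank_gen_fun L rk = (\<Sum>x\<in>carrier L. monom 1 (rk x))"

definition max_chains :: "('b, 'c) gorder_scheme \<Rightarrow> 'b set set" where
  "max_chains L = {K. pred_on.maxchain (carrier L) (le L) K}"

definition planar_poset :: "('b, 'c) gorder_scheme \<Rightarrow> bool" where
  "planar_poset L \<longleftrightarrow> finite (carrier L) \<and>
     (\<exists>(pos :: 'b \<Rightarrow> real \<times> real) (crv :: 'b \<Rightarrow> 'b \<Rightarrow> real \<Rightarrow> real \<times> real).
        inj_on pos (carrier L) \<and>
        (\<forall>x y. covers L x y \<longrightarrow>
           path (crv x y) \<and> pathstart (crv x y) = pos x \<and> pathfinish (crv x y) = pos y \<and>
           strict_mono_on {0..1} (\<lambda>t. snd (crv x y t)) \<and>
           path_image (crv x y) \<inter> pos ` carrier L = {pos x, pos y}) \<and>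
        (\<forall>x y x' y'. covers L x y \<longrightarrow> covers L x' y' \<longrightarrow> (x, y) \<noteq> (x', y') \<longrightarrow>
           path_image (crv x y) \<inter> path_image (crv x' y') \<subseteq> {pos x, pos y} \<inter> {pos x', pos y'}))"

end

theory Submission
  imports Defs "HOL-Complex_Analysis.Winding_Numbers" "HOL-Library.Nat_Bijection"
begin

text \<open>In rank two the regions form a cycle of length \<open>2 m\<close>. Contracting the spanning tree that consists
  of the minimal galleries from the base region presents the fundamental group of the Salvetti
  complex by generators \<open>x 0, \<dots>, x (m - 1)\<close> and \<open>y 0, \<dots>, y (m - 1)\<close>, the loops around the edges on the
  two sides of the cycle, subject to the pencil relations
  \<open>y 0 \<cdots> y (i - 1) = x (i - 1) \<cdots> x 0\<close> and \<open>y i \<cdots> y (m - 1) = x (m - 1) \<cdots> x i\<close>, one for each 2-cell. These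
  generators are exactly the shard generators, and the full twist is \<open>x (m - 1) \<cdots> x 0\<close>.

  A factorization of the full twist uses every index once, as one sees by mapping the group to the
  integers. Any three indices \<open>i < j < k\<close> moreover give a homomorphism onto the free group of rank two,
  here the fundamental group of the twice punctured plane, which kills all other generators. It forces
  the indices of a factorization into the cyclic order of the \<open>x\<close> or of the \<open>y\<close>, so that the
  prefixes are the products \<open>X S\<close> and \<open>Y S\<close> over subsets \<open>S\<close> of \<open>{..<m}\<close> in decreasing and in increasing
  order, which coincide just for initial and final segments. So the interval is a poset built from
  two copies of the power set of \<open>{..<m}\<close>, with \<open>2 (m choose k) - 2\<close> elements of rank \<open>k\<close>. For the
  lattice property, the chain count and a planar drawing only these combinatorics are needed.\<close>

section \<open>Path homotopy in abstract topologies\<close>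

text \<open>The presentation by generators and relations is never established in full. It is enough
  that the pencil relations hold, which the 2-cells give directly, and that each solution of them in
  the fundamental group of the twice punctured plane comes from a continuous map. That map is built
  cell by cell: edges go to loops representing the solution, and a relation is what allows a disc to
  be filled in. Elements of the interval are only ever told apart by their images there. For a
  triple \<open>i < j < k\<close> the images are forced by the wish to kill the full twist. With
  \<alpha> for \<open>i\<close> and \<gamma> for \<open>k\<close>, the letter \<open>x j\<close>
  must go to the inverse of \<alpha> \<gamma> and \<open>y j\<close> to the inverse of \<gamma>
  \<alpha>; noncommutativity is exactly what separates \<open>x j\<close> from \<open>y j\<close>.
  The steps of the poset reflect two ways to lengthen a decreasing x-word: append a smaller x, or,
  if the word ends with all indices below \<open>l\<close>, rewrite that tail as an increasing
  y-word and append \<open>y l\<close>. The reflection of \<open>i\<close> to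
  \<open>m - 1 - i\<close> exchanges the two sides, so facts on \<open>Y\<close> come from facts on
  \<open>X\<close>.\<close>

definition path_hom :: "'b topology \<Rightarrow> (real \<Rightarrow> 'b) \<Rightarrow> (real \<Rightarrow> 'b) \<Rightarrow> bool" where
  "path_hom X p q \<longleftrightarrow>
     homotopic_with (\<lambda>r. r 0 = p 0 \<and> r 1 = p 1) (top_of_set {0..1}) X p q"

lemma path_hom_ends:
  assumes "path_hom X p q" shows "q 0 = p 0" "q 1 = p 1"
  using homotopic_with_imp_property[OF assms[unfolded path_hom_def]] by auto

lemma path_hom_pathin:
  assumes "path_hom X p q" shows "pathin X p" "pathin X q"
  using homotopic_with_imp_continuous_maps[OF assms[unfolded path_hom_def]]
  by (auto simp: pathin_def)

lemma path_hom_refl: "pathin X p \<Longrightarrow> path_hom X p p"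
  by (simp add: path_hom_def pathin_def)

lemma path_hom_sym: "path_hom X p q \<Longrightarrow> path_hom X q p"
  using path_hom_ends[of X p q] unfolding path_hom_def
  by (simp add: homotopic_with_sym)

lemma path_hom_trans [trans]: "path_hom X p q \<Longrightarrow> path_hom X q r \<Longrightarrow> path_hom X p r"
  using path_hom_ends[of X p q] unfolding path_hom_def
  by (auto intro: homotopic_with_trans)

lemma path_hom_compose:
  assumes "path_hom X p q" "continuous_map X Y f"
  shows "path_hom Y (f \<circ> p) (f \<circ> q)"
  using assms unfolding path_hom_def
  by (elim homotopic_with_compose_continuous_map_left) auto

text \<open>A straight-line homotopy between \<open>g\<close> and \<open>h\<close> in the convex set
  \<open>S\<close>, pushed forward by \<open>f\<close>. With an interval for \<open>S\<close> it
  yields the reparametrisation laws below; with the closed disc it turns a 2-cell into a homotopy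
  between its two boundary galleries. Values are compared only on \<open>{0..1}\<close>, as nothing
  is known of a path elsewhere.\<close>

lemma path_hom_convexI:
  fixes g h :: "real \<Rightarrow> 'c::real_normed_vector"
  assumes "convex S" "continuous_map (top_of_set S) X f"
    and "path g" "path_image g \<subseteq> S" "path h" "path_image h \<subseteq> S"
    and "pathstart g = pathstart h" "pathfinish g = pathfinish h"
    and p: "\<And>t. 0 \<le> t \<Longrightarrow> t \<le> 1 \<Longrightarrow> p t = f (g t)"
    and q: "\<And>t. 0 \<le> t \<Longrightarrow> t \<le> 1 \<Longrightarrow> q t = f (h t)"
  shows "path_hom X p q"
proof -
  have "homotopic_paths S g h"
  proof (rule homotopic_paths_linear)
    show "closed_segment (g t) (h t) \<subseteq> S" if "t \<in> {0..1}" for t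
      using assms that by (intro closed_segment_subset) (auto simp: path_image_def)
  qed (use assms in auto)
  hence "homotopic_with (\<lambda>r. r 0 = f (g 0) \<and> r 1 = f (g 1)) (top_of_set {0..1}) X (f \<circ> g) (f \<circ> h)"
    unfolding homotopic_paths_def
    by (rule homotopic_with_compose_continuous_map_left)
       (use assms in \<open>auto simp: pathstart_def pathfinish_def\<close>)
  moreover have "p 0 = f (g 0)" "p 1 = f (g 1)" by (simp_all add: p)
  ultimately show ?thesis unfolding path_hom_def
    by (auto intro: homotopic_with_eq simp: p q)
qed

lemma path_hom_concat:
  assumes "path_hom X p p'" "path_hom X q q'" "p 1 = q 0"
  shows "path_hom X (p \<cdot> q) (p' \<cdot> q')"
proof -
  let ?I = "top_of_set {0..1::real}"
  let ?Q = "prod_topology ?I ?I"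
  obtain h where h: "continuous_map ?Q X h" "\<And>x. h (0, x) = p x" "\<And>x. h (1, x) = p' x"
      "\<And>t. t \<in> {0..1} \<Longrightarrow> h (t, 0) = p 0 \<and> h (t, 1) = p 1"
    using assms(1) unfolding path_hom_def homotopic_with_def by auto
  obtain k where k: "continuous_map ?Q X k" "\<And>x. k (0, x) = q x" "\<And>x. k (1, x) = q' x"
      "\<And>t. t \<in> {0..1} \<Longrightarrow> k (t, 0) = q 0 \<and> k (t, 1) = q 1"
    using assms(2) unfolding path_hom_def homotopic_with_def by auto
  \<comment> \<open>The two homotopies are placed side by side in the path parameter. They agree on
    the line \<open>snd z = 1/2\<close> because both are constant there, with the common value
    \<open>p 1 = q 0\<close>.\<close>
  let ?H = "\<lambda>z. if snd z \<le> 1/2 then h (fst z, 2 * snd z) else k (fst z, 2 * snd z - 1)"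
  have Q: "?Q = top_of_set ({0..1} \<times> {0..1})"
    by (simp add: subtopology_Times)
  have "continuous_map ?Q X ?H"
  proof (rule continuous_map_cases_le)
    show "continuous_map ?Q euclideanreal snd"
      unfolding Q by (auto intro: continuous_intros)
    show "continuous_map ?Q euclideanreal (\<lambda>z. 1/2)" by simp
    show "h (fst x, 2 * snd x) = k (fst x, 2 * snd x - 1)"
      if "x \<in> topspace ?Q" "snd x = 1/2" for x
      using that h(4)[of "fst x"] k(4)[of "fst x"] assms(3) by (cases x) (auto simp: mult.commute[of 2])
    have "continuous_map (subtopology ?Q {x \<in> topspace ?Q. snd x \<le> 1/2}) ?Q (\<lambda>z. (fst z, 2 * snd z))"
      unfolding Q subtopology_subtopology by (auto intro!: continuous_intros)
    from continuous_map_compose[OF this h(1)]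
    show "continuous_map (subtopology ?Q {x \<in> topspace ?Q. snd x \<le> 1/2}) X (\<lambda>z. h (fst z, 2 * snd z))"
      by (simp add: o_def)
    have "continuous_map (subtopology ?Q {x \<in> topspace ?Q. 1/2 \<le> snd x}) ?Q (\<lambda>z. (fst z, 2 * snd z - 1))"
      unfolding Q subtopology_subtopology by (auto intro!: continuous_intros)
    from continuous_map_compose[OF this k(1)]
    show "continuous_map (subtopology ?Q {x \<in> topspace ?Q. 1/2 \<le> snd x}) X (\<lambda>z. k (fst z, 2 * snd z - 1))"
      by (simp add: o_def)
  qed
  thus ?thesis unfolding path_hom_def homotopic_with_def
    by (intro exI[of _ ?H]) (auto simp: h k path_concat_def)
qed

lemma pathin_concat: "pathin X p \<Longrightarrow> pathin X q \<Longrightarrow> p 1 = q 0 \<Longrightarrow> pathin X (p \<cdot> q)"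
  using path_hom_pathin(1)[OF path_hom_concat[OF path_hom_refl path_hom_refl]] by blast

lemma concat_ends [simp]: "(p \<cdot> q) 0 = p 0" "(p \<cdot> q) 1 = q 1"
  by (simp_all add: path_concat_def)

lemma reverse_ends [simp]: "path_reverse p 0 = p 1" "path_reverse p 1 = p 0"
  by (simp_all add: path_reverse_def)

lemma reverse_reverse [simp]: "path_reverse (path_reverse p) = p"
  by (simp add: path_reverse_def)

lemma compose_concat: "f \<circ> (p \<cdot> q) = (f \<circ> p) \<cdot> (f \<circ> q)"
  by (auto simp: path_concat_def)

lemma pathin_reverse: "pathin X p \<Longrightarrow> pathin X (path_reverse p)"
proof -
  assume "pathin X p"
  moreover have "continuous_map (top_of_set {0..1}) (top_of_set {0..1}) (\<lambda>t::real. 1 - t)"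
    by (auto intro!: continuous_intros)
  ultimately have "continuous_map (top_of_set {0..1}) X (p \<circ> (\<lambda>t. 1 - t))"
    unfolding pathin_def by (intro continuous_map_compose)
  thus ?thesis by (simp add: pathin_def path_reverse_def o_def)
qed

lemma pathin_const: "x \<in> topspace X \<Longrightarrow> pathin X (\<lambda>_. x)"
  by (simp add: pathin_def)

lemma pathin_topspace: "pathin X p \<Longrightarrow> 0 \<le> t \<Longrightarrow> t \<le> 1 \<Longrightarrow> p t \<in> topspace X"
  unfolding pathin_def using continuous_map_image_subset_topspace by fastforce

lemma path_hom_assoc:
  assumes "pathin X p" "pathin X q" "pathin X r" "p 1 = q 0" "q 1 = r 0"
  shows "path_hom X ((p \<cdot> q) \<cdot> r) (p \<cdot> (q \<cdot> r))"
proof -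
  \<comment> \<open>\<open>F\<close> runs through the three paths on \<open>{0..3}\<close> at unit
    speed; both bracketings are \<open>F\<close> after a piecewise linear path from 0 to 3.\<close>
  define F where "F = (\<lambda>t. if t \<le> 1 then p t else if t \<le> 2 then q (t - 1) else r (t - 2))"
  let ?I = "top_of_set {0..3::real}"
  have sub: "continuous_map (subtopology (top_of_set A) S) X (\<lambda>t. s (t - c))"
    if "pathin X s" "A \<inter> S \<subseteq> {c..c+1}" for s and A S :: "real set" and c :: real
  proof -
    have "continuous_map (subtopology (top_of_set A) S) (top_of_set {0..1}) (\<lambda>t. t - c)"
      unfolding subtopology_subtopology using that(2) by (auto intro!: continuous_intros)
    hence "continuous_map (subtopology (top_of_set A) S) X (s \<circ> (\<lambda>t. t - c))"
      using that(1) unfolding pathin_def by (rule continuous_map_compose)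
    thus ?thesis by (simp add: o_def)
  qed
  have "continuous_map ?I X F" unfolding F_def
  proof (rule continuous_map_cases_le)
    show "continuous_map (subtopology ?I {x \<in> topspace ?I. x \<le> 1}) X p"
      using sub[OF assms(1), of "{0..3}" "{x \<in> topspace ?I. x \<le> 1}" 0] by fastforce
    show "continuous_map (subtopology ?I {x \<in> topspace ?I. 1 \<le> x}) X
       (\<lambda>t. if t \<le> 2 then q (t - 1) else r (t - 2))"
      unfolding subtopology_subtopology
    proof (rule continuous_map_cases_le, goal_cases)
      case 3 show ?case by (rule sub[OF assms(2)]) auto
      case 4 show ?case by (rule sub[OF assms(3)]) auto
    qed (use assms in auto)
  qed (use assms in auto)
  thus ?thesis
    by (rule path_hom_convexI[where g = "(linepath 0 1 +++ linepath 1 2) +++ linepath 2 3" and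
          h = "linepath 0 1 +++ (linepath 1 2 +++ linepath 2 3)", OF convex_real_interval(5)])
       (simp_all add: path_image_join closed_segment_eq_real_ivl assms,
        auto simp: F_def path_concat_def joinpaths_def linepath_def assms)
qed

lemma path_hom_const_left:
  assumes "pathin X p" shows "path_hom X ((\<lambda>_. p 0) \<cdot> p) p"
  by (rule path_hom_convexI[OF _ assms[unfolded pathin_def], where g = "linepath 0 0 +++ linepath 0 1" and
          h = "linepath 0 1"])
     (simp_all add: path_image_join closed_segment_eq_real_ivl,
      simp_all add: path_concat_def joinpaths_def linepath_def)

lemma path_hom_const_right:
  assumes "pathin X p" shows "path_hom X (p \<cdot> (\<lambda>_. p 1)) p"
  by (rule path_hom_convexI[OF _ assms[unfolded pathin_def], where g = "linepath 0 1 +++ linepath 1 1" and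
          h = "linepath 0 1"])
     (simp_all add: path_image_join closed_segment_eq_real_ivl,
      simp_all add: path_concat_def joinpaths_def linepath_def)

lemma path_hom_inverse_right:
  assumes "pathin X p" shows "path_hom X (p \<cdot> path_reverse p) (\<lambda>_. p 0)"
  by (rule path_hom_convexI[OF _ assms[unfolded pathin_def], where g = "linepath 0 1 +++ linepath 1 0" and
          h = "linepath 0 0"])
     (simp_all add: path_image_join closed_segment_eq_real_ivl,
      simp_all add: path_concat_def path_reverse_def joinpaths_def linepath_def)

lemma path_hom_inverse_left:
  assumes "pathin X p" shows "path_hom X (path_reverse p \<cdot> p) (\<lambda>_. p 1)"
  using path_hom_inverse_right[OF pathin_reverse[OF assms]] by simp


section \<open>The fundamental group is a group\<close>

lemma loop_class_alt:
  assumes "p \<in> loops X x"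
  shows "loop_class X x p = {q. path_hom X p q}"
proof -
  have "p 0 = x" "p 1 = x" using assms by (simp_all add: loops_def)
  moreover have "q \<in> loops X x" if "path_hom X p q" for q
    using path_hom_pathin(2)[OF that] path_hom_ends[OF that] assms by (simp add: loops_def)
  ultimately show ?thesis by (auto simp: loop_class_def path_hom_def)
qed

lemma loop_class_eq_iff:
  assumes "p \<in> loops X x" "q \<in> loops X x"
  shows "loop_class X x p = loop_class X x q \<longleftrightarrow> path_hom X p q"
proof
  assume "loop_class X x p = loop_class X x q"
  moreover have "path_hom X q q" using assms(2) by (simp add: loops_def path_hom_refl)
  ultimately show "path_hom X p q" using assms by (auto simp: loop_class_alt)
next
  assume "path_hom X p q"
  thus "loop_class X x p = loop_class X x q"
    using assms by (auto simp: loop_class_alt dest: path_hom_sym path_hom_trans)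
qed

lemma concat_loops: "p \<in> loops X x \<Longrightarrow> q \<in> loops X x \<Longrightarrow> p \<cdot> q \<in> loops X x"
  by (auto simp: loops_def pathin_concat)

lemma reverse_loops: "p \<in> loops X x \<Longrightarrow> path_reverse p \<in> loops X x"
  by (auto simp: loops_def pathin_reverse)

lemma const_loops: "x \<in> topspace X \<Longrightarrow> (\<lambda>_. x) \<in> loops X x"
  by (auto simp: loops_def pathin_const)

lemma loop_class_mult:
  assumes "p \<in> loops X x" "q \<in> loops X x"
  shows "loop_class X x p \<otimes>\<^bsub>fundamental_group X x\<^esub> loop_class X x q = loop_class X x (p \<cdot> q)"
proof -
  \<comment> \<open>The union over all representatives in the definition of the product collapses,
    because all these concatenations have the same class.\<close>
  have eq: "loop_class X x (p' \<cdot> q') = loop_class X x (p \<cdot> q)"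
    if "p' \<in> loop_class X x p" "q' \<in> loop_class X x q" for p' q'
  proof -
    have h: "path_hom X p p'" "path_hom X q q'" "p' \<in> loops X x" "q' \<in> loops X x"
      using that assms by (auto simp: loop_class_alt loop_class_def[of X x p] loop_class_def[of X x q] path_hom_def loops_def)
    hence "path_hom X (p \<cdot> q) (p' \<cdot> q')"
      using assms by (intro path_hom_concat) (auto simp: loops_def)
    thus ?thesis using h(3,4) assms by (simp add: loop_class_eq_iff concat_loops path_hom_sym)
  qed
  have "p \<in> loop_class X x p" "q \<in> loop_class X x q"
    using assms by (auto simp: loop_class_alt loops_def intro: path_hom_refl)
  moreover have "(\<Union>p'\<in>loop_class X x p. \<Union>q'\<in>loop_class X x q. loop_class X x (p' \<cdot> q')) =
      (\<Union>p'\<in>loop_class X x p. \<Union>q'\<in>loop_class X x q. loop_class X x (p \<cdot> q))"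
    by (simp add: eq)
  ultimately show ?thesis unfolding fundamental_group_def by auto
qed

lemma loop_class_carrier: "p \<in> loops X x \<Longrightarrow> loop_class X x p \<in> carrier (fundamental_group X x)"
  by (simp add: fundamental_group_def)

lemma fundamental_group_carrierE:
  assumes "P \<in> carrier (fundamental_group X x)"
  obtains p where "p \<in> loops X x" "P = loop_class X x p"
  using assms by (auto simp: fundamental_group_def)

lemma fundamental_group_one: "\<one>\<^bsub>fundamental_group X x\<^esub> = loop_class X x (\<lambda>_. x)"
  by (simp add: fundamental_group_def)

lemma group_fundamental_group:
  assumes x: "x \<in> topspace X"
  shows "group (fundamental_group X x)"
proof (rule groupI)
  fix P Q R assume "P \<in> carrier (fundamental_group X x)" "Q \<in> carrier (fundamental_group X x)"
     "R \<in> carrier (fundamental_group X x)"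
  then obtain p q r where p: "p \<in> loops X x" "P = loop_class X x p"
     "q \<in> loops X x" "Q = loop_class X x q" "r \<in> loops X x" "R = loop_class X x r"
    by (metis fundamental_group_carrierE)
  have "path_hom X ((p \<cdot> q) \<cdot> r) (p \<cdot> (q \<cdot> r))"
    using p by (intro path_hom_assoc) (auto simp: loops_def)
  thus "P \<otimes>\<^bsub>fundamental_group X x\<^esub> Q \<otimes>\<^bsub>fundamental_group X x\<^esub> R =
       P \<otimes>\<^bsub>fundamental_group X x\<^esub> (Q \<otimes>\<^bsub>fundamental_group X x\<^esub> R)"
    using p by (simp add: loop_class_mult loop_class_eq_iff concat_loops)
next
  fix P assume "P \<in> carrier (fundamental_group X x)"
  then obtain p where p: "p \<in> loops X x" "P = loop_class X x p" by (rule fundamental_group_carrierE)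
  show "\<one>\<^bsub>fundamental_group X x\<^esub> \<otimes>\<^bsub>fundamental_group X x\<^esub> P = P"
    using p x path_hom_const_left[of X p]
    by (simp add: fundamental_group_one loop_class_mult concat_loops const_loops loop_class_eq_iff)
       (simp add: loops_def)
  show "\<exists>Q\<in>carrier (fundamental_group X x). Q \<otimes>\<^bsub>fundamental_group X x\<^esub> P = \<one>\<^bsub>fundamental_group X x\<^esub>"
  proof
    have "path_hom X (path_reverse p \<cdot> p) (\<lambda>_. x)"
      using path_hom_inverse_left[of X p] p by (auto simp: loops_def)
    thus "loop_class X x (path_reverse p) \<otimes>\<^bsub>fundamental_group X x\<^esub> P = \<one>\<^bsub>fundamental_group X x\<^esub>"
      using p x by (simp add: fundamental_group_one loop_class_mult concat_loops const_loops loop_class_eq_iff reverse_loops)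
    show "loop_class X x (path_reverse p) \<in> carrier (fundamental_group X x)"
      using p by (simp add: loop_class_carrier reverse_loops)
  qed
next
  fix P Q assume "P \<in> carrier (fundamental_group X x)" "Q \<in> carrier (fundamental_group X x)"
  then obtain p q where p: "p \<in> loops X x" "P = loop_class X x p"
     "q \<in> loops X x" "Q = loop_class X x q"
    by (metis fundamental_group_carrierE)
  thus "P \<otimes>\<^bsub>fundamental_group X x\<^esub> Q \<in> carrier (fundamental_group X x)"
    by (simp add: loop_class_mult loop_class_carrier concat_loops)
qed (simp add: fundamental_group_one loop_class_carrier const_loops x)

text \<open>On a class, the induced homomorphism acts through a chosen representative;
  \<open>path_hom_compose\<close> makes the choice immaterial.\<close>

lemma fundamental_group_induced:
  assumes f: "continuous_map X Y f" and y: "f x = y"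
  shows "\<exists>\<phi> \<in> hom (fundamental_group X x) (fundamental_group Y y).
           \<forall>p \<in> loops X x. f \<circ> p \<in> loops Y y \<and> \<phi> (loop_class X x p) = loop_class Y y (f \<circ> p)"
proof -
  define \<phi> where "\<phi> = (\<lambda>P. loop_class Y y (f \<circ> (SOME p. p \<in> loops X x \<and> P = loop_class X x p)))"
  have l: "f \<circ> p \<in> loops Y y" if "p \<in> loops X x" for p
  proof -
    have "continuous_map (top_of_set {0..1}) Y (f \<circ> p)"
      using that f by (intro continuous_map_compose) (auto simp: loops_def pathin_def)
    thus ?thesis using that y by (auto simp: loops_def pathin_def)
  qed
  have e: "\<phi> (loop_class X x p) = loop_class Y y (f \<circ> p)" if p: "p \<in> loops X x" for p
  proof -
    define q where "q = (SOME q. q \<in> loops X x \<and> loop_class X x p = loop_class X x q)"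
    have q: "q \<in> loops X x \<and> loop_class X x p = loop_class X x q"
      unfolding q_def by (rule someI[of _ p]) (use p in auto)
    hence "path_hom X p q" using loop_class_eq_iff[OF p, of q] by blast
    hence "path_hom X q p" by (rule path_hom_sym)
    hence "path_hom Y (f \<circ> q) (f \<circ> p)" by (rule path_hom_compose[OF _ f])
    hence "loop_class Y y (f \<circ> q) = loop_class Y y (f \<circ> p)" using p q l by (simp add: loop_class_eq_iff)
    thus ?thesis by (simp add: \<phi>_def q_def)
  qed
  have "\<phi> \<in> hom (fundamental_group X x) (fundamental_group Y y)"
  proof (rule homI)
    fix P assume "P \<in> carrier (fundamental_group X x)"
    then obtain p where p: "p \<in> loops X x" "P = loop_class X x p" by (rule fundamental_group_carrierE)
    thus "\<phi> P \<in> carrier (fundamental_group Y y)" by (simp add: e l loop_class_carrier)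
  next
    fix P Q assume "P \<in> carrier (fundamental_group X x)" "Q \<in> carrier (fundamental_group X x)"
    then obtain p q where p: "p \<in> loops X x" "P = loop_class X x p"
      "q \<in> loops X x" "Q = loop_class X x q"
      by (metis fundamental_group_carrierE)
    thus "\<phi> (P \<otimes>\<^bsub>fundamental_group X x\<^esub> Q) = \<phi> P \<otimes>\<^bsub>fundamental_group Y y\<^esub> \<phi> Q"
      by (simp add: loop_class_mult e l concat_loops compose_concat)
  qed
  with e l show ?thesis by blast
qed

section \<open>The doubly punctured plane\<close>

text \<open>The sheets over \<open>T \<inter> U\<close> are the old sheets cut down to the preimage
  of \<open>U\<close>. This is meant for the exponential map over the plane without 0, restricted to
  the plane without 0 and 1.\<close>

lemma covering_space_restrict:
  assumes cov: "covering_space C p S" and U: "openin (top_of_set S) U"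
  shows "covering_space (C \<inter> p -` U) p U"
  unfolding covering_space_def
proof (intro conjI ballI)
  have US: "U \<subseteq> S" using U openin_imp_subset by blast
  show "continuous_on (C \<inter> p -` U) p"
    using covering_space_imp_continuous[OF cov] continuous_on_subset by blast
  show "p ` (C \<inter> p -` U) = U"
    using covering_space_imp_surjective[OF cov] US by auto
  fix x assume "x \<in> U"
  hence "x \<in> S" using US by blast
  with cov have "\<exists>T. x \<in> T \<and> openin (top_of_set S) T \<and>
      (\<exists>v. \<Union>v = C \<inter> p -` T \<and> (\<forall>u\<in>v. openin (top_of_set C) u) \<and>
        pairwise disjnt v \<and> (\<forall>u\<in>v. \<exists>q. homeomorphism u T p q))"
    unfolding covering_space_def by (elim conjE) (erule bspec)
  then obtain T v where T: "x \<in> T" "openin (top_of_set S) T" "\<Union>v = C \<inter> p -` T"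
      "\<And>u. u \<in> v \<Longrightarrow> openin (top_of_set C) u" "pairwise disjnt v"
      "\<And>u. u \<in> v \<Longrightarrow> \<exists>q. homeomorphism u T p q"
    by (elim exE conjE, intro that) (assumption | erule (1) bspec)+
  show "\<exists>T. x \<in> T \<and> openin (top_of_set U) T \<and>
      (\<exists>v. \<Union>v = C \<inter> p -` U \<inter> p -` T \<and> (\<forall>u\<in>v. openin (top_of_set (C \<inter> p -` U)) u) \<and>
        pairwise disjnt v \<and> (\<forall>u\<in>v. \<exists>q. homeomorphism u T p q))"
  proof (intro exI[of _ "T \<inter> U"] exI[of _ "(\<lambda>u. u \<inter> p -` U) ` v"] conjI ballI)
    show "x \<in> T \<inter> U" using T \<open>x \<in> U\<close> by simp
    show "openin (top_of_set U) (T \<inter> U)"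
    proof -
      obtain O' where "open O'" "T = S \<inter> O'" using T(2) by (meson openin_open)
      thus ?thesis unfolding openin_open using US by blast
    qed
    show "\<Union> ((\<lambda>u. u \<inter> p -` U) ` v) = C \<inter> p -` U \<inter> p -` (T \<inter> U)"
      using T(3) by blast
    show "pairwise disjnt ((\<lambda>u. u \<inter> p -` U) ` v)"
      using T(5) by (fastforce simp: pairwise_def disjnt_def)
    fix w assume "w \<in> (\<lambda>u. u \<inter> p -` U) ` v"
    then obtain u where u: "u \<in> v" "w = u \<inter> p -` U" by blast
    have "openin (top_of_set C) u" by (rule T(4)[OF u(1)])
    then obtain O' where "open O'" "u = C \<inter> O'" by (meson openin_open)
    thus "openin (top_of_set (C \<inter> p -` U)) w"
      unfolding openin_open using u by blast
    obtain q where q: "homeomorphism u T p q" using T(6) u by blast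
    have "homeomorphism w (T \<inter> U) p q"
      by (rule homeomorphism_of_subsets[OF q]) (use u q in \<open>auto simp: homeomorphism_def\<close>)
    thus "\<exists>q. homeomorphism w (T \<inter> U) p q" by blast
  qed
qed

abbreviation plane2 :: "(real \<Rightarrow> complex) set monoid" where
  "plane2 \<equiv> fundamental_group (top_of_set (- {0, 1})) 2"

lemma pathin_top_of_set: "pathin (top_of_set S) p \<longleftrightarrow> path p \<and> path_image p \<subseteq> S"
  by (auto simp: pathin_def path_def path_image_def)

lemma concat_eq_joinpaths: "p \<cdot> q = p +++ q"
  by (simp add: path_concat_def joinpaths_def)

lemma path_hom_top_of_set: "path_hom (top_of_set S) p q \<longleftrightarrow> homotopic_paths S p q"
  by (simp add: path_hom_def homotopic_paths_def pathstart_def pathfinish_def)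

text \<open>The two loops are the images under the exponential function of a segment from \<open>ln 2\<close> to
  \<open>ln 2 + 2 \<pi> \<i>\<close> and of a circle around \<open>0\<close>. Lifting the two products to the covering space,
  the circle appears around \<open>2 \<pi> \<i>\<close> in one lift and around \<open>0\<close> in the other.\<close>

lemma plane2_noncommuting:
  obtains \<alpha> \<gamma> \<nu> where "\<alpha> \<in> carrier plane2" "\<gamma> \<in> carrier plane2"
    "\<alpha> \<otimes>\<^bsub>plane2\<^esub> \<gamma> \<noteq> \<gamma> \<otimes>\<^bsub>plane2\<^esub> \<alpha>"
    "\<nu> \<alpha> = (1 :: complex)"
    "\<And>P Q. P \<in> carrier plane2 \<Longrightarrow> Q \<in> carrier plane2 \<Longrightarrow> \<nu> (P \<otimes>\<^bsub>plane2\<^esub> Q) = \<nu> P + \<nu> Q"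
proof
  let ?S = "- {0, 1 :: complex}"
  let ?L = "loops (top_of_set ?S) 2"
  let ?cl = "loop_class (top_of_set ?S) 2"
  \<comment> \<open>\<open>u0\<close> is a logarithm of the base point 2. The radius
    \<open>ln 2\<close> makes the circle around 0 start at \<open>u0\<close>; being smaller than
    \<open>pi\<close>, it keeps the circle away from the multiples of \<open>2 * pi * \<i>\<close>,
    which are the points that \<open>exp\<close> sends to 1.\<close>
  define u0 where "u0 = complex_of_real (ln 2)"
  define a' where "a' = linepath u0 (u0 + 2 * of_real pi * \<i>)"
  define c' where "c' = circlepath 0 (ln 2)"
  define c'' where "c'' = circlepath (2 * of_real pi * \<i>) (ln 2)"
  let ?C = "{u :: complex. exp u \<noteq> 1}"
  have ln2: "0 < ln (2::real)" "ln (2::real) < 1" by (auto simp: ln_2_less_1)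
  have pi3: "pi > 3" by (rule pi_gt3)
  have C_re: "u \<in> ?C" if "Re u \<noteq> 0" for u
    using that by (auto simp: exp_eq_1)
  have C_ball: "u \<in> ?C" if "cmod u = ln 2" for u
  proof -
    have False if "exp u = 1"
    proof -
      from that obtain n :: int where n: "Re u = 0" "Im u = of_int (2 * n) * pi"
        by (auto simp: exp_eq_1)
      have "cmod u = \<bar>of_int (2 * n)\<bar> * pi" using n by (simp add: cmod_eq_Im abs_mult)
      hence *: "\<bar>of_int (2 * n)\<bar> * pi = ln 2" using \<open>cmod u = ln 2\<close> by simp
      have "n = 0 \<or> 1 \<le> \<bar>of_int (2 * n)::real\<bar>" by linarith
      hence "n = 0 \<or> 1 * pi \<le> \<bar>of_int (2 * n)\<bar> * pi" using pi3 by (auto intro: mult_right_mono)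
      thus False using * ln2 pi3 by (elim disjE) simp_all
    qed
    thus ?thesis by blast
  qed
  have ends: "pathstart a' = u0" "pathfinish a' = u0 + 2 * of_real pi * \<i>"
    "pathstart c' = u0" "pathfinish c' = u0"
    "pathstart c'' = u0 + 2 * of_real pi * \<i>" "pathfinish c'' = u0 + 2 * of_real pi * \<i>"
    by (auto simp: a'_def c'_def c''_def u0_def)
  have c''_eq: "c'' t = c' t + 2 * of_real pi * \<i>" for t
    by (simp add: c'_def c''_def circlepath)
  have paths: "path a'" "path c'" "path c''" "valid_path a'" "valid_path c'" "valid_path c''"
    by (auto simp: a'_def c'_def c''_def)
  have im_a: "Re u = ln 2" if "u \<in> path_image a'" for u
    using that by (auto simp: a'_def path_image_def linepath_def u0_def algebra_simps)
  have im_c: "cmod u = ln 2" if "u \<in> path_image c'" for u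
    using that ln2 by (auto simp: c'_def path_image_circlepath_nonneg)
  have imC: "path_image a' \<subseteq> ?C" "path_image c' \<subseteq> ?C"
    using C_re im_a im_c C_ball ln2 by fastforce+
  have im_c'': "\<exists>v \<in> path_image c'. u = v + 2 * of_real pi * \<i>" if "u \<in> path_image c''" for u
    using that c''_eq by (auto simp: path_image_def)
  have imC'': "path_image c'' \<subseteq> ?C"
    using im_c'' imC by (fastforce simp: exp_add)
  define a where "a = exp \<circ> a'"
  define c where "c = exp \<circ> c'"
  have u0: "exp u0 = 2" by (simp add: u0_def exp_of_real)
  have loop: "exp \<circ> p \<in> ?L" if "path p" "path_image p \<subseteq> ?C" "exp (pathstart p) = 2" "exp (pathfinish p) = 2" for p
  proof -
    have "path (exp \<circ> p)" using that by (intro path_continuous_image continuous_intros)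
    moreover have "path_image (exp \<circ> p) \<subseteq> ?S" using that(2) by (auto simp: path_image_compose)
    ultimately show ?thesis using that
      by (auto simp: loops_def pathin_top_of_set pathstart_def pathfinish_def)
  qed
  have aL: "a \<in> ?L" and cL: "c \<in> ?L"
    unfolding a_def c_def using paths imC ends u0 by (auto intro!: loop simp: exp_add)
  show "?cl a \<in> carrier plane2" "?cl c \<in> carrier plane2"
    using aL cL by (auto intro: loop_class_carrier)
  \<comment> \<open>The winding number about 0 of any representative: a homotopy in the plane
    without 0 and 1 is also one in the plane without 0.\<close>
  define \<nu> where "\<nu> = (\<lambda>P. winding_number (SOME p. p \<in> ?L \<and> P = ?cl p) 0)"
  have \<nu>: "\<nu> (?cl p) = winding_number p 0" if p: "p \<in> ?L" for p
  proof -
    define q where "q = (SOME q. q \<in> ?L \<and> ?cl p = ?cl q)"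
    have q: "q \<in> ?L \<and> ?cl p = ?cl q"
      unfolding q_def by (rule someI[of _ p]) (use p in auto)
    hence "path_hom (top_of_set ?S) p q" using loop_class_eq_iff[OF p, of q] by blast
    hence "homotopic_paths (- {0}) p q"
      unfolding path_hom_top_of_set by (rule homotopic_paths_subset) auto
    hence "winding_number p 0 = winding_number q 0" by (rule winding_number_homotopic_paths)
    thus ?thesis by (simp add: \<nu>_def q_def)
  qed
  have a_circle: "a = circlepath 0 2"
  proof
    fix t
    have "a t = exp u0 * exp (2 * of_real pi * \<i> * t)"
      by (simp add: a_def a'_def linepath_def exp_add[symmetric] scaleR_conv_of_real algebra_simps)
    thus "a t = circlepath 0 2 t" by (simp add: u0 circlepath)
  qed
  show "\<nu> (?cl a) = 1" unfolding \<nu>[OF aL] unfolding a_circle by (rule winding_number_circlepath_centre) simp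
  show "\<nu> (P \<otimes>\<^bsub>plane2\<^esub> Q) = \<nu> P + \<nu> Q" if PQ: "P \<in> carrier plane2" "Q \<in> carrier plane2" for P Q
  proof -
    obtain p where p: "p \<in> ?L" "P = ?cl p" using PQ(1) by (rule fundamental_group_carrierE)
    obtain q where q: "q \<in> ?L" "Q = ?cl q" using PQ(2) by (rule fundamental_group_carrierE)
    have "winding_number (p +++ q) 0 = winding_number p 0 + winding_number q 0"
      by (rule winding_number_join) (use p q in \<open>auto simp: loops_def pathin_top_of_set pathstart_def pathfinish_def\<close>)
    thus ?thesis using p q \<nu>[OF concat_loops[OF p(1) q(1)]]
      by (simp add: loop_class_mult \<nu> concat_eq_joinpaths)
  qed
  show "?cl a \<otimes>\<^bsub>plane2\<^esub> ?cl c \<noteq> ?cl c \<otimes>\<^bsub>plane2\<^esub> ?cl a"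
  proof
    assume "?cl a \<otimes>\<^bsub>plane2\<^esub> ?cl c = ?cl c \<otimes>\<^bsub>plane2\<^esub> ?cl a"
    hence "path_hom (top_of_set ?S) (a \<cdot> c) (c \<cdot> a)"
      using aL cL by (simp add: loop_class_mult loop_class_eq_iff concat_loops)
    hence hom: "homotopic_paths ?S (a +++ c) (c +++ a)"
      by (simp add: path_hom_top_of_set concat_eq_joinpaths)
    have "openin (top_of_set (- {0})) ?S"
      unfolding openin_open
      by (intro exI[of _ ?S]) (auto intro!: open_Compl finite_imp_closed)
    from covering_space_restrict[OF covering_space_exp_punctured_plane this]
    have cov: "covering_space ?C exp ?S" by (simp add: vimage_def) 
    have lift1: "exp ((a' +++ c'') t) = (a +++ c) t" for t
      by (simp add: joinpaths_def a_def c_def c''_eq exp_add)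
    have lift2: "exp ((c' +++ a') t) = (c +++ a) t" for t
      by (simp add: joinpaths_def a_def c_def)
    have "homotopic_paths ?C (a' +++ c'') (c' +++ a')"
      by (rule covering_space_lift_homotopic_paths[OF cov _ _ _ _ hom])
         (use homotopic_paths_imp_path[OF hom] homotopic_paths_imp_subset[OF hom] paths imC imC'' ends in
           \<open>auto simp: lift1 lift2 path_image_join\<close>)
    moreover have "?C \<subseteq> - {0}" by auto
    ultimately have "homotopic_paths (- {0}) (a' +++ c'') (c' +++ a')" by (rule homotopic_paths_subset)
    hence eq: "winding_number (a' +++ c'') 0 = winding_number (c' +++ a') 0"
      by (rule winding_number_homotopic_paths)
    have n0: "0 \<notin> path_image a'" "0 \<notin> path_image c'" "0 \<notin> path_image c''"
      using imC imC'' by auto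
    have "winding_number (a' +++ c'') 0 = winding_number a' 0 + winding_number c'' 0"
         "winding_number (c' +++ a') 0 = winding_number c' 0 + winding_number a' 0"
      using n0 paths ends by (auto intro!: winding_number_join)
    moreover have "winding_number c' 0 = 1"
      unfolding c'_def by (rule winding_number_circlepath_centre) (rule ln2)
    \<comment> \<open>The disc bounded by \<open>c''\<close> does not contain 0. So the lifts of the
      two products differ by 1 in their winding number about 0, a point that does not belong to the
      covering space.\<close>
    moreover have "winding_number c'' 0 = 0"
    proof (rule winding_number_zero_outside[where s = "cball (2 * of_real pi * \<i>) (ln 2)"])
      show "path_image c'' \<subseteq> cball (2 * complex_of_real pi * \<i>) (ln 2)"
        using ln2 by (auto simp: c''_def)
      show "0 \<notin> cball (2 * complex_of_real pi * \<i>) (ln 2)"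
        using ln2 pi3 by (simp add: dist_norm norm_mult)
    qed (use paths ends in auto)
    ultimately show False using eq by simp
  qed
qed

section \<open>A poset of subsets of an interval\<close>

text \<open>Two ways to lengthen the decreasing word over \<open>S\<close>: an index below all of
  \<open>S\<close> is appended as \<open>x l\<close>, and the least missing index is appended as
  \<open>y l\<close> once the tail over \<open>{..<l}\<close> has become a y-word. For
  \<open>l = 0\<close> only the first way is meant.\<close>

definition xstep :: "nat set \<Rightarrow> nat \<Rightarrow> bool" where
  "xstep S l \<longleftrightarrow> l \<notin> S \<and> ((\<forall>s\<in>S. l < s) \<or> (l \<noteq> 0 \<and> {..<l} \<subseteq> S))"

text \<open>The image of \<open>xstep\<close> under \<open>i \<mapsto> m - 1 - i\<close>; here the
  second way concerns the largest missing index.\<close>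

definition ystep :: "nat \<Rightarrow> nat set \<Rightarrow> nat \<Rightarrow> bool" where
  "ystep m S l \<longleftrightarrow> l \<notin> S \<and> ((\<forall>s\<in>S. s < l) \<or> (l \<noteq> m - 1 \<and> {l<..<m} \<subseteq> S))"

definition refl_set :: "nat \<Rightarrow> nat set \<Rightarrow> nat set" where
  "refl_set m S = (\<lambda>i. m - Suc i) ` S"

text \<open>The sets on which the decreasing x-word and the increasing y-word have the same value.
  With \<open>k = 0\<close> and \<open>k = m\<close> the empty and the full set are
  included.\<close>

definition seg :: "nat \<Rightarrow> nat set \<Rightarrow> bool" where
  "seg m S \<longleftrightarrow> (\<exists>k\<le>m. S = {..<k} \<or> S = {k..<m})"

section \<open>Reversal of the index set\<close>

lemma refl_set_subset: "S \<subseteq> {..<m} \<Longrightarrow> refl_set m S \<subseteq> {..<m}"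
  by (auto simp: refl_set_def)

lemma mem_refl_set: "S \<subseteq> {..<m} \<Longrightarrow> i < m \<Longrightarrow> i \<in> refl_set m S \<longleftrightarrow> m - Suc i \<in> S"
  by (force simp: refl_set_def image_iff)

lemma refl_refl: "S \<subseteq> {..<m} \<Longrightarrow> refl_set m (refl_set m S) = S"
  by (force simp: refl_set_def image_image)

lemma card_refl_set: "S \<subseteq> {..<m} \<Longrightarrow> card (refl_set m S) = card S"
  unfolding refl_set_def
proof (rule card_image, rule inj_onI)
  fix x y assume "S \<subseteq> {..<m}" "x \<in> S" "y \<in> S" "m - Suc x = m - Suc y"
  moreover from this have "x < m" "y < m" by auto
  ultimately show "x = y" by linarith
qed

lemma refl_set_insert: "refl_set m (insert l S) = insert (m - Suc l) (refl_set m S)"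
  by (simp add: refl_set_def)

lemma refl_set_empty [simp]: "refl_set m {} = {}"
  by (simp add: refl_set_def)

lemma refl_set_lessThan: 
  assumes k: "k \<le> m" shows "refl_set m {..<k} = {m - k..<m}"
proof (rule Set.set_eqI)
  fix i
  show "i \<in> refl_set m {..<k} \<longleftrightarrow> i \<in> {m - k..<m}"
  proof (cases "i < m")
    case True thus ?thesis using k by (subst mem_refl_set) auto
  next
    case False thus ?thesis using k refl_set_subset[of "{..<k}" m] by auto
  qed
qed

lemma refl_set_atLeastLessThan: "k \<le> m \<Longrightarrow> refl_set m {k..<m} = {..<m - k}"
  using refl_set_lessThan[of "m - k" m] refl_refl[of "{..<m - k}" m] by simp

lemma refl_set_eq_iff:
  "S \<subseteq> {..<m} \<Longrightarrow> T \<subseteq> {..<m} \<Longrightarrow> refl_set m S = refl_set m T \<longleftrightarrow> S = T"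
  by (metis refl_refl)

lemma seg_refl_set: "S \<subseteq> {..<m} \<Longrightarrow> seg m (refl_set m S) \<longleftrightarrow> seg m S"
proof -
  have *: "seg m (refl_set m S)" if "seg m S" for S
    using that refl_set_lessThan refl_set_atLeastLessThan diff_le_self unfolding seg_def by metis
  show "S \<subseteq> {..<m} \<Longrightarrow> ?thesis" using *[of S] *[of "refl_set m S"] by (auto simp: refl_refl)
qed

lemma xstep_refl_set:
  assumes "S \<subseteq> {..<m}" "l < m"
  shows "xstep (refl_set m S) (m - Suc l) \<longleftrightarrow> ystep m S l"
proof -
  have 1: "m - Suc l \<in> refl_set m S \<longleftrightarrow> l \<in> S" using assms by (subst mem_refl_set) auto
  have 2: "(\<forall>s\<in>refl_set m S. m - Suc l < s) \<longleftrightarrow> (\<forall>s\<in>S. s < l)"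
    unfolding refl_set_def using assms by force
  have 3: "m - Suc l \<noteq> 0 \<longleftrightarrow> l \<noteq> m - 1" using assms by auto
  have 4: "{..<m - Suc l} \<subseteq> refl_set m S \<longleftrightarrow> {l<..<m} \<subseteq> S"
  proof
    assume *: "{..<m - Suc l} \<subseteq> refl_set m S"
    show "{l<..<m} \<subseteq> S"
    proof
      fix i assume i: "i \<in> {l<..<m}"
      hence "m - Suc i \<in> refl_set m S" using * by force
      moreover have "m - Suc (m - Suc i) = i" using i by auto
      ultimately show "i \<in> S" using i assms by (simp add: mem_refl_set)
    qed
  next
    assume *: "{l<..<m} \<subseteq> S"
    show "{..<m - Suc l} \<subseteq> refl_set m S"
    proof
      fix i assume i: "i \<in> {..<m - Suc l}"
      hence "m - Suc i \<in> S" using * by force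
      thus "i \<in> refl_set m S" using i assms by (subst mem_refl_set) auto
    qed
  qed
  show ?thesis unfolding xstep_def ystep_def 1 2 3 4 ..
qed

lemma ystep_refl_set:
  assumes "S \<subseteq> {..<m}" "l < m"
  shows "ystep m (refl_set m S) (m - Suc l) \<longleftrightarrow> xstep S l"
proof -
  have "m - Suc (m - Suc l) = l" "m - Suc l < m" using assms by auto
  thus ?thesis using xstep_refl_set[of "refl_set m S" m "m - Suc l"] assms
    by (simp add: refl_set_subset refl_refl)
qed

text \<open>Collects what the group theory delivers, so that the lattice property, the chain count,
  the rank generating function and the drawing become questions about subsets of
  \<open>{..<m}\<close>. The order is generated by the two kinds of steps; it is not inclusion of
  sets.\<close>

locale pencil_poset =
  fixes m :: nat and X Y :: "nat set \<Rightarrow> 'g" and rk :: "'g \<Rightarrow> nat" and L :: "'g gorder"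
  assumes m2: "2 \<le> m"
    and X_inj: "\<And>S T. S \<subseteq> {..<m} \<Longrightarrow> T \<subseteq> {..<m} \<Longrightarrow> X S = X T \<longleftrightarrow> S = T"
    and Y_inj: "\<And>S T. S \<subseteq> {..<m} \<Longrightarrow> T \<subseteq> {..<m} \<Longrightarrow> Y S = Y T \<longleftrightarrow> S = T"
    and X_eq_Y: "\<And>S T. S \<subseteq> {..<m} \<Longrightarrow> T \<subseteq> {..<m} \<Longrightarrow> X S = Y T \<longleftrightarrow> S = T \<and> seg m S"
    and rk_X: "\<And>S. S \<subseteq> {..<m} \<Longrightarrow> rk (X S) = card S"
    and rk_Y: "\<And>S. S \<subseteq> {..<m} \<Longrightarrow> rk (Y S) = card S"
    and carrier_L: "carrier L = X ` Pow {..<m} \<union> Y ` Pow {..<m}"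
    and eq_L: "eq L = (=)"
    and le_L: "\<And>p q. p \<in> carrier L \<Longrightarrow> q \<in> carrier L \<Longrightarrow> le L p q \<longleftrightarrow>
       (\<lambda>p q. \<exists>S l. S \<subseteq> {..<m} \<and> l < m \<and>
          (xstep S l \<and> p = X S \<and> q = X (insert l S) \<or>
           ystep m S l \<and> p = Y S \<and> q = Y (insert l S)))\<^sup>*\<^sup>* p q"
begin

definition ext :: "'g \<Rightarrow> 'g \<Rightarrow> bool" where
  "ext p q \<longleftrightarrow> (\<exists>S l. S \<subseteq> {..<m} \<and> l < m \<and>
          (xstep S l \<and> p = X S \<and> q = X (insert l S) \<or>
           ystep m S l \<and> p = Y S \<and> q = Y (insert l S)))"

lemma le_ext: "p \<in> carrier L \<Longrightarrow> q \<in> carrier L \<Longrightarrow> le L p q \<longleftrightarrow> ext\<^sup>*\<^sup>* p q"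
  using le_L unfolding ext_def[abs_def] .

text \<open>Reversal of \<open>{..<m}\<close> interchanges \<open>xstep\<close> and
  \<open>ystep\<close>, so the same \<open>L\<close> is again such a poset with the roles of
  \<open>X\<close> and \<open>Y\<close> exchanged. Facts on \<open>Y\<close> are obtained by
  applying facts on \<open>X\<close> to this instance.\<close>

lemma mirror: "pencil_poset m (\<lambda>S. Y (refl_set m S)) (\<lambda>S. X (refl_set m S)) rk L"
proof
  show "(X (refl_set m T) = X (refl_set m S)) \<longleftrightarrow> T = S" if "S \<subseteq> {..<m}" "T \<subseteq> {..<m}" for S T
    using that by (simp add: X_inj refl_set_subset refl_set_eq_iff)
  show "(Y (refl_set m T) = Y (refl_set m S)) \<longleftrightarrow> T = S" if "S \<subseteq> {..<m}" "T \<subseteq> {..<m}" for S T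
    using that by (simp add: Y_inj refl_set_subset refl_set_eq_iff)
  show "(Y (refl_set m S) = X (refl_set m T)) \<longleftrightarrow> S = T \<and> seg m S" if "S \<subseteq> {..<m}" "T \<subseteq> {..<m}" for S T
    using X_eq_Y[of "refl_set m T" "refl_set m S"] that
    by (auto simp: refl_set_subset refl_set_eq_iff seg_refl_set)
  have surj: "refl_set m ` Pow {..<m} = Pow {..<m}"
  proof (intro equalityI subsetI)
    fix S assume "S \<in> Pow {..<m}"
    hence "S = refl_set m (refl_set m S)" "refl_set m S \<in> Pow {..<m}"
      by (simp_all add: refl_refl refl_set_subset)
    thus "S \<in> refl_set m ` Pow {..<m}" by (rule image_eqI)
  qed (auto dest: subsetD[OF refl_set_subset])
  have "(\<lambda>S. f (refl_set m S)) ` Pow {..<m} = f ` Pow {..<m}" for f :: "nat set \<Rightarrow> 'g"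
    using arg_cong[OF surj, of "image f"] by (simp only: image_image)
  thus "carrier L = (\<lambda>S. Y (refl_set m S)) ` Pow {..<m} \<union> (\<lambda>S. X (refl_set m S)) ` Pow {..<m}"
    by (simp add: carrier_L Un_commute)
  have ext_eq: "ext p q \<longleftrightarrow> (\<exists>S l. S \<subseteq> {..<m} \<and> l < m \<and>
          (xstep S l \<and> p = Y (refl_set m S) \<and> q = Y (refl_set m (insert l S)) \<or>
           ystep m S l \<and> p = X (refl_set m S) \<and> q = X (refl_set m (insert l S))))"
    (is "_ \<longleftrightarrow> (\<exists>S l. ?P S l)") for p q
  proof
    assume "ext p q"
    then obtain S l where S: "S \<subseteq> {..<m}" "l < m"
          "xstep S l \<and> p = X S \<and> q = X (insert l S) \<or> ystep m S l \<and> p = Y S \<and> q = Y (insert l S)"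
      unfolding ext_def by blast
    moreover from S have "insert l S \<subseteq> {..<m}" "m - Suc l < m" by auto
    ultimately have "?P (refl_set m S) (m - Suc l)"
      by (simp add: xstep_refl_set ystep_refl_set refl_set_subset refl_refl flip: refl_set_insert) blast
    thus "\<exists>S l. ?P S l" by blast
  next
    assume "\<exists>S l. ?P S l"
    then obtain S l where S: "?P S l" by blast
    moreover from S have "m - Suc l < m" by auto
    ultimately have "refl_set m S \<subseteq> {..<m} \<and> m - Suc l < m \<and>
       (xstep (refl_set m S) (m - Suc l) \<and> p = X (refl_set m S) \<and> q = X (insert (m - Suc l) (refl_set m S)) \<or>
        ystep m (refl_set m S) (m - Suc l) \<and> p = Y (refl_set m S) \<and> q = Y (insert (m - Suc l) (refl_set m S)))"
      by (simp add: xstep_refl_set ystep_refl_set refl_set_subset refl_set_insert) blast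
    thus "ext p q" unfolding ext_def by blast
  qed
  show "le L p q \<longleftrightarrow> (\<lambda>p q. \<exists>S l. S \<subseteq> {..<m} \<and> l < m \<and>
          (xstep S l \<and> p = Y (refl_set m S) \<and> q = Y (refl_set m (insert l S)) \<or>
           ystep m S l \<and> p = X (refl_set m S) \<and> q = X (refl_set m (insert l S))))\<^sup>*\<^sup>* p q"
    if "p \<in> carrier L" "q \<in> carrier L" for p q
  proof -
    have "ext = (\<lambda>p q. \<exists>S l. S \<subseteq> {..<m} \<and> l < m \<and>
          (xstep S l \<and> p = Y (refl_set m S) \<and> q = Y (refl_set m (insert l S)) \<or>
           ystep m S l \<and> p = X (refl_set m S) \<and> q = X (refl_set m (insert l S))))"
      by (intro HOL.ext) (rule ext_eq)
    thus ?thesis using le_ext[OF that] by simp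
  qed
qed (use m2 in \<open>simp_all add: rk_X rk_Y refl_set_subset card_refl_set eq_L\<close>)


text \<open>Brings mirrored facts back: the step relation on the elements of \<open>L\<close> is
  literally the same, only its description in terms of sets has changed.\<close>

lemma ext_mirror:
  "pencil_poset.ext m (\<lambda>S. Y (refl_set m S)) (\<lambda>S. X (refl_set m S)) = ext"
proof (intro HOL.ext iffI)
  fix p q
  {
    assume "pencil_poset.ext m (\<lambda>S. Y (refl_set m S)) (\<lambda>S. X (refl_set m S)) p q"
    then obtain S l where S: "S \<subseteq> {..<m}" "l < m"
          "xstep S l \<and> p = Y (refl_set m S) \<and> q = Y (refl_set m (insert l S)) \<or>
           ystep m S l \<and> p = X (refl_set m S) \<and> q = X (refl_set m (insert l S))"
      unfolding pencil_poset.ext_def[OF mirror] by blast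
    moreover from S have "m - Suc l < m" by auto
    ultimately have "refl_set m S \<subseteq> {..<m} \<and> m - Suc l < m \<and>
       (xstep (refl_set m S) (m - Suc l) \<and> p = X (refl_set m S) \<and> q = X (insert (m - Suc l) (refl_set m S)) \<or>
        ystep m (refl_set m S) (m - Suc l) \<and> p = Y (refl_set m S) \<and> q = Y (insert (m - Suc l) (refl_set m S)))"
      by (simp add: xstep_refl_set ystep_refl_set refl_set_subset refl_set_insert) blast
    thus "ext p q" unfolding ext_def by blast
  }
  assume "ext p q"
  then obtain S l where S: "S \<subseteq> {..<m}" "l < m"
        "xstep S l \<and> p = X S \<and> q = X (insert l S) \<or> ystep m S l \<and> p = Y S \<and> q = Y (insert l S)"
    unfolding ext_def by blast
  moreover from S have "insert l S \<subseteq> {..<m}" "m - Suc l < m" by auto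
  ultimately have "refl_set m S \<subseteq> {..<m} \<and> m - Suc l < m \<and>
      (xstep (refl_set m S) (m - Suc l) \<and> p = Y (refl_set m (refl_set m S)) \<and>
         q = Y (refl_set m (insert (m - Suc l) (refl_set m S))) \<or>
       ystep m (refl_set m S) (m - Suc l) \<and> p = X (refl_set m (refl_set m S)) \<and>
         q = X (refl_set m (insert (m - Suc l) (refl_set m S))))"
    by (simp add: xstep_refl_set ystep_refl_set refl_set_subset refl_refl flip: refl_set_insert) blast
  thus "pencil_poset.ext m (\<lambda>S. Y (refl_set m S)) (\<lambda>S. X (refl_set m S)) p q"
    unfolding pencil_poset.ext_def[OF mirror] by blast
qed

lemma XE: "S \<subseteq> {..<m} \<Longrightarrow> X S \<in> carrier L" and YE: "S \<subseteq> {..<m} \<Longrightarrow> Y S \<in> carrier L"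
  by (auto simp: carrier_L)

lemma finite_sub: "S \<subseteq> {..<m} \<Longrightarrow> finite S"
  by (rule finite_subset[OF _ finite_lessThan])

lemma finite_carrier: "finite (carrier L)"
  by (simp add: carrier_L)

lemma xstep_ext: "xstep S l \<Longrightarrow> S \<subseteq> {..<m} \<Longrightarrow> l < m \<Longrightarrow> ext (X S) (X (insert l S))"
  unfolding ext_def by blast

lemma ystep_ext: "ystep m S l \<Longrightarrow> S \<subseteq> {..<m} \<Longrightarrow> l < m \<Longrightarrow> ext (Y S) (Y (insert l S))"
  unfolding ext_def by blast

lemma ext_carrier:
  assumes "ext p q" shows "p \<in> carrier L" "q \<in> carrier L"
  using assms unfolding ext_def carrier_L by auto

lemma ext_rk:
  assumes "ext p q" shows "rk q = rk p + 1"
proof -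
  obtain S l where S: "S \<subseteq> {..<m}" "l < m"
        "xstep S l \<and> p = X S \<and> q = X (insert l S) \<or> ystep m S l \<and> p = Y S \<and> q = Y (insert l S)"
    using assms unfolding ext_def by blast
  moreover have "l \<notin> S" using S(3) by (auto simp: xstep_def ystep_def)
  ultimately show ?thesis using finite_sub[OF S(1)] by (auto simp: rk_X rk_Y)
qed

lemma ext_star_carrier: "ext\<^sup>*\<^sup>* p q \<Longrightarrow> p \<in> carrier L \<longleftrightarrow> q \<in> carrier L"
  by (induction rule: rtranclp_induct) (auto dest: ext_carrier)

lemma ext_star_rk: "ext\<^sup>*\<^sup>* p q \<Longrightarrow> rk p \<le> rk q"
  by (induction rule: rtranclp_induct) (auto dest: ext_rk)

lemma ext_star_rk_eq: "ext\<^sup>*\<^sup>* p q \<Longrightarrow> rk p = rk q \<Longrightarrow> p = q"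
proof (erule converse_rtranclpE)
  fix y assume "ext p y" "ext\<^sup>*\<^sup>* y q" "rk p = rk q"
  thus "p = q" using ext_rk[of p y] ext_star_rk[of y q] by simp
qed

lemma partial_order_L: "partial_order L"
proof
  show "(.=\<^bsub>L\<^esub>) = (=)" by (rule eq_L)
  show "x \<sqsubseteq>\<^bsub>L\<^esub> x" if "x \<in> carrier L" for x using that by (simp add: le_ext)
  show "x .=\<^bsub>L\<^esub> y" if "x \<sqsubseteq>\<^bsub>L\<^esub> y" "y \<sqsubseteq>\<^bsub>L\<^esub> x" "x \<in> carrier L" "y \<in> carrier L" for x y
  proof -
    have "ext\<^sup>*\<^sup>* x y" "ext\<^sup>*\<^sup>* y x" using le_ext that by blast+
    hence "x = y" by (intro ext_star_rk_eq le_antisym ext_star_rk)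
    thus ?thesis by (simp add: eq_L)
  qed
  show "x \<sqsubseteq>\<^bsub>L\<^esub> z" if "x \<sqsubseteq>\<^bsub>L\<^esub> y" "y \<sqsubseteq>\<^bsub>L\<^esub> z" "x \<in> carrier L" "y \<in> carrier L" "z \<in> carrier L" for x y z
    using that le_ext rtranclp_trans[of ext x y z] by blast
qed (auto simp: eq_L)

definition bot where "bot = X {}"
definition top where "top = X {..<m}"

lemma seg_empty: "seg m {}" and seg_full: "seg m {..<m}"
  by (auto simp: seg_def)

lemma bot_Y: "bot = Y {}" and top_Y: "top = Y {..<m}"
  by (simp_all add: bot_def top_def X_eq_Y seg_empty seg_full)

lemma top_carrier: "top \<in> carrier L" and bot_carrier: "bot \<in> carrier L"
  by (simp_all add: top_def bot_def XE)

lemma carrier_cases: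
  assumes "p \<in> carrier L"
  obtains S where "S \<subseteq> {..<m}" "p = X S" | S where "S \<subseteq> {..<m}" "p = Y S"
  using assms by (auto simp: carrier_L)

lemma rk_le: "p \<in> carrier L \<Longrightarrow> rk p \<le> m"
  by (erule carrier_cases) (auto simp: rk_X rk_Y dest: card_mono[OF finite_lessThan])

lemma rk_top_iff: "p \<in> carrier L \<Longrightarrow> rk p = m \<longleftrightarrow> p = top"
proof (erule carrier_cases)
  fix S assume S: "S \<subseteq> {..<m}"
  have "card S = m \<longleftrightarrow> S = {..<m}" using card_subset_eq[OF finite_lessThan S] by auto
  thus "rk p = m \<longleftrightarrow> p = top" if "p = X S" using that S by (simp add: rk_X top_def X_inj)
  show "rk p = m \<longleftrightarrow> p = top" if "p = Y S"
    using that S \<open>card S = m \<longleftrightarrow> S = {..<m}\<close> by (simp add: rk_Y top_Y Y_inj)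
qed

lemma rk_bot_iff: "p \<in> carrier L \<Longrightarrow> rk p = 0 \<longleftrightarrow> p = bot"
proof (erule carrier_cases)
  fix S assume S: "S \<subseteq> {..<m}"
  have "card S = 0 \<longleftrightarrow> S = {}" using finite_sub[OF S] by simp
  thus "rk p = 0 \<longleftrightarrow> p = bot" if "p = X S" using that S by (simp add: rk_X bot_def X_inj)
  show "rk p = 0 \<longleftrightarrow> p = bot" if "p = Y S"
    using that S \<open>card S = 0 \<longleftrightarrow> S = {}\<close> by (simp add: rk_Y bot_Y Y_inj)
qed

lemma mex_exists:
  assumes "S \<subseteq> {..<m}" "S \<noteq> {..<m}"
  obtains k where "k < m" "k \<notin> S" "{..<k} \<subseteq> S"
proof -
  have ex: "\<exists>k. k < m \<and> k \<notin> S" using assms by auto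
  define k where "k = (LEAST k. k < m \<and> k \<notin> S)"
  have "k < m \<and> k \<notin> S" unfolding k_def by (rule LeastI_ex[OF ex])
  moreover have "i \<in> S" if "i < k" for i
    using not_less_Least[of i "\<lambda>k. k < m \<and> k \<notin> S"] that \<open>k < m \<and> k \<notin> S\<close> unfolding k_def by auto
  ultimately show ?thesis using that by blast
qed

text \<open>The least missing index always extends \<open>S\<close>; if it is 0, it lies below all
  of \<open>S\<close>.\<close>

lemma X_has_ext:
  assumes "S \<subseteq> {..<m}" "S \<noteq> {..<m}"
  shows "\<exists>q. ext (X S) q"
proof -
  obtain k where "k < m" "k \<notin> S" "{..<k} \<subseteq> S" using mex_exists[OF assms] .
  hence "xstep S k" unfolding xstep_def by (cases "k = 0") (auto intro: gr0I)
  thus ?thesis using xstep_ext assms(1) \<open>k < m\<close> by blast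
qed

lemma Y_has_ext:
  assumes "S \<subseteq> {..<m}" "S \<noteq> {..<m}"
  shows "\<exists>q. ext (Y S) q"
proof -
  have "refl_set m S \<noteq> {..<m}"
    using assms refl_set_eq_iff[of S m "{..<m}"] by (simp add: refl_set_lessThan)
      (simp add: atLeast0LessThan)
  thus ?thesis
    using pencil_poset.X_has_ext[OF mirror, of "refl_set m S"] assms
    by (simp add: ext_mirror refl_refl refl_set_subset)
qed

lemma has_ext: "p \<in> carrier L \<Longrightarrow> p \<noteq> top \<Longrightarrow> \<exists>q. ext p q"
  by (erule carrier_cases) (use X_has_ext Y_has_ext top_Y in \<open>auto simp: top_def\<close>)

lemma le_top: "p \<in> carrier L \<Longrightarrow> ext\<^sup>*\<^sup>* p top"
proof (induction "m - rk p" arbitrary: p rule: less_induct)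
  case less
  show ?case
  proof (cases "p = top")
    case False
    then obtain q where q: "ext p q" using has_ext less.prems by blast
    hence "q \<in> carrier L" "m - rk q < m - rk p"
      using ext_carrier[OF q] ext_rk[OF q] rk_le[of q] by auto
    with less.hyps have "ext\<^sup>*\<^sup>* q top" by blast
    with q show ?thesis by (rule converse_rtranclp_into_rtranclp)
  qed simp
qed

text \<open>\<open>S\<close> is built up in decreasing order: putting back the minimum is a step of
  the first kind.\<close>

lemma bot_le_X: "S \<subseteq> {..<m} \<Longrightarrow> ext\<^sup>*\<^sup>* bot (X S)"
proof (induction "card S" arbitrary: S)
  case 0
  thus ?case by (simp add: finite_sub bot_def)
next
  case (Suc n)
  have f: "finite S" "S \<noteq> {}" using Suc finite_sub by auto
  let ?s = "Min S" and ?S = "S - {Min S}"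
  have "ext\<^sup>*\<^sup>* bot (X ?S)" using Suc f by (intro Suc.hyps(1)) auto
  moreover have step: "xstep ?S ?s"
  proof -
    have "?s < t" if "t \<in> ?S" for t using that Min_le[OF f(1), of t] by (simp add: less_le)
    thus ?thesis unfolding xstep_def by blast
  qed
  moreover have "ext (X ?S) (X (insert ?s ?S))"
    by (rule xstep_ext[OF step]) (use Suc.prems Min_in[OF f] in blast)+
  moreover have "insert ?s ?S = S" using Min_in[OF f] by blast
  ultimately show ?case by simp
qed

lemma bot_le: "p \<in> carrier L \<Longrightarrow> ext\<^sup>*\<^sup>* bot p"
proof (erule carrier_cases)
  fix S assume "S \<subseteq> {..<m}" "p = Y S"
  thus ?thesis using pencil_poset.bot_le_X[OF mirror, of "refl_set m S"]
    by (simp add: ext_mirror pencil_poset.bot_def[OF mirror] bot_Y refl_refl refl_set_subset)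
qed (simp add: bot_le_X)

lemma lless_L: "p \<in> carrier L \<Longrightarrow> q \<in> carrier L \<Longrightarrow> p \<sqsubset>\<^bsub>L\<^esub> q \<longleftrightarrow> ext\<^sup>*\<^sup>* p q \<and> p \<noteq> q"
  by (simp add: lless_def le_ext eq_L)

text \<open>Each step raises \<open>rk\<close> by exactly one, so nothing fits strictly between its
  ends.\<close>

lemma covers_iff: "covers L p q \<longleftrightarrow> ext p q"
proof
  assume c: "covers L p q"
  hence pq: "p \<in> carrier L" "q \<in> carrier L" "p \<sqsubset>\<^bsub>L\<^esub> q"
    and no: "\<not> (\<exists>z\<in>carrier L. p \<sqsubset>\<^bsub>L\<^esub> z \<and> z \<sqsubset>\<^bsub>L\<^esub> q)"
    unfolding covers_def by blast+
  have "ext\<^sup>*\<^sup>* p q" "p \<noteq> q" using pq lless_L by blast+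
  then obtain z where z: "ext p z" "ext\<^sup>*\<^sup>* z q" by (cases rule: converse_rtranclpE) auto
  have zc: "z \<in> carrier L" by (rule ext_carrier(2)[OF z(1)])
  have "z \<noteq> p" using ext_rk[OF z(1)] by auto
  hence "p \<sqsubset>\<^bsub>L\<^esub> z" using z(1) lless_L[OF pq(1) zc] by blast
  moreover have "z \<sqsubset>\<^bsub>L\<^esub> q" if "z \<noteq> q" using z(2) that lless_L[OF zc pq(2)] by blast
  ultimately have "z = q" using no zc by blast
  with z show "ext p q" by simp
next
  assume e: "ext p q"
  have False if z: "z \<in> carrier L" "p \<sqsubset>\<^bsub>L\<^esub> z" "z \<sqsubset>\<^bsub>L\<^esub> q" for z
  proof -
    have "ext\<^sup>*\<^sup>* p z" "p \<noteq> z" using z lless_L[OF ext_carrier(1)[OF e] z(1)] by blast+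
    moreover have "ext\<^sup>*\<^sup>* z q" "z \<noteq> q" using z lless_L[OF z(1) ext_carrier(2)[OF e]] by blast+
    ultimately have "rk p < rk z" "rk z < rk q"
      using ext_star_rk ext_star_rk_eq le_neq_implies_less by metis+
    thus False using ext_rk[OF e] by simp
  qed
  moreover have "p \<noteq> q" using ext_rk[OF e] by auto
  hence "p \<sqsubset>\<^bsub>L\<^esub> q" using e lless_L[OF ext_carrier[OF e]] by blast
  ultimately show "covers L p q"
    unfolding covers_def using ext_carrier[OF e] by blast
qed

text \<open>An element given by a proper nonempty segment has two descriptions. Final segments are
  treated as x-nodes and initial ones as y-nodes, because then every step out of an x-node is an
  x-step and every step out of a y-node is a y-step. The elements \<open>bot\<close> and
  \<open>top\<close> are kept apart.\<close>

definition xnode :: "nat set \<Rightarrow> bool" where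
  "xnode S \<longleftrightarrow> S \<subseteq> {..<m} \<and> S \<noteq> {} \<and> (\<nexists>k. S = {..<k})"

definition ynode :: "nat set \<Rightarrow> bool" where
  "ynode S \<longleftrightarrow> S \<subseteq> {..<m} \<and> S \<noteq> {} \<and> (\<nexists>k. S = {k..<m})"

lemma initial_le: "{..<k} \<subseteq> {..<m::nat} \<Longrightarrow> k \<le> m"
  by auto

lemma xnode_refl: "S \<subseteq> {..<m} \<Longrightarrow> xnode (refl_set m S) \<longleftrightarrow> ynode S"
proof -
  assume S: "S \<subseteq> {..<m}"
  have e: "refl_set m S \<noteq> {} \<longleftrightarrow> S \<noteq> {}" by (simp add: refl_set_def)
  have "(\<exists>k. refl_set m S = {..<k}) \<longleftrightarrow> (\<exists>k. S = {k..<m})"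
  proof
    assume "\<exists>k. refl_set m S = {..<k}"
    then obtain k where k: "refl_set m S = {..<k}" by blast
    hence "k \<le> m" using refl_set_subset[OF S] by (intro initial_le) simp
    hence "S = {m - k..<m}" using refl_refl[OF S] k refl_set_lessThan by simp
    thus "\<exists>k. S = {k..<m}" by blast
  next
    assume "\<exists>k. S = {k..<m}"
    then obtain k where k: "S = {k..<m}" by blast
    show "\<exists>k. refl_set m S = {..<k}"
    proof (cases "k \<le> m")
      case True thus ?thesis using k refl_set_atLeastLessThan by blast
    next
      case False thus ?thesis using k by (intro exI[of _ 0]) auto
    qed
  qed
  thus ?thesis using S e refl_set_subset unfolding xnode_def ynode_def by auto
qed

lemma xnode_sub: "xnode S \<Longrightarrow> S \<subseteq> {..<m}" and ynode_sub: "ynode S \<Longrightarrow> S \<subseteq> {..<m}"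
  by (auto simp: xnode_def ynode_def)

text \<open>Among x-nodes only a final segment \<open>{k..<m}\<close> admits a y-step at all. That
  step must add \<open>k - 1\<close>, the largest missing index; the result is again a final
  segment, so the step is an x-step as well.\<close>

lemma xnode_ext:
  assumes S: "xnode S" and e: "ext (X S) q"
  obtains l where "l < m" "xstep S l" "q = X (insert l S)"
proof -
  obtain T l where T: "T \<subseteq> {..<m}" "l < m"
        "xstep T l \<and> X S = X T \<and> q = X (insert l T) \<or> ystep m T l \<and> X S = Y T \<and> q = Y (insert l T)"
    using e unfolding ext_def by blast
  note sub = xnode_sub[OF S]
  from T(3) show ?thesis
  proof (elim disjE conjE)
    assume "xstep T l" "X S = X T" "q = X (insert l T)"
    thus ?thesis using that T sub by (auto simp: X_inj)
  next
    assume y: "ystep m T l" "X S = Y T" "q = Y (insert l T)"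
    hence "S = T" "seg m S" using sub T by (auto simp: X_eq_Y)
    with S obtain k where k: "S = {k..<m}" "k < m" "k \<noteq> 0"
      unfolding seg_def xnode_def by (metis atLeast0LessThan atLeastLessThan_empty_iff gr0I linorder_not_le)
    have "l = k - 1"
      using y(1) \<open>S = T\<close> k T(2) unfolding ystep_def
    proof (elim conjE disjE)
      assume "\<forall>s\<in>T. s < l" "S = T" "l < m"
      hence "m - 1 < l" using k by auto
      thus ?thesis using T(2) by simp
    next
      assume *: "l \<notin> T" "{l<..<m} \<subseteq> T" "S = T"
      hence "l < k" using k T(2) by auto
      moreover have "k \<le> Suc l"
      proof (rule ccontr)
        assume "\<not> k \<le> Suc l"
        hence "Suc l \<in> {l<..<m}" "Suc l \<notin> T" using k * by auto
        thus False using * by blast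
      qed
      ultimately show ?thesis by simp
    qed
    hence ins: "insert l S = {l..<m}" "Suc l = k" using k by auto
    have "xstep S l" unfolding xstep_def using k \<open>l = k - 1\<close> by auto
    moreover have "q = X (insert l S)"
    proof -
      have "seg m {l..<m}" unfolding seg_def using T(2) less_imp_le by blast
      moreover have "{l..<m} \<subseteq> {..<m}" by auto
      ultimately have "X {l..<m} = Y {l..<m}" using X_eq_Y by blast
      thus ?thesis using y(3) \<open>S = T\<close> ins by simp
    qed
    ultimately show ?thesis using that T(2) by blast
  qed
qed

lemma ynode_ext:
  assumes S: "ynode S" and e: "ext (Y S) q"
  obtains l where "l < m" "ystep m S l" "q = Y (insert l S)"
proof -
  note sub = ynode_sub[OF S]
  have "ext (Y (refl_set m (refl_set m S))) q" using e by (simp add: refl_refl sub)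
  moreover have "pencil_poset.xnode m (refl_set m S)"
    using S sub xnode_refl unfolding pencil_poset.xnode_def[OF mirror] xnode_def by blast
  ultimately obtain l where l: "l < m" "xstep (refl_set m S) l" "q = Y (refl_set m (insert l (refl_set m S)))"
    using pencil_poset.xnode_ext[OF mirror, of "refl_set m S" q] unfolding ext_mirror by blast
  have *: "m - Suc (m - Suc l) = l" "m - Suc l < m" using l by auto
  hence "ystep m S (m - Suc l)" using xstep_refl_set[of S m "m - Suc l"] sub l by simp
  moreover have "refl_set m (insert l (refl_set m S)) = insert (m - Suc l) S"
    using sub by (simp add: refl_set_insert refl_refl)
  ultimately show ?thesis using that[of "m - Suc l"] l * by simp
qed

lemma initial_ynode:
  assumes "0 < k" "k < m" shows "ynode {..<k}"
proof -
  have False if "{..<k} = {j..<m}" for j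
  proof -
    have "0 \<in> {j..<m}" using that assms by blast
    hence "k \<in> {..<k}" unfolding that using assms by simp
    thus False by simp
  qed
  thus ?thesis unfolding ynode_def using assms by auto
qed

lemma node_cases:
  assumes "p \<in> carrier L"
  obtains "p = bot" | "p = top" | S where "xnode S" "p = X S" | S where "ynode S" "p = Y S"
proof -
  have X: ?thesis if S: "S \<subseteq> {..<m}" "p = X S" for S
  proof (cases "xnode S")
    case True thus ?thesis using that(2) \<open>\<And>S. \<lbrakk>xnode S; p = X S\<rbrakk> \<Longrightarrow> thesis\<close> by blast
  next
    case False
    then obtain k where k: "S = {..<k}" using S unfolding xnode_def by (metis lessThan_0)
    hence km: "k \<le> m" using S initial_le by blast
    consider "k = 0" | "k = m" | "0 < k" "k < m" using km by linarith
    thus ?thesis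
    proof cases
      case 1 thus ?thesis using S k that by (auto simp: bot_def intro: \<open>p = bot \<Longrightarrow> thesis\<close>)
    next
      case 2 thus ?thesis using S k by (auto simp: top_def intro: \<open>p = top \<Longrightarrow> thesis\<close>)
    next
      case 3
      have "p = Y S" using S k km by (auto simp: X_eq_Y seg_def)
      thus ?thesis using initial_ynode[OF 3] k \<open>\<And>S. \<lbrakk>ynode S; p = Y S\<rbrakk> \<Longrightarrow> thesis\<close> by blast
    qed
  qed
  show ?thesis using assms
  proof (cases rule: carrier_cases)
    case (2 S)
    show ?thesis
    proof (cases "ynode S")
      case True thus ?thesis using 2 \<open>\<And>S. \<lbrakk>ynode S; p = Y S\<rbrakk> \<Longrightarrow> thesis\<close> by blast
    next
      case False
      then obtain k where k: "S = {k..<m}"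
        using 2 unfolding ynode_def by (metis atLeastLessThan_empty_iff order_less_irrefl)
      hence "S = {min k m..<m}" by (auto simp: min_def)
      hence "seg m S" unfolding seg_def using min.cobounded2 by blast
      hence "p = X S" using 2 by (metis X_eq_Y)
      thus ?thesis using X 2 by blast
    qed
  qed (rule X)
qed


section \<open>Joins of covers of a common element, and the lattice property\<close>

definition is_join :: "'g \<Rightarrow> 'g \<Rightarrow> 'g \<Rightarrow> bool" where
  "is_join p q c \<longleftrightarrow> ext\<^sup>*\<^sup>* p c \<and> ext\<^sup>*\<^sup>* q c \<and> (\<forall>u. ext\<^sup>*\<^sup>* p u \<longrightarrow> ext\<^sup>*\<^sup>* q u \<longrightarrow> ext\<^sup>*\<^sup>* c u)"

lemma is_join_mirror:
  "pencil_poset.is_join m (\<lambda>S. Y (refl_set m S)) (\<lambda>S. X (refl_set m S)) = is_join"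
  by (intro HOL.ext) (simp only: pencil_poset.is_join_def[OF mirror] is_join_def ext_mirror)

lemma is_join_sym: "is_join p q c \<Longrightarrow> is_join q p c"
  unfolding is_join_def by blast

lemma atMost_insert: "{..l} = insert l {..<l::nat}"
  by auto

lemma closed_up_set:
  assumes "ext\<^sup>*\<^sup>* p u" "p \<in> A" "\<And>x y. x \<in> A \<Longrightarrow> ext x y \<Longrightarrow> y \<in> A"
  shows "u \<in> A"
  using assms(1) by (induction rule: rtranclp_induct) (use assms in blast)+

text \<open>The indices below \<open>k\<close> are inserted in increasing order, passing over those
  in \<open>S\<close>; at each moment the next one is the least missing index.\<close>

lemma X_fill:
  assumes "S \<subseteq> {..<m}" "S \<noteq> {}" "k \<le> m"
  shows "ext\<^sup>*\<^sup>* (X S) (X (S \<union> {..<k}))"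
  using assms(3)
proof (induction k)
  case 0 thus ?case by simp
next
  case (Suc k)
  hence IH: "ext\<^sup>*\<^sup>* (X S) (X (S \<union> {..<k}))" by simp
  let ?T = "S \<union> {..<k}"
  have eq: "S \<union> {..<Suc k} = insert k ?T" by auto
  show ?case
  proof (cases "k \<in> S")
    case True thus ?thesis using IH eq by (simp add: insert_absorb)
  next
    case False
    have "xstep ?T k"
    proof (cases "k = 0")
      case True
      hence "\<forall>s\<in>S. 0 < s" using False by (auto intro: gr0I)
      thus ?thesis using False True by (simp add: xstep_def)
    next
      case f: False thus ?thesis using False by (auto simp: xstep_def)
    qed
    hence "ext (X ?T) (X (insert k ?T))"
      by (rule xstep_ext) (use assms(1) Suc.prems in auto)
    thus ?thesis using IH eq by simp
  qed
qed

lemma xnode_noninitial: "S \<subseteq> {..<m} \<Longrightarrow> a \<in> S \<Longrightarrow> b \<notin> S \<Longrightarrow> b < a \<Longrightarrow> xnode S"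
  unfolding xnode_def by auto

text \<open>As soon as an index below \<open>l'\<close> is present, \<open>l'\<close> can enter only
  as the least missing index. Until then nothing above \<open>l'\<close> can enter either, so just
  the part below \<open>l'\<close> grows; when \<open>l'\<close> does enter, the set is exactly
  \<open>S \<union> {..l'}\<close>.\<close>

lemma above_missing:
  assumes "S \<subseteq> {..<m}" "l < l'" "l' < m" "\<forall>s\<in>S. l' < s" "ext\<^sup>*\<^sup>* (X (insert l S)) u" "S \<noteq> {}"
  shows "ext\<^sup>*\<^sup>* (X (S \<union> {..l'})) u \<or> (\<exists>L. L \<subseteq> {..<l'} \<and> L \<noteq> {} \<and> u = X (S \<union> L))"
proof -
  let ?c = "X (S \<union> {..l'})"
  let ?A = "{u. ext\<^sup>*\<^sup>* ?c u} \<union> {X (S \<union> L) |L. L \<subseteq> {..<l'} \<and> L \<noteq> {}}"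
  have "u \<in> ?A" using assms(5)
  proof (rule closed_up_set)
    show "X (insert l S) \<in> ?A"
      by (intro UnI2 CollectI exI[of _ "{l}"]) (use assms in auto)
    fix x y assume x: "x \<in> ?A" and e: "ext x y"
    from x consider "ext\<^sup>*\<^sup>* ?c x" | L where "L \<subseteq> {..<l'}" "L \<noteq> {}" "x = X (S \<union> L)" by blast
    thus "y \<in> ?A"
    proof cases
      case 1 thus ?thesis using e by (blast intro: rtranclp.rtrancl_into_rtrancl)
    next
      case (2 L)
      obtain s where s: "s \<in> S" "l' < s" using assms by blast
      obtain a where a: "a \<in> L" "a < l'" using 2 by blast
      have l': "l' \<notin> S \<union> L" using 2 assms by auto
      have sub: "S \<union> L \<subseteq> {..<m}" using 2 assms by auto
      have "xnode (S \<union> L)" by (rule xnode_noninitial[of _ s l']) (use sub s l' in auto)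
      then obtain j where j: "j < m" "xstep (S \<union> L) j" "y = X (insert j (S \<union> L))"
        using xnode_ext e 2 by metis
      have "j < l' \<or> j = l' \<and> {..<l'} \<subseteq> S \<union> L"
      proof -
        have "j \<le> l'" using j(2) a l' unfolding xstep_def by (meson UnI2 lessThan_iff less_imp_le not_le order_less_trans subsetD)
        moreover have "{..<l'} \<subseteq> S \<union> L" if "j = l'"
        proof -
          have "\<not> (\<forall>s\<in>S \<union> L. j < s)" using a that by (meson UnI2 less_asym)
          thus ?thesis using j(2) that unfolding xstep_def by blast
        qed
        ultimately show ?thesis by linarith
      qed
      thus ?thesis
      proof
        assume "j < l'"
        hence "insert j L \<subseteq> {..<l'} \<and> insert j L \<noteq> {}" using 2 by auto
        moreover have "y = X (S \<union> insert j L)" using j by simp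
        ultimately show ?thesis by blast
      next
        assume j': "j = l' \<and> {..<l'} \<subseteq> S \<union> L"
        hence "{..<l'} \<subseteq> L" using assms(4) by (metis UnE lessThan_iff not_less_iff_gr_or_eq subsetD subsetI)
        hence "L = {..<l'}" using 2 by blast
        hence "insert j (S \<union> L) = S \<union> {..l'}" using j' atMost_insert by simp
        thus ?thesis using j by auto
      qed
    qed
  qed
  thus ?thesis by blast
qed

text \<open>While \<open>{..<l'}\<close> has a gap, an index above \<open>l'\<close> is neither
  smaller than the whole set nor the least missing one. So only the part below \<open>l'\<close>
  grows until it is full.\<close>

lemma above_present:
  assumes "S \<subseteq> {..<m}" "0 < l'" "l' < m" "\<forall>s\<in>S. l' < s" "ext\<^sup>*\<^sup>* (X (insert l' S)) u"
  shows "ext\<^sup>*\<^sup>* (X (S \<union> {..l'})) u \<or> (\<exists>L. L \<subset> {..<l'} \<and> u = X (insert l' (S \<union> L)))"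
proof -
  let ?c = "X (S \<union> {..l'})"
  let ?A = "{u. ext\<^sup>*\<^sup>* ?c u} \<union> {X (insert l' (S \<union> L)) |L. L \<subset> {..<l'}}"
  have "u \<in> ?A" using assms(5)
  proof (rule closed_up_set)
    have "{} \<subset> {..<l'}" using assms by auto
    moreover have "X (insert l' S) = X (insert l' (S \<union> {}))" by simp
    ultimately show "X (insert l' S) \<in> ?A" by blast
    fix x y assume x: "x \<in> ?A" and e: "ext x y"
    from x consider "ext\<^sup>*\<^sup>* ?c x" | L where "L \<subset> {..<l'}" "x = X (insert l' (S \<union> L))" by blast
    thus "y \<in> ?A"
    proof cases
      case 1 thus ?thesis using e by (blast intro: rtranclp.rtrancl_into_rtrancl)
    next
      case (2 L)
      obtain b where b: "b < l'" "b \<notin> L" using 2 by blast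
      let ?T = "insert l' (S \<union> L)"
      have b': "b \<notin> ?T" using b assms(4) by auto
      have sub: "?T \<subseteq> {..<m}" using 2 assms by auto
      have "xnode ?T" by (rule xnode_noninitial[of _ l' b]) (use sub b' b in auto)
      then obtain j where j: "j < m" "xstep ?T j" "y = X (insert j ?T)"
        using xnode_ext e 2 by metis
      have "j < l'"
      proof -
        have "j < l' \<or> {..<j} \<subseteq> ?T" "j \<noteq> l'" using j(2) unfolding xstep_def by auto
        moreover have "j \<le> b" if "{..<j} \<subseteq> ?T" using that b' by (meson lessThan_iff not_le subsetD)
        ultimately show ?thesis using b by auto
      qed
      have y: "y = X (insert l' (S \<union> insert j L))" using j by (simp add: insert_commute)
      show ?thesis
      proof (cases "insert j L = {..<l'}")
        case True
        hence "insert l' (S \<union> insert j L) = S \<union> {..l'}" using atMost_insert by simp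
        thus ?thesis using y by simp
      next
        case False
        hence "insert j L \<subset> {..<l'}" using 2 \<open>j < l'\<close> by auto
        thus ?thesis using y by blast
      qed
    qed
  qed
  thus ?thesis by blast
qed

text \<open>The counterpart of \<open>above_missing\<close> for empty \<open>S\<close>. The low set
  may become an initial segment; then its element passes to the y-side, and the y-steps that follow
  keep the index 0. The second alternative absorbs all of these.\<close>

lemma above_low:
  assumes "L0 \<subseteq> {..<l'}" "L0 \<noteq> {}" "l' < m" "ext\<^sup>*\<^sup>* (X L0) u"
  shows "(\<exists>L. L \<subseteq> {..<l'} \<and> L \<noteq> {} \<and> u = X L) \<or> (\<exists>S. S \<subseteq> {..<m} \<and> 0 \<in> S \<and> u = Y S)"
proof -
  let ?A = "{X L |L. L \<subseteq> {..<l'} \<and> L \<noteq> {}} \<union> {Y S |S. S \<subseteq> {..<m} \<and> 0 \<in> S}"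
  have "u \<in> ?A" using assms(4)
  proof (rule closed_up_set)
    show "X L0 \<in> ?A" using assms by blast
    have Y: "y \<in> ?A" if S: "S \<subseteq> {..<m}" "0 \<in> S" and e: "ext (Y S) y" for S y
    proof (cases "ynode S")
      case True
      then obtain j where "j < m" "y = Y (insert j S)" using ynode_ext[OF True e] by blast
      moreover from this have "insert j S \<subseteq> {..<m}" "0 \<in> insert j S" using S by auto
      ultimately show ?thesis by blast
    next
      case False
      then obtain k where "S = {k..<m}" using S unfolding ynode_def by blast
      hence "S = {..<m}" using S by auto
      hence "rk y = m + 1" using ext_rk[OF e] rk_Y S by simp
      thus ?thesis using rk_le[OF ext_carrier(2)[OF e]] by simp
    qed
    fix x y assume x: "x \<in> ?A" and e: "ext x y"
    from x consider L where "L \<subseteq> {..<l'}" "L \<noteq> {}" "x = X L" | S where "S \<subseteq> {..<m}" "0 \<in> S" "x = Y S" by blast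
    thus "y \<in> ?A"
    proof cases
      case (2 S) thus ?thesis using Y e by blast
    next
      case (1 L)
      have sub: "L \<subseteq> {..<m}" using 1 assms by auto
      show ?thesis
      proof (cases "xnode L")
        case True
        then obtain j where j: "j < m" "xstep L j" "y = X (insert j L)" using xnode_ext e 1 by metis
        have "\<exists>s\<in>L. j < s"
        proof (rule ccontr)
          assume "\<not> ?thesis"
          hence le: "\<forall>s\<in>L. s \<le> j" by auto
          obtain s where "s \<in> L" using 1 by blast
          hence "{..<j} \<subseteq> L" "j \<notin> L" using j(2) le unfolding xstep_def by fastforce+
          hence "L = {..<j}" using le by (force simp: le_less)
          thus False using True unfolding xnode_def by blast
        qed
        hence "insert j L \<subseteq> {..<l'}" using 1 by auto
        thus ?thesis using j by blast
      next
        case False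
        then obtain k where k: "L = {..<k}" using sub 1 unfolding xnode_def by blast
        hence "k \<le> m" "0 < k" using sub 1 initial_le by auto
        hence "X L = Y L" "0 \<in> L" using k sub X_eq_Y seg_def by auto
        thus ?thesis using Y sub e 1 by simp
      qed
    qed
  qed
  thus ?thesis by blast
qed

text \<open>An upper bound of both that is not above the proposed join would contain
  \<open>l'\<close> by \<open>above_present\<close> and omit it by \<open>above_missing\<close>. For
  empty \<open>S\<close> the latter is replaced by \<open>above_low\<close>; there the remaining
  possibility is a segment containing 0 and \<open>l'\<close>, which then contains everything below
  \<open>l'\<close>.\<close>

lemma join_X_steps:
  assumes S: "S \<subseteq> {..<m}" "l < l'" "l' < m" "\<forall>s\<in>S. l' < s"
  shows "is_join (X (insert l S)) (X (insert l' S)) (X (S \<union> {..l'}))"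
proof -
  let ?c = "X (S \<union> {..l'})"
  have sub: "insert l S \<subseteq> {..<m}" "insert l' S \<subseteq> {..<m}" "S \<union> {..l'} \<subseteq> {..<m}" using S by auto
  have eq: "insert l S \<union> {..<Suc l'} = S \<union> {..l'}" "insert l' S \<union> {..<Suc l'} = S \<union> {..l'}"
    using S by auto
  have "ext\<^sup>*\<^sup>* (X (insert l S)) ?c" "ext\<^sup>*\<^sup>* (X (insert l' S)) ?c"
    using X_fill[of "insert l S" "Suc l'"] X_fill[of "insert l' S" "Suc l'"] sub S unfolding eq by simp_all
  moreover have "ext\<^sup>*\<^sup>* ?c u" if u: "ext\<^sup>*\<^sup>* (X (insert l S)) u" "ext\<^sup>*\<^sup>* (X (insert l' S)) u" for u
  proof (rule ccontr)
    assume n: "\<not> ext\<^sup>*\<^sup>* ?c u"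
    with above_present[of S l' u] S u obtain L where L: "L \<subset> {..<l'}" "u = X (insert l' (S \<union> L))" by auto
    have Lsub: "insert l' (S \<union> L) \<subseteq> {..<m}" using L S by auto
    show False
    proof (cases "S = {}")
      case False
      with above_missing[of S l l' u] S u n obtain K where K: "K \<subseteq> {..<l'}" "u = X (S \<union> K)" by auto
      have "S \<union> K \<subseteq> {..<m}" using K S by auto
      hence "S \<union> K = insert l' (S \<union> L)" using K L Lsub X_inj by metis
      moreover have "l' \<notin> S \<union> K" using K S by auto
      ultimately show False by blast
    next
      case True
      have "(\<exists>K. K \<subseteq> {..<l'} \<and> K \<noteq> {} \<and> u = X K) \<or> (\<exists>T. T \<subseteq> {..<m} \<and> 0 \<in> T \<and> u = Y T)"
        by (rule above_low[of "{l}"]) (use S u True in auto)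
      thus False
      proof (elim disjE exE conjE)
        fix K assume K: "K \<subseteq> {..<l'}" "u = X K"
        hence "K \<subseteq> {..<m}" using S by auto
        hence "K = insert l' (S \<union> L)" using K L Lsub X_inj by metis
        thus False using K by auto
      next
        fix T assume T: "T \<subseteq> {..<m}" "0 \<in> T" "u = Y T"
        hence "insert l' (S \<union> L) = T" "seg m T" using L Lsub X_eq_Y by metis+
        then obtain k where k: "insert l' L = {..<k} \<or> insert l' L = {k..<m}" using True unfolding seg_def by auto
        have "0 \<in> L" using T \<open>insert l' (S \<union> L) = T\<close> True S by auto
        have "{..<l'} \<subseteq> insert l' L" using k
        proof
          assume k: "insert l' L = {..<k}"
          hence "l' < k" by blast
          thus ?thesis unfolding k by auto
        next
          assume k: "insert l' L = {k..<m}"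
          hence "0 \<in> {k..<m}" using \<open>0 \<in> L\<close> by blast
          thus ?thesis unfolding k using S(3) by auto
        qed
        hence "{..<l'} \<subseteq> L" by auto
        thus False using L by blast
      qed
    qed
  qed
  ultimately show ?thesis unfolding is_join_def by blast
qed

lemma join_X_exts:
  assumes S: "xnode S" and e: "ext (X S) a" "ext (X S) b"
  shows "\<exists>c. is_join a b c"
proof -
  obtain l where l: "l < m" "xstep S l" "a = X (insert l S)" using xnode_ext S e by metis
  obtain l' where l': "l' < m" "xstep S l'" "b = X (insert l' S)" using xnode_ext S e by metis
  note sub = xnode_sub[OF S]
  show ?thesis
  \<comment> \<open>Once 0 is present, the only x-step adds the least missing index and the two
    covers coincide. Otherwise both added indices lie below all of \<open>S\<close>.\<close>
  proof (cases "0 \<in> S")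
    case True
    hence "{..<l} \<subseteq> S" "{..<l'} \<subseteq> S" "l \<notin> S" "l' \<notin> S" using l l' unfolding xstep_def by auto
    hence "l = l'" by (meson lessThan_iff nat_neq_iff subsetD)
    hence "is_join a b a" using l l' unfolding is_join_def by blast
    thus ?thesis by blast
  next
    case False
    obtain s where "s \<in> S" using S unfolding xnode_def by blast
    have *: "\<forall>s\<in>S. l < s" "\<forall>s\<in>S. l' < s" using l l' False unfolding xstep_def by (auto simp: subset_iff)
    consider "l = l'" | "l < l'" | "l' < l" by linarith
    thus ?thesis
    proof cases
      case 1
      hence "is_join a b a" using l l' unfolding is_join_def by blast
      thus ?thesis by blast
    next
      case 2 thus ?thesis using join_X_steps[OF sub 2] l l' * by blast
    next
      case 3 thus ?thesis using join_X_steps[OF sub 3] l l' * is_join_sym by blast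
    qed
  qed
qed

lemma join_Y_exts:
  assumes S: "ynode S" and e: "ext (Y S) a" "ext (Y S) b"
  shows "\<exists>c. is_join a b c"
proof -
  note sub = ynode_sub[OF S]
  have "pencil_poset.xnode m (refl_set m S)"
    using S sub xnode_refl unfolding pencil_poset.xnode_def[OF mirror] xnode_def by blast
  from pencil_poset.join_X_exts[OF mirror this, of a b]
  show ?thesis unfolding ext_mirror is_join_mirror using e sub by (simp add: refl_refl)
qed

lemma join_X_atoms:
  assumes "l < m" "l' < m"
  shows "\<exists>c. is_join (X {l}) (X {l'}) c"
proof -
  consider "l = l'" | "l < l'" | "l' < l" by linarith
  thus ?thesis
  proof cases
    case 1
    hence "is_join (X {l}) (X {l'}) (X {l})" unfolding is_join_def by blast
    thus ?thesis by blast
  next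
    case 2 thus ?thesis using join_X_steps[of "{}" l l'] assms by auto
  next
    case 3 thus ?thesis using is_join_sym join_X_steps[of "{}" l' l] assms by auto
  qed
qed

lemma refl_set_singleton: "refl_set m {l} = {m - Suc l}"
  by (simp add: refl_set_def)

lemma join_Y_atoms:
  assumes "l < m" "l' < m"
  shows "\<exists>c. is_join (Y {l}) (Y {l'}) c"
proof -
  have "m - Suc l < m" "m - Suc l' < m" "m - Suc (m - Suc l) = l" "m - Suc (m - Suc l') = l'" using assms by auto
  thus ?thesis using pencil_poset.join_X_atoms[OF mirror, of "m - Suc l" "m - Suc l'"]
    by (simp add: is_join_mirror refl_set_singleton)
qed

lemma X0_Y0: "X {0} = Y {0}" and Xlast_Ylast: "X {m - 1} = Y {m - 1}"
proof -
  have "seg m {0}" unfolding seg_def using m2 by (intro exI[of _ 1]) auto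
  thus "X {0} = Y {0}" using X_eq_Y[of "{0}" "{0}"] m2 by auto
  have "seg m {m - 1}" unfolding seg_def using m2 by (intro exI[of _ "m - 1"]) auto
  thus "X {m - 1} = Y {m - 1}" using X_eq_Y[of "{m-1}" "{m-1}"] m2 by auto
qed

text \<open>The atoms at 0 and \<open>m - 1\<close> belong to both sides. For inner indices, the
  elements above \<open>X {l}\<close> are x-words over \<open>{..l}\<close>, which omit
  \<open>m - 1\<close>, and y-words containing 0; those above \<open>Y {j}\<close> are y-words
  omitting 0 and x-words containing \<open>m - 1\<close>. Only the full set satisfies both
  descriptions, so the join is \<open>top\<close>.\<close>

lemma join_XY_atoms:
  assumes "l < m" "j < m"
  shows "\<exists>c. is_join (X {l}) (Y {j}) c"
proof -
  consider "l = 0 \<or> l = m - 1" | "j = 0 \<or> j = m - 1" | "0 < l" "l < m - 1" "0 < j" "j < m - 1"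
    using assms by linarith
  thus ?thesis
  proof cases
    case 1 thus ?thesis using join_Y_atoms[OF assms] X0_Y0 Xlast_Ylast by auto
  next
    case 2 thus ?thesis using join_X_atoms[OF assms] X0_Y0 Xlast_Ylast by auto
  next
    case 3
    have "is_join (X {l}) (Y {j}) top"
      unfolding is_join_def
    proof (intro conjI allI impI)
      show "ext\<^sup>*\<^sup>* (X {l}) top" "ext\<^sup>*\<^sup>* (Y {j}) top" using assms by (auto intro!: le_top XE YE)
      fix u assume u: "ext\<^sup>*\<^sup>* (X {l}) u" "ext\<^sup>*\<^sup>* (Y {j}) u"
      have 1: "(\<exists>L. L \<subseteq> {..<Suc l} \<and> L \<noteq> {} \<and> u = X L) \<or> (\<exists>S. S \<subseteq> {..<m} \<and> 0 \<in> S \<and> u = Y S)"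
        by (rule above_low[of "{l}"]) (use u 3 in auto)
      have "(\<exists>L. L \<subseteq> {..<m - j} \<and> L \<noteq> {} \<and> u = Y (refl_set m L)) \<or>
            (\<exists>S. S \<subseteq> {..<m} \<and> 0 \<in> S \<and> u = X (refl_set m S))"
        by (rule pencil_poset.above_low[OF mirror, of "{m - Suc j}", unfolded ext_mirror])
           (use u 3 assms in \<open>auto simp: refl_set_singleton Suc_diff_Suc\<close>)
      hence 2: "(\<exists>L. L \<subseteq> {..<m} \<and> 0 \<notin> L \<and> L \<noteq> {} \<and> u = Y L) \<or> (\<exists>S. S \<subseteq> {..<m} \<and> m - 1 \<in> S \<and> u = X S)"
      proof (elim disjE exE conjE)
        fix L assume L: "L \<subseteq> {..<m - j}" "L \<noteq> {}" "u = Y (refl_set m L)"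
        have "L \<subseteq> {..<m}" using L by auto
        moreover have "0 \<notin> refl_set m L" using L 3 \<open>L \<subseteq> {..<m}\<close> by (subst mem_refl_set) auto
        moreover have "refl_set m L \<noteq> {}" using L by (simp add: refl_set_def)
        ultimately show ?thesis using L refl_set_subset[OF \<open>L \<subseteq> {..<m}\<close>]
          by (intro disjI1 exI[of _ "refl_set m L"]) simp
      next
        fix S assume S: "S \<subseteq> {..<m}" "0 \<in> S" "u = X (refl_set m S)"
        moreover have "m - 1 \<in> refl_set m S" using S m2 by (subst mem_refl_set) auto
        ultimately show ?thesis using refl_set_subset[OF S(1)]
          by (intro disjI2 exI[of _ "refl_set m S"]) simp
      qed
      have "u = top" using 1 2
      proof (elim disjE exE conjE)
        fix L K assume L: "L \<subseteq> {..<Suc l}" "L \<noteq> {}" "u = X L" "K \<subseteq> {..<m}" "0 \<notin> K" "K \<noteq> {}" "u = Y K"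
        hence "L \<subseteq> {..<m}" using 3 by auto
        hence "L = K" "seg m K" using L X_eq_Y by metis+
        hence "m - 1 \<in> L" using L(5,6) unfolding seg_def by auto
        thus ?thesis using L 3 by auto
      next
        fix L K assume L: "L \<subseteq> {..<Suc l}" "L \<noteq> {}" "u = X L" "K \<subseteq> {..<m}" "m - 1 \<in> K" "u = X K"
        hence "L \<subseteq> {..<m}" using 3 by auto
        hence "L = K" using L X_inj by metis
        thus ?thesis using L 3 by auto
      next
        fix S K assume S: "S \<subseteq> {..<m}" "0 \<in> S" "u = Y S" "K \<subseteq> {..<m}" "0 \<notin> K" "u = Y K"
        hence "S = K" using Y_inj by metis
        thus ?thesis using S by auto
      next
        fix S K assume S: "S \<subseteq> {..<m}" "0 \<in> S" "u = Y S" "K \<subseteq> {..<m}" "m - 1 \<in> K" "u = X K"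
        hence SK: "K = S" "seg m K" using X_eq_Y by metis+
        then obtain k where "S = {..<k} \<or> S = {k..<m}" unfolding seg_def by auto
        hence "S = {..<m}" using S SK m2 by auto
        thus ?thesis using S top_Y by simp
      qed
      thus "ext\<^sup>*\<^sup>* top u" by simp
    qed
    thus ?thesis by blast
  qed
qed

lemma bot_ext:
  assumes "ext bot a" obtains l where "l < m" "a = X {l}" | l where "l < m" "a = Y {l}"
proof -
  obtain T l where T: "T \<subseteq> {..<m}" "l < m"
        "xstep T l \<and> bot = X T \<and> a = X (insert l T) \<or> ystep m T l \<and> bot = Y T \<and> a = Y (insert l T)"
    using assms unfolding ext_def by blast
  from T(3) show ?thesis
  proof (elim disjE conjE)
    assume "bot = X T" "a = X (insert l T)"
    moreover from this have "T = {}" using T by (simp add: bot_def X_inj)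
    ultimately show ?thesis using that(1) T by auto
  next
    assume "bot = Y T" "a = Y (insert l T)"
    moreover from this have "T = {}" using T by (simp add: bot_Y Y_inj)
    ultimately show ?thesis using that(2) T by auto
  qed
qed

lemma join_exts:
  assumes e: "ext z a" "ext z b"
  shows "\<exists>c. is_join a b c"
proof -
  have "z \<in> carrier L" using e ext_carrier by blast
  thus ?thesis
  proof (cases rule: node_cases)
    case 1
    from bot_ext[of a] bot_ext[of b] e 1 show ?thesis
      using join_X_atoms join_Y_atoms join_XY_atoms is_join_sym by metis
  next
    case 2
    hence "rk a = m + 1" using ext_rk[OF e(1)] rk_top_iff top_carrier by simp
    thus ?thesis using rk_le ext_carrier(2)[OF e(1)] by fastforce
  next
    case (3 S) thus ?thesis using join_X_exts e by blast
  next
    case (4 S) thus ?thesis using join_Y_exts e by blast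
  qed
qed

text \<open>In a finite poset, joins exist as soon as they exist for any two covers of one element.\<close>

lemma join_above:
  "z \<in> carrier L \<Longrightarrow> ext\<^sup>*\<^sup>* z p \<Longrightarrow> ext\<^sup>*\<^sup>* z q \<Longrightarrow> \<exists>c. is_join p q c"
proof (induction "m - rk z" arbitrary: z p q rule: less_induct)
  case less
  show ?case
  proof (cases "p = z \<or> q = z")
    case True
    hence "is_join p q q \<or> is_join p q p" using less.prems unfolding is_join_def by blast
    thus ?thesis by blast
  next
    case False
    obtain a where a: "ext z a" "ext\<^sup>*\<^sup>* a p" using less.prems(2) False by (cases rule: converse_rtranclpE) auto
    obtain b where b: "ext z b" "ext\<^sup>*\<^sup>* b q" using less.prems(3) False by (cases rule: converse_rtranclpE) auto
    have car: "a \<in> carrier L" "b \<in> carrier L" using a b ext_carrier by blast+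
    have dec: "m - rk a < m - rk z" "m - rk b < m - rk z"
      using ext_rk[OF a(1)] ext_rk[OF b(1)] rk_le[OF car(1)] rk_le[OF car(2)] by auto
    \<comment> \<open>\<open>c\<close> joins the two covers, \<open>d\<close> joins \<open>p\<close>
      with \<open>c\<close> above \<open>a\<close>, and \<open>f\<close> joins \<open>d\<close> with
      \<open>q\<close> above \<open>b\<close>; so the induction hypothesis is applied at the covers
      \<open>a\<close> and \<open>b\<close>, whose corank is smaller.\<close>
    obtain c where c: "is_join a b c" using join_exts a b by blast
    hence ac: "ext\<^sup>*\<^sup>* a c" "ext\<^sup>*\<^sup>* b c" unfolding is_join_def by blast+
    obtain d where d: "is_join p c d" using less.hyps[OF dec(1) car(1) a(2) ac(1)] by blast
    have "ext\<^sup>*\<^sup>* b d" using ac d unfolding is_join_def by (meson rtranclp_trans)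
    then obtain f where f: "is_join d q f" using less.hyps[OF dec(2) car(2) _ b(2)] by blast
    have "is_join p q f"
      unfolding is_join_def
    proof (intro conjI allI impI)
      show "ext\<^sup>*\<^sup>* p f" "ext\<^sup>*\<^sup>* q f" using d f unfolding is_join_def by (meson rtranclp_trans)+
      fix u assume u: "ext\<^sup>*\<^sup>* p u" "ext\<^sup>*\<^sup>* q u"
      hence "ext\<^sup>*\<^sup>* a u" "ext\<^sup>*\<^sup>* b u" using a b rtranclp_trans[of ext] by blast+
      hence "ext\<^sup>*\<^sup>* c u" using c unfolding is_join_def by blast
      hence "ext\<^sup>*\<^sup>* d u" using d u unfolding is_join_def by blast
      thus "ext\<^sup>*\<^sup>* f u" using f u unfolding is_join_def by blast
    qed
    thus ?thesis by blast
  qed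
qed

lemma join_exists:
  assumes "p \<in> carrier L" "q \<in> carrier L" shows "\<exists>c\<in>carrier L. is_join p q c"
proof -
  obtain c where c: "is_join p q c"
    using join_above[OF bot_carrier bot_le[OF assms(1)] bot_le[OF assms(2)]] by blast
  moreover have "c \<in> carrier L" using c assms ext_star_carrier unfolding is_join_def by blast
  ultimately show ?thesis by blast
qed

lemma upper_semilattice_L: "upper_semilattice L"
proof -
  interpret partial_order L by (rule partial_order_L)
  show ?thesis
  proof
    fix p q assume pq: "p \<in> carrier L" "q \<in> carrier L"
    then obtain c where c: "c \<in> carrier L" "is_join p q c" using join_exists by blast
    have "least L c (Upper L {p, q})"
    proof (rule least_UpperI)
      show "x \<sqsubseteq>\<^bsub>L\<^esub> c" if "x \<in> {p, q}" for x using that pq c le_ext unfolding is_join_def by blast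
      show "c \<sqsubseteq>\<^bsub>L\<^esub> u" if u: "u \<in> Upper L {p, q}" for u
      proof -
        have uc: "u \<in> carrier L" "p \<sqsubseteq>\<^bsub>L\<^esub> u" "q \<sqsubseteq>\<^bsub>L\<^esub> u" using u pq by (auto simp: Upper_def)
        hence "ext\<^sup>*\<^sup>* p u" "ext\<^sup>*\<^sup>* q u" using pq le_ext by blast+
        hence "ext\<^sup>*\<^sup>* c u" using c unfolding is_join_def by blast
        thus ?thesis using c uc le_ext by blast
      qed
    qed (use pq c in auto)
    thus "\<exists>s. least L s (Upper L {p, q})" ..
  qed
qed

text \<open>A finite join semilattice with a least element is a lattice: the meet of
  \<open>p\<close> and \<open>q\<close> is the join of their common lower bounds.\<close>

theorem lattice_L: "lattice L"
proof -
  interpret upper_semilattice L by (rule upper_semilattice_L)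
  have "\<exists>s. greatest L s (Lower L {p, q})" if pq: "p \<in> carrier L" "q \<in> carrier L" for p q
  proof -
    let ?A = "Lower L {p, q}"
    have A: "?A \<subseteq> carrier L" by (auto simp: Lower_def)
    moreover have "finite ?A" by (rule finite_subset[OF A finite_carrier])
    moreover have "bot \<in> ?A" using pq bot_carrier bot_le le_ext by (auto simp: Lower_def)
    ultimately have l: "least L (\<Squnion>\<^bsub>L\<^esub> ?A) (Upper L ?A)" by (intro finite_sup_least) auto
    have "greatest L (\<Squnion>\<^bsub>L\<^esub> ?A) ?A"
    proof (rule greatest_LowerI)
      show "\<Squnion>\<^bsub>L\<^esub> ?A \<sqsubseteq>\<^bsub>L\<^esub> x" if "x \<in> {p, q}" for x
      proof -
        have "x \<in> Upper L ?A" using that pq by (auto simp: Upper_def Lower_def)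
        thus ?thesis by (rule least_le[OF l])
      qed
      show "y \<sqsubseteq>\<^bsub>L\<^esub> \<Squnion>\<^bsub>L\<^esub> ?A" if "y \<in> ?A" for y by (rule least_Upper_above[OF l that A])
      show "\<Squnion>\<^bsub>L\<^esub> ?A \<in> carrier L" using l by (rule least_closed)
    qed (use pq in auto)
    thus ?thesis ..
  qed
  thus ?thesis by unfold_locales
qed


section \<open>Counting maximal chains by recursion along covers\<close>

inductive sat_chain :: "'g \<Rightarrow> 'g set \<Rightarrow> bool" where
  top: "sat_chain top {top}"
| step: "ext p q \<Longrightarrow> sat_chain q K \<Longrightarrow> sat_chain p (insert p K)"

text \<open>The last clause, that every rank from \<open>rk p\<close> to \<open>m\<close> is met, is
  what makes a saturated chain from \<open>bot\<close> maximal.\<close>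

lemma sat_chain_props:
  "sat_chain p K \<Longrightarrow> p \<in> carrier L \<and> p \<in> K \<and> K \<subseteq> carrier L \<and> (\<forall>u\<in>K. ext\<^sup>*\<^sup>* p u) \<and>
     (\<forall>u\<in>K. \<forall>v\<in>K. ext\<^sup>*\<^sup>* u v \<or> ext\<^sup>*\<^sup>* v u) \<and> (\<forall>r. rk p \<le> r \<longrightarrow> r \<le> m \<longrightarrow> (\<exists>u\<in>K. rk u = r))"
proof (induction rule: sat_chain.induct)
  case top
  have "rk top = m" using rk_top_iff top_carrier by blast
  thus ?case using top_carrier by auto
next
  case (step p q K)
  have up: "ext\<^sup>*\<^sup>* p u" if "u \<in> K" for u
    using step that by (meson converse_rtranclp_into_rtranclp)
  have "\<exists>u\<in>insert p K. rk u = r" if "rk p \<le> r" "r \<le> m" for r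
    using step that ext_rk[OF step.hyps(1)] by (cases "r = rk p") auto
  moreover have "p \<in> carrier L" using step ext_carrier by blast
  ultimately show ?case using step up by auto
qed

lemma ext_eq_of_rk: "ext\<^sup>*\<^sup>* u v \<or> ext\<^sup>*\<^sup>* v u \<Longrightarrow> rk u = rk v \<Longrightarrow> u = v"
  using ext_star_rk_eq by metis

abbreviation "chainL \<equiv> pred_on.chain (carrier L) (le L)"

lemma chainL_iff:
  "chainL K \<longleftrightarrow> K \<subseteq> carrier L \<and> (\<forall>u\<in>K. \<forall>v\<in>K. ext\<^sup>*\<^sup>* u v \<or> ext\<^sup>*\<^sup>* v u)"
proof -
  have "(u \<sqsubseteq>\<^bsub>L\<^esub> v \<or> u = v) \<longleftrightarrow> ext\<^sup>*\<^sup>* u v" if "u \<in> carrier L" "v \<in> carrier L" for u v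
    using le_ext[OF that] by auto
  thus ?thesis unfolding pred_on.chain_def by (simp add: subset_iff) meson
qed

lemma sat_chain_maximal:
  assumes "sat_chain bot K" shows "K \<in> max_chains L"
proof -
  note P = sat_chain_props[OF assms]
  have "chainL K" using P chainL_iff by blast
  moreover have "\<not> (K \<subset> S \<and> chainL S)" for S
  proof
    assume S: "K \<subset> S \<and> chainL S"
    then obtain s where s: "s \<in> S" "s \<notin> K" by blast
    have sc: "s \<in> carrier L" using S s chainL_iff by blast
    have "rk bot = 0" using rk_bot_iff bot_carrier by blast
    then obtain u where u: "u \<in> K" "rk u = rk s" using P rk_le[OF sc] by (metis le0)
    hence "ext\<^sup>*\<^sup>* u s \<or> ext\<^sup>*\<^sup>* s u" using S s chainL_iff by blast
    hence "u = s" using u ext_eq_of_rk by blast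
    thus False using u s by blast
  qed
  ultimately show ?thesis unfolding max_chains_def pred_on.maxchain_def by blast
qed

text \<open>A maximal chain cannot skip a rank: if \<open>q\<close> follows \<open>p\<close> in the
  chain, a cover \<open>z\<close> of \<open>p\<close> below \<open>q\<close> is comparable with the
  whole chain, hence belongs to it and equals \<open>q\<close>.\<close>

lemma maximal_sat_chain:
  assumes K: "K \<in> max_chains L" shows "sat_chain bot K"
proof -
  have ch: "chainL K" and mx: "\<And>S. K \<subset> S \<Longrightarrow> \<not> chainL S"
    using K unfolding max_chains_def pred_on.maxchain_def by blast+
  have sub: "K \<subseteq> carrier L" and cmp: "\<And>u v. u \<in> K \<Longrightarrow> v \<in> K \<Longrightarrow> ext\<^sup>*\<^sup>* u v \<or> ext\<^sup>*\<^sup>* v u"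
    using ch chainL_iff by blast+
  have add: "z \<in> K" if "z \<in> carrier L" "\<And>u. u \<in> K \<Longrightarrow> ext\<^sup>*\<^sup>* u z \<or> ext\<^sup>*\<^sup>* z u" for z
  proof (rule ccontr)
    assume "z \<notin> K"
    moreover have "chainL (insert z K)"
      unfolding chainL_iff using that sub cmp by auto
    ultimately show False using mx by blast
  qed
  have topK: "top \<in> K" using add top_carrier le_top sub by blast
  have botK: "bot \<in> K" using add bot_carrier bot_le sub by blast
  have "sat_chain p {u \<in> K. ext\<^sup>*\<^sup>* p u}" if "p \<in> K" for p
    using that
  proof (induction "m - rk p" arbitrary: p rule: less_induct)
    case less
    have pc: "p \<in> carrier L" using less.prems sub by blast
    show ?case
    proof (cases "p = top")
      case True
      have "u = top" if "u \<in> K" "ext\<^sup>*\<^sup>* top u" for u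
      proof -
        have "rk u = rk top"
          using ext_star_rk[OF that(2)] rk_le[of u] that sub rk_top_iff[OF top_carrier] by auto
        thus ?thesis using ext_star_rk_eq[OF that(2)] by simp
      qed
      hence "{u \<in> K. ext\<^sup>*\<^sup>* p u} = {top}" using True topK by auto
      thus ?thesis using True sat_chain.top by simp
    next
      case False
      let ?U = "{u \<in> K. ext\<^sup>*\<^sup>* p u \<and> u \<noteq> p}"
      have "top \<in> ?U" using topK le_top pc False by blast
      then obtain q where q: "q \<in> ?U" "\<And>u. u \<in> ?U \<Longrightarrow> rk q \<le> rk u"
        using ex_has_least_nat[of "\<lambda>u. u \<in> ?U" top rk] by blast
      have qu: "ext\<^sup>*\<^sup>* q u" if "u \<in> ?U" for u
      proof -
        have "ext\<^sup>*\<^sup>* q u \<or> ext\<^sup>*\<^sup>* u q" using cmp that q(1) by blast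
        thus ?thesis using q(2)[OF that] ext_star_rk[of u q] ext_star_rk_eq[of u q] by auto
      qed
      obtain z where z: "ext p z" "ext\<^sup>*\<^sup>* z q" using q(1) by (auto elim: converse_rtranclpE)
      have "z \<in> K"
      proof (rule add)
        show "z \<in> carrier L" using z ext_carrier by blast
        fix u assume u: "u \<in> K"
        show "ext\<^sup>*\<^sup>* u z \<or> ext\<^sup>*\<^sup>* z u"
        proof (cases "u \<in> ?U")
          case True thus ?thesis using qu z rtranclp_trans[of ext z q u] by blast
        next
          case False
          hence "ext\<^sup>*\<^sup>* u p" using cmp[OF u less.prems] u by auto
          thus ?thesis using z(1) by (meson rtranclp.rtrancl_into_rtrancl)
        qed
      qed
      moreover have "z \<noteq> p" using ext_rk[OF z(1)] by auto
      ultimately have "z \<in> ?U" using z(1) by blast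
      hence "rk z = rk q" using q(2) ext_star_rk[OF z(2)] by (meson le_antisym)
      hence zq: "z = q" using ext_star_rk_eq z(2) by blast
      have "{u \<in> K. ext\<^sup>*\<^sup>* p u} = insert p {u \<in> K. ext\<^sup>*\<^sup>* q u}"
      proof (intro equalityI subsetI)
        fix u assume "u \<in> {u \<in> K. ext\<^sup>*\<^sup>* p u}"
        thus "u \<in> insert p {u \<in> K. ext\<^sup>*\<^sup>* q u}" using qu by blast
      next
        fix u assume "u \<in> insert p {u \<in> K. ext\<^sup>*\<^sup>* q u}"
        thus "u \<in> {u \<in> K. ext\<^sup>*\<^sup>* p u}" using less.prems z(1) zq
          by (auto intro: converse_rtranclp_into_rtranclp)
      qed
      moreover have "sat_chain q {u \<in> K. ext\<^sup>*\<^sup>* q u}"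
      proof (rule less.hyps)
        show "q \<in> K" using q by blast
        thus "m - rk q < m - rk p" using ext_rk[OF z(1)] zq rk_le[of q] sub by auto
      qed
      ultimately show ?thesis using sat_chain.step z(1) zq by metis
    qed
  qed
  moreover have "{u \<in> K. ext\<^sup>*\<^sup>* bot u} = K" using bot_le sub by blast
  ultimately show ?thesis using botK by fastforce
qed

definition nch :: "'g \<Rightarrow> nat" where "nch p = card {K. sat_chain p K}"

lemma max_chains_eq: "max_chains L = {K. sat_chain bot K}"
  using sat_chain_maximal maximal_sat_chain by blast

lemma sat_chain_mirror:
  "pencil_poset.sat_chain m (\<lambda>S. Y (refl_set m S)) (\<lambda>S. X (refl_set m S)) = sat_chain"
proof -
  have t: "pencil_poset.top m (\<lambda>S. Y (refl_set m S)) = top"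
    by (simp add: pencil_poset.top_def[OF mirror] top_Y refl_set_lessThan) (simp add: atLeast0LessThan)
  show ?thesis
  proof (intro HOL.ext iffI)
    show "sat_chain p K" if "pencil_poset.sat_chain m (\<lambda>S. Y (refl_set m S)) (\<lambda>S. X (refl_set m S)) p K" for p K
      using that
      by (induction rule: pencil_poset.sat_chain.induct[OF mirror, consumes 1]) (auto simp: t ext_mirror intro: sat_chain.intros)
    show "pencil_poset.sat_chain m (\<lambda>S. Y (refl_set m S)) (\<lambda>S. X (refl_set m S)) p K" if "sat_chain p K" for p K
      using that
    proof (induction rule: sat_chain.induct)
      case top show ?case using pencil_poset.sat_chain.top[OF mirror] by (simp add: t)
    next
      case (step p q K)
      show ?case
        by (rule pencil_poset.sat_chain.step[OF mirror, unfolded ext_mirror, OF step.hyps(1) step.IH])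
    qed
  qed
qed

lemma nch_mirror: "pencil_poset.nch m (\<lambda>S. Y (refl_set m S)) (\<lambda>S. X (refl_set m S)) = nch"
  by (intro HOL.ext) (simp add: pencil_poset.nch_def[OF mirror] nch_def sat_chain_mirror)

lemma finite_ext: "finite {q. ext p q}"
  by (rule finite_subset[OF _ finite_carrier]) (use ext_carrier in blast)

lemma finite_sat_chains: "finite {K. sat_chain p K}"
  by (rule finite_subset[of _ "Pow (carrier L)"]) (use sat_chain_props finite_carrier in \<open>blast, simp\<close>)

lemma no_ext_top: "\<not> ext top q"
proof
  assume e: "ext top q"
  have "rk top = m" using rk_top_iff top_carrier by blast
  thus False using ext_rk[OF e] rk_le[OF ext_carrier(2)[OF e]] by simp
qed

lemma nch_top: "nch top = 1"
proof -
  have "{K. sat_chain top K} = {{top}}"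
    using no_ext_top by (auto intro: sat_chain.intros elim: sat_chain.cases)
  thus ?thesis by (simp add: nch_def)
qed

text \<open>A saturated chain from \<open>p\<close> determines its second element, as comparable
  elements of equal rank are equal; so the families for different covers are disjoint.\<close>

lemma nch_rec:
  assumes "p \<in> carrier L" "p \<noteq> top"
  shows "nch p = (\<Sum>q | ext p q. nch q)"
proof -
  have eq: "{K. sat_chain p K} = (\<Union>q\<in>{q. ext p q}. insert p ` {K. sat_chain q K})"
    using assms(2) by (auto intro: sat_chain.intros elim: sat_chain.cases)
  have rkgt: "rk p < rk u" if "ext p q" "sat_chain q K" "u \<in> K" for q K u
    using sat_chain_props[OF that(2)] that ext_star_rk[of q u] ext_rk[OF that(1)] by fastforce
  have p_notin: "p \<notin> K" if "ext p q" "sat_chain q K" for q K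
    using rkgt[OF that, of p] by blast
  have "card {K. sat_chain p K} = (\<Sum>q\<in>{q. ext p q}. card (insert p ` {K. sat_chain q K}))"
    unfolding eq
  proof (rule card_UN_disjoint[OF finite_ext])
    show "\<forall>q\<in>{q. ext p q}. finite (insert p ` {K. sat_chain q K})" by (simp add: finite_sat_chains)
    have False if q: "ext p q" "sat_chain q K" "ext p q'" "sat_chain q' K'" "insert p K = insert p K'" "q \<noteq> q'" for q q' K K'
    proof -
      have "K = K'" using q(5) insert_ident[OF p_notin[OF q(1,2)] p_notin[OF q(3,4)]] by blast
      hence "q \<in> K" "q' \<in> K" "ext\<^sup>*\<^sup>* q q'" using sat_chain_props q by blast+
      moreover have "rk q = rk q'" using ext_rk q by simp
      ultimately show False using ext_star_rk_eq q by blast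
    qed
    thus "\<forall>i\<in>{q. ext p q}. \<forall>j\<in>{q. ext p q}. i \<noteq> j \<longrightarrow>
        insert p ` {K. sat_chain i K} \<inter> insert p ` {K. sat_chain j K} = {}" by blast
  qed
  also have "\<dots> = (\<Sum>q | ext p q. nch q)"
  proof (rule sum.cong)
    fix q assume "q \<in> {q. ext p q}"
    hence "inj_on (insert p) {K. sat_chain q K}"
      using p_notin by (intro inj_onI) (metis insert_ident mem_Collect_eq)
    thus "card (insert p ` {K. sat_chain q K}) = nch q" by (simp add: card_image nch_def)
  qed simp
  finally show ?thesis by (simp add: nch_def)
qed

text \<open>Sorts the subsets of \<open>{1..<s}\<close> by their largest element, with
  \<open>l = 0\<close> standing for the empty set.\<close>

lemma sum_pow2: "0 < s \<Longrightarrow> (\<Sum>l<s. if l = 0 then 1 else 2 ^ (l - 1)) = (2::nat) ^ (s - 1)"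
proof (induction s)
  case (Suc s)
  thus ?case by (cases s) auto
qed simp

lemma xnode_exts:
  assumes S: "xnode S"
  shows "{q. ext (X S) q} = (\<lambda>l. X (insert l S)) ` {l. l < m \<and> xstep S l}"
  using xnode_ext[OF S] xstep_ext[OF _ xnode_sub[OF S]] by blast

text \<open>Here \<open>t\<close> is the maximum of \<open>S\<close>, and every saturated chain
  fills \<open>{..t}\<close> before anything larger enters. As long as 0 is missing, each new index
  is smaller than all previous ones; the indices added in this phase before 0 form an arbitrary
  subset of \<open>{1..<Min S}\<close>. After 0 has entered, the least missing index is
  forced.\<close>

lemma nch_X:
  assumes "S \<subseteq> {..t}" "t \<in> S" "t < m"
  shows "nch (X S) = (if 0 \<in> S then 1 else 2 ^ (Min S - 1)) * nch (X {..t})"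
  using assms
proof (induction "m - card S" arbitrary: S rule: less_induct)
  case less
  have sub: "S \<subseteq> {..<m}" using less.prems by auto
  have fin: "finite S" using sub finite_sub by blast
  have IH: "nch (X (insert l S)) = (if 0 \<in> insert l S then 1 else 2 ^ (Min (insert l S) - 1)) * nch (X {..t})"
    if "l < t" "l \<notin> S" for l
  proof (rule less.hyps)
    have "card (insert l S) \<le> card {..<m}" using that less.prems by (intro card_mono) auto
    thus "m - card (insert l S) < m - card S" using that fin by simp
  qed (use that less.prems in auto)
  show ?case
  proof (cases "xnode S")
    case False
    then obtain k where "S = {..<k}" using sub less.prems(2) unfolding xnode_def by blast
    hence "S = {..t}" using less.prems by force
    thus ?thesis by simp
  next
    case True
    have ne: "X S \<noteq> top" using True sub unfolding xnode_def by (auto simp: top_def X_inj)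
    hence rec: "nch (X S) = (\<Sum>q\<in>(\<lambda>l. X (insert l S)) ` {l. l < m \<and> xstep S l}. nch q)"
      using nch_rec XE sub xnode_exts[OF True] by simp
    have inj: "inj_on (\<lambda>l. X (insert l S)) {l. l < m \<and> xstep S l}"
    proof (rule inj_onI)
      fix l l' assume l: "l \<in> {l. l < m \<and> xstep S l}" "l' \<in> {l. l < m \<and> xstep S l}"
         "X (insert l S) = X (insert l' S)"
      hence "insert l S = insert l' S" using X_inj[of "insert l S" "insert l' S"] sub by auto
      thus "l = l'" using l unfolding xstep_def by blast
    qed
    have rec2: "nch (X S) = (\<Sum>l | l < m \<and> xstep S l. nch (X (insert l S)))"
      unfolding rec sum.reindex[OF inj] o_def ..
    show ?thesis
    proof (cases "0 \<in> S")
      case 0: True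
      have "S \<noteq> {..<m}" using True unfolding xnode_def by blast
      then obtain k where k: "k < m" "k \<notin> S" "{..<k} \<subseteq> S" using mex_exists[OF sub] by blast
      have "xstep S l \<longleftrightarrow> l = k" for l
      proof
        assume "xstep S l"
        hence "{..<l} \<subseteq> S" "l \<notin> S" using 0 unfolding xstep_def by auto
        thus "l = k" using k by (meson lessThan_iff nat_neq_iff subsetD)
      next
        show "l = k \<Longrightarrow> xstep S l" using k 0 unfolding xstep_def by (cases "k = 0") auto
      qed
      hence "{l. l < m \<and> xstep S l} = {k}" using k by auto
      moreover have "k < t"
      proof (rule ccontr)
        assume "\<not> k < t"
        hence "t < k" using k less.prems by (metis linorder_neqE_nat)
        hence "S = {..<k}" using k less.prems by auto
        thus False using True unfolding xnode_def by blast
      qed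
      ultimately show ?thesis using rec2 IH[of k] k 0 by simp
    next
      case 0: False
      have ne: "S \<noteq> {}" using less.prems by blast
      have st: "xstep S l \<longleftrightarrow> l < Min S" for l
      proof
        assume "xstep S l"
        hence "\<forall>s\<in>S. l < s" using 0 unfolding xstep_def by (auto simp: subset_iff)
        thus "l < Min S" using fin ne by simp
      next
        assume l: "l < Min S"
        hence "\<forall>s\<in>S. l < s" using fin ne by simp
        thus "xstep S l" unfolding xstep_def by blast
      qed
      have mt: "Min S \<le> t" using fin less.prems by simp
      have m0: "0 < Min S" using fin ne 0 by (metis Min_in gr0I)
      have "{l. l < m \<and> xstep S l} = {..<Min S}" using st mt less.prems by auto
      hence "nch (X S) = (\<Sum>l<Min S. nch (X (insert l S)))" using rec2 by simp
      also have "\<dots> = (\<Sum>l<Min S. (if l = 0 then 1 else 2 ^ (l - 1)) * nch (X {..t}))"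
      proof (rule sum.cong)
        fix l assume "l \<in> {..<Min S}"
        hence l: "l < Min S" by simp
        have "l \<notin> S" using l fin by (metis Min_le not_le)
        moreover have "Min (insert l S) = l" using l fin ne by (intro Min_eqI) auto
        ultimately show "nch (X (insert l S)) = (if l = 0 then 1 else 2 ^ (l - 1)) * nch (X {..t})"
          using IH[of l] l mt 0 by auto
      qed simp
      also have "\<dots> = 2 ^ (Min S - 1) * nch (X {..t})"
        unfolding sum_distrib_right[symmetric] sum_pow2[OF m0] ..
      finally show ?thesis using 0 by simp
    qed
  qed
qed

text \<open>Read from the y-side, the set becomes a final segment with minimum
  \<open>m - 1 - t\<close> and maximum \<open>m - 1\<close>, so the mirrored \<open>nch_X\<close>
  counts the ways all the way up to \<open>top\<close>.\<close>

lemma nch_initial: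
  assumes "t < m - 1" shows "nch (X {..t}) = 2 ^ (m - 2 - t)"
proof -
  have sub: "{..t} \<subseteq> {..<m}" using assms by auto
  have "{..t} = {..<Suc t}" by auto
  hence "seg m {..t}" using assms unfolding seg_def by (intro exI[of _ "Suc t"]) auto
  hence "X {..t} = Y {..t}" using sub X_eq_Y by blast
  moreover have r: "refl_set m {..t} = {m - Suc t..<m}"
    using refl_set_lessThan[of "Suc t" m] assms \<open>{..t} = {..<Suc t}\<close> by simp
  have "Min {m - Suc t..<m} = m - Suc t" using assms by (intro Min_eqI) auto
  moreover have "refl_set m {..m - 1} = {..<m}"
  proof -
    have "{..m - 1} = {..<m}" using m2 by auto
    thus ?thesis using refl_set_lessThan[of m m] by (simp add: atLeast0LessThan)
  qed
  moreover have "nch (Y (refl_set m (refl_set m {..t}))) =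
    (if 0 \<in> refl_set m {..t} then 1 else 2 ^ (Min (refl_set m {..t}) - 1)) * nch (Y (refl_set m {..m - 1}))"
    unfolding r
    by (rule pencil_poset.nch_X[OF mirror, unfolded nch_mirror]) (use assms in auto)
  moreover have "0 \<notin> {m - Suc t..<m}" using assms by auto
  moreover have "refl_set m {m - Suc t..<m} = {..t}" using refl_refl[OF sub] r by simp
  ultimately have "nch (X {..t}) = 2 ^ (m - Suc t - 1) * nch top"
    unfolding r top_Y by simp
  thus ?thesis using assms by (simp add: nch_top numeral_2_eq_2)
qed

lemma nch_X_singleton:
  assumes "l < m"
  shows "nch (X {l}) = (if l = 0 \<or> l = m - 1 then 2 ^ (m - 2) else 2 ^ (m - 3))"
proof -
  have *: "nch (X {l}) = (if 0 \<in> {l} then 1 else 2 ^ (Min {l} - 1)) * nch (X {..l})"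
    by (rule nch_X) (use assms in auto)
  show ?thesis
  proof (cases "l = m - 1")
    case True
    hence "{..l} = {..<m}" using m2 by auto
    thus ?thesis using * True m2 nch_top by (simp add: top_def[symmetric] numeral_2_eq_2)
  next
    case False
    hence l: "l < m - 1" using assms by auto
    show ?thesis
    proof (cases "l = 0")
      case True thus ?thesis using * nch_initial[OF l] by simp
    next
      case l0: False
      have "l - 1 + (m - 2 - l) = m - 3" using l l0 by auto
      thus ?thesis using * nch_initial[OF l] l0 False by (simp flip: power_add)
    qed
  qed
qed

lemma nch_Y_singleton:
  assumes "l < m"
  shows "nch (Y {l}) = (if l = 0 \<or> l = m - 1 then 2 ^ (m - 2) else 2 ^ (m - 3))"
proof -
  have "refl_set m {m - Suc l} = {l}" using assms by (auto simp: refl_set_def)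
  thus ?thesis
    using pencil_poset.nch_X_singleton[OF mirror, of "m - Suc l"] assms unfolding nch_mirror by auto
qed

text \<open>A sum over the atoms: each of the two end indices gives one atom with
  \<open>2 ^ (m - 2)\<close> chains above it, each of the \<open>m - 2\<close> inner indices gives
  two atoms with \<open>2 ^ (m - 3)\<close> chains.\<close>

theorem card_max_chains: "card (max_chains L) = m * 2 ^ (m - 2)"
proof -
  have e0: "seg m {0}" unfolding seg_def using m2 by (intro exI[of _ 1]) auto
  have e1: "seg m {m - 1}" unfolding seg_def using m2 by (intro exI[of _ "m - 1"]) auto
  let ?I = "{0<..<m - 1}"
  have noseg: "\<not> seg m {l}" if "l \<in> ?I" for l
  proof
    assume "seg m {l}"
    then obtain k where "{l} = {..<k} \<or> {l} = {k..<m}" unfolding seg_def by blast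
    thus False
    proof
      assume k: "{l} = {..<k}"
      hence "l < k" by blast
      hence "0 \<in> {..<k}" by simp
      hence "0 \<in> {l}" unfolding k .
      thus False using that by auto
    next
      assume k: "{l} = {k..<m}"
      hence "l \<in> {k..<m}" by blast
      hence "m - 1 \<in> {k..<m}" using that by auto
      hence "m - 1 \<in> {l}" unfolding k .
      thus False using that by auto
    qed
  qed
  have "ext bot q \<longleftrightarrow> q \<in> (\<lambda>l. X {l}) ` {..<m} \<union> (\<lambda>l. Y {l}) ` ?I" for q
  proof
    assume "ext bot q"
    then obtain T l where T: "T \<subseteq> {..<m}" "l < m"
      "xstep T l \<and> bot = X T \<and> q = X (insert l T) \<or> ystep m T l \<and> bot = Y T \<and> q = Y (insert l T)"
      unfolding ext_def by blast
    hence "T = {}" using X_inj[of "{}" T] Y_inj[of "{}" T] by (auto simp: bot_def) (auto simp: bot_def[symmetric] bot_Y)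
    hence "q = X {l} \<or> q = Y {l}" using T by auto
    moreover have "Y {l} = X {l}" if "l \<notin> ?I"
    proof -
      have "l = 0 \<or> l = m - 1" using that T(2) by auto
      thus ?thesis using X_eq_Y[of "{l}" "{l}"] e0 e1 T(2) by auto
    qed
    ultimately show "q \<in> (\<lambda>l. X {l}) ` {..<m} \<union> (\<lambda>l. Y {l}) ` ?I" using T(2) by (cases "l \<in> ?I") auto
  next
    have "ext bot (X {l})" "ext bot (Y {l})" if "l < m" for l
      using xstep_ext[of "{}" l] ystep_ext[of "{}" l] that by (auto simp: xstep_def ystep_def bot_def) (auto simp: bot_def[symmetric] bot_Y)
    thus "q \<in> (\<lambda>l. X {l}) ` {..<m} \<union> (\<lambda>l. Y {l}) ` ?I \<Longrightarrow> ext bot q" by auto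
  qed
  hence ex: "{q. ext bot q} = (\<lambda>l. X {l}) ` {..<m} \<union> (\<lambda>l. Y {l}) ` ?I" by blast
  have disj: "(\<lambda>l. X {l}) ` {..<m} \<inter> (\<lambda>l. Y {l}) ` ?I = {}"
  proof -
    have "X {l} \<noteq> Y {j}" if "l < m" "j \<in> ?I" for l j
      using X_eq_Y[of "{l}" "{j}"] noseg[OF that(2)] that by auto
    thus ?thesis by blast
  qed
  have injX: "inj_on (\<lambda>l. X {l}) {..<m}"
    by (rule inj_onI) (use X_inj in \<open>metis empty_subsetI insert_subset singleton_inject\<close>)
  have injY: "inj_on (\<lambda>l. Y {l}) ?I"
  proof (rule inj_onI)
    fix l j assume "l \<in> ?I" "j \<in> ?I" "Y {l} = Y {j}"
    thus "l = j" using Y_inj[of "{l}" "{j}"] by auto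
  qed
  have "0 \<in> {..<m}" using m2 by simp
  hence "bot \<noteq> top" using X_inj[of "{}" "{..<m}"] unfolding bot_def top_def by blast
  hence "nch bot = (\<Sum>q | ext bot q. nch q)" by (rule nch_rec[OF bot_carrier])
  also have "\<dots> = (\<Sum>l<m. nch (X {l})) + (\<Sum>l\<in>?I. nch (Y {l}))"
    unfolding ex sum.reindex[OF injX, unfolded o_def, symmetric] sum.reindex[OF injY, unfolded o_def, symmetric]
    by (rule sum.union_disjoint[OF _ _ disj]) simp_all
  also have "(\<Sum>l\<in>?I. nch (Y {l})) = (\<Sum>l\<in>?I. 2 ^ (m - 3))"
    by (rule sum.cong) (auto simp: nch_Y_singleton)
  also have "(\<Sum>l<m. nch (X {l})) = 2 ^ (m - 2) + 2 ^ (m - 2) + (\<Sum>l\<in>?I. 2 ^ (m - 3))"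
  proof -
    have "{..<m} = insert 0 (insert (m - 1) ?I)" using m2 by auto
    moreover have "(\<Sum>l\<in>?I. nch (X {l})) = (\<Sum>l\<in>?I. 2 ^ (m - 3))"
      by (rule sum.cong) (auto simp: nch_X_singleton)
    ultimately show ?thesis using m2 by (simp add: nch_X_singleton)
  qed
  also have "(\<Sum>l\<in>?I. 2 ^ (m - 3)) = (m - 2) * (2::nat) ^ (m - 3)"
    by (simp add: numeral_2_eq_2)
  finally have n: "nch bot = 2 * 2 ^ (m - 2) + 2 * ((m - 2) * 2 ^ (m - 3))" by linarith
  \<comment> \<open>For \<open>m = 2\<close> the exponent \<open>m - 3\<close> is truncated to 0,
    but the factor \<open>m - 2\<close> vanishes.\<close>
  have "2 * ((m - 2) * 2 ^ (m - 3)) = (m - 2) * (2::nat) ^ (m - 2)"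
  proof (cases "m = 2")
    case False
    hence "m - 2 = Suc (m - 3)" using m2 by auto
    thus ?thesis by (metis mult.left_commute power_Suc)
  qed simp
  hence "nch bot = (2 + (m - 2)) * 2 ^ (m - 2)" unfolding n by (simp add: algebra_simps)
  moreover have "2 + (m - 2) = m" using m2 by simp
  ultimately show ?thesis by (simp only: max_chains_eq nch_def)
qed

end

section \<open>The rank generating function\<close>

lemma sum_monom_card:
  "(\<Sum>S\<in>Pow {..<m}. monom (1::int) (card S)) = (\<Sum>k\<le>m. monom (int (m choose k)) k)"
proof -
  have "(\<Sum>S\<in>Pow {..<m}. monom (1::int) (card S)) =
      (\<Sum>k\<in>{..m}. \<Sum>S | S \<in> Pow {..<m} \<and> card S = k. monom 1 (card S))"
    by (rule sum.group[symmetric]) (auto dest: card_mono[OF finite_lessThan])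
  also have "\<dots> = (\<Sum>k\<le>m. monom (int (m choose k)) k)"
  proof (rule sum.cong)
    fix k
    have "(\<Sum>S | S \<in> Pow {..<m} \<and> card S = k. monom (1::int) (card S)) =
       of_nat (card {S. S \<subseteq> {..<m} \<and> card S = k}) * monom 1 k"
      by (simp add: Pow_def)
    also have "\<dots> = monom (int (m choose k)) k"
      by (simp add: n_subsets of_nat_poly smult_monom)
    finally show "(\<Sum>S | S \<in> Pow {..<m} \<and> card S = k. monom (1::int) (card S)) = monom (int (m choose k)) k" .
  qed simp
  finally show ?thesis .
qed

text \<open>The first sum counts the initial segments and the second the final ones. The sizes 0 and
  \<open>m\<close> are left out of the second, because there the two kinds coincide.\<close>

lemma sum_monom_seg:
  assumes "2 \<le> m"
  shows "(\<Sum>S | seg m S. monom (1::int) (card S)) = (\<Sum>k\<le>m. monom 1 k) + (\<Sum>k=1..m-1. monom 1 k)"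
proof -
  have eq: "{S. seg m S} = lessThan ` {..m} \<union> (\<lambda>k. {m - k..<m}) ` {1..m-1}"
  proof (intro equalityI subsetI)
    fix S assume "S \<in> {S. seg m S}"
    then obtain k where k: "k \<le> m" "S = {..<k} \<or> S = {k..<m}" unfolding seg_def by blast
    consider "S = {..<k}" | "k = 0" "S = {..<m}" | "k = m" "S = {..<0}" | "0 < k" "k < m" "S = {k..<m}"
      using k by (cases "k = 0"; cases "k = m") (auto simp: atLeast0LessThan)
    thus "S \<in> lessThan ` {..m} \<union> (\<lambda>k. {m - k..<m}) ` {1..m-1}"
    proof cases
      case 4
      hence "S = {m - (m - k)..<m}" "m - k \<in> {1..m-1}" by auto
      thus ?thesis by blast
    qed (use k in blast)+
  next
    fix S assume "S \<in> lessThan ` {..m} \<union> (\<lambda>k. {m - k..<m}) ` {1..m-1}"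
    then consider k where "k \<le> m" "S = {..<k}" | k where "S = {m - k..<m}" by blast
    thus "S \<in> {S. seg m S}"
    proof cases
      case (2 k) thus ?thesis unfolding seg_def using diff_le_self by blast
    qed (auto simp: seg_def)
  qed
  have disj: "lessThan ` {..m} \<inter> (\<lambda>k. {m - k..<m}) ` {1..m-1} = {}"
  proof -
    have False if k: "{..<j} = {m - k..<m}" "k \<in> {1..m-1}" for j k
    proof -
      have "m - 1 \<in> {m - k..<m}" using k(2) assms by auto
      hence "m - 1 \<in> {..<j}" unfolding k(1) .
      hence "0 \<in> {..<j}" by auto
      hence "0 \<in> {m - k..<m}" unfolding k(1) .
      thus False using k(2) by auto
    qed
    thus ?thesis by blast
  qed
  have inj1: "inj_on lessThan {..m::nat}" by (auto simp: inj_on_def)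
  have inj2: "inj_on (\<lambda>k. {m - k..<m}) {1..m-1}"
  proof (rule inj_onI)
    fix j k assume jk: "j \<in> {1..m - 1}" "k \<in> {1..m - 1}" "{m - j..<m} = {m - k..<m}"
    from jk(3) have "card {m - j..<m} = card {m - k..<m}" by (rule arg_cong)
    thus "j = k" using jk(1,2) by auto
  qed
  have "(\<Sum>S | seg m S. monom (1::int) (card S)) =
      (\<Sum>k\<in>{..m}. monom 1 (card {..<k})) + (\<Sum>k=1..m-1. monom 1 (card {m - k..<m}))"
    unfolding eq by (subst sum.union_disjoint[OF _ _ disj])
      (simp_all only: sum.reindex[OF inj1] sum.reindex[OF inj2] o_def finite_imageI finite_atMost finite_atLeastAtMost)
  also have "(\<Sum>k=1..m-1. monom (1::int) (card {m - k..<m})) = (\<Sum>k=1..m-1. monom 1 k)"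
    by (rule sum.cong) auto
  finally show ?thesis by simp
qed

context pencil_poset
begin

text \<open>Two copies of the power set are glued along the segments, so twice the binomial sum
  minus the segment count.\<close>

theorem rank_gen_fun_L:
  "rank_gen_fun L rk = 1 + (\<Sum>k=1..m-1. monom (2 * int (m choose k) - 2) k) + monom 1 m"
proof -
  let ?P = "Pow {..<m}" and ?s = "{S. seg m S}"
  have segP: "?s \<subseteq> ?P" unfolding seg_def by auto
  have car: "carrier L = X ` ?P \<union> Y ` (?P - ?s)"
  proof -
    have "Y S \<in> X ` ?P" if "S \<subseteq> {..<m}" "seg m S" for S
      using that X_eq_Y[of S S] by (intro image_eqI[of _ _ S]) auto
    hence "Y ` ?P \<subseteq> X ` ?P \<union> Y ` (?P - ?s)" by blast
    thus ?thesis unfolding carrier_L by blast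
  qed
  have disj: "X ` ?P \<inter> Y ` (?P - ?s) = {}" using X_eq_Y by auto
  have inj: "inj_on X ?P" "inj_on Y (?P - ?s)" using X_inj Y_inj by (auto simp: inj_on_def)
  have "rank_gen_fun L rk = (\<Sum>S\<in>?P. monom 1 (rk (X S))) + (\<Sum>S\<in>?P - ?s. monom 1 (rk (Y S)))"
    unfolding rank_gen_fun_def car
    by (subst sum.union_disjoint[OF _ _ disj])
       (simp_all only: sum.reindex[OF inj(1)] sum.reindex[OF inj(2)] o_def finite_imageI finite_Pow_iff finite_lessThan finite_Diff)
  also have "(\<Sum>S\<in>?P. monom 1 (rk (X S))) = (\<Sum>S\<in>?P. monom (1::int) (card S))"
    by (rule sum.cong) (auto simp: rk_X)
  also have "(\<Sum>S\<in>?P - ?s. monom 1 (rk (Y S))) = (\<Sum>S\<in>?P - ?s. monom (1::int) (card S))"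
    by (rule sum.cong) (auto simp: rk_Y)
  also have "\<dots> = (\<Sum>S\<in>?P. monom (1::int) (card S)) - (\<Sum>S\<in>?s. monom (1::int) (card S))"
    by (rule sum_diff[OF _ segP]) simp
  finally have rgf: "rank_gen_fun L rk = 2 * (\<Sum>k\<le>m. monom (int (m choose k)) k)
      - ((\<Sum>k\<le>m. monom 1 k) + (\<Sum>k=1..m-1. monom 1 k))"
    unfolding sum_monom_card sum_monom_seg[OF m2] by (simp add: algebra_simps)
  have split: "(\<Sum>k\<le>m. g k) = g 0 + g m + (\<Sum>k=1..m-1. g k)" for g :: "nat \<Rightarrow> int poly"
  proof -
    have "{..m} = insert 0 (insert m {1..m-1})" "0 \<notin> insert m {1..m-1}" "m \<notin> {1..m-1}" using m2 by auto
    thus ?thesis by simp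
  qed
  have sum2: "(\<Sum>k=1..m-1. monom (2 * int (m choose k) - 2) k) =
     2 * (\<Sum>k=1..m-1. monom (int (m choose k)) k) - 2 * (\<Sum>k=1..m-1. monom 1 k)"
  proof -
    have "monom (2 * c - 2) k = 2 * monom c k - 2 * monom 1 k" for c :: int and k
    proof -
      have "monom (2 * c - 2) k = monom (c + c) k - monom (1 + 1) k" by (simp add: diff_monom)
      thus ?thesis by (simp only: add_monom[symmetric] mult_2)
    qed
    thus ?thesis by (simp add: sum_subtractf sum_distrib_left)
  qed
  have "2 * (1 + M + A) - (1 + M + C + C) = 1 + (2 * A - 2 * C) + M" for A C M :: "int poly"
    by (simp add: algebra_simps)
  thus ?thesis unfolding rgf split sum2 by (simp only: binomial_n_0 binomial_n_n of_nat_1 monom_eq_1 add.assoc)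
qed

end

section \<open>A drawing with ranks as heights\<close>

lemma planar_posetI:
  fixes f :: "'b \<Rightarrow> real" and rk :: "'b \<Rightarrow> nat"
  assumes fin: "finite (carrier L)"
    and rk: "\<And>x y. covers L x y \<Longrightarrow> rk y = rk x + 1"
    and inj: "\<And>x y. x \<in> carrier L \<Longrightarrow> y \<in> carrier L \<Longrightarrow> rk x = rk y \<Longrightarrow> f x = f y \<Longrightarrow> x = y"
    and mono: "\<And>x y x' y'. covers L x y \<Longrightarrow> covers L x' y' \<Longrightarrow> rk x = rk x' \<Longrightarrow> f x < f x' \<Longrightarrow> f y \<le> f y'"
  shows "planar_poset L"
proof -
  \<comment> \<open>Elements are placed at height \<open>rk\<close> and covers are drawn as
    segments. Segments that start at different ranks can meet only at a vertex level; for equal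
    ranks the monotonicity of \<open>f\<close> along covers excludes a crossing.\<close>
  define pos where "pos = (\<lambda>x. (f x, real (rk x)))"
  define crv where "crv = (\<lambda>x y. linepath (pos x) (pos y))"
  have car: "x \<in> carrier L" "y \<in> carrier L" if "covers L x y" for x y
    using that unfolding covers_def by auto
  have posI: "x = y" if "x \<in> carrier L" "y \<in> carrier L" "pos x = pos y" for x y
    using inj[OF that(1,2)] that(3) unfolding pos_def by auto
  have pt: "crv x y t = (f x + t * (f y - f x), real (rk x) + t)" if "covers L x y" for x y t
    using rk[OF that] by (simp add: crv_def linepath_def pos_def algebra_simps)
  have im: "\<exists>t. 0 \<le> t \<and> t \<le> 1 \<and> w = crv x y t" if "w \<in> path_image (crv x y)" for w x y
    using that unfolding path_image_def by auto
  have ends: "crv x y 0 = pos x" "crv x y 1 = pos y" for x y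
    by (simp_all add: crv_def linepath_def)
  have "path_image (crv x y) \<inter> pos ` carrier L = {pos x, pos y}" if c: "covers L x y" for x y
  proof (intro equalityI subsetI)
    fix w assume w: "w \<in> path_image (crv x y) \<inter> pos ` carrier L"
    then obtain t z where t: "0 \<le> t" "t \<le> 1" "w = crv x y t" "w = pos z" "z \<in> carrier L"
      using im by blast
    hence "real (rk x) + t = real (rk z)" using pt[OF c] by (simp add: pos_def)
    hence "t = of_int (int (rk z) - int (rk x))" by simp
    moreover from this have "0 \<le> int (rk z) - int (rk x)" "int (rk z) - int (rk x) \<le> 1"
      using t(1,2) by simp_all
    hence "int (rk z) - int (rk x) = 0 \<or> int (rk z) - int (rk x) = 1" by linarith
    ultimately have "t = 0 \<or> t = 1" by auto
    thus "w \<in> {pos x, pos y}" using t ends by auto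
  next
    fix w assume "w \<in> {pos x, pos y}"
    moreover have "pos x \<in> path_image (crv x y)" "pos y \<in> path_image (crv x y)"
      by (simp_all add: crv_def)
    ultimately show "w \<in> path_image (crv x y) \<inter> pos ` carrier L" using car[OF c] by auto
  qed
  moreover have "w \<in> {pos x, pos y} \<inter> {pos x', pos y'}"
    if c: "covers L x y" "covers L x' y'" "(x, y) \<noteq> (x', y')"
      and w: "w \<in> path_image (crv x y)" "w \<in> path_image (crv x' y')" for x y x' y' w
  proof -
    obtain t where t: "0 \<le> t" "t \<le> 1" "w = crv x y t" using im w by blast
    obtain s where s: "0 \<le> s" "s \<le> 1" "w = crv x' y' s" using im w by blast
    have h: "real (rk x) + t = real (rk x') + s" "f x + t * (f y - f x) = f x' + s * (f y' - f x')"
      using t s pt[OF c(1)] pt[OF c(2)] by simp_all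
    have ts: "t = s + of_int (int (rk x') - int (rk x))" using h by simp
    show ?thesis
    proof (cases "rk x = rk x'")
      case False
      hence "t = 0 \<and> s = 1 \<or> t = 1 \<and> s = 0" using ts t(1,2) s(1,2) by linarith
      thus ?thesis using t(3) s(3) ends by auto
    next
      case True
      hence st: "s = t" using h by simp
      have *: "w = pos x \<and> x = x' \<or> w = pos y \<and> y = y'"
        if le: "f x \<le> f x'" "f y \<le> f y'" "0 \<le> t" "t \<le> 1" "(1 - t) * (f x' - f x) + t * (f y' - f y) = 0"
      proof -
        have "(1 - t) * (f x' - f x) = 0 \<and> t * (f y' - f y) = 0"
          using le by (simp add: add_nonneg_eq_0_iff)
        hence "t = 0 \<and> f x' = f x \<or> t = 1 \<and> f y' = f y \<or> f x' = f x \<and> f y' = f y" by auto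
        hence "t = 0 \<and> x' = x \<or> t = 1 \<and> y' = y \<or> x' = x \<and> y' = y"
          using inj car c True rk[OF c(1)] rk[OF c(2)] by metis
        thus ?thesis using c(3) t(3) ends by auto
      qed
      have eq: "(1 - t) * (f x' - f x) + t * (f y' - f y) = 0" using h(2) st by (simp add: algebra_simps)
      consider "f x < f x'" | "f x' < f x" | "f x = f x'" by linarith
      hence "w = pos x \<and> x = x' \<or> w = pos y \<and> y = y'"
      proof cases
        case 1 thus ?thesis using * mono[OF c(1,2) True] t eq by simp
      next
        case 2
        have "f y' \<le> f y" by (rule mono[OF c(2,1) True[symmetric] 2])
        have "0 \<le> (1 - t) * (f x - f x')" "0 \<le> t * (f y - f y')" using t 2 \<open>f y' \<le> f y\<close> by simp_all
        moreover have "(1 - t) * (f x - f x') + t * (f y - f y') = 0" using eq by (simp add: algebra_simps)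
        ultimately have z: "(1 - t) * (f x - f x') = 0 \<and> t * (f y - f y') = 0"
          by (rule add_nonneg_eq_0_iff[THEN iffD1])
        hence "1 - t = 0" using 2 by auto
        hence t1: "t = 1" by simp
        have "f y - f y' = 0" using z unfolding t1 by simp
        hence "t = 1 \<and> f y' = f y" using t1 by simp
        hence "t = 1 \<and> y' = y"
          using inj car c True rk[OF c(1)] rk[OF c(2)] by metis
        thus ?thesis using t(3) ends by auto
      next
        case 3
        hence "x = x'" using inj car c True by metis
        have "t * (f y' - f y) = 0" using eq 3 by simp
        hence "t = 0 \<or> f y' = f y" by auto
        moreover have "f y' \<noteq> f y"
          using inj car c True rk[OF c(1)] rk[OF c(2)] \<open>x = x'\<close> by (metis)
        ultimately have "t = 0" by blast
        thus ?thesis using t(3) ends \<open>x = x'\<close> by auto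
      qed
      thus ?thesis using t(3) s(3) st ends pt[OF c(1)] pt[OF c(2)] by auto
    qed
  qed
  moreover have "strict_mono_on {0..1} (\<lambda>t. snd (crv x y t))" if "covers L x y" for x y
    using pt[OF that] by (auto intro!: strict_mono_onI)
  moreover have "inj_on pos (carrier L)" using posI by (auto simp: inj_on_def)
  moreover have "path (crv x y) \<and> pathstart (crv x y) = pos x \<and> pathfinish (crv x y) = pos y" for x y
    by (simp add: crv_def)
  ultimately show ?thesis unfolding planar_poset_def
    by (intro conjI[OF fin] exI[of _ pos] exI[of _ crv]) (simp add: subset_iff)
qed

section \<open>Colexicographic order and horizontal positions\<close>

lemma set_encode_lessThan: "set_encode {..<d} < 2 ^ d"
  by (induction d) (auto simp: lessThan_Suc)

text \<open>Binary codes compare finite sets by the largest element in which they differ, which is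
  the colexicographic order.\<close>

lemma set_encode_less:
  assumes "finite S" "finite T" "d \<in> T" "d \<notin> S" "\<And>i. d < i \<Longrightarrow> i \<in> S \<longleftrightarrow> i \<in> T"
  shows "set_encode S < set_encode T"
proof -
  have split: "set_encode A = set_encode (A \<inter> {..<d}) + set_encode (A \<inter> {d}) + set_encode (A \<inter> {d<..})"
    if "finite A" for A
  proof -
    have "A = (A \<inter> {..<d}) \<union> (A \<inter> {d}) \<union> (A \<inter> {d<..})" by auto
    hence "set_encode A = set_encode ((A \<inter> {..<d}) \<union> (A \<inter> {d}) \<union> (A \<inter> {d<..}))" by simp
    also have "\<dots> = set_encode (A \<inter> {..<d}) + set_encode (A \<inter> {d}) + set_encode (A \<inter> {d<..})"
      unfolding set_encode_def using that by (subst sum.union_disjoint; auto)+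
    finally show ?thesis .
  qed
  have "set_encode (S \<inter> {..<d}) \<le> set_encode {..<d}"
    unfolding set_encode_def by (rule sum_mono2) auto
  also have "\<dots> < 2 ^ d" by (simp add: set_encode_lessThan)
  finally have "set_encode (S \<inter> {..<d}) < 2 ^ d" .
  moreover have "T \<inter> {d} = {d}" "S \<inter> {d} = {}" using assms by auto
  moreover have "S \<inter> {d<..} = T \<inter> {d<..}" using assms(5) by auto
  ultimately show ?thesis unfolding split[OF assms(1)] split[OF assms(2)] by (simp add: set_encode_def)
qed

lemma set_encode_lessE:
  assumes "finite S" "finite T" "set_encode S < set_encode T"
  obtains d where "d \<in> T" "d \<notin> S" "\<And>i. d < i \<Longrightarrow> i \<in> S \<longleftrightarrow> i \<in> T"
proof -
  let ?D = "(S - T) \<union> (T - S)"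
  have "S \<noteq> T" using assms(3) by auto
  hence D: "finite ?D" "?D \<noteq> {}" using assms by auto
  define d where "d = Max ?D"
  have d: "d \<in> ?D" unfolding d_def by (rule Max_in[OF D])
  have ab: "i \<in> S \<longleftrightarrow> i \<in> T" if "d < i" for i
    using that Max_ge[OF D(1), of i] unfolding d_def by (metis DiffI UnI1 UnI2 not_le)
  have "d \<in> T"
  proof (rule ccontr)
    assume "d \<notin> T"
    hence "set_encode T < set_encode S" using d ab assms by (intro set_encode_less[of T S d]) auto
    thus False using assms(3) by simp
  qed
  thus ?thesis using that d ab by blast
qed

lemma set_encode_bound: "S \<subseteq> {..<m} \<Longrightarrow> set_encode S < 2 ^ m"
proof -
  assume "S \<subseteq> {..<m}"
  hence "set_encode S \<le> set_encode {..<m}" unfolding set_encode_def by (intro sum_mono2) auto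
  also have "\<dots> < 2 ^ m" by (simp add: set_encode_lessThan)
  finally show ?thesis .
qed

text \<open>Among sets of one size the initial segment comes first in colexicographic order: a set
  before it would fit into \<open>{..<card S}\<close> with one point removed.\<close>

lemma initial_set_encode_min:
  assumes "finite S" "S \<noteq> {..<card S}"
  shows "set_encode {..<card S} < set_encode S"
proof (rule ccontr)
  assume "\<not> ?thesis"
  moreover have "set_encode {..<card S} \<noteq> set_encode S"
    using inj_on_set_encode assms by (auto dest: inj_onD)
  ultimately have "set_encode S < set_encode {..<card S}" by simp
  then obtain d where d: "d \<in> {..<card S}" "d \<notin> S" "\<And>i. d < i \<Longrightarrow> i \<in> S \<longleftrightarrow> i \<in> {..<card S}"
    using assms(1) by (elim set_encode_lessE[rotated 2]) auto
  have "S \<subseteq> {..<card S} - {d}"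
  proof
    fix i assume "i \<in> S"
    thus "i \<in> {..<card S} - {d}" using d by (cases "d < i") (auto simp: not_less)
  qed
  hence "card S \<le> card ({..<card S} - {d})" by (intro card_mono) auto
  thus False using d(1) by simp
qed

text \<open>Let \<open>d\<close> be the largest difference; it lies in \<open>S\<close> and not in
  \<open>T\<close>. If \<open>l' < d\<close>, the enlarged \<open>T\<close> still lacks
  \<open>d\<close> and stays before \<open>S\<close>. If \<open>l' = d\<close>, then
  \<open>T\<close> contains \<open>{..<d}\<close>, equality of sizes leaves \<open>S\<close> exactly
  one gap \<open>b\<close> below \<open>d\<close>, the index \<open>l\<close> has to be this gap,
  and the enlarged sets coincide.\<close>

lemma xstep_mono:
  assumes S: "finite S" "S \<noteq> {}" "xstep S l" and T: "finite T" "T \<noteq> {}" "xstep T l'"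
    and c: "card S = card T" and lt: "set_encode T < set_encode S"
  shows "set_encode (insert l' T) \<le> set_encode (insert l S)"
proof -
  obtain d where d: "d \<in> S" "d \<notin> T" "\<And>i. d < i \<Longrightarrow> i \<in> T \<longleftrightarrow> i \<in> S"
    using set_encode_lessE[OF T(1) S(1) lt] by blast
  have cut: "card A = card (A \<inter> {..<d}) + card (A \<inter> {d}) + card (A \<inter> {d<..})" if "finite A" for A :: "nat set"
  proof -
    have "A = (A \<inter> {..<d}) \<union> (A \<inter> {d}) \<union> (A \<inter> {d<..})" by auto
    hence "card A = card ((A \<inter> {..<d}) \<union> (A \<inter> {d}) \<union> (A \<inter> {d<..}))" by simp
    also have "\<dots> = card (A \<inter> {..<d}) + card (A \<inter> {d}) + card (A \<inter> {d<..})"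
      using that by (subst card_Un_disjoint; auto)+
    finally show ?thesis .
  qed
  have hi: "T \<inter> {d<..} = S \<inter> {d<..}" using d(3) by auto
  have low: "card (T \<inter> {..<d}) = card (S \<inter> {..<d}) + 1"
  proof -
    have "T \<inter> {d} = {}" "S \<inter> {d} = {d}" using d by auto
    thus ?thesis using cut[OF S(1)] cut[OF T(1)] c hi by simp
  qed
  then obtain t where t: "t \<in> T" "t < d" by (metis IntE add_is_0 card.empty ex_in_conv lessThan_iff one_neq_zero)
  have T': "l' \<notin> T" "(\<forall>s\<in>T. l' < s) \<or> (l' \<noteq> 0 \<and> {..<l'} \<subseteq> T)" using T(3) unfolding xstep_def by auto
  have "l' \<le> d" using T'(2)
  proof
    assume "\<forall>s\<in>T. l' < s" thus ?thesis using t by fastforce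
  next
    assume "l' \<noteq> 0 \<and> {..<l'} \<subseteq> T"
    thus ?thesis using d(2) by (meson lessThan_iff not_le subsetD)
  qed
  show ?thesis
  proof (cases "l' = d")
    case False
    hence "l' < d" using \<open>l' \<le> d\<close> by simp
    have "set_encode (insert l' T) < set_encode S"
      by (rule set_encode_less[of _ _ d]) (use S T d \<open>l' < d\<close> in auto)
    also have "\<dots> \<le> set_encode (insert l S)"
      unfolding set_encode_def by (rule sum_mono2) (use S in auto)
    finally show ?thesis by simp
  next
    case True
    hence Td: "{..<d} \<subseteq> T" "d \<noteq> 0" using T'(2) t by auto
    hence "T \<inter> {..<d} = {..<d}" by auto
    hence cS: "card (S \<inter> {..<d}) + 1 = d" using low by simp
    then obtain b where b: "b < d" "b \<notin> S"
    proof -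
      have "S \<inter> {..<d} \<noteq> {..<d}"
      proof
        assume e: "S \<inter> {..<d} = {..<d}"
        show False using cS unfolding e by simp
      qed
      thus ?thesis using that by blast
    qed
    have "S \<inter> {..<d} \<subseteq> {..<d} - {b}" using b by auto
    moreover have "card (S \<inter> {..<d}) = card ({..<d} - {b})" using cS b by simp
    ultimately have Sb: "S \<inter> {..<d} = {..<d} - {b}" by (intro card_subset_eq) auto
    have l: "l \<notin> S" "(\<forall>s\<in>S. l < s) \<or> (l \<noteq> 0 \<and> {..<l} \<subseteq> S)" using S(3) unfolding xstep_def by auto
    have "l = b"
    proof -
      have "l < d" using l(2)
      proof
        assume "\<forall>s\<in>S. l < s" thus ?thesis using d(1) by blast
      next
        assume "l \<noteq> 0 \<and> {..<l} \<subseteq> S"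
        hence "l \<le> b" using b by (meson lessThan_iff not_le subsetD)
        thus ?thesis using b by simp
      qed
      thus ?thesis using l(1) Sb by (metis DiffI IntE lessThan_iff singletonD)
    qed
    have "insert l S = insert l' T"
    proof (rule Set.set_eqI)
      fix i
      consider "i < d" | "i = d" | "d < i" by linarith
      thus "i \<in> insert l S \<longleftrightarrow> i \<in> insert l' T"
      proof cases
        case 1 thus ?thesis using Sb Td \<open>l = b\<close> by (metis DiffI IntE insertCI lessThan_iff singletonD subsetD)
      next
        case 2 thus ?thesis using d(1) True by simp
      next
        case 3 thus ?thesis using d(3) \<open>l = b\<close> b True by auto
      qed
    qed
    thus ?thesis by simp
  qed
qed

text \<open>Horizontal positions inside one rank. For proper nonempty sets the drawing has four
  blocks from left to right: x-words without \<open>m - 1\<close>, y-words with 0, x-words with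
  \<open>m - 1\<close>, y-words without 0; the y-positions are the negatives of the reflected
  x-positions. The first two blocks meet in the initial segment at \<open>- (2 ^ m)\<close>, the
  last two in the final segment at \<open>2 ^ m\<close>, and 0 separates the middle ones, since
  codes stay below \<open>2 ^ m\<close>. In the first block the sign of the code is reversed, so
  that the initial segment, which has the least code, comes last.\<close>

definition xkey :: "nat \<Rightarrow> nat set \<Rightarrow> real" where
  "xkey m S = (if m - 1 \<in> S
     then 2 ^ m - (real (set_encode {m - card S..<m}) - real (set_encode S))
     else - (2 ^ m) - (real (set_encode S) - real (set_encode {..<card S})))"

lemma xkey_pos:
  assumes "S \<subseteq> {..<m}" "m - 1 \<in> S" shows "0 < xkey m S"
proof -
  have b: "real (set_encode {m - card S..<m}) < 2 ^ m"
    using set_encode_bound[of "{m - card S..<m}" m] by (simp add: subset_iff)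
  have "xkey m S = 2 ^ m - (real (set_encode {m - card S..<m}) - real (set_encode S))"
    using assms(2) by (simp add: xkey_def)
  thus ?thesis using b of_nat_0_le_iff[of "set_encode S", where 'a = real] by linarith
qed

lemma xkey_neg:
  assumes "S \<subseteq> {..<m}" "m - 1 \<notin> S" shows "xkey m S \<le> - (2 ^ m)"
    "S \<noteq> {..<card S} \<Longrightarrow> xkey m S < - (2 ^ m)"
proof -
  have f: "finite S" using assms finite_subset by blast
  have "set_encode {..<card S} \<le> set_encode S"
    using initial_set_encode_min[OF f] by (cases "S = {..<card S}") auto
  thus "xkey m S \<le> - (2 ^ m)" using assms(2) by (simp add: xkey_def)
  assume "S \<noteq> {..<card S}"
  thus "xkey m S < - (2 ^ m)" using assms(2) initial_set_encode_min[OF f] by (simp add: xkey_def)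
qed

lemma final_set_encode_max:
  assumes "S \<subseteq> {..<m}" shows "set_encode S \<le> set_encode {m - card S..<m}"
proof (rule ccontr)
  let ?F = "{m - card S..<m}"
  have f: "finite S" using assms finite_subset by blast
  have cm: "card S \<le> m" using card_mono[OF _ assms] by simp
  assume "\<not> ?thesis"
  hence "set_encode ?F < set_encode S" by simp
  then obtain d where d: "d \<in> S" "d \<notin> ?F" "\<And>i. d < i \<Longrightarrow> i \<in> ?F \<longleftrightarrow> i \<in> S"
    using f by (elim set_encode_lessE[rotated 2]) auto
  have "d < m - card S" using d assms by auto
  hence "i \<in> S" if "i \<in> ?F" for i using that d(3)[of i] by simp
  hence "insert d ?F \<subseteq> S" using d(1) by blast
  hence "card (insert d ?F) \<le> card S" using f by (intro card_mono)
  thus False using d(2) cm by simp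
qed

lemma xkey_le: 
  assumes "S \<subseteq> {..<m}" shows "xkey m S \<le> 2 ^ m"
proof (cases "m - 1 \<in> S")
  case True thus ?thesis using final_set_encode_max[OF assms] by (simp add: xkey_def)
next
  case False
  have "- (2 ^ m) \<le> (2 ^ m :: real)" by simp
  thus ?thesis using xkey_neg(1)[OF assms False] by linarith
qed

lemma xkey_inj:
  assumes "S \<subseteq> {..<m}" "T \<subseteq> {..<m}" "card S = card T" "xkey m S = xkey m T"
  shows "S = T"
proof -
  have f: "finite S" "finite T" using assms finite_subset by blast+
  have "m - 1 \<in> S \<longleftrightarrow> m - 1 \<in> T"
  proof -
    have "\<not> (0 < x \<and> x \<le> - (2 ^ m))" for x :: real
      by (smt (verit) zero_less_power)
    thus ?thesis using xkey_pos[OF assms(1)] xkey_pos[OF assms(2)] xkey_neg(1)[OF assms(1)] xkey_neg(1)[OF assms(2)] assms(4) by metis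
  qed
  hence "set_encode S = set_encode T" using assms(3,4) by (auto simp: xkey_def split: if_splits)
  thus ?thesis using f inj_on_set_encode by (auto dest: inj_onD)
qed

text \<open>Within a block the reference codes depend only on the cardinality, which both sets
  share. The claim thus reduces to \<open>xstep_mono\<close>, with the direction reversed in the
  block without \<open>m - 1\<close>.\<close>

lemma xkey_step_mono:
  assumes S: "S \<subseteq> {..<m}" "S \<noteq> {}" "xstep S l" "l < m" and T: "T \<subseteq> {..<m}" "T \<noteq> {}" "xstep T l'" "l' < m"
    and c: "card S = card T" and lt: "xkey m S < xkey m T"
    and same: "m - 1 \<in> S \<longleftrightarrow> m - 1 \<in> T" "m - 1 \<in> S \<or> l \<noteq> m - 1 \<and> l' \<noteq> m - 1"
  shows "xkey m (insert l S) \<le> xkey m (insert l' T)"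
proof -
  have f: "finite S" "finite T" using S T finite_subset by blast+
  have n: "l \<notin> S" "l' \<notin> T" using S T unfolding xstep_def by auto
  have cc: "card (insert l S) = card (insert l' T)" using f n c by simp
  show ?thesis
  proof (cases "m - 1 \<in> S")
    case True
    hence "set_encode S < set_encode T" using lt c same by (simp add: xkey_def)
    hence "set_encode (insert l S) \<le> set_encode (insert l' T)"
      using xstep_mono[OF f(2) T(2,3) f(1) S(2,3) c[symmetric]] by simp
    thus ?thesis using True same cc by (simp add: xkey_def)
  next
    case False
    hence "set_encode T < set_encode S" using lt c same by (simp add: xkey_def)
    hence "set_encode (insert l' T) \<le> set_encode (insert l S)"
      using xstep_mono[OF f(1) S(2,3) f(2) T(2,3) c] by simp
    moreover have "m - 1 \<notin> insert l S" "m - 1 \<notin> insert l' T" using False same by auto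
    ultimately show ?thesis unfolding xkey_def cc by simp
  qed
qed

context pencil_poset
begin

definition ykey :: "nat set \<Rightarrow> real" where "ykey S = - xkey m (refl_set m S)"

definition key :: "'g \<Rightarrow> real" where
  "key p = (if \<exists>S\<subseteq>{..<m}. p = X S then xkey m (THE S. S \<subseteq> {..<m} \<and> p = X S)
            else ykey (THE S. S \<subseteq> {..<m} \<and> p = Y S))"

lemma key_X: "S \<subseteq> {..<m} \<Longrightarrow> key (X S) = xkey m S"
proof -
  assume S: "S \<subseteq> {..<m}"
  hence "(THE T. T \<subseteq> {..<m} \<and> X S = X T) = S" by (intro the_equality) (auto simp: X_inj)
  moreover have "\<exists>T\<subseteq>{..<m}. X S = X T" using S by blast
  ultimately show ?thesis by (simp add: key_def)
qed

lemma xkey_seg: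
  assumes "seg m S" "S \<noteq> {}" "S \<noteq> {..<m}"
  shows "xkey m S = ykey S"
proof -
  have *: "xkey m {..<k} = - (2 ^ m)" "xkey m {m - k..<m} = 2 ^ m" if "0 < k" "k < m" for k
    using that by (auto simp: xkey_def)
  from assms(1) obtain k where k: "k \<le> m" "S = {..<k} \<or> S = {k..<m}" unfolding seg_def by blast
  hence k2: "0 < k" "k < m" using assms(2,3) by (cases "k = 0"; cases "k = m"; auto simp: atLeast0LessThan)+
  from k(2) show ?thesis
  proof
    assume "S = {..<k}" thus ?thesis using * k2 refl_set_lessThan[of k m] by (simp add: ykey_def)
  next
    assume S: "S = {k..<m}"
    hence "S = {m - (m - k)..<m}" using k2 by simp
    hence "xkey m S = 2 ^ m" using *(2)[of "m - k"] k2 by simp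
    moreover have "refl_set m S = {..<m - k}" using S k2 refl_set_atLeastLessThan by simp
    ultimately show ?thesis using *(1)[of "m - k"] k2 by (simp add: ykey_def)
  qed
qed

text \<open>For the empty and the full set the two formulas have opposite signs; for all other
  segments they agree, by \<open>xkey_seg\<close>.\<close>

lemma key_Y:
  assumes S: "S \<subseteq> {..<m}" "S \<noteq> {}" "S \<noteq> {..<m}" shows "key (Y S) = ykey S"
proof (cases "seg m S")
  case True
  hence "X S = Y S" using X_eq_Y[OF S(1) S(1)] by blast
  thus ?thesis using key_X[OF S(1)] S xkey_seg[OF True] by simp
next
  case False
  have "(THE T. T \<subseteq> {..<m} \<and> Y S = Y T) = S" using S by (intro the_equality) (auto simp: Y_inj)
  moreover have "\<not> (\<exists>T\<subseteq>{..<m}. Y S = X T)" using S False X_eq_Y by metis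
  ultimately show ?thesis unfolding key_def by (simp only: if_False)
qed

lemma refl_set_full: "refl_set m {..<m} = {..<m}"
  using refl_set_lessThan[of m m] by (simp add: atLeast0LessThan)

lemma mid_rank:
  assumes "p \<in> carrier L" "p \<noteq> bot" "p \<noteq> top"
  obtains S where "xnode S" "p = X S" "key p = xkey m S" | S where "ynode S" "p = Y S" "key p = ykey S"
proof -
  from assms(1) show ?thesis
  proof (cases rule: node_cases)
    case (3 S) thus ?thesis using that(1) key_X xnode_sub by blast
  next
    case (4 S)
    hence "S \<noteq> {}" unfolding ynode_def by blast
    moreover have "S \<noteq> {..<m}" using 4(2) assms(3) by (auto simp: top_Y)
    ultimately show ?thesis using that(2) key_Y ynode_sub 4 by blast
  qed (use assms in auto)
qed

lemma xnode_key:
  assumes "xnode S"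
  shows "m - 1 \<in> S \<Longrightarrow> 0 < xkey m S \<and> xkey m S \<le> 2 ^ m" "m - 1 \<notin> S \<Longrightarrow> xkey m S < - (2 ^ m)"
  using xkey_pos[OF xnode_sub[OF assms]] xkey_le[OF xnode_sub[OF assms]]
    xkey_neg(2)[OF xnode_sub[OF assms]] assms unfolding xnode_def by auto

lemma ynode_key:
  assumes "ynode S"
  shows "0 \<in> S \<Longrightarrow> ykey S < 0 \<and> - (2 ^ m) \<le> ykey S" "0 \<notin> S \<Longrightarrow> 2 ^ m < ykey S"
proof -
  note sub = ynode_sub[OF assms]
  have "xnode (refl_set m S)" using xnode_refl[OF sub] assms by blast
  moreover have "m - 1 \<in> refl_set m S \<longleftrightarrow> 0 \<in> S" using mem_refl_set[OF sub, of "m - 1"] m2 by simp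
  ultimately show "0 \<in> S \<Longrightarrow> ykey S < 0 \<and> - (2 ^ m) \<le> ykey S" "0 \<notin> S \<Longrightarrow> 2 ^ m < ykey S"
    using xnode_key[of "refl_set m S"] unfolding ykey_def by auto
qed

text \<open>A step out of an x-node stays in its block: the index \<open>m - 1\<close> could enter
  only as the least missing one, which would make \<open>S\<close> the initial segment
  \<open>{..<m - 1}\<close>.\<close>

lemma X_key_cover:
  assumes S: "xnode S" "ext (X S) q" "q \<noteq> top"
  obtains l where "l < m" "xstep S l" "key q = xkey m (insert l S)" "m - 1 \<in> S \<or> l \<noteq> m - 1"
    "m - 1 \<in> S \<longrightarrow> 0 < key q \<and> key q \<le> 2 ^ m" "m - 1 \<notin> S \<longrightarrow> key q \<le> - (2 ^ m)"
proof -
  obtain l where l: "l < m" "xstep S l" "q = X (insert l S)" using xnode_ext S by blast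
  note sub = xnode_sub[OF S(1)]
  have sub': "insert l S \<subseteq> {..<m}" using sub l by auto
  have n: "l \<noteq> m - 1" if "m - 1 \<notin> S"
  proof
    assume lm: "l = m - 1"
    obtain s where "s \<in> S" using S(1) unfolding xnode_def by blast
    hence "\<not> (\<forall>s\<in>S. l < s)" using sub lm by force
    hence "{..<m - 1} \<subseteq> S" using l(2) lm unfolding xstep_def by blast
    moreover have "i < m - 1" if "i \<in> S" for i
    proof -
      have "i < m" "i \<noteq> m - 1" using that sub \<open>m - 1 \<notin> S\<close> by auto
      thus ?thesis by simp
    qed
    ultimately have "S = {..<m - 1}" by blast
    thus False using S(1) unfolding xnode_def by blast
  qed
  have k: "key q = xkey m (insert l S)" using l key_X[OF sub'] by simp
  show ?thesis
  proof (rule that[OF l(1,2) k])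
    show "m - 1 \<in> S \<or> l \<noteq> m - 1" using n by blast
    show "m - 1 \<in> S \<longrightarrow> 0 < key q \<and> key q \<le> 2 ^ m" unfolding k using xkey_pos[OF sub'] xkey_le[OF sub'] by blast
    show "m - 1 \<notin> S \<longrightarrow> key q \<le> - (2 ^ m)" unfolding k using xkey_neg(1)[OF sub'] n by blast
  qed
qed

lemma key_mirror:
  assumes "p \<in> carrier L" "p \<noteq> bot" "p \<noteq> top"
  shows "pencil_poset.key m (\<lambda>S. Y (refl_set m S)) (\<lambda>S. X (refl_set m S)) p = - key p"
  using mid_rank[OF assms]
proof cases
  case (1 S)
  note sub = xnode_sub[OF 1(1)]
  have "S \<noteq> {}" "S \<noteq> {..<m}" using 1 assms(3) unfolding xnode_def top_def by auto
  hence "refl_set m S \<noteq> {}" "refl_set m S \<noteq> {..<m}"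
    using sub refl_set_eq_iff[of S m "{..<m}"] refl_set_full by (simp_all add: refl_set_def)
  from pencil_poset.key_Y[OF mirror refl_set_subset[OF sub] this]
  show ?thesis using 1 sub by (simp add: refl_refl pencil_poset.ykey_def[OF mirror])
next
  case (2 S)
  note sub = ynode_sub[OF 2(1)]
  from pencil_poset.key_X[OF mirror refl_set_subset[OF sub]]
  show ?thesis using 2 sub by (simp add: refl_refl ykey_def)
qed

lemma Y_key_cover:
  assumes S: "ynode S" "ext (Y S) q" "q \<noteq> top"
  obtains l where "l < m" "xstep (refl_set m S) l" "key q = - xkey m (insert l (refl_set m S))"
    "0 \<in> S \<or> l \<noteq> m - 1"
    "0 \<in> S \<longrightarrow> key q < 0 \<and> - (2 ^ m) \<le> key q" "0 \<notin> S \<longrightarrow> 2 ^ m \<le> key q"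
proof -
  note sub = ynode_sub[OF S(1)]
  have t: "pencil_poset.top m (\<lambda>S. Y (refl_set m S)) = top"
    by (simp add: pencil_poset.top_def[OF mirror] top_Y refl_set_full)
  have x: "pencil_poset.xnode m (refl_set m S)"
    using S sub xnode_refl unfolding pencil_poset.xnode_def[OF mirror] xnode_def by blast
  have q: "q \<in> carrier L" "q \<noteq> bot"
    using ext_carrier[OF S(2)] ext_rk[OF S(2)] rk_bot_iff by fastforce+
  have m0: "m - 1 \<in> refl_set m S \<longleftrightarrow> 0 \<in> S" using mem_refl_set[OF sub, of "m - 1"] m2 by simp
  have e: "pencil_poset.ext m (\<lambda>S. Y (refl_set m S)) (\<lambda>S. X (refl_set m S)) (Y (refl_set m (refl_set m S))) q"
    using S(2) sub by (simp add: ext_mirror refl_refl)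
  show ?thesis
    by (rule pencil_poset.X_key_cover[OF mirror x e, unfolded t key_mirror[OF q S(3)] m0, OF S(3)], rule that) auto
qed

text \<open>Inside a block this is the colexicographic monotonicity of steps. For different blocks,
  the thresholds \<open>- (2 ^ m)\<close>, 0 and \<open>2 ^ m\<close> separate the keys both before
  and after the step. If one cover is \<open>top\<close>, both are, by rank.\<close>

lemma key_cover_mono:
  assumes e: "ext p q" "ext p' q'" and r: "rk p = rk p'" and lt: "key p < key p'"
  shows "key q \<le> key q'"
proof (cases "q = top \<or> q' = top")
  case True
  have "rk q = rk q'" using e r ext_rk by simp
  hence "q = q'" using True rk_top_iff ext_carrier e by metis
  thus ?thesis by simp
next
  case False
  have car: "p \<in> carrier L" "p' \<in> carrier L" using e ext_carrier by blast+
  have "rk p \<noteq> 0"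
  proof
    assume "rk p = 0"
    hence "p = bot" "p' = bot" using rk_bot_iff[OF car(1)] rk_bot_iff[OF car(2)] r by auto
    thus False using lt by simp
  qed
  hence "p \<noteq> bot" "p' \<noteq> bot" using rk_bot_iff[OF car(1)] rk_bot_iff[OF car(2)] r by auto
  moreover have "rk p \<noteq> m" using rk_le[OF ext_carrier(2)[OF e(1)]] ext_rk[OF e(1)] by simp
  hence "p \<noteq> top" "p' \<noteq> top" using rk_top_iff[OF car(1)] rk_top_iff[OF car(2)] r by auto
  moreover have pow: "0 < (2::real) ^ m" by simp
  ultimately show ?thesis
    using mid_rank[OF car(1)] mid_rank[OF car(2)]
  proof (elim mid_rank[OF car(1)] mid_rank[OF car(2)])
    fix S T assume S: "xnode S" "p = X S" "key p = xkey m S" and T: "xnode T" "p' = X T" "key p' = xkey m T"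
    obtain l where l: "l < m" "xstep S l" "key q = xkey m (insert l S)" "m - 1 \<in> S \<or> l \<noteq> m - 1"
       "m - 1 \<in> S \<longrightarrow> 0 < key q \<and> key q \<le> 2 ^ m" "m - 1 \<notin> S \<longrightarrow> key q \<le> - (2 ^ m)"
      using X_key_cover[of S q] S e False by blast
    obtain l' where l': "l' < m" "xstep T l'" "key q' = xkey m (insert l' T)" "m - 1 \<in> T \<or> l' \<noteq> m - 1"
       "m - 1 \<in> T \<longrightarrow> 0 < key q' \<and> key q' \<le> 2 ^ m" "m - 1 \<notin> T \<longrightarrow> key q' \<le> - (2 ^ m)"
      using X_key_cover[of T q'] T e False by blast
    show ?thesis
    proof (cases "m - 1 \<in> S \<longleftrightarrow> m - 1 \<in> T")
      case True
      have c: "card S = card T" using r S T xnode_sub rk_X by metis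
      show ?thesis unfolding l(3) l'(3)
        by (rule xkey_step_mono) (use S T l l' c lt True xnode_sub in \<open>auto simp: xnode_def\<close>)
    next
      case False
      thus ?thesis using lt l l' S T xnode_key[OF S(1)] xnode_key[OF T(1)] pow
        by (cases "m - 1 \<in> S"; cases "m - 1 \<in> T"; simp; linarith)
    qed
  next
    fix S T assume S: "xnode S" "p = X S" "key p = xkey m S" and T: "ynode T" "p' = Y T" "key p' = ykey T"
    obtain l where l: "m - 1 \<in> S \<longrightarrow> 0 < key q \<and> key q \<le> 2 ^ m" "m - 1 \<notin> S \<longrightarrow> key q \<le> - (2 ^ m)"
      using X_key_cover[of S q] S e False by blast
    obtain l' where l': "0 \<in> T \<longrightarrow> key q' < 0 \<and> - (2 ^ m) \<le> key q'" "0 \<notin> T \<longrightarrow> 2 ^ m \<le> key q'"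
      using Y_key_cover[of T q'] T e False by blast
    show ?thesis using lt l l' S T xnode_key[OF S(1)] ynode_key[OF T(1)] pow
      by (cases "m - 1 \<in> S"; cases "0 \<in> T"; simp; linarith)
  next
    fix S T assume S: "ynode S" "p = Y S" "key p = ykey S" and T: "xnode T" "p' = X T" "key p' = xkey m T"
    obtain l where l: "m - 1 \<in> T \<longrightarrow> 0 < key q' \<and> key q' \<le> 2 ^ m" "m - 1 \<notin> T \<longrightarrow> key q' \<le> - (2 ^ m)"
      using X_key_cover[of T q'] T e False by blast
    obtain l' where l': "0 \<in> S \<longrightarrow> key q < 0 \<and> - (2 ^ m) \<le> key q" "0 \<notin> S \<longrightarrow> 2 ^ m \<le> key q"
      using Y_key_cover[of S q] S e False by blast
    show ?thesis using lt l l' S T xnode_key[OF T(1)] ynode_key[OF S(1)] pow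
      by (cases "m - 1 \<in> T"; cases "0 \<in> S"; simp; linarith)
  next
    fix S T assume S: "ynode S" "p = Y S" "key p = ykey S" and T: "ynode T" "p' = Y T" "key p' = ykey T"
    let ?S = "refl_set m S" and ?T = "refl_set m T"
    obtain l where l: "l < m" "xstep ?S l" "key q = - xkey m (insert l ?S)" "0 \<in> S \<or> l \<noteq> m - 1"
       "0 \<in> S \<longrightarrow> key q < 0 \<and> - (2 ^ m) \<le> key q" "0 \<notin> S \<longrightarrow> 2 ^ m \<le> key q"
      using Y_key_cover[of S q] S e False by blast
    obtain l' where l': "l' < m" "xstep ?T l'" "key q' = - xkey m (insert l' ?T)" "0 \<in> T \<or> l' \<noteq> m - 1"
       "0 \<in> T \<longrightarrow> key q' < 0 \<and> - (2 ^ m) \<le> key q'" "0 \<notin> T \<longrightarrow> 2 ^ m \<le> key q'"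
      using Y_key_cover[of T q'] T e False by blast
    show ?thesis
    proof (cases "0 \<in> S \<longleftrightarrow> 0 \<in> T")
      case True
      have sub: "S \<subseteq> {..<m}" "T \<subseteq> {..<m}" using S T ynode_sub by blast+
      have c: "card ?S = card ?T" using r S T sub rk_Y card_refl_set by metis
      have m0: "m - 1 \<in> ?S \<longleftrightarrow> 0 \<in> S" "m - 1 \<in> ?T \<longleftrightarrow> 0 \<in> T"
        using mem_refl_set[OF sub(1), of "m - 1"] mem_refl_set[OF sub(2), of "m - 1"] m2 by simp_all
      have ne: "?S \<noteq> {}" "?T \<noteq> {}" using S T by (auto simp: refl_set_def ynode_def)
      have lt': "xkey m ?T < xkey m ?S" using lt S T by (simp add: ykey_def)
      have "xkey m (insert l' ?T) \<le> xkey m (insert l ?S)"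
        by (rule xkey_step_mono[OF refl_set_subset[OF sub(2)] ne(2) l'(2,1) refl_set_subset[OF sub(1)] ne(1) l(2,1)
              c[symmetric] lt']) (use m0 True l(4) l'(4) in auto)
      thus ?thesis unfolding l(3) l'(3) by simp
    next
      case False
      thus ?thesis using lt l l' S T ynode_key[OF S(1)] ynode_key[OF T(1)] pow
        by (cases "0 \<in> S"; cases "0 \<in> T"; simp; linarith)
    qed
  qed
qed

lemma key_inj:
  assumes "p \<in> carrier L" "q \<in> carrier L" "rk p = rk q" "key p = key q"
  shows "p = q"
proof (cases "rk p = 0 \<or> rk p = m")
  case True thus ?thesis using assms rk_bot_iff rk_top_iff by metis
next
  case False
  hence n: "p \<noteq> bot" "q \<noteq> bot" "p \<noteq> top" "q \<noteq> top" using assms rk_bot_iff rk_top_iff by metis+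
  have pow: "0 < (2::real) ^ m" by simp
  from mid_rank[OF assms(1) n(1,3)] show ?thesis
  proof cases
    case (1 S)
    from mid_rank[OF assms(2) n(2,4)] show ?thesis
    proof cases
      case 2: (1 T)
      have "card S = card T" using assms(3) 1 2 xnode_sub rk_X by metis
      thus ?thesis using xkey_inj 1 2 assms(4) xnode_sub by metis
    next
      case (2 T)
      have False using xnode_key[OF 1(1)] ynode_key[OF 2(1)] assms(4) 1(3) 2(3) pow
        by (cases "m - 1 \<in> S"; cases "0 \<in> T"; simp; linarith)
      thus ?thesis ..
    qed
  next
    case (2 S)
    from mid_rank[OF assms(2) n(2,4)] show ?thesis
    proof cases
      case (1 T)
      have False using xnode_key[OF 1(1)] ynode_key[OF 2(1)] assms(4) 1(3) 2(3) pow
        by (cases "m - 1 \<in> T"; cases "0 \<in> S"; simp; linarith)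
      thus ?thesis ..
    next
      case T: (2 T)
      have sub: "S \<subseteq> {..<m}" "T \<subseteq> {..<m}" using 2 T ynode_sub by blast+
      have "card (refl_set m S) = card (refl_set m T)" using assms(3) 2 T sub rk_Y card_refl_set by metis
      moreover have "xkey m (refl_set m S) = xkey m (refl_set m T)" using assms(4) 2 T by (simp add: ykey_def)
      ultimately have "refl_set m S = refl_set m T" using xkey_inj refl_set_subset sub by metis
      thus ?thesis using 2 T sub refl_set_eq_iff by metis
    qed
  qed
qed

theorem planar_L: "planar_poset L"
  by (rule planar_posetI[where rk = rk and f = key])
     (use finite_carrier ext_rk key_inj key_cover_mono in \<open>auto simp: covers_iff\<close>)

end

section \<open>The interval in a group with the pencil relations\<close>

definition list_prod :: "('g, 'z) monoid_scheme \<Rightarrow> 'g list \<Rightarrow> 'g" where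
  "list_prod G xs = foldr (\<lambda>a b. a \<otimes>\<^bsub>G\<^esub> b) xs \<one>\<^bsub>G\<^esub>"

lemma list_prod_Nil [simp]: "list_prod G [] = \<one>\<^bsub>G\<^esub>"
  and list_prod_Cons [simp]: "list_prod G (a # xs) = a \<otimes>\<^bsub>G\<^esub> list_prod G xs"
  by (simp_all add: list_prod_def)

context monoid
begin

lemma list_prod_closed [simp]: "set xs \<subseteq> carrier G \<Longrightarrow> list_prod G xs \<in> carrier G"
  by (induction xs) auto

lemma list_prod_append:
  "set xs \<subseteq> carrier G \<Longrightarrow> set ys \<subseteq> carrier G \<Longrightarrow> list_prod G (xs @ ys) = list_prod G xs \<otimes> list_prod G ys"
  by (induction xs) (auto simp: m_assoc)

end

lemma hom_list_prod:
  assumes "\<phi> \<in> hom G K" "group G" "group K" "set xs \<subseteq> carrier G"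
  shows "\<phi> (list_prod G xs) = list_prod K (map \<phi> xs)"
proof -
  interpret group_hom G K \<phi> using assms by (simp add: group_hom_def group_hom_axioms_def)
  show ?thesis using assms(4) by (induction xs) auto
qed

text \<open>The two equations for \<open>i\<close> come from the 2-cells based at the regions number
  \<open>i\<close> and \<open>m + i\<close> of the cycle; at the extreme values of \<open>i\<close>
  they are trivial or repeat each other.\<close>

definition pencil_rel :: "('g, 'z) monoid_scheme \<Rightarrow> nat \<Rightarrow> (nat \<Rightarrow> 'g) \<Rightarrow> (nat \<Rightarrow> 'g) \<Rightarrow> bool" where
  "pencil_rel G m x y \<longleftrightarrow> (\<forall>i<m. x i \<in> carrier G \<and> y i \<in> carrier G) \<and>
     (\<forall>i\<le>m. list_prod G (map y [0..<i]) = list_prod G (map x (rev [0..<i])) \<and>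
            list_prod G (map y [i..<m]) = list_prod G (map x (rev [i..<m])))"

lemma map_diff_Suc_upt: "i \<le> m \<Longrightarrow> map (\<lambda>i. m - Suc i) [0..<i] = rev [m - i..<m]"
  by (rule nth_equalityI) (auto simp: rev_nth)

lemma map_diff_Suc_upt2: "i \<le> m \<Longrightarrow> map (\<lambda>i. m - Suc i) [i..<m] = rev [0..<m - i]"
  by (rule nth_equalityI) (auto simp: rev_nth)

lemma pencil_rel_mirror:
  assumes "pencil_rel G m x y"
  shows "pencil_rel G m (\<lambda>i. y (m - Suc i)) (\<lambda>i. x (m - Suc i))"
  unfolding pencil_rel_def
proof (intro conjI allI impI)
  fix i assume "i < m"
  thus "y (m - Suc i) \<in> carrier G" "x (m - Suc i) \<in> carrier G" using assms unfolding pencil_rel_def by auto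
next
  fix i assume i: "i \<le> m"
  have *: "map (\<lambda>i. f (m - Suc i)) xs = map f (map (\<lambda>i. m - Suc i) xs)" for f :: "nat \<Rightarrow> 'a" and xs by simp
  have "m - i \<le> m" by simp
  hence r: "list_prod G (map y [0..<m - i]) = list_prod G (map x (rev [0..<m - i]))"
    "list_prod G (map y [m - i..<m]) = list_prod G (map x (rev [m - i..<m]))"
    using assms unfolding pencil_rel_def by blast+
  show "list_prod G (map (\<lambda>i. x (m - Suc i)) [0..<i]) = list_prod G (map (\<lambda>i. y (m - Suc i)) (rev [0..<i]))"
    unfolding *[of x] *[of y] rev_map[symmetric] map_diff_Suc_upt[OF i] using r by (simp add: rev_map)
  show "list_prod G (map (\<lambda>i. x (m - Suc i)) [i..<m]) = list_prod G (map (\<lambda>i. y (m - Suc i)) (rev [i..<m]))"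
    unfolding *[of x] *[of y] rev_map[symmetric] map_diff_Suc_upt2[OF i] using r by (simp add: rev_map)
qed

lemma pencil_rel_first_last:
  assumes "pencil_rel G m x y" "group G" "0 < m" shows "x 0 = y 0" "x (m - 1) = y (m - 1)"
proof -
  interpret group G by fact
  have c: "x i \<in> carrier G" "y i \<in> carrier G" if "i < m" for i
    using assms(1) that unfolding pencil_rel_def by auto
  have "list_prod G (map y [0..<1]) = list_prod G (map x (rev [0..<1]))"
    "list_prod G (map y [m - 1..<m]) = list_prod G (map x (rev [m - 1..<m]))"
    using assms unfolding pencil_rel_def by (auto simp del: upt_Suc)
  moreover have "[m - 1..<m] = [m - 1]" using assms(3) by (simp add: upt_rec)
  ultimately show "x 0 = y 0" "x (m - 1) = y (m - 1)" using c[of 0] c[of "m - 1"] assms(3) by auto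
qed

text \<open>Keeps one index and forgets the others. Together with an additive function on
  \<open>K\<close> this counts the occurrences of an index in a word.\<close>

lemma pencil_rel_one_generator:
  assumes "group K" "\<alpha> \<in> carrier K"
  shows "pencil_rel K m (\<lambda>i. if i = j then \<alpha> else \<one>\<^bsub>K\<^esub>) (\<lambda>i. if i = j then \<alpha> else \<one>\<^bsub>K\<^esub>)"
proof -
  interpret group K by fact
  have "list_prod K (map (\<lambda>i. if i = j then \<alpha> else \<one>\<^bsub>K\<^esub>) xs) = (if j \<in> set xs then \<alpha> else \<one>\<^bsub>K\<^esub>)"
    if "distinct xs" for xs
    using that assms(2) by (induction xs) auto
  thus ?thesis unfolding pencil_rel_def using assms(2) by simp
qed

definition tri_gen :: "('k, 'z) monoid_scheme \<Rightarrow> 'k \<Rightarrow> 'k \<Rightarrow> 'k \<Rightarrow> nat \<Rightarrow> nat \<Rightarrow> nat \<Rightarrow> nat \<Rightarrow> 'k" where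
  "tri_gen K \<alpha> \<beta> \<gamma> i j k l = (if l = i then \<alpha> else if l = j then \<beta> else if l = k then \<gamma> else \<one>\<^bsub>K\<^esub>)"

text \<open>With the full twist sent to 1, the y-word demands that \<alpha>, \<open>y j\<close>,
  \<gamma> multiply to 1 and the x-word that \<gamma>, \<open>x j\<close>, \<alpha> do; this
  determines both images of \<open>j\<close>. The other equations hold too, since \<open>y j\<close>
  after \<alpha> and \<open>x j\<close> before \<alpha> both give the inverse of \<gamma>, and
  likewise at the other end.\<close>

lemma pencil_rel_tri:
  assumes "group K" "\<alpha> \<in> carrier K" "\<gamma> \<in> carrier K" "i < j" "j < k" "k < m"
  shows "pencil_rel K m (tri_gen K \<alpha> (inv\<^bsub>K\<^esub> (\<alpha> \<otimes>\<^bsub>K\<^esub> \<gamma>)) \<gamma> i j k) (tri_gen K \<alpha> (inv\<^bsub>K\<^esub> (\<gamma> \<otimes>\<^bsub>K\<^esub> \<alpha>)) \<gamma> i j k)"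
    (is "pencil_rel K m ?x ?y")
proof -
  interpret group K by fact
  note a = assms(2,3)
  have a1: "inv\<^bsub>K\<^esub> (\<alpha> \<otimes>\<^bsub>K\<^esub> \<gamma>) \<otimes>\<^bsub>K\<^esub> \<alpha> = inv\<^bsub>K\<^esub> \<gamma>" "\<alpha> \<otimes>\<^bsub>K\<^esub> inv\<^bsub>K\<^esub> (\<gamma> \<otimes>\<^bsub>K\<^esub> \<alpha>) = inv\<^bsub>K\<^esub> \<gamma>"
    "\<gamma> \<otimes>\<^bsub>K\<^esub> inv\<^bsub>K\<^esub> (\<alpha> \<otimes>\<^bsub>K\<^esub> \<gamma>) = inv\<^bsub>K\<^esub> \<alpha>" "inv\<^bsub>K\<^esub> (\<gamma> \<otimes>\<^bsub>K\<^esub> \<alpha>) \<otimes>\<^bsub>K\<^esub> \<gamma> = inv\<^bsub>K\<^esub> \<alpha>"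
    using a by (simp_all add: inv_mult_group m_assoc) (simp_all add: m_assoc[symmetric])
  have c: "?x l \<in> carrier K" "?y l \<in> carrier K" for l using a by (auto simp: tri_gen_def)
  hence cs: "set (map ?x xs) \<subseteq> carrier K" "set (map ?y xs) \<subseteq> carrier K" for xs by auto
  \<comment> \<open>The common value of both partial products over the indices below
    \<open>c\<close>; past \<open>j\<close> it is the inverse of \<gamma>, past \<open>k\<close> it
    is 1.\<close>
  let ?f = "\<lambda>c. if c \<le> i then \<one>\<^bsub>K\<^esub> else if c \<le> j then \<alpha> else if c \<le> k then inv\<^bsub>K\<^esub> \<gamma> else \<one>\<^bsub>K\<^esub>"
  have low: "list_prod K (map ?y [0..<c]) = ?f c \<and> list_prod K (map ?x (rev [0..<c])) = ?f c" for c
  proof (induction c)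
    case (Suc c)
    have A: "list_prod K (map ?y [0..<Suc c]) = ?f c \<otimes>\<^bsub>K\<^esub> ?y c"
      using Suc list_prod_append[OF cs(2)[of "[0..<c]"] cs(2)[of "[c]"]] c by simp
    have B: "list_prod K (map ?x (rev [0..<Suc c])) = ?x c \<otimes>\<^bsub>K\<^esub> ?f c"
      using Suc by simp
    have "?f c \<otimes>\<^bsub>K\<^esub> ?y c = ?f (Suc c)" "?x c \<otimes>\<^bsub>K\<^esub> ?f c = ?f (Suc c)"
      unfolding tri_gen_def using assms(4,5) a a1
      by (cases "c < i"; cases "c = i"; cases "c < j"; cases "c = j"; cases "c < k"; cases "c = k"; simp)+
    thus ?case by (simp only: A B)
  qed simp
  let ?h = "\<lambda>c. if c \<le> i then \<one>\<^bsub>K\<^esub> else if c \<le> j then inv\<^bsub>K\<^esub> \<alpha> else if c \<le> k then \<gamma> else \<one>\<^bsub>K\<^esub>"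
  have high: "list_prod K (map ?y [c..<m]) = ?h c \<and> list_prod K (map ?x (rev [c..<m])) = ?h c" if "c \<le> m" for c
    using that
  proof (induction rule: inc_induct)
    case base show ?case using assms(4-6) by simp
  next
    case (step c)
    have u: "[c..<m] = c # [Suc c..<m]" using step by (simp add: upt_rec)
    have A: "list_prod K (map ?y [c..<m]) = ?y c \<otimes>\<^bsub>K\<^esub> ?h (Suc c)"
      unfolding u using step by simp
    have B: "list_prod K (map ?x (rev [c..<m])) = ?h (Suc c) \<otimes>\<^bsub>K\<^esub> ?x c"
      unfolding u using step list_prod_append[OF cs(1)[of "rev [Suc c..<m]"] cs(1)[of "[c]"]] c by simp
    have "?y c \<otimes>\<^bsub>K\<^esub> ?h (Suc c) = ?h c" "?h (Suc c) \<otimes>\<^bsub>K\<^esub> ?x c = ?h c"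
      unfolding tri_gen_def using assms(4,5) a a1
      by (cases "c < i"; cases "c = i"; cases "c < j"; cases "c = j"; cases "c < k"; cases "c = k"; simp)+
    thus ?case by (simp only: A B)
  qed
  show ?thesis unfolding pencil_rel_def using c low high by simp
qed

text \<open>The universal property is asked for one target \<open>K\<close> only. From
  \<open>K\<close> come two noncommuting elements, which detect order, and the additive function
  \<nu>, which detects multiplicity.\<close>

locale pencil_group = G: group G + K: group K
  for G :: "'g monoid" and K :: "'k monoid" +
  fixes x y :: "nat \<Rightarrow> 'g" and m :: nat and \<alpha> \<gamma> :: 'k and \<nu> :: "'k \<Rightarrow> complex"
  assumes m3: "3 \<le> m"
    and rel: "pencil_rel G m x y"
    and \<alpha>\<gamma>: "\<alpha> \<in> carrier K" "\<gamma> \<in> carrier K" "\<alpha> \<otimes>\<^bsub>K\<^esub> \<gamma> \<noteq> \<gamma> \<otimes>\<^bsub>K\<^esub> \<alpha>"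
    and \<nu>: "\<nu> \<alpha> = 1" "\<And>P Q. P \<in> carrier K \<Longrightarrow> Q \<in> carrier K \<Longrightarrow> \<nu> (P \<otimes>\<^bsub>K\<^esub> Q) = \<nu> P + \<nu> Q"
    and univ: "\<And>x' y'. pencil_rel K m x' y' \<Longrightarrow>
       \<exists>\<phi> \<in> hom G K. \<forall>i<m. \<phi> (x i) = x' i \<and> \<phi> (y i) = y' i"
begin

lemma mirror: "pencil_group G K (\<lambda>i. y (m - Suc i)) (\<lambda>i. x (m - Suc i)) m \<alpha> \<gamma> \<nu>"
proof unfold_locales
  show "pencil_rel G m (\<lambda>i. y (m - Suc i)) (\<lambda>i. x (m - Suc i))" by (rule pencil_rel_mirror[OF rel])
  fix x' y' assume "pencil_rel K m x' y'"
  then obtain \<phi> where \<phi>: "\<phi> \<in> hom G K" "\<forall>i<m. \<phi> (x i) = y' (m - Suc i) \<and> \<phi> (y i) = x' (m - Suc i)"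
    using univ[OF pencil_rel_mirror] by blast
  have "\<phi> (y (m - Suc i)) = x' i \<and> \<phi> (x (m - Suc i)) = y' i" if "i < m" for i
  proof -
    have "m - Suc (m - Suc i) = i" "m - Suc i < m" using that by auto
    thus ?thesis using \<phi>(2) by metis
  qed
  thus "\<exists>\<phi>\<in>hom G K. \<forall>i<m. \<phi> (y (m - Suc i)) = x' i \<and> \<phi> (x (m - Suc i)) = y' i" using \<phi> by blast
qed (use m3 \<alpha>\<gamma> \<nu> in auto)

definition letter :: "bool \<times> nat \<Rightarrow> 'g" where
  "letter p = (if fst p then x (snd p) else y (snd p))"

definition val :: "(bool \<times> nat) list \<Rightarrow> 'g" where
  "val w = list_prod G (map letter w)"

definition valid :: "(bool \<times> nat) list \<Rightarrow> bool" where
  "valid w \<longleftrightarrow> snd ` set w \<subseteq> {..<m}"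

lemma xy_closed: "i < m \<Longrightarrow> x i \<in> carrier G" "i < m \<Longrightarrow> y i \<in> carrier G"
  using rel unfolding pencil_rel_def by auto

lemma letter_closed: "snd p < m \<Longrightarrow> letter p \<in> carrier G"
  by (simp add: letter_def xy_closed)

lemma valid_letters: "valid w \<Longrightarrow> set (map letter w) \<subseteq> carrier G"
  using letter_closed unfolding valid_def by auto

lemma valid_simps [simp]: "valid []" "valid (p # w) \<longleftrightarrow> snd p < m \<and> valid w"
  "valid (u @ w) \<longleftrightarrow> valid u \<and> valid w"
  by (auto simp: valid_def)

lemma val_closed: "valid w \<Longrightarrow> val w \<in> carrier G"
  unfolding val_def by (rule G.list_prod_closed[OF valid_letters])

lemma val_append: "valid u \<Longrightarrow> valid w \<Longrightarrow> val (u @ w) = val u \<otimes>\<^bsub>G\<^esub> val w"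
  unfolding val_def map_append by (rule G.list_prod_append[OF valid_letters valid_letters])

lemma val_simps [simp]: "val [] = \<one>\<^bsub>G\<^esub>" "val (p # w) = letter p \<otimes>\<^bsub>G\<^esub> val w"
  by (simp_all add: val_def)

lemma hom_val:
  assumes "\<phi> \<in> hom G K" "valid w"
  shows "\<phi> (val w) = list_prod K (map (\<lambda>p. \<phi> (letter p)) w)"
  unfolding val_def using hom_list_prod[OF assms(1) G.is_group K.is_group valid_letters[OF assms(2)]]
  by (simp add: o_def)

text \<open>Under the homomorphism that keeps only index \<open>j\<close>, both \<open>x j\<close>
  and \<open>y j\<close> go to \<alpha>, and \<nu> turns a product into a count.\<close>

lemma count_index:
  assumes "valid u" "valid w" "val u = val w" "j < m"
  shows "length (filter (\<lambda>p. snd p = j) u) = length (filter (\<lambda>p. snd p = j) w)"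
proof -
  have "pencil_rel K m (\<lambda>i. if i = j then \<alpha> else \<one>\<^bsub>K\<^esub>) (\<lambda>i. if i = j then \<alpha> else \<one>\<^bsub>K\<^esub>)"
    by (rule pencil_rel_one_generator[OF K.is_group \<alpha>\<gamma>(1)])
  from univ[OF this] obtain \<phi> where \<phi>: "\<phi> \<in> hom G K"
    "\<forall>i<m. \<phi> (x i) = (if i = j then \<alpha> else \<one>\<^bsub>K\<^esub>) \<and> \<phi> (y i) = (if i = j then \<alpha> else \<one>\<^bsub>K\<^esub>)" by blast
  have "\<nu> \<one>\<^bsub>K\<^esub> = \<nu> \<one>\<^bsub>K\<^esub> + \<nu> \<one>\<^bsub>K\<^esub>" using \<nu>(2)[of "\<one>\<^bsub>K\<^esub>" "\<one>\<^bsub>K\<^esub>"] by simp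
  hence \<nu>1: "\<nu> \<one>\<^bsub>K\<^esub> = 0" by simp
  have *: "\<nu> (\<phi> (val v)) = of_nat (length (filter (\<lambda>p. snd p = j) v))" if "valid v" for v
  proof -
    have l: "\<phi> (letter p) = (if snd p = j then \<alpha> else \<one>\<^bsub>K\<^esub>)" if "snd p < m" for p
      using \<phi>(2) that by (simp add: letter_def)
    show ?thesis unfolding hom_val[OF \<phi>(1) that] using that
    proof (induction v)
      case (Cons p v)
      have "list_prod K (map (\<lambda>p. \<phi> (letter p)) v) \<in> carrier K"
        using Cons.prems valid_letters[of v] \<phi>(1) by (intro K.list_prod_closed) (auto simp: hom_def)
      thus ?case using Cons \<alpha>\<gamma> \<nu>1 \<nu> by (simp add: l)
    qed (simp add: \<nu>1)
  qed
  show ?thesis using *[OF assms(1)] *[OF assms(2)] assms(3) by simp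
qed

lemma sum_count: "valid w \<Longrightarrow> length w = (\<Sum>j<m. length (filter (\<lambda>p. snd p = j) w))"
proof (induction w)
  case (Cons p w)
  have "(\<Sum>j<m. length (filter (\<lambda>q. snd q = j) (p # w))) =
    (\<Sum>j<m. (if j = snd p then 1 else 0) + length (filter (\<lambda>q. snd q = j) w))"
    by (rule sum.cong) auto
  also have "\<dots> = 1 + length w" using Cons by (simp add: sum.distrib)
  finally show ?case by simp
qed simp

lemma val_length: "valid u \<Longrightarrow> valid w \<Longrightarrow> val u = val w \<Longrightarrow> length u = length w"
  using count_index[of u w] by (simp add: sum_count)

definition xs :: "nat set \<Rightarrow> (bool \<times> nat) list" where
  "xs S = map (Pair True) (rev (sorted_list_of_set S))"

definition ys :: "nat set \<Rightarrow> (bool \<times> nat) list" where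
  "ys S = map (Pair False) (sorted_list_of_set S)"

definition X where "X S = val (xs S)"
definition Y where "Y S = val (ys S)"

definition twist where "twist = X {..<m}"

lemma finS: "S \<subseteq> {..<m} \<Longrightarrow> finite S" by (rule finite_subset) auto

lemma valid_xs: "S \<subseteq> {..<m} \<Longrightarrow> valid (xs S)" and valid_ys: "S \<subseteq> {..<m} \<Longrightarrow> valid (ys S)"
  using finS[of S] by (auto simp: valid_def xs_def ys_def)

lemma length_xs: "length (xs S) = card S" and length_ys: "length (ys S) = card S"
  by (simp_all add: xs_def ys_def)

lemma filter_sorted_list: "finite S \<Longrightarrow> filter P (sorted_list_of_set S) = sorted_list_of_set {s \<in> S. P s}"
  by (rule sorted_distinct_set_unique) (auto simp: sorted_wrt_filter)

lemma filter_xs: "finite S \<Longrightarrow> filter (\<lambda>p. P (snd p)) (xs S) = xs {s \<in> S. P s}"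
  by (simp add: xs_def filter_map o_def rev_filter[symmetric] filter_sorted_list)

lemma filter_ys: "finite S \<Longrightarrow> filter (\<lambda>p. P (snd p)) (ys S) = ys {s \<in> S. P s}"
  by (simp add: ys_def filter_map o_def filter_sorted_list)

lemma sorted_list_lessThan: "sorted_list_of_set {..<k::nat} = [0..<k]"
  by (simp add: lessThan_atLeast0)

lemma X_interval:
  "k \<le> m \<Longrightarrow> X {..<k} = Y {..<k}" "k \<le> m \<Longrightarrow> X {k..<m} = Y {k..<m}"
  using rel unfolding X_def Y_def val_def xs_def ys_def pencil_rel_def
  by (simp_all add: sorted_list_lessThan o_def letter_def)

lemma X_seg: "seg m S \<Longrightarrow> X S = Y S"
  using X_interval unfolding seg_def by blast

lemma XY_same_set:
  assumes "S \<subseteq> {..<m}" "T \<subseteq> {..<m}" "w \<in> {xs S, ys S}" "w' \<in> {xs T, ys T}" "val w = val w'"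
  shows "S = T"
proof -
  have v: "valid w" "valid w'" using assms valid_xs valid_ys by auto
  have c: "length (filter (\<lambda>p. snd p = j) u) = (if j \<in> R then 1 else 0)" if "finite R" "u \<in> {xs R, ys R}" for u R j
  proof -
    have "{s \<in> R. s = j} = (if j \<in> R then {j} else {})" by auto
    hence "length (filter (\<lambda>p. snd p = j) (xs R)) = (if j \<in> R then 1 else 0)"
      "length (filter (\<lambda>p. snd p = j) (ys R)) = (if j \<in> R then 1 else 0)"
      unfolding filter_xs[OF that(1), of "\<lambda>s. s = j"] filter_ys[OF that(1), of "\<lambda>s. s = j"] length_xs length_ys
      by simp_all
    thus ?thesis using that(2) by blast
  qed
  have "j \<in> S \<longleftrightarrow> j \<in> T" if "j < m" for j
  proof -
    have "(if j \<in> S then 1 else 0) = (if j \<in> T then 1 else (0::nat))"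
      using count_index[OF v assms(5) that]
      unfolding c[OF finS[OF assms(1)] assms(3), of j] c[OF finS[OF assms(2)] assms(4), of j] .
    thus ?thesis by (simp split: if_splits)
  qed
  thus ?thesis using assms by blast
qed

lemma tri_hom:
  assumes "i < j" "j < k" "k < m"
  obtains \<phi> where "\<phi> \<in> hom G K"
    "\<And>w. valid w \<Longrightarrow> \<phi> (val w) = list_prod K (map (\<lambda>p. \<phi> (letter p)) (filter (\<lambda>p. snd p \<in> {i, j, k}) w))"
    "\<And>b. \<phi> (letter (b, i)) = \<alpha>" "\<And>b. \<phi> (letter (b, k)) = \<gamma>"
    "\<phi> (letter (True, j)) = inv\<^bsub>K\<^esub> (\<alpha> \<otimes>\<^bsub>K\<^esub> \<gamma>)" "\<phi> (letter (False, j)) = inv\<^bsub>K\<^esub> (\<gamma> \<otimes>\<^bsub>K\<^esub> \<alpha>)"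
proof -
  from univ[OF pencil_rel_tri[OF K.is_group \<alpha>\<gamma>(1,2) assms]] obtain \<phi> where \<phi>: "\<phi> \<in> hom G K"
    "\<forall>l<m. \<phi> (x l) = tri_gen K \<alpha> (inv\<^bsub>K\<^esub> (\<alpha> \<otimes>\<^bsub>K\<^esub> \<gamma>)) \<gamma> i j k l \<and>
           \<phi> (y l) = tri_gen K \<alpha> (inv\<^bsub>K\<^esub> (\<gamma> \<otimes>\<^bsub>K\<^esub> \<alpha>)) \<gamma> i j k l" by blast
  have one: "\<phi> (letter p) = \<one>\<^bsub>K\<^esub>" if "snd p < m" "snd p \<notin> {i, j, k}" for p
    using \<phi>(2) that by (simp add: letter_def tri_gen_def)
  have car: "\<phi> (letter p) \<in> carrier K" if "snd p < m" for p
    using \<phi>(1) letter_closed[OF that] by (auto simp: hom_def)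
  have "\<phi> (val w) = list_prod K (map (\<lambda>p. \<phi> (letter p)) (filter (\<lambda>p. snd p \<in> {i, j, k}) w))" if "valid w" for w
    unfolding hom_val[OF \<phi>(1) that] using that
  proof (induction w)
    case (Cons p w)
    have "set (map (\<lambda>p. \<phi> (letter p)) (filter (\<lambda>p. snd p \<in> {i, j, k}) w)) \<subseteq> carrier K"
      using Cons.prems car by (auto simp: valid_def)
    hence "list_prod K (map (\<lambda>p. \<phi> (letter p)) (filter (\<lambda>p. snd p \<in> {i, j, k}) w)) \<in> carrier K"
      by (rule K.list_prod_closed)
    thus ?case using Cons one[of p] by (cases "snd p \<in> {i, j, k}") auto
  qed simp
  thus ?thesis using that \<phi> assms by (simp add: letter_def tri_gen_def)
qed

lemma inv_comm_contra: "inv\<^bsub>K\<^esub> (\<alpha> \<otimes>\<^bsub>K\<^esub> \<gamma>) \<noteq> inv\<^bsub>K\<^esub> (\<gamma> \<otimes>\<^bsub>K\<^esub> \<alpha>)"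
  using \<alpha>\<gamma> by (metis K.inv_inv K.m_closed)

text \<open>A set that is not a segment contains, for some \<open>i < j < k\<close>, the outer two
  without the middle one or the middle one without the outer two. Under the projection to this
  triple the x-word and the y-word become \<gamma> \<alpha> and \<alpha> \<gamma>, or the two
  different images of \<open>j\<close>.\<close>

lemma X_eq_Y_imp_seg:
  assumes S: "S \<subseteq> {..<m}" and e: "X S = Y S"
  shows "seg m S"
proof (rule ccontr)
  assume n: "\<not> seg m S"
  have "finite S" using S finS by blast
  have "seg m {}" unfolding seg_def by auto
  hence "S \<noteq> {}" using n by blast
  have pat: False if ijk: "i < j" "j < k" "k < m" and p: "(i \<notin> S \<and> j \<in> S \<and> k \<notin> S) \<or> (i \<in> S \<and> j \<notin> S \<and> k \<in> S)" for i j k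
  proof -
    obtain \<phi> where \<phi>: "\<phi> \<in> hom G K"
      "\<And>w. valid w \<Longrightarrow> \<phi> (val w) = list_prod K (map (\<lambda>p. \<phi> (letter p)) (filter (\<lambda>p. snd p \<in> {i, j, k}) w))"
      "\<And>b. \<phi> (letter (b, i)) = \<alpha>" "\<And>b. \<phi> (letter (b, k)) = \<gamma>"
      "\<phi> (letter (True, j)) = inv\<^bsub>K\<^esub> (\<alpha> \<otimes>\<^bsub>K\<^esub> \<gamma>)" "\<phi> (letter (False, j)) = inv\<^bsub>K\<^esub> (\<gamma> \<otimes>\<^bsub>K\<^esub> \<alpha>)"
      by (rule tri_hom[OF ijk]) blast
    have eq: "list_prod K (map (\<lambda>p. \<phi> (letter p)) (xs {s \<in> S. s \<in> {i, j, k}})) =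
          list_prod K (map (\<lambda>p. \<phi> (letter p)) (ys {s \<in> S. s \<in> {i, j, k}}))"
      using e \<phi>(2)[OF valid_xs[OF S]] \<phi>(2)[OF valid_ys[OF S]] unfolding X_def Y_def
      unfolding filter_xs[OF \<open>finite S\<close>, of "\<lambda>s. s \<in> {i, j, k}"]
        filter_ys[OF \<open>finite S\<close>, of "\<lambda>s. s \<in> {i, j, k}"] by simp
    from p show False
    proof
      assume "i \<notin> S \<and> j \<in> S \<and> k \<notin> S"
      hence "{s \<in> S. s \<in> {i, j, k}} = {j}" by auto
      thus False using eq \<phi>(5,6) inv_comm_contra \<alpha>\<gamma> by (simp add: xs_def ys_def)
    next
      assume "i \<in> S \<and> j \<notin> S \<and> k \<in> S"
      hence "{s \<in> S. s \<in> {i, j, k}} = {i, k}" by auto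
      moreover have "sorted_list_of_set {i, k} = [i, k]" using ijk by (simp add: insort_key.simps)
      ultimately show False using eq \<phi>(3,4) \<alpha>\<gamma> by (simp add: xs_def ys_def)
    qed
  qed
  define a where "a = Min S"
  define b where "b = Max S"
  have ab: "a \<in> S" "b \<in> S" "\<And>s. s \<in> S \<Longrightarrow> a \<le> s \<and> s \<le> b"
    unfolding a_def b_def using \<open>finite S\<close> \<open>S \<noteq> {}\<close> by auto
  show False
  proof (cases "\<exists>c. a < c \<and> c < b \<and> c \<notin> S")
    case True
    then obtain c where "a < c" "c < b" "c \<notin> S" by blast
    thus False using pat[of a c b] ab S by auto
  next
    case False
    have Sab: "S = {a..b}"
    proof (intro equalityI subsetI)
      fix c assume "c \<in> {a..b}"
      thus "c \<in> S" using False ab by (metis atLeastAtMost_iff le_neq_implies_less)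
    qed (use ab in auto)
    have "a \<noteq> 0"
    proof
      assume "a = 0"
      hence "S = {..<Suc b}" using Sab by auto
      moreover have "Suc b \<le> m" using ab S by auto
      ultimately show False using n unfolding seg_def by blast
    qed
    have "b \<noteq> m - 1"
    proof
      assume b: "b = m - 1"
      have "a \<le> m" using ab S by auto
      moreover have "S = {a..<m}" using Sab b m3 by auto
      ultimately show False using n unfolding seg_def by blast
    qed
    moreover have "b < m" using ab S by auto
    ultimately have "0 < a" "a < m - 1" "m - 1 \<notin> S" "0 \<notin> S" "m - 1 < m"
      using \<open>a \<noteq> 0\<close> ab m3 by fastforce+
    \<comment> \<open>An interval of indices that touches neither end is the middle of a triple with
      0 and \<open>m - 1\<close>.\<close>
    thus False using pat[of 0 a "m - 1"] ab by blast
  qed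
qed

lemma X_eq_Y: "S \<subseteq> {..<m} \<Longrightarrow> T \<subseteq> {..<m} \<Longrightarrow> X S = Y T \<longleftrightarrow> S = T \<and> seg m S"
proof -
  assume S: "S \<subseteq> {..<m}" "T \<subseteq> {..<m}"
  have "S = T" if "X S = Y T"
    using XY_same_set[OF S, of "xs S" "ys T"] that unfolding X_def Y_def by blast
  thus ?thesis using X_eq_Y_imp_seg[OF S(1)] X_seg[of S] by blast
qed

lemma X_inj: "S \<subseteq> {..<m} \<Longrightarrow> T \<subseteq> {..<m} \<Longrightarrow> X S = X T \<longleftrightarrow> S = T"
  using XY_same_set[of S T "xs S" "xs T"] unfolding X_def by blast

lemma Y_inj: "S \<subseteq> {..<m} \<Longrightarrow> T \<subseteq> {..<m} \<Longrightarrow> Y S = Y T \<longleftrightarrow> S = T"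
  using XY_same_set[of S T "ys S" "ys T"] unfolding Y_def by blast


lemma mirror_letter: "pencil_group.letter (\<lambda>i. y (m - Suc i)) (\<lambda>i. x (m - Suc i)) = (\<lambda>p. letter (\<not> fst p, m - Suc (snd p)))"
  by (rule ext) (simp add: pencil_group.letter_def[OF mirror] letter_def)

definition flip :: "(bool \<times> nat) list \<Rightarrow> (bool \<times> nat) list" where
  "flip = map (\<lambda>p. (\<not> fst p, m - Suc (snd p)))"

lemma mirror_val: "pencil_group.val G (\<lambda>i. y (m - Suc i)) (\<lambda>i. x (m - Suc i)) w = val (flip w)"
  by (simp add: pencil_group.val_def[OF mirror] val_def mirror_letter flip_def o_def)

lemma valid_flip: "valid w \<Longrightarrow> valid (flip w)"
  by (auto simp: valid_def flip_def)

lemma flip_flip: "valid w \<Longrightarrow> flip (flip w) = w"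
  unfolding valid_def flip_def map_map by (rule map_idI) auto

lemma flip_xs: "S \<subseteq> {..<m} \<Longrightarrow> flip (xs S) = ys (refl_set m S)"
proof -
  assume S: "S \<subseteq> {..<m}"
  let ?f = "\<lambda>i. m - Suc i"
  have fin: "finite S" using S finS by blast
  have "sorted_list_of_set (refl_set m S) = map ?f (rev (sorted_list_of_set S))"
  proof (rule sorted_distinct_set_unique)
    have "set (sorted_list_of_set S) \<subseteq> {..<m}" using S fin by simp
    moreover have "sorted_wrt (<) l \<Longrightarrow> set l \<subseteq> {..<m} \<Longrightarrow> sorted_wrt (<) (map ?f (rev l))" for l
    proof (induction l)
      case (Cons a l)
      have "m - Suc x < m - Suc a" if "x \<in> set l" for x
      proof -
        have "a < x" "x < m" using Cons.prems that by auto
        thus ?thesis by linarith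
      qed
      thus ?case using Cons by (simp add: sorted_wrt_append)
    qed simp
    ultimately have "sorted_wrt (<) (map ?f (rev (sorted_list_of_set S)))" by simp
    thus "sorted (map ?f (rev (sorted_list_of_set S)))" "distinct (map ?f (rev (sorted_list_of_set S)))"
      by (simp_all add: strict_sorted_iff)
    show "set (sorted_list_of_set (refl_set m S)) = set (map ?f (rev (sorted_list_of_set S)))"
      using fin by (simp add: refl_set_def)
  qed (simp_all)
  thus ?thesis by (simp add: flip_def xs_def ys_def o_def)
qed

lemma mirror_X: "S \<subseteq> {..<m} \<Longrightarrow> pencil_group.X G (\<lambda>i. y (m - Suc i)) (\<lambda>i. x (m - Suc i)) S = Y (refl_set m S)"
  by (simp add: pencil_group.X_def[OF mirror] Y_def mirror_val pencil_group.xs_def[OF mirror] flip: flip_xs xs_def)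

lemma twist_Y: "twist = Y {..<m}"
  unfolding twist_def by (rule X_interval) simp

lemma mirror_twist: "pencil_group.twist G (\<lambda>i. y (m - Suc i)) (\<lambda>i. x (m - Suc i)) m = twist"
proof -
  have "refl_set m {..<m} = {..<m}" using refl_set_lessThan[of m m] by (simp add: atLeast0LessThan)
  thus ?thesis unfolding pencil_group.twist_def[OF mirror] mirror_X[OF order_refl] twist_Y by simp
qed

section \<open>Factorizations of the full twist\<close>

lemma twist_word:
  assumes "valid w" "val w = twist"
  shows "distinct (map snd w)" "snd ` set w = {..<m}"
proof -
  have fin: "finite {..<m}" by simp
  have one: "length (filter (\<lambda>p. snd p = j) w) = 1" if "j < m" for j
  proof -
    have "length (filter (\<lambda>p. snd p = j) w) = length (filter (\<lambda>p. snd p = j) (xs {..<m}))"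
      by (rule count_index) (use assms that valid_xs in \<open>auto simp: twist_def X_def\<close>)
    moreover have "{s \<in> {..<m}. s = j} = {j}" using that by auto
    ultimately show ?thesis
      unfolding filter_xs[OF fin, of "\<lambda>s. s = j"] length_xs by simp
  qed
  have s: "snd ` set w \<subseteq> {..<m}" using assms(1) unfolding valid_def .
  have "j \<in> snd ` set w" if j: "j < m" for j
  proof -
    have "filter (\<lambda>p. snd p = j) w \<noteq> []" using one[OF j] by auto
    thus ?thesis by (force simp: filter_empty_conv)
  qed
  thus eq: "snd ` set w = {..<m}" using s by auto
  have "length w = m" using sum_count[OF assms(1)] one by simp
  thus "distinct (map snd w)" using eq by (intro card_distinct) simp
qed

lemma filter_split:
  assumes "distinct (map snd w)" "p \<in> set w"
  shows "filter (\<lambda>q. snd q = snd p) w = [p]"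
  using assms by (induction w) (auto simp: filter_empty_conv image_iff)

text \<open>Projecting to three hyperplanes \<open>i < j < k\<close>, a word for the full twist becomes a word in
  three letters with product one; this constrains their cyclic order.\<close>

lemma tri_one:
  assumes "i < j" "j < k" "k < m" "valid w" "val w = twist"
  obtains \<phi> where
    "list_prod K (map (\<lambda>p. \<phi> (letter p)) (filter (\<lambda>p. snd p \<in> {i, j, k}) w)) = \<one>\<^bsub>K\<^esub>"
    "\<And>b. \<phi> (letter (b, i)) = \<alpha>" "\<And>b. \<phi> (letter (b, k)) = \<gamma>"
    "\<phi> (letter (True, j)) = inv\<^bsub>K\<^esub> (\<alpha> \<otimes>\<^bsub>K\<^esub> \<gamma>)" "\<phi> (letter (False, j)) = inv\<^bsub>K\<^esub> (\<gamma> \<otimes>\<^bsub>K\<^esub> \<alpha>)"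
proof -
  obtain \<phi> where \<phi>: "\<phi> \<in> hom G K"
    "\<And>w. valid w \<Longrightarrow> \<phi> (val w) = list_prod K (map (\<lambda>p. \<phi> (letter p)) (filter (\<lambda>p. snd p \<in> {i, j, k}) w))"
    "\<And>b. \<phi> (letter (b, i)) = \<alpha>" "\<And>b. \<phi> (letter (b, k)) = \<gamma>"
    "\<phi> (letter (True, j)) = inv\<^bsub>K\<^esub> (\<alpha> \<otimes>\<^bsub>K\<^esub> \<gamma>)" "\<phi> (letter (False, j)) = inv\<^bsub>K\<^esub> (\<gamma> \<otimes>\<^bsub>K\<^esub> \<alpha>)"
    by (rule tri_hom[OF assms(1-3)]) blast
  have "{s \<in> {..<m}. s \<in> {i, j, k}} = {i, j, k}" using assms by auto
  moreover have "sorted_list_of_set {i, j, k} = [i, j, k]"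
    using assms(1,2) by (intro sorted_distinct_set_unique) auto
  ultimately have f: "filter (\<lambda>p. snd p \<in> {i, j, k}) (ys {..<m}) = [(False, i), (False, j), (False, k)]"
    unfolding filter_ys[OF finite_lessThan, of "\<lambda>s. s \<in> {i, j, k}"] by (simp add: ys_def)
  have "\<phi> twist = list_prod K (map (\<lambda>p. \<phi> (letter p)) [(False, i), (False, j), (False, k)])"
    unfolding twist_Y Y_def \<phi>(2)[OF valid_ys[OF order_refl]] f ..
  also have "\<dots> = \<alpha> \<otimes>\<^bsub>K\<^esub> (inv\<^bsub>K\<^esub> (\<gamma> \<otimes>\<^bsub>K\<^esub> \<alpha>) \<otimes>\<^bsub>K\<^esub> \<gamma>)" using \<phi> \<alpha>\<gamma> by simp
  also have "\<dots> = \<one>\<^bsub>K\<^esub>"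
  proof -
    have "inv\<^bsub>K\<^esub> (\<gamma> \<otimes>\<^bsub>K\<^esub> \<alpha>) \<otimes>\<^bsub>K\<^esub> \<gamma> = inv\<^bsub>K\<^esub> \<alpha>" using \<alpha>\<gamma> by (simp add: K.inv_mult_group K.m_assoc)
    thus ?thesis using \<alpha>\<gamma> by simp
  qed
  finally have "\<phi> (val w) = \<one>\<^bsub>K\<^esub>" using assms by simp
  thus ?thesis using that \<phi>(2)[OF assms(4)] \<phi>(3-) by metis
qed

text \<open>In the cyclic order \<open>i\<close>, \<open>j\<close>, \<open>k\<close> the letter for
  \<open>j\<close> must be a y, in the cyclic order \<open>k\<close>, \<open>j\<close>,
  \<open>i\<close> it must be an x; otherwise the inverse of one of \<alpha> \<gamma> and \<gamma>
  \<alpha> would cancel the other product. The four arrangements are those met in the analysis of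
  prefixes.\<close>

lemma tri_order:
  assumes ijk: "i < j" "j < k" "k < m" and w: "valid w" "val w = twist"
    and f: "filter (\<lambda>p. snd p \<in> {i, j, k}) w = ps"
  shows "ps = [(b, j), (b', k), (b'', i)] \<Longrightarrow> \<not> b"
    and "ps = [(b', k), (b, j), (b'', i)] \<Longrightarrow> b"
    and "ps = [(b', i), (b'', k), (b, j)] \<Longrightarrow> b"
    and "ps = [(b', k), (b'', i), (b, j)] \<Longrightarrow> \<not> b"
proof -
  obtain \<phi> where \<phi>:
    "list_prod K (map (\<lambda>p. \<phi> (letter p)) ps) = \<one>\<^bsub>K\<^esub>"
    "\<And>b. \<phi> (letter (b, i)) = \<alpha>" "\<And>b. \<phi> (letter (b, k)) = \<gamma>"
    "\<phi> (letter (True, j)) = inv\<^bsub>K\<^esub> (\<alpha> \<otimes>\<^bsub>K\<^esub> \<gamma>)" "\<phi> (letter (False, j)) = inv\<^bsub>K\<^esub> (\<gamma> \<otimes>\<^bsub>K\<^esub> \<alpha>)"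
    using tri_one[OF ijk w] unfolding f by metis
  let ?P = "\<alpha> \<otimes>\<^bsub>K\<^esub> \<gamma>" and ?Q = "\<gamma> \<otimes>\<^bsub>K\<^esub> \<alpha>"
  have c: "?P \<in> carrier K" "?Q \<in> carrier K" using \<alpha>\<gamma> by simp_all
  have *: False if "inv\<^bsub>K\<^esub> u \<otimes>\<^bsub>K\<^esub> v = \<one>\<^bsub>K\<^esub>" "{u, v} = {?P, ?Q}" for u v
  proof -
    have uv: "u \<in> carrier K" "v \<in> carrier K" using that(2) c by (auto simp: doubleton_eq_iff)
    hence "v = u" using that(1) by (metis K.inv_comm K.inv_equality K.inv_inv K.inv_closed)
    thus False using that(2) \<alpha>\<gamma>(3) by (auto simp: doubleton_eq_iff)
  qed
  have **: False if "u \<otimes>\<^bsub>K\<^esub> inv\<^bsub>K\<^esub> v = \<one>\<^bsub>K\<^esub>" "{u, v} = {?P, ?Q}" for u v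
  proof -
    have uv: "u \<in> carrier K" "v \<in> carrier K" using that(2) c by (auto simp: doubleton_eq_iff)
    hence "v = u" using that(1) by (metis K.inv_equality K.inv_inv K.inv_closed)
    thus False using that(2) \<alpha>\<gamma>(3) by (auto simp: doubleton_eq_iff)
  qed
  show "\<not> b" if "ps = [(b, j), (b', k), (b'', i)]"
  proof
    assume b
    hence "inv\<^bsub>K\<^esub> ?P \<otimes>\<^bsub>K\<^esub> ?Q = \<one>\<^bsub>K\<^esub>" using \<phi> that \<alpha>\<gamma> by simp
    thus False by (rule *) simp
  qed
  show b if "ps = [(b', k), (b, j), (b'', i)]"
  proof (rule ccontr)
    assume "\<not> b"
    hence "\<gamma> \<otimes>\<^bsub>K\<^esub> (inv\<^bsub>K\<^esub> ?Q \<otimes>\<^bsub>K\<^esub> \<alpha>) = \<one>\<^bsub>K\<^esub>" using \<phi> that \<alpha>\<gamma> by simp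
    hence "inv\<^bsub>K\<^esub> ?Q \<otimes>\<^bsub>K\<^esub> \<alpha> = inv\<^bsub>K\<^esub> \<gamma>" using \<alpha>\<gamma> c by (metis K.inv_closed K.inv_comm K.inv_equality K.m_closed)
    hence "inv\<^bsub>K\<^esub> ?Q \<otimes>\<^bsub>K\<^esub> \<alpha> \<otimes>\<^bsub>K\<^esub> \<gamma> = \<one>\<^bsub>K\<^esub>" using \<alpha>\<gamma> by simp
    hence "inv\<^bsub>K\<^esub> ?Q \<otimes>\<^bsub>K\<^esub> ?P = \<one>\<^bsub>K\<^esub>" using \<alpha>\<gamma> c by (simp add: K.m_assoc)
    thus False by (rule *) auto
  qed
  show b if "ps = [(b', i), (b'', k), (b, j)]"
  proof (rule ccontr)
    assume "\<not> b"
    hence "\<alpha> \<otimes>\<^bsub>K\<^esub> (\<gamma> \<otimes>\<^bsub>K\<^esub> inv\<^bsub>K\<^esub> ?Q) = \<one>\<^bsub>K\<^esub>" using \<phi> that \<alpha>\<gamma> by simp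
    hence "?P \<otimes>\<^bsub>K\<^esub> inv\<^bsub>K\<^esub> ?Q = \<one>\<^bsub>K\<^esub>" using \<alpha>\<gamma> c by (simp add: K.m_assoc)
    thus False by (rule **) simp
  qed
  show "\<not> b" if "ps = [(b', k), (b'', i), (b, j)]"
  proof
    assume b
    hence "\<gamma> \<otimes>\<^bsub>K\<^esub> (\<alpha> \<otimes>\<^bsub>K\<^esub> inv\<^bsub>K\<^esub> ?P) = \<one>\<^bsub>K\<^esub>" using \<phi> that \<alpha>\<gamma> by simp
    hence "?Q \<otimes>\<^bsub>K\<^esub> inv\<^bsub>K\<^esub> ?P = \<one>\<^bsub>K\<^esub>" using \<alpha>\<gamma> c by (simp add: K.m_assoc)
    thus False by (rule **) auto
  qed
qed

lemma xs_insert_less: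
  assumes "finite S" "\<forall>s\<in>S. l < s" shows "xs (insert l S) = xs S @ [(True, l)]"
proof -
  have "sorted_list_of_set (insert l S) = l # sorted_list_of_set S"
  proof -
    have "l \<notin> S" using assms(2) by blast
    hence "sorted_list_of_set (insert l S) = insort l (sorted_list_of_set S)"
      using assms(1) by simp
    also have "\<dots> = l # sorted_list_of_set S"
      by (rule insort_is_Cons) (use assms in \<open>simp add: less_imp_le\<close>)
    finally show ?thesis .
  qed
  thus ?thesis by (simp add: xs_def)
qed

lemma xs_split:
  assumes "finite U" "\<forall>u\<in>U. k \<le> u" shows "xs ({..<k} \<union> U) = xs U @ xs {..<k}"
proof -
  have "sorted_list_of_set ({..<k} \<union> U) = [0..<k] @ sorted_list_of_set U"
    by (rule sorted_distinct_set_unique) (use assms in \<open>auto simp: sorted_append\<close>)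
  thus ?thesis by (simp add: xs_def sorted_list_lessThan)
qed

lemma first_last: "x 0 = y 0" "x (m - 1) = y (m - 1)"
  using pencil_rel_first_last[OF rel G.is_group] m3 by auto

lemma X_insert_less:
  assumes "S \<subseteq> {..<m}" "l < m" "\<forall>s\<in>S. l < s"
  shows "X (insert l S) = X S \<otimes>\<^bsub>G\<^esub> x l"
  using xs_insert_less[OF finS[OF assms(1)] assms(3)] val_append[OF valid_xs[OF assms(1)], of "[(True, l)]"]
    assms(2) xy_closed by (simp add: X_def letter_def)

text \<open>By the pencil relations the \<open>x\<close>-word of an initial segment may be traded for its \<open>y\<close>-word,
  which is extended on the right by \<open>y k\<close>.\<close>

lemma X_insert_mex:
  assumes "S \<subseteq> {..<m}" "k < m" "k \<notin> S" "{..<k} \<subseteq> S"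
  shows "X (insert k S) = X S \<otimes>\<^bsub>G\<^esub> y k"
proof -
  define U where "U = {s \<in> S. k < s}"
  have U: "finite U" "U \<subseteq> {..<m}" "\<forall>u\<in>U. k \<le> u" "\<forall>u\<in>U. Suc k \<le> u"
    unfolding U_def using assms finS by auto
  have S: "S = {..<k} \<union> U" unfolding U_def using assms by (auto simp: not_less le_less)
  have S': "insert k S = {..<Suc k} \<union> U" unfolding S by auto
  have val: "valid (xs U)" "valid (xs {..<k})" "valid (xs {..<Suc k})" using U assms by (auto intro!: valid_xs)
  have c: "X U \<in> carrier G" "X {..<k} \<in> carrier G" "y k \<in> carrier G"
    unfolding X_def using val val_closed assms xy_closed by auto
  have k: "{..<k} \<subseteq> {..<m}" using assms by auto
  have "X {..<Suc k} = Y {..<Suc k}" using assms X_interval by simp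
  also have "\<dots> = val (ys {..<k} @ [(False, k)])" by (simp add: Y_def ys_def sorted_list_lessThan)
  also have "\<dots> = Y {..<k} \<otimes>\<^bsub>G\<^esub> y k"
    using val_append[OF valid_ys[OF k], of "[(False, k)]"] assms c by (simp add: letter_def Y_def)
  also have "Y {..<k} = X {..<k}" using assms X_interval by simp
  finally have 1: "X {..<Suc k} = X {..<k} \<otimes>\<^bsub>G\<^esub> y k" .
  have "X (insert k S) = X U \<otimes>\<^bsub>G\<^esub> X {..<Suc k}"
    unfolding S' X_def xs_split[OF U(1,4)] by (rule val_append[OF val(1,3)])
  also have "\<dots> = X U \<otimes>\<^bsub>G\<^esub> X {..<k} \<otimes>\<^bsub>G\<^esub> y k" using 1 c by (simp add: G.m_assoc)
  also have "X U \<otimes>\<^bsub>G\<^esub> X {..<k} = X S"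
    unfolding S X_def xs_split[OF U(1,3)] by (rule val_append[OF val(1,2), symmetric])
  finally show ?thesis .
qed

lemma xstep_mult:
  assumes "S \<subseteq> {..<m}" "l < m" "xstep S l"
  obtains b where "X (insert l S) = X S \<otimes>\<^bsub>G\<^esub> letter (b, l)"
proof (cases "\<forall>s\<in>S. l < s")
  case True thus ?thesis using that[of True] X_insert_less[OF assms(1,2)] by (simp add: letter_def)
next
  case False
  hence "l \<notin> S" "{..<l} \<subseteq> S" using assms(3) unfolding xstep_def by auto
  thus ?thesis using that[of False] X_insert_mex[OF assms(1,2)] by (simp add: letter_def)
qed

text \<open>The converse of \<open>xstep_mult\<close> inside factorizations of the full twist, and
  the core of the argument. As every index occurs exactly once, any three indices give a subword
  whose order is known, and \<open>tri_order\<close> applies to it.\<close>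

lemma X_step_necessary:
  assumes S: "S \<subseteq> {..<m}" "S \<noteq> {}" "\<nexists>k. S = {..<k}"
    and v: "l < m" "valid v" and tw: "val (xs S @ (b, l) # v) = twist"
  shows "xstep S l \<and> X (insert l S) = X S \<otimes>\<^bsub>G\<^esub> letter (b, l)"
proof -
  let ?w = "xs S @ (b, l) # v"
  have fin: "finite S" using S finS by blast
  have vw: "valid ?w" using S v valid_xs by simp
  note d = twist_word[OF vw tw]
  have setxs: "snd ` set (xs S) = S" using fin by (force simp: xs_def)
  have dis: "distinct (map snd v)" "l \<notin> S" "l \<notin> snd ` set v" "S \<inter> snd ` set v = {}"
    using d(1) setxs by auto
  have inv: "t \<in> snd ` set v" if "t < m" "t \<notin> S" "t \<noteq> l" for t
    using d(2) setxs that by (auto simp: image_Un)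
  have filt: "filter (\<lambda>p. snd p \<in> A) ?w = xs {s \<in> S. s \<in> A} @ (if l \<in> A then [(b, l)] else []) @ filter (\<lambda>p. snd p \<in> A) v" for A
    using filter_xs[OF fin, of "\<lambda>s. s \<in> A"] by simp
  have filv: "\<exists>c. filter (\<lambda>p. snd p \<in> A) v = [(c, t)]" if "A \<inter> snd ` set v = {t}" for A t
  proof -
    have "t \<in> snd ` set v" using that by blast
    then obtain p where p: "p \<in> set v" "snd p = t" by auto
    have "filter (\<lambda>q. snd q \<in> A) v = filter (\<lambda>q. snd q = snd p) v"
      by (rule filter_cong) (use that p in auto)
    also have "\<dots> = [p]" by (rule filter_split[OF dis(1) p(1)])
    finally show ?thesis using p by (metis prod.collapse)
  qed
  have filv0: "filter (\<lambda>p. snd p \<in> A) v = []" if "A \<inter> snd ` set v = {}" for A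
    using that by (auto simp: filter_empty_conv)
  have xs1: "xs {s} = [(True, s)]" for s by (simp add: xs_def)
  show ?thesis
  \<comment> \<open>If 0 is still to come after \<open>l\<close>, the triples of 0, \<open>s\<close>
    and \<open>l\<close> force \<open>l < s\<close> and an x-letter, for every \<open>s\<close> in
    \<open>S\<close>. If 0 has been used, the least missing index \<open>k\<close> must come next:
    were it delayed past \<open>l\<close>, its letter would be a y by the triple of 0,
    \<open>k\<close> and an element \<open>u > k\<close> of \<open>S\<close>, and an x by the triple
    of 0, \<open>k\<close> and \<open>l\<close>.\<close>
  proof (cases "0 \<in> S")
    case False
    show ?thesis
    proof (cases "l = 0")
      case True
      hence "\<forall>s\<in>S. l < s" using False by (auto intro: gr0I)
      moreover have "letter (b, l) = x l" using first_last True by (simp add: letter_def)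
      ultimately show ?thesis using X_insert_less[OF S(1) v(1)] dis(2) by (simp add: xstep_def)
    next
      case l0: False
      have v0: "0 \<in> snd ` set v" using inv[of 0] False l0 m3 by auto
      have ord: "l < s \<and> b" if s: "s \<in> S" for s
      proof -
        have sl: "s \<noteq> l" "0 < s" "s < m" using s dis False S by (auto intro: gr0I)
        have A: "{r \<in> S. r \<in> {0, s, l}} = {s}" using s False dis by auto
        have "{0, s, l} \<inter> snd ` set v = {0}" using v0 s dis by auto
        from filv[OF this] obtain c where c: "filter (\<lambda>p. snd p \<in> {0, s, l}) v = [(c, 0)]" by blast
        have f: "filter (\<lambda>p. snd p \<in> {0, s, l}) ?w = [(True, s), (b, l), (c, 0)]"
          unfolding filt A c xs1 by simp
        have "\<not> s < l"
          using tri_order(1)[OF sl(2) _ v(1) vw tw f, of True b c] by blast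
        hence "l < s" using sl by simp
        have f': "filter (\<lambda>p. snd p \<in> {0, l, s}) ?w = [(True, s), (b, l), (c, 0)]"
          using f by (simp add: insert_commute)
        have "b" using tri_order(2)[OF _ \<open>l < s\<close> sl(3) vw tw f', of True b c] l0 by blast
        thus ?thesis using \<open>l < s\<close> by blast
      qed
      hence "\<forall>s\<in>S. l < s" "letter (b, l) = x l" using S(2) by (auto simp: letter_def)
      thus ?thesis using X_insert_less[OF S(1) v(1)] dis(2) by (simp add: xstep_def)
    qed
  next
    case True
    have "S \<noteq> {..<m}" using S(3) by blast
    then obtain k where k: "k < m" "k \<notin> S" "{..<k} \<subseteq> S"
    proof -
      define k where "k = (LEAST k. k < m \<and> k \<notin> S)"
      have ex: "\<exists>k. k < m \<and> k \<notin> S" using \<open>S \<noteq> {..<m}\<close> S(1) by auto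
      have kk: "k < m \<and> k \<notin> S" unfolding k_def by (rule LeastI_ex[OF ex])
      moreover have "i \<in> S" if "i < k" for i
        using not_less_Least[of i "\<lambda>k. k < m \<and> k \<notin> S"] that kk unfolding k_def by auto
      ultimately show ?thesis using that by blast
    qed
    have k0: "0 < k" using k True by (auto intro: gr0I)
    obtain u where u: "u \<in> S" "k < u"
    proof -
      have "S \<noteq> {..<k}" using S by blast
      then obtain u where "u \<in> S" "\<not> u < k" using k by blast
      thus ?thesis using that k by (metis linorder_neqE_nat)
    qed
    have um: "u < m" using u S by auto
    have A: "{r \<in> S. r \<in> {0, k, u}} = {0, u}" using u True k by auto
    have "sorted_list_of_set {0, u} = [0, u]"
      using u by (intro sorted_distinct_set_unique) auto
    hence xs0u: "xs {0, u} = [(True, u), (True, 0)]" by (simp add: xs_def)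
    have lk: "l = k"
    proof (rule ccontr)
      assume "l \<noteq> k"
      hence kl: "k < l" using k dis by (meson lessThan_iff linorder_neqE_nat subsetD)
      have kv: "k \<in> snd ` set v" using inv k \<open>l \<noteq> k\<close> by auto
      have sep: "0 \<notin> snd ` set v" "u \<notin> snd ` set v" using True u dis(4) by blast+
      have "{0, k, u} \<inter> snd ` set v = {k}" using kv sep by blast
      from filv[OF this] obtain c where c: "filter (\<lambda>p. snd p \<in> {0, k, u}) v = [(c, k)]" by blast
      have "l \<notin> {0, k, u}" using kl u dis by auto
      hence "filter (\<lambda>p. snd p \<in> {0, k, u}) ?w = [(True, u), (True, 0), (c, k)]"
        unfolding filt A c xs0u by simp
      from tri_order(4)[OF k0 u(2) um vw tw this, of True True c] have "\<not> c" by blast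
      have "{0, k, l} \<inter> snd ` set v = {k}" using kv sep(1) dis(3) by blast
      from filv[OF this] obtain c' where c': "filter (\<lambda>p. snd p \<in> {0, k, l}) v = [(c', k)]" by blast
      have A': "{r \<in> S. r \<in> {0, k, l}} = {0}" using True dis k by auto
      have "filter (\<lambda>p. snd p \<in> {0, k, l}) ?w = [(True, 0), (b, l), (c', k)]"
        unfolding filt A' c' xs1 by simp
      from tri_order(3)[OF k0 kl v(1) vw tw this, of True b c'] have "c'" by blast
      have "(c, k) \<in> set v" "(c', k) \<in> set v"
        using arg_cong[OF c, of set] arg_cong[OF c', of set] by auto
      moreover have "inj_on snd (set v)" using dis(1) by (simp add: distinct_map)
      ultimately have "c = c'" using inj_onD[of snd "set v" "(c, k)" "(c', k)"] by simp
      thus False using \<open>\<not> c\<close> \<open>c'\<close> by blast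
    qed
    have emp: "{0, k, u} \<inter> snd ` set v = {}" using True u dis lk by auto
    have "filter (\<lambda>p. snd p \<in> {0, k, u}) ?w = [(True, u), (True, 0), (b, k)]"
      unfolding filt A xs0u using lk filv0[OF emp] by simp
    from tri_order(4)[OF k0 u(2) um vw tw this, of True True b] have "\<not> b" by blast
    hence "letter (b, l) = y k" using lk by (simp add: letter_def)
    moreover have "xstep S l" using k lk k0 by (simp add: xstep_def)
    ultimately show ?thesis using X_insert_mex[OF S(1) k] lk by simp
  qed
qed


section \<open>The interval as a poset of prefixes\<close>

definition mon :: "'g set" where
  "mon = submonoid_generated G (x ` {..<m} \<union> y ` {..<m})"

definition mon_ord :: "'g gorder" where
  "mon_ord = \<lparr>carrier = mon, eq = (=), le = (\<lambda>p p'. \<exists>q\<in>mon. p' = p \<otimes>\<^bsub>G\<^esub> q)\<rparr>"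

definition interval :: "'g gorder" where
  "interval = mon_ord\<lparr>carrier := \<lbrace>\<one>\<^bsub>G\<^esub>..twist\<rbrace>\<^bsub>mon_ord\<^esub>\<rparr>"

definition len :: "'g \<Rightarrow> nat" where
  "len p = (THE k. \<exists>w. valid w \<and> length w = k \<and> val w = p)"

lemma gen_letter: "x ` {..<m} \<union> y ` {..<m} = letter ` {p. snd p < m}"
proof (intro equalityI subsetI)
  fix g assume "g \<in> x ` {..<m} \<union> y ` {..<m}"
  then obtain i where "i < m" "g = letter (True, i) \<or> g = letter (False, i)" by (auto simp: letter_def)
  thus "g \<in> letter ` {p. snd p < m}" by auto
qed (auto simp: letter_def)

lemma mon_iff: "p \<in> mon \<longleftrightarrow> (\<exists>w. valid w \<and> p = val w)"
proof
  assume "p \<in> mon"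
  thus "\<exists>w. valid w \<and> p = val w"
    unfolding mon_def
  proof (induction rule: submonoid_generated.induct)
    case one show ?case by (intro exI[of _ "[]"]) simp
  next
    case (incl s)
    then obtain q where "snd q < m" "s = letter q" unfolding gen_letter by blast
    thus ?case using letter_closed by (intro exI[of _ "[q]"]) simp
  next
    case (mult p q)
    then obtain u w where "valid u" "p = val u" "valid w" "q = val w" by blast
    thus ?case using val_append by (intro exI[of _ "u @ w"]) simp
  qed
next
  assume "\<exists>w. valid w \<and> p = val w"
  then obtain w where w: "valid w" "p = val w" by blast
  have "val w \<in> mon" using w(1)
  proof (induction w)
    case Nil thus ?case unfolding mon_def by (simp add: submonoid_generated.one)
  next
    case (Cons q w)
    hence "letter q \<in> mon" unfolding mon_def gen_letter by (intro submonoid_generated.incl) auto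
    thus ?case using Cons unfolding mon_def by (simp add: submonoid_generated.mult)
  qed
  thus "p \<in> mon" using w by simp
qed

lemma len_val: "valid w \<Longrightarrow> len (val w) = length w"
  unfolding len_def
proof (rule the_equality)
  assume w: "valid w"
  thus "\<exists>w'. valid w' \<and> length w' = length w \<and> val w' = val w" by blast
  fix k assume "\<exists>w'. valid w' \<and> length w' = k \<and> val w' = val w"
  then obtain w' where "valid w'" "length w' = k" "val w' = val w" by blast
  thus "k = length w" using val_length[of w' w] w by simp
qed

abbreviation step_rel :: "'g \<Rightarrow> 'g \<Rightarrow> bool" where
  "step_rel p q \<equiv> \<exists>S l. S \<subseteq> {..<m} \<and> l < m \<and>
          (xstep S l \<and> p = X S \<and> q = X (insert l S) \<or>
           ystep m S l \<and> p = Y S \<and> q = Y (insert l S))"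

lemma pencil_posetI:
  assumes "carrier L = X ` Pow {..<m} \<union> Y ` Pow {..<m}" "eq L = (=)"
    and "\<And>p q. p \<in> carrier L \<Longrightarrow> q \<in> carrier L \<Longrightarrow> le L p q \<longleftrightarrow> step_rel\<^sup>*\<^sup>* p q"
  shows "pencil_poset m X Y len L"
proof
  show "len (X S) = card S" "len (Y S) = card S" if "S \<subseteq> {..<m}" for S
    using len_val[OF valid_xs[OF that]] len_val[OF valid_ys[OF that]]
    by (simp_all add: X_def Y_def length_xs length_ys)
qed (use assms m3 X_inj Y_inj X_eq_Y in simp_all)

text \<open>The poset that the interval will turn out to be. Introducing it first makes the results
  on such posets available for the identification, notably \<open>node_cases\<close> and
  \<open>le_top\<close>.\<close>

definition L0 :: "'g gorder" where
  "L0 = \<lparr>carrier = X ` Pow {..<m} \<union> Y ` Pow {..<m}, eq = (=), le = step_rel\<^sup>*\<^sup>*\<rparr>"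

interpretation P0: pencil_poset m X Y len L0
  by (rule pencil_posetI) (simp_all add: L0_def)

lemma ext_mult:
  assumes "P0.ext p q" shows "\<exists>r. snd r < m \<and> q = p \<otimes>\<^bsub>G\<^esub> letter r"
proof -
  obtain S l where S: "S \<subseteq> {..<m}" "l < m"
      "xstep S l \<and> p = X S \<and> q = X (insert l S) \<or> ystep m S l \<and> p = Y S \<and> q = Y (insert l S)"
    using assms unfolding P0.ext_def by blast
  from S(3) show ?thesis
  proof
    assume "xstep S l \<and> p = X S \<and> q = X (insert l S)"
    thus ?thesis using xstep_mult[OF S(1,2)] S(2) by (metis snd_conv)
  next
    assume y: "ystep m S l \<and> p = Y S \<and> q = Y (insert l S)"
    have l: "m - Suc l < m" "m - Suc (m - Suc l) = l" using S(2) by auto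
    have sub: "refl_set m S \<subseteq> {..<m}" "insert (m - Suc l) (refl_set m S) \<subseteq> {..<m}"
      using refl_set_subset[OF S(1)] l by auto
    have "xstep (refl_set m S) (m - Suc l)" using xstep_refl_set[OF S(1,2)] y by simp
    then obtain b where "Y (refl_set m (insert (m - Suc l) (refl_set m S))) =
        Y (refl_set m (refl_set m S)) \<otimes>\<^bsub>G\<^esub> letter (\<not> b, m - Suc (m - Suc l))"
      using pencil_group.xstep_mult[OF mirror sub(1) l(1)] unfolding mirror_letter mirror_X[OF sub(1)] mirror_X[OF sub(2)]
      by auto
    hence "Y (insert l S) = Y S \<otimes>\<^bsub>G\<^esub> letter (\<not> b, l)" using S(1) l by (simp add: refl_set_insert refl_refl)
    thus ?thesis using y S(2) by (intro exI[of _ "(\<not> b, l)"]) simp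
  qed
qed

text \<open>\<open>X_step_necessary\<close> for arbitrary elements: at \<open>bot\<close> every
  letter is a step, at \<open>top\<close> the word length leaves no room for a further letter, and
  y-nodes are treated by reflecting the whole word.\<close>

lemma step_necessary:
  assumes p: "p \<in> carrier L0" and v: "l < m" "valid v"
    and tw: "p \<otimes>\<^bsub>G\<^esub> (letter (b, l) \<otimes>\<^bsub>G\<^esub> val v) = twist"
  shows "P0.ext p (p \<otimes>\<^bsub>G\<^esub> letter (b, l))"
  using p
proof (cases rule: P0.node_cases)
  case 1
  have c: "letter (True, l) \<in> carrier G" "letter (False, l) \<in> carrier G" using letter_closed v by simp_all
  have "p = \<one>\<^bsub>G\<^esub>" using 1 by (simp add: P0.bot_def X_def xs_def)
  hence "p \<otimes>\<^bsub>G\<^esub> letter (b, l) = (if b then X {l} else Y {l})"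
    using c by (cases b) (simp_all add: X_def Y_def xs_def ys_def)
  moreover have "P0.ext p (X {l})" "P0.ext p (Y {l})"
    using P0.xstep_ext[of "{}" l] P0.ystep_ext[of "{}" l] v 1 P0.bot_def P0.bot_Y by (simp_all add: xstep_def ystep_def)
  ultimately show ?thesis by simp
next
  case 2
  hence "p = val (xs {..<m})" by (simp add: P0.top_def X_def)
  hence "val (xs {..<m} @ (b, l) # v) = val (xs {..<m})"
    using tw 2 val_append[OF valid_xs[OF order_refl], of "(b, l) # v"] v
    by (simp add: twist_def P0.top_def X_def)
  hence "length (xs {..<m} @ (b, l) # v) = length (xs {..<m})"
    by (rule val_length[rotated 2]) (use v valid_xs in auto)
  thus ?thesis by simp
next
  case (3 S)
  hence S: "S \<subseteq> {..<m}" "S \<noteq> {}" "\<nexists>k. S = {..<k}" unfolding P0.xnode_def by auto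
  have "val (xs S @ (b, l) # v) = twist"
    using tw 3 val_append[OF valid_xs[OF S(1)], of "(b, l) # v"] v by (simp add: X_def)
  from X_step_necessary[OF S v this] show ?thesis using P0.xstep_ext[OF _ S(1) v(1)] 3 by simp
next
  case (4 S)
  hence S: "S \<subseteq> {..<m}" "P0.xnode (refl_set m S)" using P0.ynode_sub P0.xnode_refl by blast+
  let ?S = "refl_set m S" and ?l = "m - Suc l"
  have S': "?S \<subseteq> {..<m}" "?S \<noteq> {}" "\<nexists>k. ?S = {..<k}" using S(2) unfolding P0.xnode_def by auto
  have l: "?l < m" "m - Suc ?l = l" using v by auto
  have sub: "insert ?l ?S \<subseteq> {..<m}" using S'(1) l by auto
  have "val (ys S @ (b, l) # v) = twist"
    using tw 4 val_append[OF valid_ys[OF S(1)], of "(b, l) # v"] v by (simp add: Y_def)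
  moreover have "flip (xs ?S @ (\<not> b, ?l) # flip v) = ys S @ (b, l) # v"
  proof -
    have "flip (xs ?S) = ys S" using flip_xs[OF S'(1)] S(1) by (simp add: refl_refl)
    moreover have "flip ((\<not> b, ?l) # flip v) = (b, l) # v"
      using flip_flip[OF v(2)] l by (simp add: flip_def)
    moreover have "flip (u @ w) = flip u @ flip w" for u w by (simp add: flip_def)
    ultimately show ?thesis by simp
  qed
  ultimately have tw': "pencil_group.val G (\<lambda>i. y (m - Suc i)) (\<lambda>i. x (m - Suc i))
      (pencil_group.xs ?S @ (\<not> b, ?l) # flip v) =
     pencil_group.twist G (\<lambda>i. y (m - Suc i)) (\<lambda>i. x (m - Suc i)) m"
    by (simp add: mirror_val mirror_twist pencil_group.xs_def[OF mirror] flip: xs_def)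
  have vf: "pencil_group.valid m (flip v)"
    using valid_flip[OF v(2)] by (simp add: pencil_group.valid_def[OF mirror] valid_def)
  from pencil_group.X_step_necessary[OF mirror S' l(1) vf tw']
  have "xstep ?S ?l" "Y (refl_set m (insert ?l ?S)) = Y (refl_set m ?S) \<otimes>\<^bsub>G\<^esub> letter (b, l)"
    unfolding mirror_X[OF S'(1)] mirror_X[OF sub] mirror_letter using l by auto
  hence "ystep m S l" "Y (insert l S) = Y S \<otimes>\<^bsub>G\<^esub> letter (b, l)"
    using xstep_refl_set[OF S(1) v(1)] S(1) l by (simp_all add: refl_set_insert refl_refl)
  thus ?thesis using P0.ystep_ext[OF _ S(1) v(1)] 4 by simp
qed

lemma twist_top: "twist = P0.top"
  by (simp add: twist_def P0.top_def)

lemma carrier_closed: "p \<in> carrier L0 \<Longrightarrow> p \<in> carrier G"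
  by (erule P0.carrier_cases) (auto simp: X_def Y_def intro!: val_closed valid_xs valid_ys)

lemma ext_star_mult: "P0.ext\<^sup>*\<^sup>* p q \<Longrightarrow> p \<in> carrier L0 \<Longrightarrow> \<exists>w. valid w \<and> q = p \<otimes>\<^bsub>G\<^esub> val w"
proof (induction rule: rtranclp_induct)
  case base
  thus ?case using carrier_closed by (intro exI[of _ "[]"]) simp
next
  case (step q r)
  then obtain w where w: "valid w" "q = p \<otimes>\<^bsub>G\<^esub> val w" by blast
  obtain g where g: "snd g < m" "r = q \<otimes>\<^bsub>G\<^esub> letter g" using ext_mult step by blast
  have c: "p \<in> carrier G" "val w \<in> carrier G" "letter g \<in> carrier G"
    using carrier_closed step val_closed w letter_closed g by auto
  show ?case using w g c val_append[of w "[g]"] by (intro exI[of _ "w @ [g]"]) (simp add: G.m_assoc)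
qed

text \<open>\<open>w\<close> is read letter by letter. The remaining letters together with
  \<open>v\<close> complete the factorization of the twist, so \<open>step_necessary\<close>
  certifies each letter as a step.\<close>

lemma prefix_ext:
  assumes "p \<in> carrier L0" "valid w" "valid v" "p \<otimes>\<^bsub>G\<^esub> (val w \<otimes>\<^bsub>G\<^esub> val v) = twist"
  shows "P0.ext\<^sup>*\<^sup>* p (p \<otimes>\<^bsub>G\<^esub> val w)"
  using assms
proof (induction w arbitrary: p)
  case Nil thus ?case using carrier_closed by simp
next
  case (Cons g w)
  obtain b l where g: "g = (b, l)" by (cases g)
  have c: "p \<in> carrier G" "letter g \<in> carrier G" "val w \<in> carrier G" "val v \<in> carrier G"
    using Cons.prems carrier_closed letter_closed val_closed by auto
  have "p \<otimes>\<^bsub>G\<^esub> (letter (b, l) \<otimes>\<^bsub>G\<^esub> val (w @ v)) = twist"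
    using Cons.prems c g by (simp add: val_append G.m_assoc)
  hence e: "P0.ext p (p \<otimes>\<^bsub>G\<^esub> letter g)"
    using step_necessary[of p l "w @ v" b] Cons.prems g by simp
  hence "p \<otimes>\<^bsub>G\<^esub> letter g \<in> carrier L0" using P0.ext_carrier by blast
  moreover have "p \<otimes>\<^bsub>G\<^esub> letter g \<otimes>\<^bsub>G\<^esub> (val w \<otimes>\<^bsub>G\<^esub> val v) = twist"
    using Cons.prems c by (simp add: G.m_assoc)
  ultimately have "P0.ext\<^sup>*\<^sup>* (p \<otimes>\<^bsub>G\<^esub> letter g) (p \<otimes>\<^bsub>G\<^esub> letter g \<otimes>\<^bsub>G\<^esub> val w)"
    using Cons by simp
  with e have "P0.ext\<^sup>*\<^sup>* p (p \<otimes>\<^bsub>G\<^esub> letter g \<otimes>\<^bsub>G\<^esub> val w)" by (rule converse_rtranclp_into_rtranclp)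
  thus ?case using c by (simp add: G.m_assoc)
qed

lemma one_bot: "\<one>\<^bsub>G\<^esub> = P0.bot"
  by (simp add: P0.bot_def X_def xs_def)

text \<open>From \<open>q\<close> a chain of steps leads to \<open>top\<close>, that is to the full
  twist. This completes any divisibility relation in the monoid to a factorization of the
  twist.\<close>

lemma le_iff:
  assumes "p \<in> carrier L0" "q \<in> carrier L0"
  shows "(\<exists>r\<in>mon. q = p \<otimes>\<^bsub>G\<^esub> r) \<longleftrightarrow> P0.ext\<^sup>*\<^sup>* p q"
proof
  assume "\<exists>r\<in>mon. q = p \<otimes>\<^bsub>G\<^esub> r"
  then obtain r where r: "r \<in> mon" "q = p \<otimes>\<^bsub>G\<^esub> r" by blast
  obtain w where "valid w" "r = val w" using iffD1[OF mon_iff r(1)] by blast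
  with r have w: "valid w" "q = p \<otimes>\<^bsub>G\<^esub> val w" by simp_all
  obtain v where v: "valid v" "twist = q \<otimes>\<^bsub>G\<^esub> val v"
    using ext_star_mult[OF P0.le_top[OF assms(2)] assms(2)] twist_top by auto
  have "p \<otimes>\<^bsub>G\<^esub> (val w \<otimes>\<^bsub>G\<^esub> val v) = twist"
    using v w assms carrier_closed val_closed by (simp add: G.m_assoc)
  from prefix_ext[OF assms(1) w(1) v(1) this] show "P0.ext\<^sup>*\<^sup>* p q" using w by simp
next
  assume "P0.ext\<^sup>*\<^sup>* p q"
  thus "\<exists>r\<in>mon. q = p \<otimes>\<^bsub>G\<^esub> r" using ext_star_mult assms(1) mon_iff by blast
qed

lemma carrier_interval: "carrier interval = carrier L0"
proof (intro equalityI subsetI)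
  fix p assume "p \<in> carrier interval"
  hence p: "p \<in> mon" "\<exists>r\<in>mon. twist = p \<otimes>\<^bsub>G\<^esub> r"
    by (auto simp: interval_def mon_ord_def at_least_at_most_def)
  then obtain r where r: "r \<in> mon" "twist = p \<otimes>\<^bsub>G\<^esub> r" by blast
  obtain w where w: "valid w" "p = val w" using iffD1[OF mon_iff p(1)] by blast
  obtain v where "valid v" "r = val v" using iffD1[OF mon_iff r(1)] by blast
  with r w have wv: "valid w" "p = val w" "valid v" "twist = p \<otimes>\<^bsub>G\<^esub> val v" by simp_all
  have "\<one>\<^bsub>G\<^esub> \<otimes>\<^bsub>G\<^esub> (val w \<otimes>\<^bsub>G\<^esub> val v) = twist" using wv val_closed by simp
  hence "P0.ext\<^sup>*\<^sup>* \<one>\<^bsub>G\<^esub> (\<one>\<^bsub>G\<^esub> \<otimes>\<^bsub>G\<^esub> val w)"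
    using prefix_ext[OF _ wv(1,3)] P0.bot_carrier one_bot by metis
  moreover have "\<one>\<^bsub>G\<^esub> \<otimes>\<^bsub>G\<^esub> val w = p" using wv val_closed by simp
  ultimately have "P0.ext\<^sup>*\<^sup>* P0.bot p" unfolding one_bot[symmetric] by simp
  thus "p \<in> carrier L0" using P0.ext_star_carrier P0.bot_carrier by blast
next
  fix p assume p: "p \<in> carrier L0"
  have "\<exists>w. valid w \<and> p = val w"
    using p by (cases rule: P0.carrier_cases) (auto simp: X_def Y_def intro: valid_xs valid_ys)
  hence "p \<in> mon" using mon_iff by blast
  moreover from this have "p = \<one>\<^bsub>G\<^esub> \<otimes>\<^bsub>G\<^esub> p" using p carrier_closed by simp
  moreover have "\<exists>r\<in>mon. twist = p \<otimes>\<^bsub>G\<^esub> r"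
    unfolding twist_top le_iff[OF p P0.top_carrier] by (rule P0.le_top[OF p])
  ultimately show "p \<in> carrier interval"
    by (auto simp: interval_def mon_ord_def at_least_at_most_def)
qed

lemma pencil_poset_interval: "pencil_poset m X Y len interval"
proof (rule pencil_posetI)
  show "carrier interval = X ` Pow {..<m} \<union> Y ` Pow {..<m}"
    unfolding carrier_interval by (simp add: L0_def)
  show "eq interval = (=)" by (simp add: interval_def mon_ord_def)
  fix p q assume pq: "p \<in> carrier interval" "q \<in> carrier interval"
  have "le interval p q \<longleftrightarrow> (\<exists>r\<in>mon. q = p \<otimes>\<^bsub>G\<^esub> r)" by (simp add: interval_def mon_ord_def)
  also have "\<dots> \<longleftrightarrow> P0.ext\<^sup>*\<^sup>* p q" using le_iff pq unfolding carrier_interval by blast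
  also have "P0.ext = step_rel" unfolding P0.ext_def[abs_def] ..
  finally show "le interval p q \<longleftrightarrow> step_rel\<^sup>*\<^sup>* p q" .
qed

theorem interval_structure:
  "lattice interval" "planar_poset interval" "card (max_chains interval) = m * 2 ^ (m - 2)"
  "rank_gen_fun interval len = 1 + (\<Sum>k=1..m-1. monom (2 * int (m choose k) - 2) k) + monom 1 m"
  "\<And>p q. covers interval p q \<Longrightarrow> len q = len p + 1"
proof -
  interpret P: pencil_poset m X Y len interval by (rule pencil_poset_interval)
  show "lattice interval" by (rule P.lattice_L)
  show "planar_poset interval" by (rule P.planar_L)
  show "card (max_chains interval) = m * 2 ^ (m - 2)" by (rule P.card_max_chains)
  show "rank_gen_fun interval len = 1 + (\<Sum>k=1..m-1. monom (2 * int (m choose k) - 2) k) + monom 1 m"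
    by (rule P.rank_gen_fun_L)
  show "len q = len p + 1" if "covers interval p q" for p q
    using that P.covers_iff P.ext_rk by blast
qed

text \<open>Passes between words as lists of group elements and words as lists of formal letters;
  different letters may denote the same element, such as \<open>x 0\<close> and
  \<open>y 0\<close>.\<close>

lemma word_length:
  "(\<exists>ws. set ws \<subseteq> x ` {..<m} \<union> y ` {..<m} \<and> length ws = k \<and> foldr (\<lambda>a b. a \<otimes>\<^bsub>G\<^esub> b) ws \<one>\<^bsub>G\<^esub> = p) \<longleftrightarrow>
   (\<exists>w. valid w \<and> length w = k \<and> val w = p)"
proof
  assume "\<exists>ws. set ws \<subseteq> x ` {..<m} \<union> y ` {..<m} \<and> length ws = k \<and> foldr (\<lambda>a b. a \<otimes>\<^bsub>G\<^esub> b) ws \<one>\<^bsub>G\<^esub> = p"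
  then obtain ws where ws: "set ws \<subseteq> letter ` {q. snd q < m}" "length ws = k" "list_prod G ws = p"
    unfolding gen_letter list_prod_def by blast
  define f where "f g = (SOME q. snd q < m \<and> g = letter q)" for g
  have f: "snd (f g) < m \<and> g = letter (f g)" if "g \<in> set ws" for g
  proof -
    have "\<exists>q. snd q < m \<and> g = letter q" using that ws(1) by blast
    thus ?thesis unfolding f_def by (rule someI_ex)
  qed
  have "map letter (map f ws) = ws" unfolding map_map by (rule map_idI) (use f in auto)
  hence "val (map f ws) = p" using ws(3) by (simp add: val_def)
  moreover have "valid (map f ws)" using f by (auto simp: valid_def)
  ultimately show "\<exists>w. valid w \<and> length w = k \<and> val w = p" using ws(2) by (intro exI[of _ "map f ws"]) simp
next
  assume "\<exists>w. valid w \<and> length w = k \<and> val w = p"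
  then obtain w where w: "valid w" "length w = k" "val w = p" by blast
  have "set (map letter w) \<subseteq> letter ` {q. snd q < m}" using w(1) by (auto simp: valid_def)
  thus "\<exists>ws. set ws \<subseteq> x ` {..<m} \<union> y ` {..<m} \<and> length ws = k \<and> foldr (\<lambda>a b. a \<otimes>\<^bsub>G\<^esub> b) ws \<one>\<^bsub>G\<^esub> = p"
    unfolding gen_letter using w by (intro exI[of _ "map letter w"]) (simp add: val_def list_prod_def)
qed

lemma word_length_unique: "p \<in> carrier interval \<Longrightarrow> \<exists>!k. \<exists>w. valid w \<and> length w = k \<and> val w = p"
proof -
  assume "p \<in> carrier interval"
  hence "p \<in> mon" by (simp add: interval_def mon_ord_def at_least_at_most_def)
  then obtain w where "valid w" "p = val w" using mon_iff by blast
  moreover have "k = length w" if "\<exists>u. valid u \<and> length u = k \<and> val u = p" for k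
  proof -
    from that obtain u where "valid u" "length u = k" "val u = p" by blast
    thus ?thesis using val_length[of u w] \<open>valid w\<close> \<open>p = val w\<close> by simp
  qed
  ultimately show ?thesis by (intro ex1I[of _ "length w"]) blast+
qed

end

section \<open>Central arrangements of rank two\<close>

text \<open>Normals are scaled to have inner product 1 with the point \<open>b\<close> of the base
  region. They then lie on an affine line in the two-dimensional orthogonal complement of
  \<open>\<Inter>H\<close>, and the parameter \<open>c\<close> along this line lists the hyperplanes
  in their cyclic order, beginning next to the base region.\<close>

lemma rank2_normals:
  fixes H :: "'a::euclidean_space set set"
  assumes H: "central_arrangement H" "arrangement_rank H = 2" and b: "b \<notin> \<Union>H"
    and card: "card H = m" "2 \<le> m"
  obtains u v :: 'a and c :: "nat \<Rightarrow> real" where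
    "H = (\<lambda>j. {x. (u + c j *\<^sub>R v) \<bullet> x = 0}) ` {..<m}"
    "\<And>i j. i < j \<Longrightarrow> j < m \<Longrightarrow> c i < c j" "u \<bullet> b = 1" "v \<bullet> b = 0" "v \<noteq> 0"
proof -
  have fin: "finite H" using H unfolding central_arrangement_def by blast
  have "\<exists>a. h = {x. a \<bullet> x = 0} \<and> a \<bullet> b = 1" if h: "h \<in> H" for h
  proof -
    obtain a where a: "a \<noteq> 0" "h = {x. a \<bullet> x = 0}" using H h unfolding central_arrangement_def by blast
    have ab: "a \<bullet> b \<noteq> 0" using b h a by auto
    let ?a = "(1 / (a \<bullet> b)) *\<^sub>R a"
    have "h = {x. ?a \<bullet> x = 0} \<and> ?a \<bullet> b = 1" using a ab by simp
    thus ?thesis by blast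
  qed
  then obtain a where a: "\<And>h. h \<in> H \<Longrightarrow> h = {x. a h \<bullet> x = 0}" "\<And>h. h \<in> H \<Longrightarrow> a h \<bullet> b = 1" by metis
  have inj_a: "inj_on a H" using a(1) by (metis inj_onI)
  obtain h0 where h0: "h0 \<in> H" using card by fastforce
  obtain h1 where h1: "h1 \<in> H" "h1 \<noteq> h0"
  proof -
    have "\<not> H \<subseteq> {h0}" using card card_mono[of "{h0}" H] by auto
    thus ?thesis using that by blast
  qed
  let ?L = "\<Inter>H"
  let ?W = "{y \<in> UNIV. \<forall>x\<in>?L. orthogonal x y}"
  have "subspace h" if "h \<in> H" for h
    using a(1)[OF that] subspace_hyperplane by metis
  hence subL: "subspace ?L" by (intro subspace_Inter ballI)
  have "dim ?W + dim ?L = dim (UNIV :: 'a set)"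
    by (rule dim_subspace_orthogonal_to_vectors) (use subL in auto)
  hence dimW: "dim ?W = 2" using H(2) unfolding arrangement_rank_def by (simp add: dim_UNIV) 
  have subW: "subspace ?W" by (auto simp: subspace_def orthogonal_def inner_add_right)
  have aW: "a h \<in> ?W" if "h \<in> H" for h
    using that a(1)[OF that] by (auto simp: orthogonal_def inner_commute)
  let ?p = "a h0" and ?q = "a h1"
  have pq: "?p \<noteq> ?q" using inj_a h0 h1 by (auto dest: inj_onD)
  have ind: "independent {?p, ?q}"
  proof -
    have "?p \<noteq> 0" "?q \<noteq> 0" using a(2) h0 h1 by fastforce+
    moreover have "?q \<notin> span {?p}"
    proof
      assume "?q \<in> span {?p}"
      then obtain k where k: "?q = k *\<^sub>R ?p" by (auto simp: span_singleton)
      hence "k = 1" using a(2)[OF h0] a(2)[OF h1(1)] by (metis inner_scaleR_left mult.right_neutral)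
      thus False using k pq by simp
    qed
    ultimately show ?thesis by (simp add: independent_insert insert_commute[of ?p ?q])
  qed
  have "span {?p, ?q} = ?W"
  proof (rule subspace_dim_equal)
    show "span {?p, ?q} \<subseteq> ?W" by (rule span_minimal) (use aW h0 h1 subW in auto)
    have "dim (span {?p, ?q}) = card {?p, ?q}" using ind by (simp add: dim_eq_card_independent)
    thus "dim ?W \<le> dim (span {?p, ?q})" using pq dimW by simp
  qed (use subW in auto)
  hence rep: "\<exists>\<beta>. a h = ?p + \<beta> *\<^sub>R (?q - ?p)" if h: "h \<in> H" for h
  proof -
    have "a h \<in> span {?p, ?q}" using aW[OF h] \<open>span {?p, ?q} = ?W\<close> by blast
    then obtain k l where kl: "a h = k *\<^sub>R ?p + l *\<^sub>R ?q" by (auto simp: span_insert span_singleton algebra_simps)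
    have "k + l = 1"
      using a(2)[OF h] a(2)[OF h0] a(2)[OF h1(1)] unfolding kl by (simp add: inner_add_left)
    hence k: "k = 1 - l" by simp
    show ?thesis unfolding kl k by (intro exI[of _ l]) (simp add: algebra_simps)
  qed
  then obtain \<beta> where \<beta>: "\<And>h. h \<in> H \<Longrightarrow> a h = ?p + \<beta> h *\<^sub>R (?q - ?p)" by metis
  have inj\<beta>: "inj_on \<beta> H" using inj_a \<beta> by (metis inj_onD inj_onI)
  let ?l = "sorted_list_of_set (\<beta> ` H)"
  have len: "length ?l = m" using card inj\<beta> by (simp add: card_image)
  have setl: "set ?l = \<beta> ` H" using fin by simp
  have H_eq: "H = (\<lambda>j. {x. (?p + (?l ! j) *\<^sub>R (?q - ?p)) \<bullet> x = 0}) ` {..<m}"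
  proof (intro equalityI subsetI)
    fix h assume h: "h \<in> H"
    then obtain j where "j < m" "?l ! j = \<beta> h" using setl len by (metis imageI in_set_conv_nth)
    thus "h \<in> (\<lambda>j. {x. (?p + (?l ! j) *\<^sub>R (?q - ?p)) \<bullet> x = 0}) ` {..<m}"
      using a(1)[OF h] \<beta>[OF h] by (intro image_eqI[of _ _ j]) auto
  next
    fix g assume "g \<in> (\<lambda>j. {x. (?p + (?l ! j) *\<^sub>R (?q - ?p)) \<bullet> x = 0}) ` {..<m}"
    then obtain j where j: "j < m" "g = {x. (?p + (?l ! j) *\<^sub>R (?q - ?p)) \<bullet> x = 0}" by blast
    have "?l ! j \<in> \<beta> ` H" using j len setl nth_mem by metis
    then obtain h where h: "h \<in> H" "?l ! j = \<beta> h" by blast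
    thus "g \<in> H" using j a(1)[OF h(1)] \<beta>[OF h(1)] by simp
  qed
  have "sorted_wrt (<) ?l" by simp
  hence mono: "?l ! i < ?l ! j" if "i < j" "j < m" for i j
    using that len by (simp add: sorted_wrt_nth_less)
  show ?thesis
    by (rule that[OF H_eq mono]) (use a(2) h0 h1 pq in \<open>auto simp: inner_diff_left\<close>)
qed

text \<open>The regions are indexed by the integers modulo \<open>2 m\<close> in cyclic order; \<open>neg i j\<close> says that the
  \<open>j\<close>-th hyperplane separates the \<open>i\<close>-th region from the base region.\<close>

locale rank2_arrangement =
  fixes H :: "'a::euclidean_space set set" and B :: "'a set" and m :: nat
    and u v b :: 'a and c :: "nat \<Rightarrow> real"
  assumes m3: "3 \<le> m"
    and H_eq: "H = (\<lambda>j. {x. (u + c j *\<^sub>R v) \<bullet> x = 0}) ` {..<m}"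
    and c_mono: "\<And>i j. i < j \<Longrightarrow> j < m \<Longrightarrow> c i < c j"
    and ub: "u \<bullet> b = 1" "v \<bullet> b = 0" "v \<noteq> 0"
    and B: "B \<in> regions H" "b \<in> B"
    and rank2: "arrangement_rank H = 2"
begin

definition n where "n j = u + c j *\<^sub>R v"
definition h where "h j = {x. n j \<bullet> x = 0}"

definition neg :: "int \<Rightarrow> nat \<Rightarrow> bool" where
  "neg i j \<longleftrightarrow> int j < i mod (2 * int m) \<and> i mod (2 * int m) \<le> int j + int m"

definition R :: "int \<Rightarrow> 'a set" where
  "R i = {x. \<forall>j<m. if neg i j then n j \<bullet> x < 0 else n j \<bullet> x > 0}"

lemma H_h: "H = h ` {..<m}"
  unfolding H_eq h_def n_def ..

lemma nb: "n j \<bullet> b = 1"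
  by (simp add: n_def inner_add_left ub)

lemma inj_h: "inj_on h {..<m}"
proof (rule inj_onI)
  have *: "h i \<noteq> h j" if "i < j" "j < m" for i j
  proof
    assume e: "h i = h j"
    let ?x = "v - (n i \<bullet> v) *\<^sub>R b"
    have "n i \<bullet> ?x = 0" by (simp add: inner_diff_right nb)
    hence "n j \<bullet> ?x = 0" using e unfolding h_def by blast
    hence "n j \<bullet> v = n i \<bullet> v" by (simp add: inner_diff_right nb)
    hence "(c j - c i) * (v \<bullet> v) = 0" by (simp add: n_def inner_add_left algebra_simps)
    thus False using c_mono[OF that] ub(3) by simp
  qed
  fix i j assume "i \<in> {..<m}" "j \<in> {..<m}" "h i = h j"
  thus "i = j" using *[of i j] *[of j i] by (metis lessThan_iff linorder_neqE_nat)
qed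

lemma mpos: "0 < 2 * int m" using m3 by simp

lemma neg_mod: "neg (i mod (2 * int m)) j = neg i j"
  by (simp add: neg_def)

lemma neg_period: "neg (i + 2 * int m * k) j = neg i j"
  by (simp add: neg_def)

lemma R_mod: "R (i mod (2 * int m)) = R i"
  by (simp add: R_def neg_mod)

lemma R_period: "R (i + 2 * int m * k) = R i"
  by (simp add: R_def neg_period)

lemma add_mod_cases:
  fixes i d M :: int
  assumes "0 \<le> d" "d < M"
  shows "(i + d) mod M = (if i mod M + d < M then i mod M + d else i mod M + d - M)"
proof -
  have M: "0 < M" using assms by simp
  have r: "0 \<le> i mod M" "i mod M < M" using M by simp_all
  have "(i + d) mod M = (i mod M + d) mod M" by (simp add: mod_simps)
  also have "\<dots> = (if i mod M + d < M then i mod M + d else i mod M + d - M)"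
  proof (cases "i mod M + d < M")
    case False
    have "(i mod M + d) mod M = (i mod M + d - M) mod M" by simp
    also have "\<dots> = i mod M + d - M" by (rule mod_pos_pos_trivial) (use False r assms in linarith)+
    finally show ?thesis using False by simp
  qed (use r assms in simp)
  finally show ?thesis .
qed

lemma mod_bounds: "0 \<le> i mod (2 * int m)" "i mod (2 * int m) < 2 * int m"
  using mpos by simp_all

lemma neg_opposite: "j < m \<Longrightarrow> neg (i + int m) j \<longleftrightarrow> \<not> neg i j"
proof -
  assume j: "j < m"
  define r where "r = i mod (2 * int m)"
  have r: "0 \<le> r" "r < 2 * int m" using mod_bounds unfolding r_def by auto
  have e: "(i + int m) mod (2 * int m) = (if r + int m < 2 * int m then r + int m else r + int m - 2 * int m)"
    using add_mod_cases[of "int m" "2 * int m" i] m3 unfolding r_def by simp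
  show ?thesis unfolding neg_def e r_def[symmetric] using r j by (auto split: if_splits)
qed

text \<open>Passing from region \<open>i\<close> to region \<open>i + 1\<close> crosses just the
  hyperplane with number \<open>i mod m\<close>, and within half a turn none is crossed
  twice.\<close>

lemma neg_change:
  assumes "0 \<le> d" "d \<le> int m" "j < m"
  shows "neg i j \<noteq> neg (i + d) j \<longleftrightarrow> (\<exists>e. 0 \<le> e \<and> e < d \<and> (i + e) mod int m = int j)"
proof -
  define r where "r = i mod (2 * int m)"
  have r: "0 \<le> r" "r < 2 * int m" using mod_bounds unfolding r_def by auto
  have mm: "(i + e) mod int m = (r + e) mod int m" for e
  proof -
    have "(r + e) mod int m = ((i mod (2 * int m)) mod int m + e) mod int m" unfolding r_def by (simp add: mod_simps)
    also have "(i mod (2 * int m)) mod int m = i mod int m" by (simp add: mod_mod_cancel)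
    finally show ?thesis by (simp add: mod_simps)
  qed
  have 1: "(r + e) mod int m = int j \<longleftrightarrow> r + e = int j \<or> r + e = int j + int m \<or> r + e = int j + 2 * int m"
    if "0 \<le> e" "e < d" for e
  proof -
    have lt: "0 \<le> r + e" "r + e < 3 * int m" using r that assms by auto
    show ?thesis
    proof
      assume e: "(r + e) mod int m = int j"
      have "r + e = int m * ((r + e) div int m) + int j" using e by (metis mult_div_mod_eq)
      moreover define q where "q = (r + e) div int m"
      ultimately have q: "r + e = int m * q + int j" by simp
      have "0 \<le> q" unfolding q_def using lt using m3 by (simp add: pos_imp_zdiv_nonneg_iff)
      moreover have "q < 3"
      proof (rule ccontr)
        assume "\<not> q < 3"
        hence "int m * 3 \<le> int m * q" by (intro mult_left_mono) auto
        thus False using q lt(2) by linarith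
      qed
      ultimately have "q = 0 \<or> q = 1 \<or> q = 2" by linarith
      thus "r + e = int j \<or> r + e = int j + int m \<or> r + e = int j + 2 * int m" using q by auto
    next
      assume "r + e = int j \<or> r + e = int j + int m \<or> r + e = int j + 2 * int m"
      thus "(r + e) mod int m = int j" using assms(3) by auto
    qed
  qed
  have "(\<exists>e. 0 \<le> e \<and> e < d \<and> (i + e) mod int m = int j) \<longleftrightarrow>
     (r \<le> int j \<and> int j < r + d) \<or> (r \<le> int j + int m \<and> int j + int m < r + d) \<or>
     (r \<le> int j + 2 * int m \<and> int j + 2 * int m < r + d)" (is "?l \<longleftrightarrow> ?r")
  proof
    assume ?l
    then obtain e where "0 \<le> e" "e < d" "r + e = int j \<or> r + e = int j + int m \<or> r + e = int j + 2 * int m"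
      using mm 1 by auto
    thus ?r by auto
  next
    have *: "?l" if "r \<le> t" "t < r + d" "t = int j \<or> t = int j + int m \<or> t = int j + 2 * int m" for t
    proof -
      have "(i + (t - r)) mod int m = int j" using mm[of "t - r"] 1[of "t - r"] that by simp
      thus ?l using that by (intro exI[of _ "t - r"]) auto
    qed
    assume ?r
    thus ?l using * by blast
  qed
  also have "\<dots> \<longleftrightarrow> neg i j \<noteq> neg (i + d) j"
  proof -
    have e: "(i + d) mod (2 * int m) = (if r + d < 2 * int m then r + d else r + d - 2 * int m)"
      using add_mod_cases[of d "2 * int m" i] m3 assms unfolding r_def by simp
    show ?thesis unfolding neg_def e r_def[symmetric] using r assms by (auto split: if_splits)
  qed
  finally show ?thesis by blast
qed


section \<open>The regions as a cycle of length 2m\<close>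

lemma exists_d: obtains d where "u \<bullet> d = 0" "v \<bullet> d = 1"
proof -
  define d0 where "d0 = (1 / (v \<bullet> v)) *\<^sub>R v"
  have v1: "v \<bullet> d0 = 1" using ub(3) by (simp add: d0_def)
  show ?thesis
    by (rule that[of "d0 - (u \<bullet> d0) *\<^sub>R b"]) (simp_all add: inner_diff_right ub v1)
qed

lemma R_nonempty: "R i \<noteq> {}"
proof -
  define r where "r = i mod (2 * int m)"
  have r: "0 \<le> r" "r < 2 * int m" using mod_bounds unfolding r_def by auto
  have neg: "neg i j \<longleftrightarrow> int j < r \<and> r \<le> int j + int m" for j
    unfolding neg_def r_def ..
  obtain d where d: "u \<bullet> d = 0" "v \<bullet> d = 1" by (rule exists_d)
  \<comment> \<open>At \<open>d - t *\<^sub>R b\<close> the \<open>j\<close>-th normal takes the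
    value \<open>c j - t\<close>. The midpoint of \<open>c (k - 1)\<close> and \<open>c k\<close> as
    \<open>t\<close> makes exactly the first \<open>k\<close> signs negative. The points
    \<open>b\<close>, these points, and the antipodes of all of them serve all regions.\<close>
  define pt where "pt k = d - ((c (k - 1) + c k) / 2) *\<^sub>R b" for k
  have pt: "n j \<bullet> pt k = c j - (c (k - 1) + c k) / 2" for j k
    by (simp add: pt_def n_def inner_add_left inner_diff_right ub d)
  have pt_neg: "n j \<bullet> pt k < 0" if "j < k" "k < m" for j k
  proof -
    have "c j \<le> c (k - 1)"
    proof (cases "j = k - 1")
      case False
      hence "j < k - 1" "k - 1 < m" using that by linarith+
      thus ?thesis using c_mono less_imp_le by blast
    qed simp
    moreover have "c (k - 1) < c k" using that c_mono by simp
    ultimately show ?thesis unfolding pt by simp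
  qed
  have pt_pos: "n j \<bullet> pt k > 0" if "0 < k" "k \<le> j" "j < m" for j k
  proof -
    have "c k \<le> c j" using c_mono[of k j] that by (cases "j = k") auto
    moreover have "c (k - 1) < c k" using that c_mono by simp
    ultimately show ?thesis unfolding pt by simp
  qed
  consider "r = 0" | "0 < r" "r < int m" | "r = int m" | "int m < r" using r by linarith
  thus ?thesis
  proof cases
    case 1
    hence "b \<in> R i" unfolding R_def neg by (simp add: nb)
    thus ?thesis by blast
  next
    case 2
    have "pt (nat r) \<in> R i" unfolding R_def neg using pt_neg[of _ "nat r"] pt_pos[of "nat r"] 2 by auto
    thus ?thesis by blast
  next
    case 3
    hence "- b \<in> R i" unfolding R_def neg by (simp add: nb)
    thus ?thesis by blast
  next
    case 4
    have "- pt (nat (r - int m)) \<in> R i"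
      unfolding R_def neg using pt_neg[of _ "nat (r - int m)"] pt_pos[of "nat (r - int m)"] 4 r by auto
    thus ?thesis by blast
  qed
qed

lemma down_closed_initial:
  assumes "\<And>i j. i < j \<Longrightarrow> j < m \<Longrightarrow> P j \<Longrightarrow> P i"
  obtains k where "k \<le> m" "\<And>j. j < m \<Longrightarrow> P j \<longleftrightarrow> j < k"
proof (cases "\<exists>l. l < m \<and> \<not> P l")
  case True
  define l where "l = (LEAST l. l < m \<and> \<not> P l)"
  have l: "l < m \<and> \<not> P l" unfolding l_def by (rule LeastI_ex[OF True])
  have "P j" if "j < l" for j
    using not_less_Least[of j "\<lambda>l. l < m \<and> \<not> P l"] that l unfolding l_def[symmetric] by auto
  moreover have "\<not> P j" if "\<not> j < l" "j < m" for j
    using assms[of l j] that l by (cases "j = l") auto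
  ultimately show ?thesis using that[of l] l by (meson less_imp_le)
next
  case False thus ?thesis using that[of m] by blast
qed

lemma R_I: "(\<And>j. j < m \<Longrightarrow> n j \<bullet> x \<noteq> 0) \<Longrightarrow> (\<And>j. j < m \<Longrightarrow> neg i j \<longleftrightarrow> n j \<bullet> x < 0) \<Longrightarrow> x \<in> R i"
  unfolding R_def by (auto simp: not_less less_le)

lemma neg_int:
  assumes "k < 2 * m" shows "neg (int k) j \<longleftrightarrow> j < k \<and> k \<le> j + m"
proof -
  have "int k mod (2 * int m) = int k" using assms by simp
  thus ?thesis unfolding neg_def by auto
qed

text \<open>The values \<open>n j \<bullet> x\<close> are monotone in \<open>j\<close>, in a
  direction given by the sign of \<open>v \<bullet> x\<close>. So the negative ones belong to an
  initial or a final segment of indices, and these are the sign patterns of the cycle.\<close>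

lemma R_cover:
  assumes "x \<notin> \<Union>H" shows "\<exists>i. x \<in> R i"
proof -
  have nz: "n j \<bullet> x \<noteq> 0" if "j < m" for j using assms that unfolding H_h h_def by blast
  have nx: "n j \<bullet> x = u \<bullet> x + c j * (v \<bullet> x)" for j by (simp add: n_def inner_add_left)
  let ?t = "v \<bullet> x"
  consider "?t \<ge> 0" | "?t < 0" by linarith
  thus ?thesis
  proof cases
    case 1
    have "n i \<bullet> x < 0" if "i < j" "j < m" "n j \<bullet> x < 0" for i j
    proof -
      have "c i * ?t \<le> c j * ?t" using c_mono[OF that(1,2)] 1 by (intro mult_right_mono) auto
      thus ?thesis using that(3) unfolding nx by linarith
    qed
    then obtain k where k: "k \<le> m" "\<And>j. j < m \<Longrightarrow> n j \<bullet> x < 0 \<longleftrightarrow> j < k"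
      using down_closed_initial[of "\<lambda>j. n j \<bullet> x < 0"] by blast
    have "x \<in> R (int k)"
    proof (rule R_I[OF nz])
      fix j assume "j < m"
      thus "neg (int k) j \<longleftrightarrow> n j \<bullet> x < 0" using neg_int[of k j] k m3 by simp
    qed
    thus ?thesis by blast
  next
    case 2
    have "n i \<bullet> x > 0" if "i < j" "j < m" "n j \<bullet> x > 0" for i j
    proof -
      have "c j * ?t \<le> c i * ?t" using c_mono[OF that(1,2)] 2 by (intro mult_right_mono_neg) auto
      thus ?thesis using that(3) unfolding nx by linarith
    qed
    then obtain k where k: "k \<le> m" "\<And>j. j < m \<Longrightarrow> n j \<bullet> x > 0 \<longleftrightarrow> j < k"
      using down_closed_initial[of "\<lambda>j. n j \<bullet> x > 0"] by blast
    have k': "n j \<bullet> x < 0 \<longleftrightarrow> k \<le> j" if "j < m" for j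
      using k(2)[OF that] nz[OF that] by linarith
    show ?thesis
    proof (cases "k = m")
      case True
      have "x \<in> R (int 0)"
      proof (rule R_I[OF nz])
        fix j assume "j < m"
        thus "neg (int 0) j \<longleftrightarrow> n j \<bullet> x < 0" using neg_int[of 0 j] k' True m3 by simp
      qed
      thus ?thesis by blast
    next
      case False
      have "x \<in> R (int (k + m))"
      proof (rule R_I[OF nz])
        fix j assume "j < m"
        thus "neg (int (k + m)) j \<longleftrightarrow> n j \<bullet> x < 0" using neg_int[of "k + m" j] k(1) k' False by auto
      qed
      thus ?thesis by blast
    qed
  qed
qed

lemma R_sub: "R i \<subseteq> - \<Union>H"
proof
  fix x assume x: "x \<in> R i"
  have "n j \<bullet> x \<noteq> 0" if "j < m" for j
    using x that unfolding R_def by (cases "neg i j") fastforce+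
  thus "x \<in> - \<Union>H" unfolding H_h h_def by blast
qed

lemma convex_R: "convex (R i)"
proof -
  have "R i = (\<Inter>j\<in>{..<m}. if neg i j then {x. n j \<bullet> x < 0} else {x. n j \<bullet> x > 0})"
    unfolding R_def by (auto split: if_splits)
  also have "convex \<dots>"
    by (intro convex_INT) (auto simp: convex_halfspace_lt convex_halfspace_gt)
  finally show ?thesis .
qed

lemma neg_of_R: "x \<in> R i \<Longrightarrow> j < m \<Longrightarrow> neg i j \<longleftrightarrow> n j \<bullet> x < 0"
  unfolding R_def by (cases "neg i j") fastforce+

lemma connected_sign:
  assumes "connected C" "C \<subseteq> - h j" "x \<in> C" "y \<in> C" "n j \<bullet> x < 0" shows "n j \<bullet> y < 0"
proof (rule ccontr)
  assume y: "\<not> n j \<bullet> y < 0"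
  have con: "connected ((\<lambda>x. n j \<bullet> x) ` C)"
    by (intro connected_continuous_image assms continuous_intros)
  have "0 \<in> (\<lambda>x. n j \<bullet> x) ` C"
    by (rule connectedD_interval[OF con, of "n j \<bullet> x" "n j \<bullet> y"]) (use assms y in \<open>simp_all add: imageI\<close>)
  thus False using assms(2) unfolding h_def by auto
qed

text \<open>A set given by strict signs is convex, hence connected; conversely a linear functional
  keeps its sign on a connected set that avoids its kernel.\<close>

lemma component_R: "x \<in> R i \<Longrightarrow> connected_component_set (- \<Union>H) x = R i"
proof
  assume x: "x \<in> R i"
  show "R i \<subseteq> connected_component_set (- \<Union>H) x"
    by (rule connected_component_maximal[OF x convex_connected[OF convex_R] R_sub])
  let ?C = "connected_component_set (- \<Union>H) x"
  have xC: "x \<in> ?C" using x R_sub by (simp add: subset_iff)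
  have con: "connected ?C" by (rule connected_connected_component)
  show "?C \<subseteq> R i"
  proof
    fix y assume y: "y \<in> ?C"
    have sub: "?C \<subseteq> - h j" if "j < m" for j
      using connected_component_subset[of "- \<Union>H" x] that unfolding H_h by blast
    have "neg i j \<longleftrightarrow> n j \<bullet> y < 0" if "j < m" for j
      using connected_sign[OF con sub[OF that] xC y] connected_sign[OF con sub[OF that] y xC] neg_of_R[OF x that] by blast
    moreover have "n j \<bullet> y \<noteq> 0" if "j < m" for j using sub[OF that] y unfolding h_def by auto
    ultimately show "y \<in> R i" unfolding R_def by (auto simp: not_less less_le)
  qed
qed

lemma regions_R: "regions H = range R"
proof (intro equalityI subsetI)
  fix C assume "C \<in> regions H"
  then obtain x where x: "x \<in> - \<Union>H" "C = connected_component_set (- \<Union>H) x"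
    unfolding regions_def components_def by blast
  then obtain i where "x \<in> R i" using R_cover by blast
  thus "C \<in> range R" using component_R x by blast
next
  fix C assume "C \<in> range R"
  then obtain i where i: "C = R i" by blast
  obtain x where x: "x \<in> R i" using R_nonempty by blast
  hence "x \<in> - \<Union>H" using R_sub by blast
  thus "C \<in> regions H" unfolding regions_def components_def using component_R[OF x] i by blast
qed


text \<open>A nonzero shift by at most half a turn changes the sign for the hyperplane that is
  crossed first. A longer shift is replaced by the complementary arc back to the start.\<close>

lemma neg_eq_imp:
  assumes "0 \<le> d" "d < 2 * int m" "\<And>j. j < m \<Longrightarrow> neg i j \<longleftrightarrow> neg (i + d) j" shows "d = 0"
proof (cases "d \<le> int m")
  case True
  show ?thesis
  proof (rule ccontr)
    assume "d \<noteq> 0"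
    define j where "j = nat (i mod int m)"
    have "j < m" "i mod int m = int j" using m3 by (auto simp: j_def nat_less_iff)
    thus False using neg_change[OF assms(1) True \<open>j < m\<close>, of i] assms(3)[OF \<open>j < m\<close>] \<open>d \<noteq> 0\<close> assms(1)
      by (metis add.right_neutral le_less order_refl)
  qed
next
  case False
  define j where "j = nat ((i + d) mod int m)"
  have j: "j < m" "(i + d) mod int m = int j" using m3 by (auto simp: j_def nat_less_iff)
  have "neg (i + d) j \<noteq> neg (i + d + (2 * int m - d)) j"
  proof -
    have "0 \<le> 2 * int m - d" "2 * int m - d \<le> int m" "0 < 2 * int m - d" using False assms(1,2) by auto
    moreover have "(i + d + 0) mod int m = int j" using j(2) by simp
    ultimately show ?thesis using neg_change[of "2 * int m - d" j "i + d"] j(1) by blast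
  qed
  moreover have "neg (i + d + (2 * int m - d)) j = neg i j" using neg_period[of i 1 j] by simp
  ultimately show ?thesis using assms(3)[OF j(1)] by simp
qed

lemma R_eq_iff: "R i = R k \<longleftrightarrow> i mod (2 * int m) = k mod (2 * int m)"
proof
  assume e: "R i = R k"
  let ?d = "(k - i) mod (2 * int m)"
  obtain x where x: "x \<in> R i" using R_nonempty by blast
  have "neg (i + ?d) j = neg k j" for j
    using neg_mod[of "i + ?d" j] neg_mod[of k j] by (simp add: mod_simps)
  hence "neg i j \<longleftrightarrow> neg (i + ?d) j" if "j < m" for j
    using neg_of_R[OF x that] neg_of_R[of x k j] x e that by simp
  hence "?d = 0" using mpos by (intro neg_eq_imp) auto
  thus "i mod (2 * int m) = k mod (2 * int m)" by (simp add: mod_eq_dvd_iff dvd_diff_commute mod_eq_0_iff_dvd)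
next
  assume "i mod (2 * int m) = k mod (2 * int m)"
  thus "R i = R k" using R_mod by metis
qed

lemma separates_R:
  assumes j: "j < m" shows "separates (h j) (R i) (R k) \<longleftrightarrow> neg i j \<noteq> neg k j"
proof
  assume "separates (h j) (R i) (R k)"
  then obtain a where a: "h j = {x. a \<bullet> x = 0}" "\<forall>x\<in>R i. a \<bullet> x < 0" "\<forall>x\<in>R k. a \<bullet> x > 0"
    unfolding separates_def by blast
  obtain p where p: "p \<in> R i" using R_nonempty by blast
  obtain q where q: "q \<in> R k" using R_nonempty by blast
  show "neg i j \<noteq> neg k j"
  proof
    assume e: "neg i j = neg k j"
    \<comment> \<open>If both regions lay on the same side \<open>D\<close> of the hyperplane, the
      separating functional \<open>a\<close> would change sign on the connected set \<open>D\<close>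
      and vanish there, at a point of \<open>h j\<close>.\<close>
    define D where "D = (if neg i j then {x. n j \<bullet> x < 0} else {x. n j \<bullet> x > 0})"
    have "convex D" by (simp add: D_def convex_halfspace_lt convex_halfspace_gt)
    have "p \<in> D" "q \<in> D" using p q j e unfolding D_def R_def by auto
    have con: "connected ((\<lambda>x. a \<bullet> x) ` D)"
      by (intro connected_continuous_image convex_connected \<open>convex D\<close> continuous_intros)
    have "0 \<in> (\<lambda>x. a \<bullet> x) ` D"
      by (rule connectedD_interval[OF con, of "a \<bullet> p" "a \<bullet> q"])
        (use a p q \<open>p \<in> D\<close> \<open>q \<in> D\<close> in \<open>simp_all add: imageI less_imp_le\<close>)
    then obtain x where "x \<in> D" "x \<in> h j" using a(1) by auto
    thus False unfolding D_def h_def by (auto split: if_splits)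
  qed
next
  assume ne: "neg i j \<noteq> neg k j"
  show "separates (h j) (R i) (R k)"
  proof (cases "neg i j")
    case True
    thus ?thesis unfolding separates_def using ne j by (intro exI[of _ "n j"]) (auto simp: h_def R_def)
  next
    case False
    hence "\<forall>x\<in>R i. - n j \<bullet> x < 0" "\<forall>x\<in>R k. - n j \<bullet> x > 0" using ne j unfolding R_def by auto
    moreover have "h j = {x. - n j \<bullet> x = 0}" by (simp add: h_def)
    ultimately show ?thesis unfolding separates_def by blast
  qed
qed

lemma sep_set_R: "sep_set H (R i) (R k) = h ` {j. j < m \<and> neg i j \<noteq> neg k j}"
proof -
  have "sep_set H (R i) (R k) = h ` {j \<in> {..<m}. separates (h j) (R i) (R k)}"
    unfolding sep_set_def H_h by blast
  also have "{j \<in> {..<m}. separates (h j) (R i) (R k)} = {j. j < m \<and> neg i j \<noteq> neg k j}"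
  proof (rule Collect_cong)
    fix j show "j \<in> {..<m} \<and> separates (h j) (R i) (R k) \<longleftrightarrow> j < m \<and> neg i j \<noteq> neg k j"
      by (cases "j < m") (simp_all only: lessThan_iff separates_R simp_thms)
  qed
  finally show ?thesis .
qed

lemma card_sep_set_R: "card (sep_set H (R i) (R k)) = card {j. j < m \<and> neg i j \<noteq> neg k j}"
  unfolding sep_set_R by (rule card_image) (rule inj_on_subset[OF inj_h], auto)

lemma card_sep_set_sym: "card (sep_set H (R i) (R k)) = card (sep_set H (R k) (R i))"
  unfolding card_sep_set_R by metis

lemma card_sep_set_dist:
  assumes "d \<le> m" shows "card (sep_set H (R i) (R (i + int d))) = d"
proof -
  have "{j. j < m \<and> neg i j \<noteq> neg (i + int d) j} = (\<lambda>e. nat ((i + int e) mod int m)) ` {..<d}"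
  proof (intro equalityI subsetI)
    fix j assume j: "j \<in> {j. j < m \<and> neg i j \<noteq> neg (i + int d) j}"
    then obtain e where "0 \<le> e" "e < int d" "(i + e) mod int m = int j"
      using neg_change[of "int d" j i] assms by auto
    thus "j \<in> (\<lambda>e. nat ((i + int e) mod int m)) ` {..<d}" by (intro image_eqI[of _ _ "nat e"]) auto
  next
    fix j assume "j \<in> (\<lambda>e. nat ((i + int e) mod int m)) ` {..<d}"
    then obtain e where e: "e < d" "j = nat ((i + int e) mod int m)" by auto
    hence j: "j < m" "(i + int e) mod int m = int j" using m3 by (auto simp: nat_less_iff)
    have "0 \<le> int e \<and> int e < int d \<and> (i + int e) mod int m = int j" using e(1) j(2) by simp
    hence "neg i j \<noteq> neg (i + int d) j" using neg_change[of "int d" j i] assms j(1) by auto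
    thus "j \<in> {j. j < m \<and> neg i j \<noteq> neg (i + int d) j}" using j(1) by simp
  qed
  moreover have "inj_on (\<lambda>e. nat ((i + int e) mod int m)) {..<d}"
  proof (rule inj_onI)
    fix e f assume ef: "e \<in> {..<d}" "f \<in> {..<d}" "nat ((i + int e) mod int m) = nat ((i + int f) mod int m)"
    hence "(i + int e) mod int m = (i + int f) mod int m" using m3 by (simp add: nat_eq_iff)
    hence "int m dvd (i + int e) - (i + int f)" by (simp add: mod_eq_dvd_iff)
    hence dv: "int m dvd int e - int f" by simp
    have "\<bar>int e - int f\<bar> < int m" using ef assms by auto
    hence "int e - int f = 0" using dv by (metis dvd_imp_le_int linorder_not_less abs_of_nat)
    thus "e = f" by simp
  qed
  ultimately show ?thesis unfolding card_sep_set_R by (simp add: card_image)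
qed

text \<open>The two directions around the cycle. Distance \<open>m\<close> is reached both ways and
  is put under the first alternative.\<close>

lemma R_dist:
  obtains d where "d \<le> m" "R k = R (i + int d)" | d where "0 < d" "d < m" "R k = R (i - int d)"
proof -
  define e where "e = (k - i) mod (2 * int m)"
  have e: "0 \<le> e" "e < 2 * int m" using mpos unfolding e_def by simp_all
  have Re: "R k = R (i + e)" unfolding R_eq_iff e_def by (simp add: mod_simps)
  show ?thesis
  proof (cases "e \<le> int m")
    case True thus ?thesis using that(1)[of "nat e"] Re e by simp
  next
    case False
    have "R (i + e) = R (i - (2 * int m - e))" using R_period[of "i - (2 * int m - e)" 1] by simp
    thus ?thesis using that(2)[of "nat (2 * int m - e)"] Re e False by simp
  qed
qed

lemma card_sep_set_dist_neg:
  assumes "d \<le> m" shows "card (sep_set H (R i) (R (i - int d))) = d"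
  using card_sep_set_dist[OF assms, of "i - int d"] card_sep_set_sym[of i "i - int d"] by simp

lemma sal_edges_R:
  "(R i, R k) \<in> sal_edges H \<longleftrightarrow> R k = R (i + 1) \<or> R k = R (i - 1)"
proof
  assume "(R i, R k) \<in> sal_edges H"
  hence c: "card (sep_set H (R i) (R k)) = 1" unfolding sal_edges_def by blast
  show "R k = R (i + 1) \<or> R k = R (i - 1)"
  proof (rule R_dist[of k i])
    fix d assume d: "d \<le> m" "R k = R (i + int d)"
    hence "d = 1" using c card_sep_set_dist[OF d(1)] by simp
    thus ?thesis using d by simp
  next
    fix d assume d: "0 < d" "d < m" "R k = R (i - int d)"
    hence "d = 1" using c card_sep_set_dist_neg[of d i] by simp
    thus ?thesis using d by simp
  qed
next
  assume "R k = R (i + 1) \<or> R k = R (i - 1)"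
  hence "card (sep_set H (R i) (R k)) = 1"
    using card_sep_set_dist[of 1 i] card_sep_set_dist_neg[of 1 i] m3 by auto
  thus "(R i, R k) \<in> sal_edges H" unfolding sal_edges_def regions_R by blast
qed

lemma sal_edgesE:
  assumes "(D, D') \<in> sal_edges H"
  obtains i where "D = R i" "D' = R (i + 1)" | i where "D = R (i + 1)" "D' = R i"
proof -
  obtain i k where ik: "D = R i" "D' = R k" using assms unfolding sal_edges_def regions_R by auto
  with assms have "R k = R (i + 1) \<or> R k = R (i - 1)" using sal_edges_R by blast
  thus ?thesis using ik that(1)[of i] that(2)[of "i - 1"] by auto
qed

lemma B_R: "B = R 0"
proof -
  have "b \<in> R 0" unfolding R_def neg_def by (simp add: nb)
  moreover obtain i where i: "B = R i" using B(1) unfolding regions_R by blast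
  ultimately show ?thesis using component_R[of b 0] component_R[of b i] B(2) by simp
qed

lemma sep_set_full: "sep_set H (R i) (R k) = H \<longleftrightarrow> R k = R (i + int m)"
proof
  assume e: "sep_set H (R i) (R k) = H"
  have cH: "card H = m" unfolding H_h using card_image[OF inj_h] by simp
  have ce: "card (sep_set H (R i) (R k)) = m" using e cH by simp
  show "R k = R (i + int m)"
  proof (rule R_dist[of k i])
    fix d assume d: "d \<le> m" "R k = R (i + int d)"
    hence "d = m" using ce card_sep_set_dist[OF d(1), of i] by simp
    thus ?thesis using d by simp
  next
    fix d assume d: "0 < d" "d < m" "R k = R (i - int d)"
    hence "d = m" using ce card_sep_set_dist_neg[of d i] by simp
    thus ?thesis using d by simp
  qed
next
  assume "R k = R (i + int m)"
  hence "sep_set H (R i) (R k) = sep_set H (R i) (R (i + int m))" by simp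
  also have "\<dots> = h ` {..<m}" unfolding sep_set_R using neg_opposite by auto
  finally show "sep_set H (R i) (R k) = H" unfolding H_h .
qed

lemma opposite_R: "opposite H (R i) = R (i + int m)"
  unfolding opposite_def by (rule the_equality) (use sep_set_full in \<open>auto simp: regions_R\<close>)


section \<open>The only face of codimension two\<close>

lemma Inter_H: "\<Inter>H = {x. \<forall>j<m. n j \<bullet> x = 0}"
  unfolding H_h h_def by auto

lemma subspace_Inter_H: "subspace (\<Inter>H)"
  unfolding Inter_H subspace_def by (simp add: inner_add_right)

lemma R_affine: "x \<in> R i \<Longrightarrow> 0 < t \<Longrightarrow> w \<in> \<Inter>H \<Longrightarrow> t *\<^sub>R x + w \<in> R i"
  unfolding R_def Inter_H by (auto simp: inner_add_right mult_pos_neg)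

lemma closure_R_affine:
  assumes "x \<in> closure (R i)" "0 < t" "w \<in> \<Inter>H" shows "t *\<^sub>R x + w \<in> closure (R i)"
proof -
  have "(\<lambda>x. t *\<^sub>R x + w) ` closure (R i) \<subseteq> closure ((\<lambda>x. t *\<^sub>R x + w) ` R i)"
    by (rule continuous_image_closure_subset[of UNIV]) (auto intro!: continuous_intros)
  also have "\<dots> \<subseteq> closure (R i)" by (intro closure_mono) (use R_affine assms in blast)
  finally show ?thesis using assms(1) by blast
qed

lemma zero_closure_R: "0 \<in> closure (R i)"
proof -
  obtain x where x: "x \<in> R i" using R_nonempty by blast
  have z: "0 \<in> \<Inter>H" unfolding Inter_H by simp
  have "(\<lambda>t. t *\<^sub>R x) ` closure {0<..} \<subseteq> closure ((\<lambda>t. t *\<^sub>R x) ` {0::real<..})"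
    by (rule continuous_image_closure_subset[of UNIV]) (auto intro!: continuous_intros)
  also have "\<dots> \<subseteq> closure (R i)" by (intro closure_mono) (use R_affine[OF x _ z] in auto)
  finally have *: "(\<lambda>t. t *\<^sub>R x) ` {0..} \<subseteq> closure (R i)" by simp
  have "(\<lambda>t. t *\<^sub>R x) 0 \<in> (\<lambda>t. t *\<^sub>R x) ` {0..}" by (intro imageI) simp
  thus ?thesis using * by auto
qed

lemma Inter_H_closure: "\<Inter>H \<subseteq> closure (R i)"
  using closure_R_affine[OF zero_closure_R, of 1] by auto

lemma closure_R_sign:
  assumes "x \<in> closure (R i)" "j < m" shows "if neg i j then n j \<bullet> x \<le> 0 else n j \<bullet> x \<ge> 0"
proof -
  let ?D = "if neg i j then {x. n j \<bullet> x \<le> 0} else {x. n j \<bullet> x \<ge> 0}"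
  have "closed ?D" by (simp add: closed_halfspace_le closed_halfspace_ge)
  moreover have "R i \<subseteq> ?D" using assms(2) unfolding R_def by (auto intro: less_imp_le)
  ultimately have "closure (R i) \<subseteq> ?D" by (simp add: closure_minimal)
  thus ?thesis using assms(1) by (auto split: if_splits)
qed

lemma Inter_H_face: "\<Inter>H face_of closure (R i)"
  unfolding face_of_def
proof (intro conjI ballI impI)
  show "convex (\<Inter>H)" by (rule subspace_imp_convex[OF subspace_Inter_H])
  fix p q x assume p: "p \<in> closure (R i)" "q \<in> closure (R i)" "x \<in> \<Inter>H" "x \<in> open_segment p q"
  then obtain t where t: "0 < t" "t < 1" "x = (1 - t) *\<^sub>R p + t *\<^sub>R q" by (auto simp: in_segment)
  have "n j \<bullet> p = 0 \<and> n j \<bullet> q = 0" if j: "j < m" for j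
  proof -
    have s: "(1 - t) * (n j \<bullet> p) + t * (n j \<bullet> q) = 0"
      using p(3) j unfolding Inter_H t(3) by (simp add: inner_add_right)
    have "(1 - t) * (n j \<bullet> p) = 0 \<and> t * (n j \<bullet> q) = 0"
    proof (cases "neg i j")
      case True
      hence "n j \<bullet> p \<le> 0" "n j \<bullet> q \<le> 0" using closure_R_sign[OF p(1) j] closure_R_sign[OF p(2) j] by auto
      hence "(1 - t) * (n j \<bullet> p) \<le> 0" "t * (n j \<bullet> q) \<le> 0" using t by (auto intro: mult_nonneg_nonpos)
      thus ?thesis using s by linarith
    next
      case False
      hence "0 \<le> n j \<bullet> p" "0 \<le> n j \<bullet> q" using closure_R_sign[OF p(1) j] closure_R_sign[OF p(2) j] by auto
      hence "0 \<le> (1 - t) * (n j \<bullet> p)" "0 \<le> t * (n j \<bullet> q)" using t by auto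
      thus ?thesis using s by linarith
    qed
    thus ?thesis using t by simp
  qed
  thus "p \<in> \<Inter>H" "q \<in> \<Inter>H" unfolding Inter_H by auto
qed (rule Inter_H_closure)

lemma aff_dim_Inter_H: "aff_dim (\<Inter>H) = int DIM('a) - 2"
proof -
  have "dim (\<Inter>H) + 2 = DIM('a)" using rank2 unfolding arrangement_rank_def by linarith
  thus ?thesis using aff_dim_subspace[OF subspace_Inter_H] by simp
qed

text \<open>A point \<open>x\<close> of the face lies inside the segment from 0 to
  \<open>2 *\<^sub>R x\<close>, so the face contains 0. Each \<open>w\<close> in
  \<open>\<Inter>H\<close> lies at the end of a segment from \<open>w\<close> to \<open>- w\<close>
  with 0 inside, so the face contains \<open>\<Inter>H\<close>. Equality of affine dimensions leaves
  nothing else.\<close>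

lemma codim2_faces_eq: "codim2_faces H = {\<Inter>H}"
proof (intro equalityI subsetI)
  fix F assume F: "F \<in> {\<Inter>H}"
  have "0 \<in> \<Inter>H" unfolding Inter_H by simp
  thus "F \<in> codim2_faces H"
    unfolding codim2_faces_def using F aff_dim_Inter_H Inter_H_face[of 0] regions_R by auto
next
  fix F assume "F \<in> codim2_faces H"
  then obtain i where F: "F \<noteq> {}" "aff_dim F = int DIM('a) - 2" "F face_of closure (R i)"
    unfolding codim2_faces_def regions_R by auto
  have Fs: "F \<subseteq> closure (R i)" using F(3) by (rule face_of_imp_subset)
  have face: "p \<in> F" if "p \<in> closure (R i)" "q \<in> closure (R i)" "x \<in> F" "x \<in> open_segment p q" for p q x
    using F(3) that unfolding face_of_def by blast
  have zero: "0 \<in> \<Inter>H" unfolding Inter_H by simp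
  have "0 \<in> F"
  proof (rule ccontr)
    assume n: "0 \<notin> F"
    obtain x where x: "x \<in> F" using F(1) by blast
    hence xc: "x \<in> closure (R i)" "x \<noteq> 0" using Fs n by auto
    have "2 *\<^sub>R x \<in> closure (R i)" using closure_R_affine[OF xc(1), of 2 0] zero by simp
    moreover have "x \<in> open_segment 0 (2 *\<^sub>R x)" using xc(2) by (auto simp: in_segment intro!: exI[of _ "1/2"])
    ultimately show False using face[OF zero_closure_R _ x] n by blast
  qed
  have LF: "\<Inter>H \<subseteq> F"
  proof
    fix w assume w: "w \<in> \<Inter>H"
    show "w \<in> F"
    proof (cases "w = 0")
      case False
      have "- w \<in> \<Inter>H" using w subspace_neg[OF subspace_Inter_H] by blast
      hence "w \<in> closure (R i)" "- w \<in> closure (R i)" using Inter_H_closure w by blast+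
      moreover have "w \<noteq> - w"
      proof
        assume "w = - w"
        hence "w + w = w + - w" by (rule arg_cong)
        hence "2 *\<^sub>R w = 0" by (simp add: scaleR_2)
        thus False using False by simp
      qed
      hence "midpoint w (- w) \<in> open_segment w (- w)" by simp
      hence "0 \<in> open_segment w (- w)" by (simp add: midpoint_def)
      ultimately show ?thesis using face \<open>0 \<in> F\<close> by blast
    qed (use \<open>0 \<in> F\<close> in simp)
  qed
  have "affine hull \<Inter>H = affine hull F"
    by (rule aff_dim_eq_full_gen[THEN iffD1, OF LF]) (simp add: F(2) aff_dim_Inter_H)
  moreover have "affine hull \<Inter>H = \<Inter>H"
    using subspace_imp_affine[OF subspace_Inter_H] by (simp add: affine_hull_eq)
  ultimately have "F \<subseteq> \<Inter>H" using hull_subset[of F affine] by blast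
  thus "F \<in> {\<Inter>H}" using LF by blast
qed

lemma opposite_about_R: "opposite_about H (\<Inter>H) (R i) = R (i + int m)"
proof -
  have "{g \<in> H. \<Inter>H \<subseteq> g} = H" by blast
  thus ?thesis unfolding opposite_about_def
    by (intro the_equality) (use sep_set_full Inter_H_closure in \<open>auto simp: regions_R\<close>)
qed

lemma sal_cells_iff: "(F, C) \<in> sal_cells H \<longleftrightarrow> F = \<Inter>H \<and> C \<in> range R"
  unfolding sal_cells_def codim2_faces_eq regions_R using Inter_H_closure by auto

section \<open>Galleries in rank two\<close>

text \<open>Galleries are lifted from the cycle of regions to the integers. There a directed edge
  path becomes a walk with unit steps, and a minimal one a monotone walk.\<close>

definition walk :: "int list \<Rightarrow> bool" where
  "walk w \<longleftrightarrow> successively (\<lambda>x y. y = x + 1 \<or> y = x - 1) w"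

lemma walk_simps [simp]: "walk []" "walk [x]" "walk (x # y # w) \<longleftrightarrow> (y = x + 1 \<or> y = x - 1) \<and> walk (y # w)"
  by (auto simp: walk_def)

lemma pos_gallery_walk:
  "g \<noteq> [] \<Longrightarrow> hd g = R i \<Longrightarrow> successively (\<lambda>E E'. (E, E') \<in> sal_edges H) g \<Longrightarrow>
     \<exists>w. w \<noteq> [] \<and> hd w = i \<and> walk w \<and> g = map R w"
proof (induction g arbitrary: i)
  case (Cons C g)
  show ?case
  proof (cases g)
    case Nil thus ?thesis using Cons by (intro exI[of _ "[i]"]) simp
  next
    case (Cons D g')
    have e: "(R i, D) \<in> sal_edges H" "successively (\<lambda>E E'. (E, E') \<in> sal_edges H) g"
      using Cons.prems Cons by auto
    from e(1) obtain k where k: "D = R k" unfolding sal_edges_def regions_R by blast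
    then obtain k' where k': "D = R k'" "k' = i + 1 \<or> k' = i - 1"
      using e(1) sal_edges_R[of i k] by blast
    have "g \<noteq> []" "hd g = R k'" using Cons k' by simp_all
    from Cons.IH[OF this e(2)] obtain w where w: "w \<noteq> []" "hd w = k'" "walk w" "g = map R w" by blast
    then obtain w' where "w = k' # w'" by (cases w) auto
    thus ?thesis using w k'(2) Cons.prems(2) by (intro exI[of _ "i # w"]) auto
  qed
qed simp

lemma walk_last_le: "walk w \<Longrightarrow> w \<noteq> [] \<Longrightarrow> \<bar>last w - hd w\<bar> \<le> int (length w) - 1"
proof (induction w)
  case (Cons x w) thus ?case by (cases w) auto
qed simp

lemma walk_up: "walk w \<Longrightarrow> w \<noteq> [] \<Longrightarrow> last w - hd w = int (length w) - 1 \<Longrightarrow> w = [hd w..last w]"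
proof (induction w)
  case (Cons x w)
  show ?case
  proof (cases w)
    case Nil thus ?thesis by simp
  next
    case (Cons y w')
    hence w: "walk w" "w \<noteq> []" "hd w = y" "y = x + 1 \<or> y = x - 1" using Cons.prems by auto
    have l: "last w - x = int (length w)" using Cons.prems w by simp
    hence y: "y = x + 1" using walk_last_le[OF w(1,2)] w(3,4) by auto
    have "w = [y..last w]" using Cons.IH w l y by simp
    moreover have "[x..last w] = x # [y..last w]" using l w(2) y by (subst upto_rec1) auto
    ultimately show ?thesis using w(2) by simp
  qed
qed simp

lemma walk_down: "walk w \<Longrightarrow> w \<noteq> [] \<Longrightarrow> hd w - last w = int (length w) - 1 \<Longrightarrow> w = rev [last w..hd w]"
proof -
  assume w: "walk w" "w \<noteq> []" "hd w - last w = int (length w) - 1"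
  have "walk (rev w)"
    using w(1) unfolding walk_def successively_rev by (rule successively_mono) auto
  hence "rev w = [hd (rev w)..last (rev w)]" using w by (intro walk_up) (auto simp: hd_rev last_rev)
  thus ?thesis using w(2) by (metis hd_rev last_rev rev_rev_ident)
qed

lemma walk_upto: "walk [i..k]"
proof (induction "nat (k - i)" arbitrary: i)
  case 0 thus ?case by (cases "i = k") auto
next
  case (Suc p)
  hence "walk [i + 1..k]" "i < k" by auto
  moreover have "[i..k] = i # (i + 1) # [i + 2..k]" "[i + 1..k] = (i + 1) # [i + 2..k]"
    using \<open>i < k\<close> by (simp_all add: upto_rec1 add.assoc)
  ultimately show ?case by simp
qed

lemma walk_rev: "walk w \<Longrightarrow> walk (rev w)"
  unfolding walk_def successively_rev by (erule successively_mono) auto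

lemma walk_gallery:
  assumes "walk w" "w \<noteq> []"
  shows "pos_gallery H (R (hd w)) (R (last w)) (map R w)"
proof -
  have "successively (\<lambda>E E'. (E, E') \<in> sal_edges H) (map R w)"
    using assms(1) unfolding walk_def successively_map
    by (rule successively_mono) (use sal_edges_R in auto)
  thus ?thesis unfolding pos_gallery_def using assms(2) by (auto simp: hd_map last_map regions_R)
qed

lemma upto_ends: "i \<le> k \<Longrightarrow> [i..k] \<noteq> []" "i \<le> k \<Longrightarrow> hd [i..k] = i" "i \<le> k \<Longrightarrow> last [i..k] = k"
proof -
  assume ik: "i \<le> k"
  show "[i..k] \<noteq> []" "hd [i..k] = i" using ik by (simp_all add: upto_rec1)
  show "last [i..k] = k" using ik by (subst upto_rec2) simp_all
qed

lemma min_gallery_up: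
  assumes "d \<le> m" shows "min_gallery H (R i) (R (i + int d)) (map R [i..i + int d])"
proof -
  have "hd [i..i + int d] = i" "last [i..i + int d] = i + int d" "[i..i + int d] \<noteq> []"
    by (rule upto_ends, simp)+
  thus ?thesis using walk_gallery[OF walk_upto, of i "i + int d"] card_sep_set_dist[OF assms, of i]
    unfolding min_gallery_def by simp
qed

lemma min_gallery_down:
  assumes "d \<le> m" shows "min_gallery H (R i) (R (i - int d)) (map R (rev [i - int d..i]))"
proof -
  have "i - int d \<le> i" by simp
  from upto_ends[OF this] have "hd (rev [i - int d..i]) = i" "last (rev [i - int d..i]) = i - int d" "[i - int d..i] \<noteq> []"
    by (simp_all only: hd_rev last_rev not_False_eq_True)
  thus ?thesis using walk_gallery[OF walk_rev[OF walk_upto], of "i - int d" i] card_sep_set_dist_neg[OF assms, of i]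
    unfolding min_gallery_def by simp
qed

text \<open>The end of the lifted walk is known modulo \<open>2 * m\<close> and is at most
  \<open>d\<close> away from \<open>i\<close>. So it is \<open>i + d\<close>, or
  \<open>i - m\<close> when \<open>d = m\<close>; in both cases the number of steps equals the
  distance and the walk is monotone.\<close>

lemma min_gallery_cases:
  assumes "min_gallery H (R i) (R k) g" "R k = R (i + int d)" "d \<le> m"
  shows "g = map R [i..i + int d] \<or> d = m \<and> g = map R (rev [i - int m..i])"
proof -
  have len: "length g - 1 = d" "g \<noteq> []"
    using assms card_sep_set_dist[OF assms(3), of i] unfolding min_gallery_def pos_gallery_def by auto
  obtain w where w: "w \<noteq> []" "hd w = i" "walk w" "g = map R w"
    using assms(1) pos_gallery_walk unfolding min_gallery_def pos_gallery_def by blast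
  have lw: "int (length w) - 1 = int d" using len w by (cases w) auto
  have "R (last w) = R (i + int d)"
    using assms(1,2) w unfolding min_gallery_def pos_gallery_def by (simp add: last_map)
  hence "2 * int m dvd last w - (i + int d)" unfolding R_eq_iff by (simp add: mod_eq_dvd_iff)
  then obtain q where q: "last w - (i + int d) = 2 * int m * q" by blast
  have b: "\<bar>last w - i\<bar> \<le> int d" using walk_last_le[OF w(3,1)] w(2) lw by simp
  have "q = 0 \<or> q = - 1"
  proof (rule ccontr)
    assume "\<not> ?thesis"
    hence "q \<ge> 1 \<or> q \<le> - 2" by linarith
    thus False
    proof
      assume "q \<ge> 1"
      hence "2 * int m * 1 \<le> 2 * int m * q" by (intro mult_left_mono) auto
      thus False using q b m3 by linarith
    next
      assume "q \<le> - 2"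
      hence "2 * int m * q \<le> 2 * int m * (- 2)" by (intro mult_left_mono) auto
      thus False using q b m3 assms(3) by linarith
    qed
  qed
  thus ?thesis
  proof
    assume "q = 0"
    hence "last w = i + int d" using q by simp
    thus ?thesis using walk_up[OF w(3,1)] w lw by simp
  next
    assume "q = - 1"
    hence l: "last w = i + int d - 2 * int m" using q by simp
    hence "d = m" using b assms(3) by linarith
    moreover have "w = rev [last w..hd w]" using walk_down[OF w(3,1)] w lw l \<open>d = m\<close> by simp
    ultimately show ?thesis using w l by auto
  qed
qed

lemma min_gallery_cases_neg:
  assumes "min_gallery H (R i) (R k) g" "R k = R (i - int d)" "d < m"
  shows "g = map R (rev [i - int d..i])"
proof -
  have len: "length g - 1 = d" "g \<noteq> []"
    using assms card_sep_set_dist_neg[of d i] unfolding min_gallery_def pos_gallery_def by auto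
  obtain w where w: "w \<noteq> []" "hd w = i" "walk w" "g = map R w"
    using assms(1) pos_gallery_walk unfolding min_gallery_def pos_gallery_def by blast
  have lw: "int (length w) - 1 = int d" using len w by (cases w) auto
  have "R (last w) = R (i - int d)"
    using assms(1,2) w unfolding min_gallery_def pos_gallery_def by (simp add: last_map)
  hence "2 * int m dvd last w - (i - int d)" unfolding R_eq_iff by (simp add: mod_eq_dvd_iff)
  moreover have "\<bar>last w - (i - int d)\<bar> < 2 * int m"
    using walk_last_le[OF w(3,1)] w(2) lw assms(3) by linarith
  ultimately have "last w = i - int d" using zdvd_imp_le[of "2 * int m" "\<bar>last w - (i - int d)\<bar>"] by fastforce
  thus ?thesis using walk_down[OF w(3,1)] w lw by simp
qed

lemma min_gallery_gal:
  "min_gallery H (R i) (R k) (gal H (R i) (R k))"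
proof -
  have "\<exists>g. min_gallery H (R i) (R k) g"
  proof (rule R_dist[of k i])
    fix d assume "d \<le> m" "R k = R (i + int d)"
    thus ?thesis using min_gallery_up[of d i] by auto
  next
    fix d assume "0 < d" "d < m" "R k = R (i - int d)"
    thus ?thesis using min_gallery_down[of d i] by auto
  qed
  thus ?thesis unfolding gal_def by (rule someI_ex)
qed

lemma cell_galleries_R:
  "cell_galleries H (\<Inter>H) (R i) = {map R [i..i + int m], map R (rev [i - int m..i])}"
proof (intro equalityI subsetI)
  fix g assume "g \<in> cell_galleries H (\<Inter>H) (R i)"
  hence "min_gallery H (R i) (R (i + int m)) g" unfolding cell_galleries_def opposite_about_R by blast
  from min_gallery_cases[OF this refl order_refl]
  show "g \<in> {map R [i..i + int m], map R (rev [i - int m..i])}" by blast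
next
  fix g assume "g \<in> {map R [i..i + int m], map R (rev [i - int m..i])}"
  moreover have e: "R (i - int m) = R (i + int m)" using R_period[of "i - int m" 1] by (simp add: add.commute)
  have "min_gallery H (R i) (R (i + int m)) (map R [i..i + int m])"
    "min_gallery H (R i) (R (i + int m)) (map R (rev [i - int m..i]))"
    using min_gallery_up[OF order_refl, of i] min_gallery_down[OF order_refl, of i] unfolding e by blast+
  moreover have "\<forall>D\<in>set (map R w). \<Inter>H \<subseteq> closure D" for w
    using Inter_H_closure by (simp only: set_map) blast
  ultimately show "g \<in> cell_galleries H (\<Inter>H) (R i)"
    unfolding cell_galleries_def opposite_about_R by blast
qed

text \<open>The second regions already differ, because \<open>i + 1\<close> and \<open>i - 1\<close>
  are not congruent modulo \<open>2 * m\<close>.\<close>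

lemma cell_galleries_distinct: "map R [i..i + int m] \<noteq> map R (rev [i - int m..i])"
proof
  assume e: "map R [i..i + int m] = map R (rev [i - int m..i])"
  have "[i..i + int m] = i # (i + 1) # [i + 2..i + int m]" using m3 by (simp add: upto_rec1 add.assoc)
  moreover have "rev [i - int m..i] = i # (i - 1) # rev [i - int m..i - 2]"
    using m3 by (simp add: upto_rec2)
  ultimately have "R (i + 1) = R (i - 1)" using e by simp
  hence "2 * int m dvd (i + 1) - (i - 1)" unfolding R_eq_iff mod_eq_dvd_iff .
  hence "2 * int m \<le> 2" by (intro zdvd_imp_le) auto
  thus False using m3 by simp
qed

lemma cell_gallery_pair_R:
  "fst (cell_gallery_pair H (\<Inter>H) (R i)) \<noteq> snd (cell_gallery_pair H (\<Inter>H) (R i)) \<and>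
   {fst (cell_gallery_pair H (\<Inter>H) (R i)), snd (cell_gallery_pair H (\<Inter>H) (R i))} =
     {map R [i..i + int m], map R (rev [i - int m..i])}"
  unfolding cell_gallery_pair_def cell_galleries_R
  by (rule someI[of _ "(map R [i..i + int m], map R (rev [i - int m..i]))"])
     (use cell_galleries_distinct in simp)

section \<open>Covers in the weak order\<close>

definition N :: "int \<Rightarrow> nat set" where "N i = {j. j < m \<and> neg i j}"

lemma neg_0: "\<not> neg 0 j" by (simp add: neg_def)

lemma weak_le: "le (weak_order H B) (R i) (R k) \<longleftrightarrow> N i \<subseteq> N k"
proof -
  have s: "sep_set H B (R i) = h ` N i" for i
    unfolding B_R sep_set_R N_def using neg_0 by simp
  have "le (weak_order H B) (R i) (R k) \<longleftrightarrow> h ` N i \<subseteq> h ` N k" by (simp add: weak_order_def s)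
  also have "\<dots> \<longleftrightarrow> N i \<subseteq> N k"
    by (rule inj_on_image_subset_iff[OF inj_h]) (auto simp: N_def)
  finally show ?thesis .
qed

lemma N_pos: "0 \<le> i \<Longrightarrow> i \<le> int m \<Longrightarrow> N i = {..<nat i}"
proof -
  assume i: "0 \<le> i" "i \<le> int m"
  have "i mod (2 * int m) = i" by (rule mod_pos_pos_trivial) (use i m3 in linarith)+
  hence "neg i j \<longleftrightarrow> int j < i" for j using i unfolding neg_def by simp
  moreover have "j < m \<and> int j < i \<longleftrightarrow> j < nat i" for j using i by linarith
  ultimately show ?thesis unfolding N_def by (simp add: lessThan_def)
qed

lemma N_neg: "0 < e \<Longrightarrow> e \<le> int m \<Longrightarrow> N (- e) = {nat (int m - e)..<m}"
proof -
  assume e: "0 < e" "e \<le> int m"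
  have "(- e) mod (2 * int m) = (- e + 2 * int m) mod (2 * int m)" by simp
  also have "\<dots> = - e + 2 * int m" by (rule mod_pos_pos_trivial) (use e in linarith)+
  finally have "neg (- e) j \<longleftrightarrow> j < m \<and> int m - e \<le> int j" if "j < m" for j
    using e that unfolding neg_def by auto
  thus ?thesis unfolding N_def using e by auto
qed

lemma N_inj: "N i = N k \<Longrightarrow> R i = R k"
proof -
  assume e: "N i = N k"
  have "neg i j \<longleftrightarrow> neg k j" if "j < m" for j using e that unfolding N_def by blast
  thus ?thesis unfolding R_def by (metis (mono_tags, lifting))
qed

lemma weak_less: "lless (weak_order H B) (R i) (R k) \<longleftrightarrow> N i \<subset> N k"
proof -
  have "N i = N k" if "R i = R k"
    using weak_le[of i k] weak_le[of k i] weak_le[of i i] that by auto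
  moreover have "eq (weak_order H B) = (=)" by (simp add: weak_order_def)
  ultimately show ?thesis unfolding lless_def weak_le using N_inj[of i k] by (simp add: psubset_eq) blast
qed

lemma covers_weak_iff:
  "covers (weak_order H B) (R i) (R k) \<longleftrightarrow> N i \<subset> N k \<and> (\<nexists>z. N i \<subset> N z \<and> N z \<subset> N k)"
proof -
  have "carrier (weak_order H B) = range R" by (simp add: weak_order_def regions_R)
  thus ?thesis unfolding covers_def by (auto simp: weak_less)
qed

lemma region_repr: obtains z where "- int m < z" "z \<le> int m" "R i = R z"
proof -
  define r where "r = i mod (2 * int m)"
  have r: "0 \<le> r" "r < 2 * int m" "R i = R r" using mod_bounds R_mod unfolding r_def by auto
  show ?thesis
  proof (cases "r \<le> int m")
    case True thus ?thesis using that[of r] r m3 by simp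
  next
    case False
    have "R (r - 2 * int m) = R r" using R_period[of r "- 1"] by simp
    thus ?thesis using that[of "r - 2 * int m"] r False by simp
  qed
qed

text \<open>The inversion sets are \<open>{..<i}\<close> on one side of the base region and
  \<open>{m - e..<m}\<close> on the other. So the weak order consists of two chains of length
  \<open>m\<close> with common ends, and a cover adds the next index of its chain.\<close>

lemma covers_weak:
  "covers (weak_order H B) C D \<longleftrightarrow>
     (\<exists>j<m. C = R (int j) \<and> D = R (int j + 1)) \<or> (\<exists>j<m. C = R (- int j) \<and> D = R (- int j - 1))"
proof
  assume cv: "covers (weak_order H B) C D"
  hence "C \<in> range R" "D \<in> range R" unfolding covers_def by (auto simp: weak_order_def regions_R)
  then obtain i k where ik: "- int m < i" "i \<le> int m" "C = R i" "- int m < k" "k \<le> int m" "D = R k"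
    using region_repr by (metis rangeE)
  have ss: "N i \<subset> N k" "\<And>z. N i \<subset> N z \<Longrightarrow> \<not> N z \<subset> N k" using cv ik covers_weak_iff by auto
  have step: "R k = R z" if "N i \<subset> N z" "N z \<subseteq> N k" for z
  proof -
    have "N z = N k" using ss(2)[OF that(1)] that(2) by blast
    thus ?thesis using N_inj by metis
  qed
  have neg_form: "N i = {nat (int m + i)..<m}" if "i \<le> 0" "- int m \<le> i" for i
  proof (cases "i = 0")
    case True thus ?thesis using N_pos[of 0] by simp
  next
    case False thus ?thesis using N_neg[of "- i"] that by simp
  qed
  consider "0 < i" | "i = 0" "0 < k" | "i = 0" "k \<le> 0" | "i < 0" by linarith
  thus "(\<exists>j<m. C = R (int j) \<and> D = R (int j + 1)) \<or> (\<exists>j<m. C = R (- int j) \<and> D = R (- int j - 1))"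
  proof cases
    case 1
    have Ni: "N i = {..<nat i}" using N_pos ik 1 by simp
    hence "0 \<in> N k" using ss(1) 1 by auto
    have "0 < k"
    proof (rule ccontr)
      assume "\<not> 0 < k"
      hence "N k = {nat (int m + k)..<m}" using neg_form[of k] ik by auto
      thus False using \<open>0 \<in> N k\<close> ik by auto
    qed
    hence Nk: "N k = {..<nat k}" using N_pos ik by simp
    have "nat i < nat k" using psubset_card_mono[OF finite_lessThan ss(1)[unfolded Ni Nk]] by simp
    hence "i < k" using 1 by linarith
    hence N1: "N (i + 1) = {..<nat (i + 1)}" using N_pos 1 ik by simp
    have "R k = R (i + 1)"
    proof (rule step)
      have "nat i \<in> N (i + 1)" "nat i \<notin> N i" "N i \<subseteq> N (i + 1)" unfolding Ni N1 using 1 by auto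
      thus "N i \<subset> N (i + 1)" by blast
      show "N (i + 1) \<subseteq> N k" unfolding N1 Nk using \<open>i < k\<close> by simp
    qed
    thus ?thesis using ik 1 \<open>i < k\<close> by (intro disjI1 exI[of _ "nat i"]) auto
  next
    case 2
    have NN: "N i = {..<nat 0}" "N 1 = {..<nat 1}" "N k = {..<nat k}"
      using N_pos[of 0] N_pos[of 1] N_pos[of k] ik 2 m3 by simp_all
    have "R k = R 1"
    proof (rule step)
      have "0 \<in> N 1" "N i = {}" unfolding NN by simp_all
      thus "N i \<subset> N 1" by blast
      show "N 1 \<subseteq> N k" unfolding NN using 2 by simp
    qed
    thus ?thesis using ik 2 m3 by (intro disjI1 exI[of _ 0]) auto
  next
    case 3
    have NN: "N i = {}" "N (- 1) = {nat (int m - 1)..<m}" "N k = {nat (int m + k)..<m}"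
    proof -
      show "N i = {}" using N_pos[of 0] 3 by simp
      show "N (- 1) = {nat (int m - 1)..<m}" using N_neg[of 1] m3 by simp
      show "N k = {nat (int m + k)..<m}"
      proof (cases "k = 0")
        case True thus ?thesis using N_pos[of 0] by simp
      next
        case False thus ?thesis using N_neg[of "- k"] ik 3 by simp
      qed
    qed
    have "k \<noteq> 0"
    proof
      assume "k = 0"
      hence "N k = {}" using N_pos[of 0] by simp
      thus False using ss(1) by blast
    qed
    have "nat (int m - 1) \<in> {nat (int m - 1)..<m}" using m3 by auto
    moreover have "nat (int m + k) \<le> nat (int m - 1)" using \<open>k \<noteq> 0\<close> 3 by simp
    hence "{nat (int m - 1)..<m} \<subseteq> {nat (int m + k)..<m}" by simp
    ultimately have "R k = R (- 1)" by (intro step; unfold NN) blast+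
    thus ?thesis using ik 3 m3 by (intro disjI2 exI[of _ 0]) auto
  next
    case 4
    have Ni: "N i = {nat (int m + i)..<m}" using neg_form ik 4 by auto
    have N1: "N (i - 1) = {nat (int m + i - 1)..<m}" using neg_form[of "i - 1"] ik 4 by (simp add: add_diff_eq)
    have "N i \<subset> N (i - 1)"
    proof -
      have "nat (int m + i - 1) \<in> N (i - 1)" "nat (int m + i - 1) \<notin> N i" unfolding Ni N1 using ik 4 by auto
      moreover have "N i \<subseteq> N (i - 1)" unfolding Ni N1 by auto
      ultimately show ?thesis by blast
    qed
    moreover have "N (i - 1) \<subseteq> N k"
    proof (cases "0 < k")
      \<comment> \<open>A nonempty final segment lies in an initial one only if the latter is
        everything. So \<open>k = m\<close>, which is the common top of the two chains.\<close>
      case True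
      hence Nk: "N k = {..<nat k}" using N_pos ik by simp
      have "m - 1 \<in> N i" unfolding Ni using 4 ik m3 by auto
      hence "m - 1 \<in> {..<nat k}" using ss(1) Nk by auto
      hence "k = int m" using ik by auto
      thus ?thesis unfolding Nk N1 by auto
    next
      case False
      hence Nk: "N k = {nat (int m + k)..<m}" using neg_form ik by auto
      have "k < i"
      proof (rule ccontr)
        assume "\<not> k < i"
        hence "N k \<subseteq> N i" unfolding Nk Ni by auto
        thus False using ss(1) by blast
      qed
      thus ?thesis unfolding Nk N1 by auto
    qed
    ultimately have "R k = R (i - 1)" by (rule step)
    thus ?thesis using ik 4 by (intro disjI2 exI[of _ "nat (- i)"]) auto
  qed
next
  have gen: "covers (weak_order H B) (R i) (R k)" if "N k = insert j (N i)" "j \<notin> N i" for i k j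
    unfolding covers_weak_iff that(1) using that(2) by blast
  assume "(\<exists>j<m. C = R (int j) \<and> D = R (int j + 1)) \<or> (\<exists>j<m. C = R (- int j) \<and> D = R (- int j - 1))"
  thus "covers (weak_order H B) C D"
  proof (elim disjE exE conjE)
    fix j assume j: "j < m" "C = R (int j)" "D = R (int j + 1)"
    have "N (int j) = {..<j}" using N_pos[of "int j"] j by simp
    moreover have "nat (int j + 1) = Suc j" by simp
    hence "N (int j + 1) = {..<Suc j}" using N_pos[of "int j + 1"] j by simp
    ultimately have "N (int j + 1) = insert j (N (int j))" "j \<notin> N (int j)" by (simp_all add: lessThan_Suc)
    thus ?thesis unfolding j by (rule gen)
  next
    fix j assume j: "j < m" "C = R (- int j)" "D = R (- int j - 1)"
    have "N (- int j) = {m - j..<m}"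
    proof (cases "j = 0")
      case True thus ?thesis using N_pos[of 0] by simp
    next
      case False
      have "nat (int m - int j) = m - j" by linarith
      thus ?thesis using N_neg[of "int j"] j False by simp
    qed
    moreover have "N (- int j - 1) = {m - Suc j..<m}"
    proof -
      have "- int j - 1 = - (int j + 1)" "nat (int m - (int j + 1)) = m - Suc j" by linarith+
      moreover have "0 < int j + 1" "int j + 1 \<le> int m" using j by linarith+
      ultimately show ?thesis using N_neg[of "int j + 1"] by presburger
    qed
    moreover have "{m - Suc j..<m} = insert (m - Suc j) {m - j..<m}" "m - Suc j \<notin> {m - j..<m}" using j by auto
    ultimately have "N (- int j - 1) = insert (m - Suc j) (N (- int j))" "m - Suc j \<notin> N (- int j)" by simp_all
    thus ?thesis unfolding j by (rule gen)
  qed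
qed

end

section \<open>Filling in a disc\<close>

text \<open>The disc is the quotient of the square which collapses the two sides \<open>t = 0\<close> and \<open>t = 1\<close>,
  on which a homotopy of paths is constant.\<close>

lemma homotopic_paths_extend_disc:
  fixes S :: "complex set"
  assumes "homotopic_paths S p q"
  obtains g where "continuous_on (cball 0 1) g" "g ` cball 0 1 \<subseteq> S"
    "\<And>z. norm z = 1 \<Longrightarrow> g z = (if Im z \<ge> 0 then p ((1 - Re z) / 2) else q ((1 - Re z) / 2))"
proof -
  obtain h where h: "continuous_on ({0..1} \<times> {0..1}) h" "h \<in> {0..1} \<times> {0..1} \<rightarrow> S"
      "\<And>t. t \<in> {0..1} \<Longrightarrow> h (0, t) = p t" "\<And>t. t \<in> {0..1} \<Longrightarrow> h (1, t) = q t"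
      "\<And>s. s \<in> {0..1::real} \<Longrightarrow> h (s, 0) = p 0 \<and> h (s, 1::real) = p 1"
    using assms unfolding homotopic_paths by (auto simp: pathstart_def pathfinish_def)
  \<comment> \<open>For fixed \<open>t\<close>, the parameter \<open>s\<close> runs down the
    vertical chord over \<open>1 - 2 * t\<close>, from the upper half circle at \<open>s = 0\<close>
    to the lower one at \<open>s = 1\<close>. The chord is a point exactly for \<open>t = 0\<close>
    and \<open>t = 1\<close>.\<close>
  define D where "D = (\<lambda>(s::real, t::real). complex_of_real (1 - 2 * t) +
    \<i> * complex_of_real ((1 - 2 * s) * sqrt (1 - (1 - 2 * t)\<^sup>2)))"
  let ?Q = "top_of_set ({0..1::real} \<times> {0..1::real})" and ?C = "top_of_set (cball (0::complex) 1)"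
  have Re_D: "Re (D (s, t)) = 1 - 2 * t" and Im_D: "Im (D (s, t)) = (1 - 2 * s) * sqrt (1 - (1 - 2 * t)\<^sup>2)" for s t
    by (simp_all add: D_def)
  have half: "1 - 2 * ((1 - a) / 2) = a" for a :: real by (simp add: field_simps)
  have t_sq: "(1 - 2 * t)\<^sup>2 \<le> 1" if "t \<in> {0..1}" for t :: real
    using that by (intro abs_square_le_1[THEN iffD2]) (auto simp: abs_le_iff)
  have D_disc: "norm (D (s, t)) \<le> 1" if "s \<in> {0..1}" "t \<in> {0..1}" for s t
  proof -
    have "(1 - 2 * s)\<^sup>2 * (1 - (1 - 2 * t)\<^sup>2) \<le> 1 * (1 - (1 - 2 * t)\<^sup>2)"
      by (intro mult_right_mono) (use t_sq that in auto)
    moreover have "(Im (D (s, t)))\<^sup>2 = (1 - 2 * s)\<^sup>2 * (1 - (1 - 2 * t)\<^sup>2)"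
      using t_sq[OF that(2)] by (simp add: Im_D power_mult_distrib)
    ultimately have "(Re (D (s, t)))\<^sup>2 + (Im (D (s, t)))\<^sup>2 \<le> 1" by (simp add: Re_D)
    thus ?thesis by (simp add: cmod_def)
  qed
  have D_surj: "\<exists>s\<in>{0..1}. \<exists>t\<in>{0..1}. z = D (s, t)" if "norm z \<le> 1" for z
  proof -
    define w where "w = sqrt (1 - (Re z)\<^sup>2)"
    have nz: "(Re z)\<^sup>2 + (Im z)\<^sup>2 \<le> 1" using that by (simp add: cmod_def)
    hence rz: "(Re z)\<^sup>2 \<le> 1" by (smt (verit) zero_le_power2)
    have t: "(1 - Re z) / 2 \<in> {0..1}" using abs_Re_le_cmod[of z] that by auto
    have w: "w \<ge> 0" "\<bar>Im z\<bar> \<le> w" unfolding w_def using nz rz by (auto intro!: real_le_rsqrt)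
    define s where "s = (if w = 0 then 0 else (1 - Im z / w) / 2)"
    have s: "s \<in> {0..1}" unfolding s_def using w by (auto simp: field_simps abs_le_iff)
    have "(1 - 2 * s) * w = Im z"
    proof (cases "w = 0")
      case True thus ?thesis using w by simp
    next
      case False
      hence "1 - 2 * s = Im z / w" by (simp only: s_def half if_False)
      thus ?thesis using False by simp
    qed
    hence "z = D (s, (1 - Re z) / 2)" unfolding w_def by (intro complex_eqI) (simp_all only: Re_D Im_D half)
    thus ?thesis using s t by blast
  qed
  have "continuous_map ?Q ?C D"
    unfolding continuous_map_in_subtopology
    by (auto simp: D_def split_beta intro!: continuous_intros) (use D_disc in \<open>auto simp: D_def\<close>)
  moreover have "D ` ({0..1} \<times> {0..1}) = cball 0 1" using D_disc D_surj by fastforce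
  \<comment> \<open>A continuous surjection from a compact space onto a Hausdorff space is a
    quotient map, so \<open>h\<close> descends to the disc once it is constant on the fibres of
    \<open>D\<close>.\<close>
  ultimately have qm: "quotient_map ?Q ?C D"
    by (intro continuous_imp_quotient_map)
       (auto simp: compact_space_subtopology compactin_euclidean_iff compact_Times Hausdorff_space_subtopology)
  have "h (s, t) = h (s', t')" if "s \<in> {0..1}" "t \<in> {0..1}" "s' \<in> {0..1}" "t' \<in> {0..1}" "D (s, t) = D (s', t')" for s t s' t'
  proof -
    have tt: "t = t'" using Re_D[of s t] Re_D[of s' t'] that(5) by simp
    show ?thesis
    proof (cases "(1 - 2 * t)\<^sup>2 = 1")
      case True
      hence "t = 0 \<or> t = 1" by (auto simp: power2_eq_1_iff)
      thus ?thesis using h(5) that tt by auto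
    next
      case False
      hence w: "sqrt (1 - (1 - 2 * t)\<^sup>2) \<noteq> 0" by simp
      have "Im (D (s, t)) = Im (D (s', t'))" using that(5) by (rule arg_cong)
      hence "1 - 2 * s = 1 - 2 * s'" unfolding Im_D tt[symmetric] mult_right_cancel[OF w] .
      hence "s = s'" by simp
      thus ?thesis using tt by simp
    qed
  qed
  hence fib: "\<And>x y. x \<in> topspace ?Q \<Longrightarrow> y \<in> topspace ?Q \<Longrightarrow> D x = D y \<Longrightarrow> h x = h y"
    by (simp only: topspace_euclidean_subtopology) blast
  have hc: "continuous_map ?Q (top_of_set S) h" using h(1,2) by (auto simp: continuous_map_in_subtopology)
  have "\<exists>g. continuous_map ?C (top_of_set S) g \<and> (\<forall>x\<in>topspace ?Q. g (D x) = h x)"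
  proof (rule quotient_map_lift_exists[OF qm hc])
    fix x y assume "x \<in> topspace ?Q" "y \<in> topspace ?Q" "D x = D y"
    thus "h x = h y" by (rule fib)
  next
    fix g assume "continuous_map ?C (top_of_set S) g" "\<And>x. x \<in> topspace ?Q \<Longrightarrow> g (D x) = h x"
    thus "\<exists>g. continuous_map ?C (top_of_set S) g \<and> (\<forall>x\<in>topspace ?Q. g (D x) = h x)" by blast
  qed
  then obtain g where g: "continuous_map ?C (top_of_set S) g" "\<And>x. x \<in> topspace ?Q \<Longrightarrow> g (D x) = h x"
    by (elim exE conjE) (rule that, assumption, erule bspec)
  show ?thesis
  proof
    show "continuous_on (cball 0 1) g" "g ` cball 0 1 \<subseteq> S"
      using g(1) by (auto simp: continuous_map_in_subtopology)
    fix z :: complex assume z: "norm z = 1"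
    define s where "s = (if Im z \<ge> 0 then 0 else 1 :: real)"
    have nz: "(Re z)\<^sup>2 + (Im z)\<^sup>2 = 1" using z by (simp add: cmod_def)
    have "sqrt (1 - (Re z)\<^sup>2) = \<bar>Im z\<bar>" using nz by (metis add_diff_cancel_left' real_sqrt_abs)
    hence "(1 - 2 * s) * sqrt (1 - (Re z)\<^sup>2) = Im z" by (simp add: s_def)
    hence "z = D (s, (1 - Re z) / 2)" by (intro complex_eqI) (simp_all only: Re_D Im_D half)
    moreover have t: "(1 - Re z) / 2 \<in> {0..1}" using abs_Re_le_cmod[of z] z by auto
    ultimately have "g z = h (s, (1 - Re z) / 2)" using g(2)[of "(s, (1 - Re z) / 2)"] by (simp add: s_def)
    thus "g z = (if Im z \<ge> 0 then p ((1 - Re z) / 2) else q ((1 - Re z) / 2))"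
      using h(3,4)[OF t] by (simp add: s_def)
  qed
qed


section \<open>Closing up paths along a tree\<close>

text \<open>\<open>\<tau> v\<close> is a path from the base point to the vertex \<open>v\<close>.
  Closing up makes a loop class of every path between vertices and turns concatenation into
  multiplication; this contracts the tree without forming a quotient space.\<close>

locale based_paths =
  fixes X :: "'b topology" and b :: 'b and V :: "'b set" and \<tau> :: "'b \<Rightarrow> real \<Rightarrow> 'b"
  assumes tau: "v \<in> V \<Longrightarrow> pathin X (\<tau> v)" "v \<in> V \<Longrightarrow> \<tau> v 0 = b" "v \<in> V \<Longrightarrow> \<tau> v 1 = v"
begin

definition closed_up :: "(real \<Rightarrow> 'b) \<Rightarrow> (real \<Rightarrow> 'b) set" where
  "closed_up p = loop_class X b (\<tau> (p 0) \<cdot> (p \<cdot> path_reverse (\<tau> (p 1))))"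

lemma closed_up_loop:
  "pathin X p \<Longrightarrow> p 0 \<in> V \<Longrightarrow> p 1 \<in> V \<Longrightarrow> \<tau> (p 0) \<cdot> (p \<cdot> path_reverse (\<tau> (p 1))) \<in> loops X b"
  using tau by (auto simp: loops_def intro!: pathin_concat pathin_reverse)

lemma closed_up_carrier:
  "pathin X p \<Longrightarrow> p 0 \<in> V \<Longrightarrow> p 1 \<in> V \<Longrightarrow> closed_up p \<in> carrier (fundamental_group X b)"
  unfolding closed_up_def by (intro loop_class_carrier closed_up_loop)

lemma closed_up_hom:
  assumes "path_hom X p q" "p 0 \<in> V" "p 1 \<in> V" shows "closed_up p = closed_up q"
proof -
  note e = path_hom_ends[OF assms(1)]
  note r = path_hom_pathin[OF assms(1)]
  have "path_hom X (\<tau> (p 0) \<cdot> (p \<cdot> path_reverse (\<tau> (p 1)))) (\<tau> (p 0) \<cdot> (q \<cdot> path_reverse (\<tau> (p 1))))"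
    using assms tau e by (intro path_hom_concat path_hom_refl pathin_reverse) auto
  thus ?thesis unfolding closed_up_def using closed_up_loop[of p] closed_up_loop[of q] e r assms(2,3)
    by (simp add: loop_class_eq_iff)
qed

lemma closed_up_const:
  assumes "v \<in> V" shows "closed_up (\<lambda>_. v) = \<one>\<^bsub>fundamental_group X b\<^esub>"
proof -
  note t = tau[OF assms]
  have v: "v \<in> topspace X" "b \<in> topspace X" using pathin_topspace[OF t(1), of 1] pathin_topspace[OF t(1), of 0] t by auto
  have "path_hom X ((\<lambda>_. v) \<cdot> path_reverse (\<tau> v)) (path_reverse (\<tau> v))"
    using path_hom_const_left[OF pathin_reverse[OF t(1)]] t by simp
  hence "path_hom X (\<tau> v \<cdot> ((\<lambda>_. v) \<cdot> path_reverse (\<tau> v))) (\<tau> v \<cdot> path_reverse (\<tau> v))"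
    using t by (intro path_hom_concat path_hom_refl) auto
  also have "path_hom X (\<tau> v \<cdot> path_reverse (\<tau> v)) (\<lambda>_. b)"
    using path_hom_inverse_right[OF t(1)] t by simp
  finally show ?thesis unfolding closed_up_def fundamental_group_one
    using closed_up_loop[of "\<lambda>_. v"] v assms by (simp add: loop_class_eq_iff const_loops pathin_const)
qed

text \<open>The return along \<open>\<tau> (p 1)\<close> cancels against the departure along the
  same path in the middle of the product.\<close>

lemma closed_up_concat:
  assumes "pathin X p" "pathin X q" "p 1 = q 0" "p 0 \<in> V" "p 1 \<in> V" "q 1 \<in> V"
  shows "closed_up (p \<cdot> q) = closed_up p \<otimes>\<^bsub>fundamental_group X b\<^esub> closed_up q"
proof -
  let ?a = "\<tau> (p 0)" and ?b = "\<tau> (p 1)" and ?c = "path_reverse (\<tau> (q 1))"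
  note t = tau[OF assms(4)] tau[OF assms(5)] tau[OF assms(6)]
  note i = pathin_concat pathin_reverse assms t path_hom_refl path_hom_concat
  let ?r = "q \<cdot> ?c"
  have r: "pathin X ?r" "?r 0 = p 1" "?r 1 = b" using assms t by (auto intro!: i)
  have "path_hom X (path_reverse ?b \<cdot> (?b \<cdot> ?r)) ((path_reverse ?b \<cdot> ?b) \<cdot> ?r)"
    using r t by (intro path_hom_sym[OF path_hom_assoc] pathin_reverse) auto
  also have "path_hom X \<dots> ((\<lambda>_. ?b 1) \<cdot> ?r)"
    using r t by (intro path_hom_concat path_hom_inverse_left path_hom_refl) auto
  also have "path_hom X \<dots> ?r" using path_hom_const_left[OF r(1)] r t by simp
  finally have 1: "path_hom X (path_reverse ?b \<cdot> (?b \<cdot> ?r)) ?r" .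
  have "path_hom X ((p \<cdot> path_reverse ?b) \<cdot> (?b \<cdot> ?r)) (p \<cdot> (path_reverse ?b \<cdot> (?b \<cdot> ?r)))"
    using r t assms by (intro path_hom_assoc pathin_reverse pathin_concat) auto
  also have "path_hom X \<dots> (p \<cdot> ?r)"
    by (rule path_hom_concat[OF path_hom_refl[OF assms(1)] 1]) (use t assms in simp)
  also have "path_hom X \<dots> ((p \<cdot> q) \<cdot> ?c)"
    using t assms by (intro path_hom_sym[OF path_hom_assoc] pathin_reverse) auto
  finally have 2: "path_hom X ((p \<cdot> path_reverse ?b) \<cdot> (?b \<cdot> ?r)) ((p \<cdot> q) \<cdot> ?c)" .
  have "path_hom X ((?a \<cdot> (p \<cdot> path_reverse ?b)) \<cdot> (?b \<cdot> ?r)) (?a \<cdot> ((p \<cdot> path_reverse ?b) \<cdot> (?b \<cdot> ?r)))"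
    using r t assms by (intro path_hom_assoc pathin_reverse pathin_concat) auto
  also have "path_hom X \<dots> (?a \<cdot> ((p \<cdot> q) \<cdot> ?c))"
    by (rule path_hom_concat[OF path_hom_refl[OF t(1)] 2]) (use t in simp)
  finally have 3: "path_hom X ((?a \<cdot> (p \<cdot> path_reverse ?b)) \<cdot> (?b \<cdot> ?r)) (?a \<cdot> ((p \<cdot> q) \<cdot> ?c))" .
  have l: "?a \<cdot> (p \<cdot> path_reverse ?b) \<in> loops X b" "?b \<cdot> ?r \<in> loops X b" "?a \<cdot> ((p \<cdot> q) \<cdot> ?c) \<in> loops X b"
    using closed_up_loop[of p] closed_up_loop[of q] closed_up_loop[of "p \<cdot> q"] assms
    by (simp_all add: pathin_concat)
  have "closed_up (p \<cdot> q) = loop_class X b (?a \<cdot> ((p \<cdot> q) \<cdot> ?c))" by (simp add: closed_up_def)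
  also have "\<dots> = loop_class X b ((?a \<cdot> (p \<cdot> path_reverse ?b)) \<cdot> (?b \<cdot> ?r))"
    using 3 l by (simp add: loop_class_eq_iff concat_loops path_hom_sym)
  also have "\<dots> = loop_class X b (?a \<cdot> (p \<cdot> path_reverse ?b)) \<otimes>\<^bsub>fundamental_group X b\<^esub> loop_class X b (?b \<cdot> ?r)"
    by (rule loop_class_mult[OF l(1,2), symmetric])
  finally show ?thesis using assms(3) by (simp add: closed_up_def)
qed

lemma closed_up_loop_class:
  assumes "p \<in> loops X b" "b \<in> V" "\<tau> b = (\<lambda>_. b)" shows "closed_up p = loop_class X b p"
proof -
  have p: "pathin X p" "p 0 = b" "p 1 = b" using assms(1) by (auto simp: loops_def)
  have r: "path_reverse (\<lambda>_. b) = (\<lambda>_. b)" by (simp add: path_reverse_def)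
  have q: "path_hom X (p \<cdot> (\<lambda>_. b)) p" using path_hom_const_right[OF p(1)] p by simp
  have "path_hom X ((\<lambda>_. b) \<cdot> (p \<cdot> (\<lambda>_. b))) (p \<cdot> (\<lambda>_. b))"
    using path_hom_const_left[OF path_hom_pathin(1)[OF q]] p by simp
  from path_hom_trans[OF this q] show ?thesis
    using closed_up_loop[OF p(1)] assms p unfolding closed_up_def by (simp add: loop_class_eq_iff r)
qed

lemma closed_up_tau:
  assumes "v \<in> V" "b \<in> V" "\<tau> b = (\<lambda>_. b)" shows "closed_up (\<tau> v) = \<one>\<^bsub>fundamental_group X b\<^esub>"
proof -
  note t = tau[OF assms(1)]
  let ?p = "\<tau> v \<cdot> path_reverse (\<tau> v)"
  have b: "b \<in> topspace X" using pathin_topspace[OF t(1), of 0] t by simp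
  have h: "path_hom X ?p (\<lambda>_. b)" using path_hom_inverse_right[OF t(1)] t by simp
  have "path_hom X ((\<lambda>_. b) \<cdot> ?p) ?p"
    using path_hom_const_left[OF path_hom_pathin(1)[OF h]] t by simp
  from path_hom_trans[OF this h] show ?thesis
    using closed_up_loop[OF t(1)] assms t b unfolding closed_up_def fundamental_group_one
    by (simp add: loop_class_eq_iff const_loops)
qed

end


section \<open>Cyclic labels\<close>

lemma upto_append: "i \<le> j \<Longrightarrow> j \<le> k + 1 \<Longrightarrow> [i..k] = [i..j - 1] @ [j..k]"
  by (cases "j = k + 1") (auto intro: upto_split1)

lemma upto_shift: "[i..i + int d - 1] = map (\<lambda>k. i + int k) [0..<d]"
  by (rule nth_equalityI) auto

text \<open>The labels of the edges of the 2m-gon in its two directions, in the notation of the pencil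
  relations: the edges of the spanning tree are labelled by the identity.\<close>

definition label_up :: "('g, 'z) monoid_scheme \<Rightarrow> nat \<Rightarrow> (nat \<Rightarrow> 'g) \<Rightarrow> int \<Rightarrow> 'g" where
  "label_up G m y i = (if i mod (2 * int m) < int m then \<one>\<^bsub>G\<^esub> else y (nat (i mod (2 * int m) - int m)))"

definition label_down :: "('g, 'z) monoid_scheme \<Rightarrow> nat \<Rightarrow> (nat \<Rightarrow> 'g) \<Rightarrow> int \<Rightarrow> 'g" where
  "label_down G m x i = (if i mod (2 * int m) < int m then x (nat (i mod (2 * int m))) else \<one>\<^bsub>G\<^esub>)"

lemma label_period:
  "label_up G m y (i + 2 * int m) = label_up G m y i" "label_down G m x (i + 2 * int m) = label_down G m x i"
  by (simp_all add: label_up_def label_down_def)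

lemma label_values:
  assumes "0 \<le> k" "k < int m"
  shows "label_up G m y k = \<one>\<^bsub>G\<^esub>" "label_up G m y (int m + k) = y (nat k)"
    "label_down G m x k = x (nat k)" "label_down G m x (int m + k) = \<one>\<^bsub>G\<^esub>"
    "label_down G m x (k - int m) = \<one>\<^bsub>G\<^esub>"
proof -
  have e: "k mod (2 * int m) = k" "(int m + k) mod (2 * int m) = int m + k"
    by (rule mod_pos_pos_trivial; use assms in linarith)+
  show "label_up G m y k = \<one>\<^bsub>G\<^esub>" "label_up G m y (int m + k) = y (nat k)"
    "label_down G m x k = x (nat k)" and d: "label_down G m x (int m + k) = \<one>\<^bsub>G\<^esub>"
    using assms by (simp_all add: label_up_def label_down_def e)
  show "label_down G m x (k - int m) = \<one>\<^bsub>G\<^esub>" using label_period(2)[of G m x "k - int m"] d by (simp add: add.commute)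
qed

context monoid
begin

lemma list_prod_ones: "(\<And>a. a \<in> set xs \<Longrightarrow> a = \<one>) \<Longrightarrow> list_prod G xs = \<one>"
proof (induction xs)
  case (Cons a xs)
  have "a = \<one>" "list_prod G xs = \<one>" using Cons by simp_all
  thus ?case by simp
qed simp

text \<open>These are the arcs of half a turn that start at the regions \<open>c\<close> and
  \<open>m + c\<close>. Their edges with trivial label drop out, and the others spell one side of a
  pencil relation.\<close>

lemma label_prods:
  assumes "c \<le> m" "\<And>i. i < m \<Longrightarrow> x i \<in> carrier G \<and> y i \<in> carrier G"
  shows "list_prod G (map (label_up G m y) [int c..int c + int m - 1]) = list_prod G (map y [0..<c])"
    "list_prod G (map (label_down G m x) (rev [int c - int m..int c - 1])) = list_prod G (map x (rev [0..<c]))"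
    "list_prod G (map (label_up G m y) [int m + int c..int m + int c + int m - 1]) = list_prod G (map y [c..<m])"
    "list_prod G (map (label_down G m x) (rev [int c..int c + int m - 1])) = list_prod G (map x (rev [c..<m]))"
proof -
  note lv = label_values[where G = G and m = m]
  have sub: "y ` {0..<c} \<subseteq> carrier G" "x ` {0..<c} \<subseteq> carrier G"
      "y ` {c..<m} \<subseteq> carrier G" "x ` {c..<m} \<subseteq> carrier G"
    using assms by auto
  have y1: "map (label_up G m y) [int m..int m + int c - 1] = map y [0..<c]"
    unfolding upto_shift using assms(1) lv(2) by (auto simp: o_def)
  have x1: "map (label_down G m x) [0..int c - 1] = map x [0..<c]"
    using upto_shift[of 0 c] assms(1) lv(3) by (auto simp: o_def)
  have e: "int m + int c + int (m - c) - 1 = 2 * int m - 1" "int c + int (m - c) - 1 = int m - 1"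
    using assms(1) by auto
  have sh: "map (\<lambda>k. c + k) [0..<m - c] = [c..<m]"
    using assms(1) by (intro nth_equalityI) auto
  have "map (label_up G m y) [int m + int c..2 * int m - 1] = map (\<lambda>k. y (c + k)) [0..<m - c]"
    unfolding upto_shift[of "int m + int c" "m - c", unfolded e]
    using lv(2)[of "int c + int k" y for k] by (auto simp: o_def add.assoc nat_int_add)
  also have "\<dots> = map y (map (\<lambda>k. c + k) [0..<m - c])" by simp
  finally have y2: "map (label_up G m y) [int m + int c..2 * int m - 1] = map y [c..<m]" unfolding sh .
  have "map (label_down G m x) [int c..int m - 1] = map (\<lambda>k. x (c + k)) [0..<m - c]"
    unfolding upto_shift[of "int c" "m - c", unfolded e]
    using lv(3)[of "int c + int k" x for k] by (auto simp: o_def add.assoc nat_int_add)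
  also have "\<dots> = map x (map (\<lambda>k. c + k) [0..<m - c])" by simp
  finally have x2: "map (label_down G m x) [int c..int m - 1] = map x [c..<m]" unfolding sh .
  have s1: "[int c..int c + int m - 1] = [int c..int m - 1] @ [int m..int m + int c - 1]"
    using upto_append[of "int c" "int m" "int c + int m - 1"] assms(1) by (simp add: add.commute)
  have o1: "list_prod G (map (label_up G m y) [int c..int m - 1]) = \<one>"
    by (rule list_prod_ones) (use lv(1) in auto)
  have up1: "set (map (label_up G m y) [int c..int m - 1]) \<subseteq> carrier G" using lv(1) by auto
  show "list_prod G (map (label_up G m y) [int c..int c + int m - 1]) = list_prod G (map y [0..<c])"
    unfolding s1 map_append using up1 o1 sub y1 by (simp add: list_prod_append)
  have s2: "[int c - int m..int c - 1] = [int c - int m..-1] @ [0..int c - 1]"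
    using upto_append[of "int c - int m" 0 "int c - 1"] assms(1) by simp
  have ld: "label_down G m x i = \<one>" if "i \<in> set [int c - int m..-1]" for i
    using lv(5)[of "i + int m" x] that assms(1) by auto
  have d1: "set (map (label_down G m x) (rev [int c - int m..-1])) \<subseteq> carrier G" using ld by auto
  have o2: "list_prod G (map (label_down G m x) (rev [int c - int m..-1])) = \<one>"
    by (rule list_prod_ones) (use ld in auto)
  have x1': "map (label_down G m x) (rev [0..int c - 1]) = map x (rev [0..<c])" using x1 by (simp add: rev_map[symmetric])
  show "list_prod G (map (label_down G m x) (rev [int c - int m..int c - 1])) = list_prod G (map x (rev [0..<c]))"
    unfolding s2 rev_append map_append x1' using d1 o2 sub by (simp add: list_prod_append)
  have s3: "[int m + int c..int m + int c + int m - 1] = [int m + int c..2 * int m - 1] @ [2 * int m..int m + int c + int m - 1]"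
    using upto_append[of "int m + int c" "2 * int m" "int m + int c + int m - 1"] assms(1) by simp
  have lu: "label_up G m y i = \<one>" if "i \<in> set [2 * int m..int m + int c + int m - 1]" for i
    using lv(1)[of "i - 2 * int m" y] label_period(1)[of G m y "i - 2 * int m"] that assms(1) by auto
  have u1: "set (map (label_up G m y) [2 * int m..int m + int c + int m - 1]) \<subseteq> carrier G" using lu by auto
  have o3: "list_prod G (map (label_up G m y) [2 * int m..int m + int c + int m - 1]) = \<one>"
    by (rule list_prod_ones) (use lu in auto)
  show "list_prod G (map (label_up G m y) [int m + int c..int m + int c + int m - 1]) = list_prod G (map y [c..<m])"
    unfolding s3 map_append y2 using u1 o3 sub by (simp add: list_prod_append)
  have s4: "[int c..int c + int m - 1] = [int c..int m - 1] @ [int m..int c + int m - 1]"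
    using upto_append[of "int c" "int m" "int c + int m - 1"] assms(1) by simp
  have le: "label_down G m x i = \<one>" if "i \<in> set [int m..int c + int m - 1]" for i
    using lv(4)[of "i - int m" x] that assms(1) by auto
  have d2: "set (map (label_down G m x) (rev [int m..int c + int m - 1])) \<subseteq> carrier G" using le by auto
  have o4: "list_prod G (map (label_down G m x) (rev [int m..int c + int m - 1])) = \<one>"
    by (rule list_prod_ones) (use le in auto)
  have x2': "map (label_down G m x) (rev [int c..int m - 1]) = map x (rev [c..<m])" using x2 by (simp add: rev_map[symmetric])
  show "list_prod G (map (label_down G m x) (rev [int c..int c + int m - 1])) = list_prod G (map x (rev [c..<m]))"
    unfolding s4 rev_append map_append x2' using d2 o4 sub by (simp add: list_prod_append)
qed

end

section \<open>The Salvetti complex of a rank two arrangement\<close>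

lemma gallery_path_Cons: "g \<noteq> [] \<Longrightarrow> tl g \<noteq> [] \<Longrightarrow> gallery_path (C # g) = edge_path C (hd g) \<cdot> gallery_path g"
  by (cases "C # g" rule: gallery_path.cases) auto

lemma edge_path_ends [simp]: "edge_path C D 0 = Vertex C" "edge_path C D 1 = Vertex D"
  by (simp_all add: edge_path_def)

lemma gallery_path_ends:
  assumes "g \<noteq> []" shows "gallery_path g 0 = Vertex (hd g) \<and> gallery_path g 1 = Vertex (last g)"
  using assms
proof (induction g rule: gallery_path.induct)
  case (4 C D E g)
  thus ?case by (simp add: path_concat_def)
qed simp_all

context rank2_arrangement
begin

abbreviation up_word :: "int \<Rightarrow> int list" where "up_word i \<equiv> [i..i + int m]"
abbreviation down_word :: "int \<Rightarrow> int list" where "down_word i \<equiv> rev [i - int m..i]"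

lemma edge_path_points: "(C, D) \<in> sal_edges H \<Longrightarrow> edge_path C D t \<in> sal_points H"
  by (auto simp: edge_path_def sal_points_def sal_edges_def)

lemma vertex_points: "Vertex (R i) \<in> sal_points H" by (auto simp: sal_points_def regions_R)

lemma walk_edges: "k = i + 1 \<or> k = i - 1 \<Longrightarrow> (R i, R k) \<in> sal_edges H"
  using sal_edges_R by auto

lemma gallery_path_points:
  "w \<noteq> [] \<Longrightarrow> walk w \<Longrightarrow> gallery_path (map R w) t \<in> sal_points H"
proof (induction w arbitrary: t)
  case (Cons i w)
  show ?case
  proof (cases w)
    case Nil thus ?thesis by (simp add: vertex_points)
  next
    case (Cons k w')
    have e: "(R i, R k) \<in> sal_edges H" using Cons.prems(2) \<open>w = k # w'\<close> walk_edges by auto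
    show ?thesis
    proof (cases w')
      case Nil thus ?thesis using e \<open>w = k # w'\<close> by (simp add: edge_path_points)
    next
      case (Cons l w'')
      have "gallery_path (map R w) s \<in> sal_points H" for s
        using Cons.IH Cons.prems(2) \<open>w = k # w'\<close> by auto
      thus ?thesis using e \<open>w = k # w'\<close> \<open>w' = l # w''\<close> by (auto simp: path_concat_def edge_path_points)
    qed
  qed
qed simp

lemma words: "up_word i \<noteq> []" "down_word i \<noteq> []" "walk (up_word i)" "walk (down_word i)"
    "hd (up_word i) = i" "last (up_word i) = i + int m" "hd (down_word i) = i" "last (down_word i) = i - int m"
  using upto_ends[of i "i + int m"] upto_ends[of "i - int m" i] walk_upto walk_rev
  by (auto simp: hd_rev last_rev)

lemma cell_words:
  obtains w w' where "fst (cell_gallery_pair H (\<Inter>H) (R i)) = map R w"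
    "snd (cell_gallery_pair H (\<Inter>H) (R i)) = map R w'"
    "w = up_word i \<and> w' = down_word i \<or> w = down_word i \<and> w' = up_word i"
  using cell_gallery_pair_R[of i] by (auto simp: doubleton_eq_iff)

lemma cell_word_facts:
  assumes "w = up_word i \<or> w = down_word i"
  shows "w \<noteq> []" "walk w" "gallery_path (map R w) 0 = Vertex (R i)" "gallery_path (map R w) 1 = Vertex (R (i + int m))"
proof -
  have e: "R (i - int m) = R (i + int m)" using R_period[of "i - int m" 1] by (simp add: add.commute)
  show w: "w \<noteq> []" "walk w" using assms words by auto
  have "hd w = i" "R (last w) = R (i + int m)" by (rule disjE[OF assms]; simp only: words e)+
  thus "gallery_path (map R w) 0 = Vertex (R i)" "gallery_path (map R w) 1 = Vertex (R (i + int m))"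
    using gallery_path_ends[of "map R w"] w(1) by (simp_all add: hd_map last_map)
qed

lemma cell_map_points: "cell_map H (\<Inter>H) (R i) z \<in> sal_points H"
proof (rule cell_words[of i])
  fix w w' assume w: "fst (cell_gallery_pair H (\<Inter>H) (R i)) = map R w"
    "snd (cell_gallery_pair H (\<Inter>H) (R i)) = map R w'"
    "w = up_word i \<and> w' = down_word i \<or> w = down_word i \<and> w' = up_word i"
  from w(3) have "w = up_word i \<or> w = down_word i" "w' = up_word i \<or> w' = down_word i" by argo+
  note this[THEN cell_word_facts(1)] this[THEN cell_word_facts(2)]
  hence "gallery_path (map R w) t \<in> sal_points H" "gallery_path (map R w') t \<in> sal_points H" for t
    using gallery_path_points by auto
  moreover have "Cell (\<Inter>H) (R i) z \<in> sal_points H" if "norm z < 1"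
  proof -
    have "(\<Inter>H, R i) \<in> sal_cells H" by (simp add: sal_cells_iff)
    thus ?thesis unfolding sal_points_def using that
      by (intro UnI2 CollectI exI[of _ "\<Inter>H"] exI[of _ "R i"] exI[of _ z] conjI refl)
  qed
  ultimately show ?thesis unfolding cell_map_def attaching_map_def w(1,2) by simp
qed

text \<open>The whole point set is open, because all characteristic maps take their values in
  it.\<close>

lemma topspace_salvetti: "topspace (salvetti H) = sal_points H"
proof
  show "topspace (salvetti H) \<subseteq> sal_points H"
    using openin_topspace[of "salvetti H"] unfolding openin_salvetti salvetti_open_def by blast
  have "{t \<in> {0..1}. edge_path C D t \<in> sal_points H} = {0..1}" if "(C, D) \<in> sal_edges H" for C D
    using edge_path_points[OF that] by blast
  moreover have "{z \<in> cball 0 1. cell_map H F C z \<in> sal_points H} = cball 0 1" if "(F, C) \<in> sal_cells H" for F C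
    using that cell_map_points unfolding sal_cells_iff by blast
  ultimately have "openin (salvetti H) (sal_points H)"
    unfolding openin_salvetti salvetti_open_def by auto
  thus "sal_points H \<subseteq> topspace (salvetti H)" by (rule openin_subset)
qed

lemma pathin_edge_path: "(C, D) \<in> sal_edges H \<Longrightarrow> pathin (salvetti H) (edge_path C D)"
  unfolding pathin_def continuous_map_def topspace_salvetti openin_salvetti salvetti_open_def
  by (auto simp: edge_path_points)

lemma continuous_cell_map: "continuous_map (top_of_set (cball 0 1)) (salvetti H) (cell_map H (\<Inter>H) (R i))"
proof -
  have "(\<Inter>H, R i) \<in> sal_cells H" by (simp add: sal_cells_iff)
  thus ?thesis
    unfolding continuous_map_def topspace_salvetti openin_salvetti salvetti_open_def
    by (auto simp: cell_map_points simp del: mem_cball mem_cball_0)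
qed

lemma pathin_gallery_path: "w \<noteq> [] \<Longrightarrow> walk w \<Longrightarrow> pathin (salvetti H) (gallery_path (map R w))"
proof (induction w)
  case (Cons i w)
  show ?case
  proof (cases w)
    case Nil thus ?thesis by (simp add: pathin_const topspace_salvetti vertex_points)
  next
    case (Cons k w')
    hence e: "pathin (salvetti H) (edge_path (R i) (R k))" "walk w"
      using Cons.prems(2) by (auto intro!: pathin_edge_path walk_edges)
    show ?thesis
    proof (cases w')
      case Nil thus ?thesis using e \<open>w = k # w'\<close> by simp
    next
      case (Cons l w'')
      have "pathin (salvetti H) (gallery_path (map R w))" using Cons.IH e(2) \<open>w = k # w'\<close> by simp
      moreover have "gallery_path (map R w) 0 = Vertex (R k)"
        using gallery_path_ends[of "map R w"] \<open>w = k # w'\<close> by simp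
      ultimately have "pathin (salvetti H) (edge_path (R i) (R k) \<cdot> gallery_path (map R w))"
        using e(1) by (intro pathin_concat) simp_all
      thus ?thesis using \<open>w = k # w'\<close> \<open>w' = l # w''\<close> by simp
    qed
  qed
qed simp

text \<open>The two galleries are the images, under the characteristic map of the cell, of the two
  half circles from 1 to -1, and these are homotopic in the convex disc.\<close>

lemma cell_relation:
  "path_hom (salvetti H) (gallery_path (map R (up_word i))) (gallery_path (map R (down_word i)))"
proof (rule cell_words[of i])
  fix w w' assume w: "fst (cell_gallery_pair H (\<Inter>H) (R i)) = map R w"
    "snd (cell_gallery_pair H (\<Inter>H) (R i)) = map R w'"
    "w = up_word i \<and> w' = down_word i \<or> w = down_word i \<and> w' = up_word i"
  define s where "s t = sqrt (1 - (1 - 2 * t)\<^sup>2)" for t :: real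
  define f g where "f t = complex_of_real (1 - 2 * t) + \<i> * complex_of_real (s t)"
    and "g t = complex_of_real (1 - 2 * t) - \<i> * complex_of_real (s t)" for t
  have t_sq: "(1 - 2 * t)\<^sup>2 \<le> 1" if "0 \<le> t" "t \<le> 1" for t :: real
    using that by (intro abs_square_le_1[THEN iffD2]) (auto simp: abs_le_iff)
  have n1: "norm (f t) = 1 \<and> norm (g t) = 1" if "0 \<le> t" "t \<le> 1" for t
    using t_sq[OF that] by (simp add: cmod_def f_def g_def s_def)
  have s0: "s t \<ge> 0" if "0 \<le> t" "t \<le> 1" for t using t_sq[OF that] by (simp add: s_def)
  have s1: "t = 0 \<or> t = 1" if "s t = 0" for t using that by (auto simp: s_def power2_eq_1_iff)
  have fg: "Re (f t) = 1 - 2 * t" "Im (f t) = s t" "Re (g t) = 1 - 2 * t" "Im (g t) = - s t" for t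
    by (simp_all add: f_def g_def)
  have half: "(1 - (1 - 2 * t)) / 2 = t" for t :: real by simp
  note W = cell_word_facts[of w i] cell_word_facts[of w' i]
  have "path_hom (salvetti H) (gallery_path (map R w)) (gallery_path (map R w'))"
  proof (rule path_hom_convexI[OF convex_cball continuous_cell_map[of i], of f g])
    show "path f" "path g" unfolding path_def f_def g_def s_def by (intro continuous_intros)+
    show "path_image f \<subseteq> cball 0 1" "path_image g \<subseteq> cball 0 1"
      using n1 by (auto simp: path_image_def)
    show "pathstart f = pathstart g" "pathfinish f = pathfinish g"
      by (simp_all add: pathstart_def pathfinish_def f_def g_def s_def)
    fix t :: real assume t: "0 \<le> t" "t \<le> 1"
    show "gallery_path (map R w) t = cell_map H (\<Inter>H) (R i) (f t)"
      unfolding cell_map_def attaching_map_def w(1,2) fg half using n1[OF t] s0[OF t] by simp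
    show "gallery_path (map R w') t = cell_map H (\<Inter>H) (R i) (g t)"
    \<comment> \<open>At its two ends the lower half circle has imaginary part 0, where the
      attaching map takes the value of the upper gallery; there both galleries agree.\<close>
    proof (cases "s t = 0")
      case True
      thus ?thesis unfolding cell_map_def attaching_map_def w(1,2) fg half
        using n1[OF t] s1[OF True] W w(3) by auto
    next
      case False
      hence "s t > 0" using s0[OF t] by simp
      thus ?thesis unfolding cell_map_def attaching_map_def w(1,2) fg half using n1[OF t] by simp
    qed
  qed
  thus ?thesis using w(3) path_hom_sym by blast
qed


section \<open>Generators and relations of the fundamental group\<close>

text \<open>The representative of \<open>i\<close> between \<open>1 - m\<close> and \<open>m\<close>
  decides the direction; in particular the opposite region is reached on the ascending side.\<close>

definition tree_word :: "int \<Rightarrow> int list" where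
  "tree_word i = (let r = i mod (2 * int m) in if r \<le> int m then [0..r] else rev [r - 2 * int m..0])"

text \<open>The chosen index is immaterial, since \<open>tree_word\<close> depends on it only modulo
  \<open>2 * m\<close>.\<close>

definition tree :: "'a sal_point \<Rightarrow> real \<Rightarrow> 'a sal_point" where
  "tree p = gallery_path (map R (tree_word (SOME i. p = Vertex (R i))))"

lemma tree_R: "tree (Vertex (R i)) = gallery_path (map R (tree_word i))"
proof -
  have "Vertex (R i) = Vertex (R (SOME k. Vertex (R i) = Vertex (R k)))" by (rule someI) (rule refl)
  hence "R (SOME k. Vertex (R i) = Vertex (R k)) = R i" by simp
  hence "tree_word (SOME k. Vertex (R i) = Vertex (R k)) = tree_word i"
    unfolding R_eq_iff tree_word_def by simp
  thus ?thesis by (simp add: tree_def)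
qed

lemma tree_word_up: "0 \<le> i \<Longrightarrow> i \<le> int m \<Longrightarrow> tree_word i = [0..i]"
proof -
  assume "0 \<le> i" "i \<le> int m"
  moreover from this m3 have "i mod (2 * int m) = i" by (intro mod_pos_pos_trivial) linarith+
  ultimately show ?thesis by (simp add: tree_word_def)
qed

lemma tree_word_down: "- int m < i \<Longrightarrow> i \<le> 0 \<Longrightarrow> tree_word i = rev [i..0]"
proof (cases "i = 0")
  case False
  assume i: "- int m < i" "i \<le> 0"
  have "i mod (2 * int m) = (i + 2 * int m) mod (2 * int m)" by simp
  also have "\<dots> = i + 2 * int m" by (rule mod_pos_pos_trivial) (use i False m3 in linarith)+
  finally show ?thesis using i by (simp add: tree_word_def)
qed (simp add: tree_word_up)

lemma tree_word_facts: "tree_word i \<noteq> []" "walk (tree_word i)" "hd (tree_word i) = 0" "R (last (tree_word i)) = R i"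
proof -
  obtain z where z: "- int m < z" "z \<le> int m" "R i = R z" by (rule region_repr)
  have e: "tree_word i = tree_word z" using z(3) unfolding R_eq_iff tree_word_def by simp
  have "tree_word z = [0..z] \<and> 0 \<le> z \<or> tree_word z = rev [z..0] \<and> z \<le> 0" using tree_word_up tree_word_down z by force
  thus "tree_word i \<noteq> []" "walk (tree_word i)" "hd (tree_word i) = 0" "R (last (tree_word i)) = R i"
    unfolding e z(3) using upto_ends[of 0 z] upto_ends[of z 0] walk_upto walk_rev by (auto simp: hd_rev last_rev)
qed

lemma tree_based: "based_paths (salvetti H) (Vertex B) (Vertex ` range R) tree"
proof
  fix p assume "p \<in> Vertex ` range R"
  then obtain i where p: "p = Vertex (R i)" by blast
  show "pathin (salvetti H) (tree p)" "tree p 0 = Vertex B" "tree p 1 = p"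
    unfolding p tree_R using pathin_gallery_path gallery_path_ends[of "map R (tree_word i)"] tree_word_facts[of i]
    by (simp_all add: hd_map last_map B_R)
qed

sublocale T: based_paths "salvetti H" "Vertex B" "Vertex ` range R" tree
  by (rule tree_based)

abbreviation "SG \<equiv> sal_group H B"

lemma group_SG: "group SG"
  by (rule group_fundamental_group) (simp add: topspace_salvetti B_R vertex_points)

sublocale SG: group SG by (rule group_SG)

definition up_class :: "int \<Rightarrow> (real \<Rightarrow> 'a sal_point) set" where
  "up_class i = T.closed_up (edge_path (R i) (R (i + 1)))"

definition down_class :: "int \<Rightarrow> (real \<Rightarrow> 'a sal_point) set" where
  "down_class i = T.closed_up (edge_path (R (i + 1)) (R i))"

lemma class_closed: "up_class i \<in> carrier SG" "down_class i \<in> carrier SG"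
  unfolding up_class_def down_class_def
  by (intro T.closed_up_carrier pathin_edge_path walk_edges; simp)+

lemma class_period: "up_class (i + 2 * int m) = up_class i" "down_class (i + 2 * int m) = down_class i"
proof -
  have "R (i + 2 * int m) = R i" "R (i + 2 * int m + 1) = R (i + 1)" unfolding R_eq_iff by (simp_all add: add.assoc add.commute[of _ 1] flip: add.assoc)
  thus "up_class (i + 2 * int m) = up_class i" "down_class (i + 2 * int m) = down_class i"
    by (simp_all add: up_class_def down_class_def)
qed

text \<open>A single edge is a case of its own: its gallery path is the bare edge path, with no
  constant path appended.\<close>

lemma closed_up_Cons:
  assumes "walk (i # w)" "w \<noteq> []"
  shows "T.closed_up (gallery_path (map R (i # w))) =
    T.closed_up (edge_path (R i) (R (hd w))) \<otimes>\<^bsub>SG\<^esub> T.closed_up (gallery_path (map R w))"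
proof -
  have e: "pathin (salvetti H) (edge_path (R i) (R (hd w)))" "walk w"
    using assms by (cases w; auto intro!: pathin_edge_path walk_edges)+
  have ends: "gallery_path (map R w) 0 = Vertex (R (hd w))" "gallery_path (map R w) 1 = Vertex (R (last w))"
    using gallery_path_ends[of "map R w"] assms(2) by (simp_all add: hd_map last_map)
  show ?thesis
  proof (cases "tl w = []")
    case True
    then obtain k where k: "w = [k]" using assms(2) by (cases w) auto
    have "T.closed_up (edge_path (R i) (R k)) \<in> carrier SG"
      using e(1) k by (intro T.closed_up_carrier) auto
    thus ?thesis using k by (simp add: T.closed_up_const)
  next
    case False
    hence g: "gallery_path (map R (i # w)) = edge_path (R i) (R (hd w)) \<cdot> gallery_path (map R w)"
      using gallery_path_Cons[of "map R w" "R i"] assms(2) by (simp add: hd_map map_tl[symmetric])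
    show ?thesis unfolding g
      using e pathin_gallery_path[OF assms(2)] ends by (intro T.closed_up_concat) auto
  qed
qed

lemma closed_up_up: "T.closed_up (gallery_path (map R [i..i + int d])) = list_prod SG (map up_class [i..i + int d - 1])"
proof (induction d arbitrary: i)
  case 0 show ?case by (simp add: T.closed_up_const)
next
  case (Suc d)
  have l: "[i..i + int (Suc d)] = i # [i + 1..(i + 1) + int d]" "[i..i + int (Suc d) - 1] = i # [i + 1..(i + 1) + int d - 1]"
    by (simp_all add: upto_rec1 add.assoc)
  have w: "[i + 1..(i + 1) + int d] \<noteq> []" "hd [i + 1..(i + 1) + int d] = i + 1" by (rule upto_ends; simp)+
  have "walk (i # [i + 1..(i + 1) + int d])" using walk_upto[of i "i + int (Suc d)"] unfolding l .
  from closed_up_Cons[OF this w(1)] show ?case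
    unfolding l w(2) Suc.IH by (simp add: up_class_def[of i])
qed

lemma closed_up_down:
  "T.closed_up (gallery_path (map R (rev [i - int d..i]))) = list_prod SG (map down_class (rev [i - int d..i - 1]))"
proof (induction d arbitrary: i)
  case 0 show ?case by (simp add: T.closed_up_const)
next
  case (Suc d)
  have l: "rev [i - int (Suc d)..i] = i # rev [(i - 1) - int d..i - 1]"
    "rev [i - int (Suc d)..i - 1] = (i - 1) # rev [(i - 1) - int d..(i - 1) - 1]"
    by (simp_all add: upto_rec2 diff_diff_eq add.commute)
  have "(i - 1) - int d \<le> i - 1" by simp
  from upto_ends[OF this] have w: "rev [(i - 1) - int d..i - 1] \<noteq> []" "hd (rev [(i - 1) - int d..i - 1]) = i - 1"
    by (simp_all only: hd_rev rev_is_Nil_conv not_False_eq_True)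
  have "walk (i # rev [(i - 1) - int d..i - 1])"
    using walk_rev[OF walk_upto[of "i - int (Suc d)" i]] unfolding l .
  from closed_up_Cons[OF this w(1)] show ?case
    unfolding l w(2) Suc.IH by (simp add: down_class_def[of "i - 1"])
qed

lemma cell_prod_relation:
  "list_prod SG (map up_class [i..i + int m - 1]) = list_prod SG (map down_class (rev [i - int m..i - 1]))"
proof -
  have "T.closed_up (gallery_path (map R (up_word i))) = T.closed_up (gallery_path (map R (down_word i)))"
    using cell_word_facts[of "up_word i" i] by (intro T.closed_up_hom[OF cell_relation]) auto
  thus ?thesis unfolding closed_up_up closed_up_down .
qed

lemma tree_base: "tree (Vertex B) = (\<lambda>_. Vertex B)"
  unfolding B_R tree_R by (simp add: tree_word_up)

lemma closed_up_tree: "T.closed_up (gallery_path (map R (tree_word i))) = \<one>\<^bsub>SG\<^esub>"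
  using T.closed_up_tau[of "Vertex (R i)", OF _ _ tree_base] by (simp add: B_R tree_R)

text \<open>The tree paths with \<open>j\<close> and with \<open>j + 1\<close> edges both close up
  to the identity, and they differ by this one edge.\<close>

lemma up_class_tree: "j < m \<Longrightarrow> up_class (int j) = \<one>\<^bsub>SG\<^esub>"
proof -
  assume j: "j < m"
  have p: "list_prod SG (map up_class [0..int d - 1]) = \<one>\<^bsub>SG\<^esub>" if "d \<le> m" for d
    using closed_up_tree[of "int d"] closed_up_up[of 0 d] tree_word_up[of "int d"] that by simp
  have "[0..int (Suc j) - 1] = [0..int j - 1] @ [int j]" using upto_rec2[of 0 "int j"] by simp
  hence "list_prod SG (map up_class [0..int (Suc j) - 1]) =
      list_prod SG (map up_class [0..int j - 1]) \<otimes>\<^bsub>SG\<^esub> list_prod SG [up_class (int j)]"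
    by (simp only: map_append list.map) (rule SG.list_prod_append; use class_closed in auto)
  thus ?thesis using p[of j] p[of "Suc j"] j class_closed by (simp del: of_nat_Suc)
qed

lemma down_class_tree: "j < m \<Longrightarrow> down_class (- int j - 1) = \<one>\<^bsub>SG\<^esub>"
proof -
  assume j: "j < m"
  have p: "list_prod SG (map down_class (rev [- int d..- 1])) = \<one>\<^bsub>SG\<^esub>" if "d \<le> m" for d
  \<comment> \<open>The descending side of the tree ends one edge short of the opposite region. That
    the complete descending path is trivial as well follows from the 2-cell at the base region,
    whose ascending side lies in the tree.\<close>
  proof (cases "d = m")
    case True
    have "up_class i = \<one>\<^bsub>SG\<^esub>" if "i \<in> set [0..int m - 1]" for i
      using up_class_tree[of "nat i"] that by (simp add: nat_less_iff)
    hence "list_prod SG (map up_class [0..int m - 1]) = \<one>\<^bsub>SG\<^esub>"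
      by (intro SG.list_prod_ones) (auto simp only: set_map image_iff)
    thus ?thesis using cell_prod_relation[of 0] True by simp
  next
    case False
    thus ?thesis using closed_up_tree[of "- int d"] closed_up_down[of 0 d] tree_word_down[of "- int d"] that by simp
  qed
  have s: "- int (Suc j) = - int j - 1" by simp
  have "[- int j - 1..- 1] = (- int j - 1) # [- int j..- 1]" using upto_rec1[of "- int j - 1" "- 1"] by simp
  hence "rev [- int (Suc j)..- 1] = rev [- int j..- 1] @ [- int j - 1]" unfolding s by (simp only: rev.simps)
  hence "list_prod SG (map down_class (rev [- int (Suc j)..- 1])) =
      list_prod SG (map down_class (rev [- int j..- 1])) \<otimes>\<^bsub>SG\<^esub> list_prod SG [down_class (- int j - 1)]"
    by (simp only: map_append list.map) (rule SG.list_prod_append; use class_closed in auto)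
  thus ?thesis using p[of j] p[of "Suc j"] j class_closed by (simp del: of_nat_Suc)
qed

definition xg :: "nat \<Rightarrow> (real \<Rightarrow> 'a sal_point) set" where "xg j = down_class (int j)"
definition yg :: "nat \<Rightarrow> (real \<Rightarrow> 'a sal_point) set" where "yg j = up_class (int m + int j)"

lemma class_mod: "up_class (i mod (2 * int m)) = up_class i" "down_class (i mod (2 * int m)) = down_class i"
proof -
  have "R (i mod (2 * int m)) = R i" "R (i mod (2 * int m) + 1) = R (i + 1)" unfolding R_eq_iff by (simp_all add: mod_simps)
  thus "up_class (i mod (2 * int m)) = up_class i" "down_class (i mod (2 * int m)) = down_class i"
    by (simp_all add: up_class_def down_class_def)
qed

lemma up_class_label: "up_class = label_up SG m yg"
proof
  fix i :: int
  define r where "r = i mod (2 * int m)"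
  have r: "0 \<le> r" "r < 2 * int m" using mod_bounds unfolding r_def by auto
  show "up_class i = label_up SG m yg i"
  proof (cases "r < int m")
    case True
    hence "up_class r = \<one>\<^bsub>SG\<^esub>" using up_class_tree[of "nat r"] r by simp
    thus ?thesis using class_mod(1)[of i] True by (simp add: label_up_def r_def)
  next
    case False
    thus ?thesis using class_mod(1)[of i] r by (simp add: label_up_def r_def yg_def)
  qed
qed

lemma down_class_label: "down_class = label_down SG m xg"
proof
  fix i :: int
  define r where "r = i mod (2 * int m)"
  have r: "0 \<le> r" "r < 2 * int m" using mod_bounds unfolding r_def by auto
  show "down_class i = label_down SG m xg i"
  proof (cases "r < int m")
    case True
    thus ?thesis using class_mod(2)[of i] r by (simp add: label_down_def r_def xg_def)
  next
    case False
    hence "down_class (r - 2 * int m) = \<one>\<^bsub>SG\<^esub>" using down_class_tree[of "nat (2 * int m - r - 1)"] r by simp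
    hence "down_class r = \<one>\<^bsub>SG\<^esub>" using class_period(2)[of "r - 2 * int m"] by simp
    thus ?thesis using class_mod(2)[of i] False by (simp add: label_down_def r_def)
  qed
qed

lemma pencil_rel_SG: "pencil_rel SG m xg yg"
  unfolding pencil_rel_def
proof (intro conjI allI impI)
  have xy: "xg i \<in> carrier SG" "yg i \<in> carrier SG" for i by (simp_all add: xg_def yg_def class_closed)
  thus "xg i \<in> carrier SG" "yg i \<in> carrier SG" for i by auto
  fix i assume i: "i \<le> m"
  note P = SG.label_prods[OF i, of xg yg]
  show "list_prod SG (map yg [0..<i]) = list_prod SG (map xg (rev [0..<i]))"
    using P(1,2) xy cell_prod_relation[of "int i"] unfolding up_class_label down_class_label by simp
  show "list_prod SG (map yg [i..<m]) = list_prod SG (map xg (rev [i..<m]))"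
    using P(3,4) xy cell_prod_relation[of "int m + int i"] unfolding up_class_label down_class_label
    by (simp add: add.commute)
qed

end

section \<open>The shard generators and the full twist\<close>

context rank2_arrangement
begin

lemma edge_loop_eq:
  assumes "gal H B (R i) = map R (tree_word i)" "k = i + 1 \<or> k = i - 1"
  shows "edge_loop H B (R i) (R k) =
    T.closed_up (edge_path (R i) (R k)) \<otimes>\<^bsub>SG\<^esub> T.closed_up (edge_path (R k) (R i))"
proof -
  let ?t = "tree (Vertex (R i))" and ?e = "edge_path (R i) (R k)" and ?f = "edge_path (R k) (R i)"
  have e: "pathin (salvetti H) ?e" "pathin (salvetti H) ?f"
    using assms(2) by (auto intro!: pathin_edge_path walk_edges)
  have t: "pathin (salvetti H) ?t" "?t 0 = Vertex B" "?t 1 = Vertex (R i)" using T.tau[of "Vertex (R i)"] by auto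
  have h: "path_hom (salvetti H) (?t \<cdot> ((?e \<cdot> ?f) \<cdot> path_reverse ?t)) (?t \<cdot> ?e \<cdot> ?f \<cdot> path_reverse ?t)"
    using e t by (intro path_hom_concat path_hom_assoc path_hom_refl pathin_reverse) simp_all
  have l: "?t \<cdot> ((?e \<cdot> ?f) \<cdot> path_reverse ?t) \<in> loops (salvetti H) (Vertex B)"
    using T.closed_up_loop[OF pathin_concat[OF e]] by simp
  hence r: "?t \<cdot> ?e \<cdot> ?f \<cdot> path_reverse ?t \<in> loops (salvetti H) (Vertex B)"
    using path_hom_pathin(2)[OF h] path_hom_ends[OF h] unfolding loops_def by simp
  have "edge_loop H B (R i) (R k) = T.closed_up (?e \<cdot> ?f)"
    unfolding edge_loop_def assms(1) T.closed_up_def using loop_class_eq_iff[OF l r] h by (simp add: tree_R)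
  thus ?thesis using e by (simp add: T.closed_up_concat)
qed

text \<open>The edge away from the base region lies in the tree and closes up to the identity, so
  only the class of the returning edge remains.\<close>

lemma edge_loop_up: "j < m \<Longrightarrow> edge_loop H B (R (int j)) (R (int j + 1)) = xg j"
proof -
  assume j: "j < m"
  have "gal H B (R (int j)) = map R (tree_word (int j))"
    using min_gallery_cases[OF min_gallery_gal[of 0 "int j"], of j] j by (simp add: B_R tree_word_up)
  from edge_loop_eq[OF this, of "int j + 1"] show ?thesis
    using up_class_tree[OF j] class_closed unfolding up_class_def[symmetric] down_class_def[symmetric]
    by (simp add: xg_def up_class_def[symmetric] down_class_def[symmetric])
qed

text \<open>On the descending side the returning edge has the ascending index
  \<open>- j - 1\<close>, which is \<open>m + (m - 1 - j)\<close> modulo \<open>2 * m\<close>; hence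
  the reversed numbering.\<close>

lemma edge_loop_down: "j < m \<Longrightarrow> edge_loop H B (R (- int j)) (R (- int j - 1)) = yg (m - 1 - j)"
proof -
  assume j: "j < m"
  have g: "gal H B (R (- int j)) = map R (tree_word (- int j))"
    using min_gallery_cases_neg[OF min_gallery_gal[of 0 "- int j"], of j] j by (simp add: B_R tree_word_down)
  have "edge_loop H B (R (- int j)) (R (- int j - 1)) = down_class (- int j - 1) \<otimes>\<^bsub>SG\<^esub> up_class (- int j - 1)"
    unfolding edge_loop_eq[OF g disjI2[OF refl]] down_class_def up_class_def by simp
  also have "\<dots> = up_class (- int j - 1)" using down_class_tree[OF j] class_closed by simp
  also have "\<dots> = up_class (- int j - 1 + 2 * int m)" by (simp only: class_period)
  also have "- int j - 1 + 2 * int m = int m + int (m - 1 - j)" using j by simp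
  finally show ?thesis by (simp add: yg_def)
qed

lemma shard_generators_eq: "shard_generators H B = xg ` {..<m} \<union> yg ` {..<m}"
proof (intro equalityI subsetI)
  fix g assume "g \<in> shard_generators H B"
  then obtain C D where g: "g = edge_loop H B C D" and c: "covers (weak_order H B) C D"
    unfolding shard_generators_def by blast
  from c[unfolded covers_weak] show "g \<in> xg ` {..<m} \<union> yg ` {..<m}"
  proof (elim disjE exE conjE)
    fix j assume "j < m" "C = R (int j)" "D = R (int j + 1)"
    thus ?thesis using g edge_loop_up[of j] by auto
  next
    fix j assume j: "j < m" "C = R (- int j)" "D = R (- int j - 1)"
    hence "m - 1 - j \<in> {..<m}" by auto
    thus ?thesis using g edge_loop_down[of j] j by (intro UnI2) (auto simp only: image_iff)
  qed
next
  fix g assume "g \<in> xg ` {..<m} \<union> yg ` {..<m}"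
  thus "g \<in> shard_generators H B"
  proof (elim UnE imageE)
    fix j assume j: "g = xg j" "j \<in> {..<m}"
    hence "covers (weak_order H B) (R (int j)) (R (int j + 1))" unfolding covers_weak by blast
    thus ?thesis unfolding shard_generators_def using edge_loop_up[of j] j by blast
  next
    fix j assume j: "g = yg j" "j \<in> {..<m}"
    hence l: "m - 1 - j < m" "m - 1 - (m - 1 - j) = j" by auto
    hence "covers (weak_order H B) (R (- int (m - 1 - j))) (R (- int (m - 1 - j) - 1))" unfolding covers_weak by blast
    thus ?thesis unfolding shard_generators_def using edge_loop_down[OF l(1)] j(1) l(2) by fastforce
  qed
qed

text \<open>Between opposite regions \<open>gal\<close> may pick either of two galleries; the cell
  relations make the choice immaterial. Taken upwards the way out is trivial, and taken downwards
  the way back spells the x-word.\<close>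

lemma full_twist_eq: "full_twist H B = list_prod SG (map xg (rev [0..<m]))"
proof -
  have xy: "xg i \<in> carrier SG \<and> yg i \<in> carrier SG" for i by (simp add: xg_def yg_def class_closed)
  have opp: "opposite H B = R (int m)" using opposite_R[of 0] by (simp add: B_R)
  have per: "R 0 = R (int m + int m)" using R_period[of 0 1] by simp
  have g1: "gal H B (opposite H B) = map R (up_word 0) \<or> gal H B (opposite H B) = map R (down_word 0)"
    using min_gallery_cases[OF min_gallery_gal[of 0 "int m"], of m] unfolding opp unfolding B_R by simp
  have g2: "gal H (opposite H B) B = map R (up_word (int m)) \<or> gal H (opposite H B) B = map R (down_word (int m))"
    using min_gallery_cases[OF min_gallery_gal[of "int m" 0] per] unfolding opp unfolding B_R by simp
  obtain w1 where w1: "gal H B (opposite H B) = map R w1" "w1 = up_word 0 \<or> w1 = down_word 0" using g1 by blast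
  obtain w2 where w2: "gal H (opposite H B) B = map R w2" "w2 = up_word (int m) \<or> w2 = down_word (int m)" using g2 by blast
  note W1 = cell_word_facts[OF w1(2)] and W2 = cell_word_facts[OF w2(2)]
  have p: "pathin (salvetti H) (gallery_path (map R w1))" "pathin (salvetti H) (gallery_path (map R w2))"
    using W1 W2 by (simp_all add: pathin_gallery_path)
  have ends: "gallery_path (map R w1) 0 = Vertex B" "gallery_path (map R w1) 1 = Vertex (R (int m))"
    "gallery_path (map R w2) 0 = Vertex (R (int m))" "gallery_path (map R w2) 1 = Vertex B"
    using W1 W2 per by (simp_all add: B_R)
  have V: "Vertex B \<in> Vertex ` range R" by (simp add: B_R)
  have l: "gallery_path (map R w1) \<cdot> gallery_path (map R w2) \<in> loops (salvetti H) (Vertex B)"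
    using p ends by (auto simp: loops_def intro!: pathin_concat)
  have "full_twist H B = T.closed_up (gallery_path (map R w1) \<cdot> gallery_path (map R w2))"
    unfolding full_twist_def w1(1) w2(1) by (rule T.closed_up_loop_class[OF l V tree_base, symmetric])
  also have "\<dots> = T.closed_up (gallery_path (map R w1)) \<otimes>\<^bsub>SG\<^esub> T.closed_up (gallery_path (map R w2))"
    using p ends V by (intro T.closed_up_concat) simp_all
  also have "T.closed_up (gallery_path (map R w1)) = list_prod SG (map up_class [0..0 + int m - 1])"
    using w1(2) closed_up_up[of 0 m] closed_up_down[of 0 m] cell_prod_relation[of 0] by auto
  also have "\<dots> = \<one>\<^bsub>SG\<^esub>"
    using SG.label_prods(1)[of 0 m xg yg] xy unfolding up_class_label by simp
  also have "T.closed_up (gallery_path (map R w2)) = list_prod SG (map down_class (rev [int m - int m..int m - 1]))"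
    using w2(2) closed_up_up[of "int m" m] closed_up_down[of "int m" m] cell_prod_relation[of "int m"] by auto
  also have "\<dots> = list_prod SG (map xg (rev [0..<m]))"
    using SG.label_prods(2)[of m m xg yg] xy unfolding down_class_label by simp
  finally show ?thesis using class_closed by (simp add: xg_def image_subset_iff)
qed


section \<open>Maps from the Salvetti complex to the twice punctured plane\<close>

abbreviation P2 :: "complex set" where "P2 \<equiv> - {0, 1}"

definition rep :: "(real \<Rightarrow> complex) set \<Rightarrow> real \<Rightarrow> complex" where
  "rep P = (SOME p. p \<in> loops (top_of_set P2) 2 \<and> P = loop_class (top_of_set P2) 2 p)"

lemma rep: "P \<in> carrier plane2 \<Longrightarrow> rep P \<in> loops (top_of_set P2) 2 \<and> loop_class (top_of_set P2) 2 (rep P) = P"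
proof -
  assume "P \<in> carrier plane2"
  then obtain p where "p \<in> loops (top_of_set P2) 2" "P = loop_class (top_of_set P2) 2 p"
    by (rule fundamental_group_carrierE)
  hence "\<exists>p. p \<in> loops (top_of_set P2) 2 \<and> P = loop_class (top_of_set P2) 2 p" by blast
  from someI_ex[OF this] show ?thesis unfolding rep_def by auto
qed

lemma group_plane2: "group plane2" by (rule group_fundamental_group) simp

interpretation K: group plane2 by (rule group_plane2)

text \<open>The two neighbours of a region differ, so an ordered pair of regions is not both an
  ascending and a descending edge. This makes the image of an edge well defined.\<close>

lemma R_edge_unique: "R i = R k \<Longrightarrow> R (i + 1) \<noteq> R (k - 1)"
proof
  assume "R i = R k" "R (i + 1) = R (k - 1)"
  hence d: "2 * int m dvd i - k" "2 * int m dvd (i + 1) - (k - 1)" unfolding R_eq_iff mod_eq_dvd_iff by auto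
  have "2 * int m dvd ((i + 1) - (k - 1)) - (i - k)" by (rule dvd_diff[OF d(2,1)])
  moreover have "((i + 1) - (k - 1)) - (i - k) = 2" by simp
  ultimately have "2 * int m dvd 2" by (simp only:)
  hence "2 * int m \<le> 2" by (intro zdvd_imp_le) auto
  thus False using m3 by simp
qed

context
  fixes x' y' :: "nat \<Rightarrow> (real \<Rightarrow> complex) set"
  assumes rel': "pencil_rel plane2 m x' y'"
begin

abbreviation "LU \<equiv> label_up plane2 m y'"
abbreviation "LD \<equiv> label_down plane2 m x'"

lemma label_closed: "LU i \<in> carrier plane2" "LD i \<in> carrier plane2"
proof -
  have "nat (i mod (2 * int m) - int m) < m" if "\<not> i mod (2 * int m) < int m" using mod_bounds[of i] that by linarith
  thus "LU i \<in> carrier plane2" using rel' unfolding label_up_def pencil_rel_def by auto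
  have "nat (i mod (2 * int m)) < m" if "i mod (2 * int m) < int m" using mod_bounds[of i] that by linarith
  thus "LD i \<in> carrier plane2" using rel' unfolding label_down_def pencil_rel_def by auto
qed

text \<open>Labels depend on the index modulo \<open>2 * m\<close> only, so \<open>i\<close> may be
  reduced to the range from 0 to \<open>2 * m - 1\<close>. Up to \<open>m\<close> the first pencil
  equation applies, beyond \<open>m\<close> the second.\<close>

lemma label_relation:
  "list_prod plane2 (map LU [i..i + int m - 1]) = list_prod plane2 (map LD (rev [i - int m..i - 1]))"
proof -
  have xy: "x' i \<in> carrier plane2 \<and> y' i \<in> carrier plane2" if "i < m" for i
    using rel' that unfolding pencil_rel_def by blast
  define r where "r = i mod (2 * int m)"
  have r: "0 \<le> r" "r < 2 * int m" using mod_bounds unfolding r_def by auto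
  have sh: "map f [r + d..r + e] = map f [i + d..i + e]"
    if fm: "\<And>k. f k = f (k mod (2 * int m))" for f :: "int \<Rightarrow> (real \<Rightarrow> complex) set" and d e
  proof -
    have "f (r + d + int k) = f (i + d + int k)" for k
      using fm[of "r + d + int k"] fm[of "i + d + int k"] by (simp add: r_def add.assoc mod_simps)
    thus ?thesis by (intro nth_equalityI) (auto simp: nth_upto)
  qed
  have goal: "list_prod plane2 (map LU [r..r + int m - 1]) = list_prod plane2 (map LD (rev [r - int m..r - 1]))"
  proof (cases "r \<le> int m")
    case True
    hence "nat r \<le> m" "int (nat r) = r" using r by auto
    thus ?thesis using K.label_prods(1,2)[of "nat r" m x' y'] xy rel' unfolding pencil_rel_def by simp
  next
    case False
    hence e: "nat (r - int m) \<le> m" "int m + int (nat (r - int m)) = r" "int (nat (r - int m)) = r - int m" using r by auto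
    have "r + int m - 1 = int m + int (nat (r - int m)) + int m - 1" "r - int m + int m - 1 = r - 1" using e by auto
    thus ?thesis using K.label_prods(3,4)[OF e(1), of x' y'] xy rel' e unfolding pencil_rel_def by simp
  qed
  have "map LU [r + 0..r + (int m - 1)] = map LU [i + 0..i + (int m - 1)]" by (rule sh) (simp add: label_up_def)
  moreover have "map LD [r + (- int m)..r + (- 1)] = map LD [i + (- int m)..i + (- 1)]" by (rule sh) (simp add: label_down_def)
  ultimately show ?thesis using goal by (simp add: rev_map[symmetric] add_diff_eq)
qed

definition edge_img :: "'a set \<Rightarrow> 'a set \<Rightarrow> real \<Rightarrow> complex" where
  "edge_img C D = (if \<exists>i. C = R i \<and> D = R (i + 1)
     then rep (LU (SOME i. C = R i \<and> D = R (i + 1))) else rep (LD (SOME i. C = R (i + 1) \<and> D = R i)))"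

lemma label_cong: "R i = R k \<Longrightarrow> LU i = LU k \<and> LD i = LD k"
  unfolding R_eq_iff label_up_def label_down_def by simp

lemma edge_img_up: "edge_img (R i) (R (i + 1)) = rep (LU i)"
proof -
  have ex: "R i = R i \<and> R (i + 1) = R (i + 1)" by simp
  hence "R i = R (SOME k. R i = R k \<and> R (i + 1) = R (k + 1))"
    by (rule someI2[of "\<lambda>k. R i = R k \<and> R (i + 1) = R (k + 1)"]) blast
  from label_cong[OF this] show ?thesis unfolding edge_img_def using ex by auto
qed

lemma edge_img_down: "edge_img (R (i + 1)) (R i) = rep (LD i)"
proof -
  have no: "\<nexists>k. R (i + 1) = R k \<and> R i = R (k + 1)"
  proof (intro notI, elim exE conjE)
    fix k assume "R (i + 1) = R k" "R i = R (k + 1)"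
    thus False using R_edge_unique[of k "i + 1"] by simp
  qed
  have ex: "R (i + 1) = R (i + 1) \<and> R i = R i" by simp
  hence "R i = R (SOME k. R (i + 1) = R (k + 1) \<and> R i = R k)"
    by (rule someI2[of "\<lambda>k. R (i + 1) = R (k + 1) \<and> R i = R k"]) blast
  from label_cong[OF this] show ?thesis unfolding edge_img_def using no by auto
qed

text \<open>The values \<open>f\<close> on open 2-cells are a parameter, since galleries never meet
  these cells. Classes of images of galleries are computed with the constant 2 as a placeholder;
  afterwards \<open>f\<close> is chosen so as to extend the boundary values continuously.\<close>

definition sal_map :: "('a set \<Rightarrow> complex \<Rightarrow> complex) \<Rightarrow> 'a sal_point \<Rightarrow> complex" where
  "sal_map f p = (case p of Vertex C \<Rightarrow> 2 | Edge C D t \<Rightarrow> edge_img C D t | Cell F C z \<Rightarrow> f C z)"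

lemma edge_img_loop: "(C, D) \<in> sal_edges H \<Longrightarrow> edge_img C D \<in> loops (top_of_set P2) 2"
proof (erule sal_edgesE)
  fix i assume "C = R i" "D = R (i + 1)"
  thus ?thesis using rep[OF label_closed(1)] by (simp add: edge_img_up)
next
  fix i assume "C = R (i + 1)" "D = R i"
  thus ?thesis using rep[OF label_closed(2)] by (simp add: edge_img_down)
qed

lemma sal_map_edge_path:
  assumes "(C, D) \<in> sal_edges H" "0 \<le> t" "t \<le> 1" shows "sal_map f (edge_path C D t) = edge_img C D t"
  using edge_img_loop[OF assms(1)] assms(2,3) by (auto simp: sal_map_def edge_path_def loops_def)

lemma sal_map_gallery: "g \<noteq> [] \<Longrightarrow> sal_map f (gallery_path g t) = sal_map f' (gallery_path g t)"
proof (induction g arbitrary: t rule: gallery_path.induct)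
  case (4 C D E g)
  thus ?case by (simp add: path_concat_def) (simp add: sal_map_def edge_path_def)
qed (simp_all add: sal_map_def edge_path_def)

definition img_class :: "(real \<Rightarrow> 'a sal_point) \<Rightarrow> (real \<Rightarrow> complex) set" where
  "img_class p = loop_class (top_of_set P2) 2 (sal_map (\<lambda>_ _. 2) \<circ> p)"

definition img_loop :: "(real \<Rightarrow> 'a sal_point) \<Rightarrow> bool" where
  "img_loop p \<longleftrightarrow> sal_map (\<lambda>_ _. 2) \<circ> p \<in> loops (top_of_set P2) 2"

lemma loops_cong:
  assumes "p \<in> loops Z z" "\<And>t. 0 \<le> t \<Longrightarrow> t \<le> 1 \<Longrightarrow> q t = p t"
  shows "q \<in> loops Z z" "loop_class Z z q = loop_class Z z p"
proof -
  have p: "pathin Z p" "p 0 = z" "p 1 = z" using assms(1) by (auto simp: loops_def)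
  have h: "path_hom Z q p"
    by (rule path_hom_convexI[OF _ p(1)[unfolded pathin_def], of "\<lambda>t. t" "\<lambda>t. t"])
      (use assms(2) in \<open>auto simp: path_def path_image_def\<close>)
  show q: "q \<in> loops Z z" using path_hom_pathin(1)[OF h] p assms(2)[of 0] assms(2)[of 1] by (simp add: loops_def)
  show "loop_class Z z q = loop_class Z z p" using loop_class_eq_iff[OF q assms(1)] h by simp
qed

lemma img_edge:
  assumes "(C, D) \<in> sal_edges H"
  shows "img_loop (edge_path C D)" "img_class (edge_path C D) = loop_class (top_of_set P2) 2 (edge_img C D)"
  unfolding img_loop_def img_class_def
  using loops_cong[OF edge_img_loop[OF assms], of "sal_map (\<lambda>_ _. 2) \<circ> edge_path C D"] sal_map_edge_path[OF assms]
  by simp_all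

lemma img_edge_up: "img_class (edge_path (R i) (R (i + 1))) = LU i"
  using img_edge(2)[OF walk_edges, of "i + 1" i] rep[OF label_closed(1)] by (simp add: edge_img_up)

lemma img_edge_down: "img_class (edge_path (R (i + 1)) (R i)) = LD i"
  using img_edge(2)[OF walk_edges, of i "i + 1"] rep[OF label_closed(2)] by (simp add: edge_img_down)

lemma img_concat:
  assumes "img_loop p" "img_loop q"
  shows "img_loop (p \<cdot> q)" "img_class (p \<cdot> q) = img_class p \<otimes>\<^bsub>plane2\<^esub> img_class q"
  using assms unfolding img_loop_def img_class_def compose_concat by (simp_all add: concat_loops loop_class_mult)

lemma img_const: "img_loop (\<lambda>_. Vertex C)" "img_class (\<lambda>_. Vertex C) = \<one>\<^bsub>plane2\<^esub>"
proof -
  have e: "sal_map (\<lambda>_ _. 2) \<circ> (\<lambda>_. Vertex C) = (\<lambda>_. 2)" by (auto simp: sal_map_def)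
  show "img_loop (\<lambda>_. Vertex C)" "img_class (\<lambda>_. Vertex C) = \<one>\<^bsub>plane2\<^esub>"
    unfolding img_loop_def img_class_def e fundamental_group_one by (simp_all add: const_loops)
qed

lemma img_Cons:
  assumes "walk (i # w)" "w \<noteq> []" "img_loop (gallery_path (map R w))"
  shows "img_loop (gallery_path (map R (i # w)))"
    "img_class (gallery_path (map R (i # w))) =
       img_class (edge_path (R i) (R (hd w))) \<otimes>\<^bsub>plane2\<^esub> img_class (gallery_path (map R w))"
proof -
  have e: "(R i, R (hd w)) \<in> sal_edges H" using assms(1,2) by (cases w) (auto intro!: walk_edges)
  note E = img_edge[OF e]
  have c: "img_class (edge_path (R i) (R (hd w))) \<in> carrier plane2"
    unfolding E(2) using edge_img_loop[OF e] by (rule loop_class_carrier)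
  have "img_loop (gallery_path (map R (i # w))) \<and> img_class (gallery_path (map R (i # w))) =
       img_class (edge_path (R i) (R (hd w))) \<otimes>\<^bsub>plane2\<^esub> img_class (gallery_path (map R w))"
  proof (cases "tl w = []")
    case True
    then obtain k where k: "w = [k]" using assms(2) by (cases w) auto
    thus ?thesis using E(1) c img_const by simp
  next
    case False
    hence g: "gallery_path (map R (i # w)) = edge_path (R i) (R (hd w)) \<cdot> gallery_path (map R w)"
      using gallery_path_Cons[of "map R w" "R i"] assms(2) by (simp add: hd_map map_tl[symmetric])
    show ?thesis unfolding g using img_concat[OF E(1) assms(3)] by simp
  qed
  thus "img_loop (gallery_path (map R (i # w)))" "img_class (gallery_path (map R (i # w))) =
       img_class (edge_path (R i) (R (hd w))) \<otimes>\<^bsub>plane2\<^esub> img_class (gallery_path (map R w))" by auto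
qed

lemma img_up: "img_loop (gallery_path (map R [i..i + int d])) \<and>
  img_class (gallery_path (map R [i..i + int d])) = list_prod plane2 (map LU [i..i + int d - 1])"
proof (induction d arbitrary: i)
  case 0 show ?case by (simp add: img_const)
next
  case (Suc d)
  have l: "[i..i + int (Suc d)] = i # [i + 1..(i + 1) + int d]" "[i..i + int (Suc d) - 1] = i # [i + 1..(i + 1) + int d - 1]"
    by (simp_all add: upto_rec1 add.assoc)
  have w: "[i + 1..(i + 1) + int d] \<noteq> []" "hd [i + 1..(i + 1) + int d] = i + 1" by (rule upto_ends; simp)+
  have "walk (i # [i + 1..(i + 1) + int d])" using walk_upto[of i "i + int (Suc d)"] unfolding l .
  from img_Cons[OF this w(1)] Suc.IH[of "i + 1"] show ?case
    unfolding l w(2) img_edge_up by simp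
qed

lemma img_down: "img_loop (gallery_path (map R (rev [i - int d..i]))) \<and>
  img_class (gallery_path (map R (rev [i - int d..i]))) = list_prod plane2 (map LD (rev [i - int d..i - 1]))"
proof (induction d arbitrary: i)
  case 0 show ?case by (simp add: img_const)
next
  case (Suc d)
  have l: "rev [i - int (Suc d)..i] = i # rev [(i - 1) - int d..i - 1]"
    "rev [i - int (Suc d)..i - 1] = (i - 1) # rev [(i - 1) - int d..(i - 1) - 1]"
    by (simp_all add: upto_rec2 diff_diff_eq add.commute)
  have "(i - 1) - int d \<le> i - 1" by simp
  from upto_ends[OF this] have w: "rev [(i - 1) - int d..i - 1] \<noteq> []" "hd (rev [(i - 1) - int d..i - 1]) = i - 1"
    by (simp_all only: hd_rev rev_is_Nil_conv not_False_eq_True)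
  have "walk (i # rev [(i - 1) - int d..i - 1])"
    using walk_rev[OF walk_upto[of "i - int (Suc d)" i]] unfolding l .
  from img_Cons[OF this w(1)] Suc.IH[of "i - 1"] show ?case
    unfolding l w(2) using img_edge_down[of "i - 1"] by simp
qed

text \<open>All edges along the tree paths carry the trivial label. So closing up a path along the
  tree will not change the class of its image.\<close>

lemma img_tree: "img_loop (tree (Vertex (R i)))" "img_class (tree (Vertex (R i))) = \<one>\<^bsub>plane2\<^esub>"
proof -
  obtain z where z: "- int m < z" "z \<le> int m" "R i = R z" by (rule region_repr)
  have "img_loop (tree (Vertex (R z))) \<and> img_class (tree (Vertex (R z))) = \<one>\<^bsub>plane2\<^esub>"
  proof (cases "0 \<le> z")
    case True
    have "LU k = \<one>\<^bsub>plane2\<^esub>" if "k \<in> set [0..z - 1]" for k using label_values(1)[of k m] that z by simp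
    hence "list_prod plane2 (map LU [0..z - 1]) = \<one>\<^bsub>plane2\<^esub>"
      by (intro K.list_prod_ones) (auto simp only: set_map image_iff)
    thus ?thesis using img_up[of 0 "nat z"] True z by (simp add: tree_R tree_word_up)
  next
    case False
    have "LD k = \<one>\<^bsub>plane2\<^esub>" if "k \<in> set (rev [z..- 1])" for k
      using label_values(5)[of "k + int m" m plane2 x'] that z by simp
    hence "list_prod plane2 (map LD (rev [z..- 1])) = \<one>\<^bsub>plane2\<^esub>"
      by (intro K.list_prod_ones) (auto simp only: set_map image_iff)
    thus ?thesis using img_down[of 0 "nat (- z)"] False z by (simp add: tree_R tree_word_down)
  qed
  thus "img_loop (tree (Vertex (R i)))" "img_class (tree (Vertex (R i))) = \<one>\<^bsub>plane2\<^esub>" using z(3) by auto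
qed

text \<open>By \<open>label_relation\<close> the images of the two boundary galleries have equal
  classes, and a homotopy between them fills in the disc.\<close>

lemma cell_extension:
  "\<exists>f. continuous_on (cball 0 1) f \<and> f ` cball 0 1 \<subseteq> P2 \<and>
     (\<forall>z. norm z = 1 \<longrightarrow> f z = sal_map (\<lambda>_ _. 2) (attaching_map H (\<Inter>H) (R i) z))"
proof (rule cell_words[of i])
  fix w w' assume w: "fst (cell_gallery_pair H (\<Inter>H) (R i)) = map R w"
    "snd (cell_gallery_pair H (\<Inter>H) (R i)) = map R w'"
    "w = up_word i \<and> w' = down_word i \<or> w = down_word i \<and> w' = up_word i"
  let ?p = "sal_map (\<lambda>_ _. 2) \<circ> gallery_path (map R w)" and ?q = "sal_map (\<lambda>_ _. 2) \<circ> gallery_path (map R w')"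
  have *: "img_loop (gallery_path (map R w))" "img_loop (gallery_path (map R w'))"
      "img_class (gallery_path (map R w)) = img_class (gallery_path (map R w'))"
    using w(3) img_up[of i m] img_down[of i m] label_relation[of i] by auto
  note * = *[unfolded img_loop_def img_class_def]
  have "path_hom (top_of_set P2) ?p ?q" using *(3) unfolding loop_class_eq_iff[OF *(1,2)] .
  hence "homotopic_paths P2 ?p ?q" by (simp add: path_hom_top_of_set)
  thus ?thesis
  proof (rule homotopic_paths_extend_disc)
    fix f assume "continuous_on (cball 0 1) f" "f ` cball 0 1 \<subseteq> P2"
      "\<And>z. norm z = 1 \<Longrightarrow> f z = (if Im z \<ge> 0 then ?p ((1 - Re z) / 2) else ?q ((1 - Re z) / 2))"
    thus ?thesis by (intro exI[of _ f] conjI allI impI) (simp_all add: attaching_map_def w(1,2))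
  qed
qed

definition cell_img :: "'a set \<Rightarrow> complex \<Rightarrow> complex" where
  "cell_img C = (SOME f. continuous_on (cball 0 1) f \<and> f ` cball 0 1 \<subseteq> P2 \<and>
     (\<forall>z. norm z = 1 \<longrightarrow> f z = sal_map (\<lambda>_ _. 2) (attaching_map H (\<Inter>H) C z)))"

lemma cell_img:
  "continuous_on (cball 0 1) (cell_img (R i))" "cell_img (R i) ` cball 0 1 \<subseteq> P2"
  "norm z = 1 \<Longrightarrow> cell_img (R i) z = sal_map (\<lambda>_ _. 2) (attaching_map H (\<Inter>H) (R i) z)"
  using someI_ex[OF cell_extension[of i]] unfolding cell_img_def by blast+

lemma sal_map_cell:
  assumes "norm z \<le> 1" shows "sal_map cell_img (cell_map H (\<Inter>H) (R i) z) = cell_img (R i) z"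
proof (cases "norm z < 1")
  case True thus ?thesis by (simp add: cell_map_def sal_map_def)
next
  case False
  hence z: "norm z = 1" using assms by simp
  have "sal_map cell_img (attaching_map H (\<Inter>H) (R i) z) = sal_map (\<lambda>_ _. 2) (attaching_map H (\<Inter>H) (R i) z)"
  proof (rule cell_words[of i])
    fix w w' assume w: "fst (cell_gallery_pair H (\<Inter>H) (R i)) = map R w"
      "snd (cell_gallery_pair H (\<Inter>H) (R i)) = map R w'"
      "w = up_word i \<and> w' = down_word i \<or> w = down_word i \<and> w' = up_word i"
    hence ne: "map R w \<noteq> []" "map R w' \<noteq> []" using words(1,2)[of i] by auto
    have "sal_map cell_img (gallery_path (map R w) t) = sal_map (\<lambda>_ _. 2) (gallery_path (map R w) t)" for t
      by (rule sal_map_gallery[OF ne(1)])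
    moreover have "sal_map cell_img (gallery_path (map R w') t) = sal_map (\<lambda>_ _. 2) (gallery_path (map R w') t)" for t
      by (rule sal_map_gallery[OF ne(2)])
    ultimately show ?thesis unfolding attaching_map_def w(1,2) by simp
  qed
  thus ?thesis using cell_img(3)[OF z] False by (simp add: cell_map_def)
qed

text \<open>For the quotient topology, continuity is tested after composition with every
  characteristic map; on an edge this gives \<open>edge_img\<close>, on a 2-cell
  \<open>cell_img\<close>.\<close>

lemma continuous_sal_map: "continuous_map (salvetti H) (top_of_set P2) (sal_map cell_img)"
proof -
  have edge: "continuous_map (top_of_set {0..1}) (top_of_set P2) (edge_img C D)" if "(C, D) \<in> sal_edges H" for C D
    using edge_img_loop[OF that] by (simp add: loops_def pathin_def)
  have cell: "continuous_map (top_of_set (cball 0 1)) (top_of_set P2) (cell_img (R i))" for i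
    using cell_img(1,2)[of i] by (auto simp: continuous_map_in_subtopology)
  have im: "sal_map cell_img p \<in> P2" if "p \<in> sal_points H" for p
    using that unfolding sal_points_def
  proof (elim UnE imageE CollectE exE conjE)
    fix C D t assume p: "p = Edge C D t" "(C, D) \<in> sal_edges H" "0 < t" "t < 1"
    have "pathin (top_of_set P2) (edge_img C D)" using edge_img_loop[OF p(2)] by (simp add: loops_def)
    from pathin_topspace[OF this, of t] p show ?thesis by (simp add: sal_map_def)
  next
    fix F C z assume p: "p = Cell F C z" "(F, C) \<in> sal_cells H" "norm z < 1"
    then obtain i where "C = R i" unfolding sal_cells_iff by blast
    have "cell_img (R i) z \<in> P2" by (rule subsetD[OF cell_img(2)], rule imageI) (use p in simp)
    thus ?thesis using p \<open>C = R i\<close> by (simp add: sal_map_def)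
  qed (simp add: sal_map_def)
  show ?thesis unfolding continuous_map_def
  proof (intro conjI allI impI)
    show "sal_map cell_img \<in> topspace (salvetti H) \<rightarrow> topspace (top_of_set P2)"
      using im unfolding topspace_salvetti by auto
    fix U assume U: "openin (top_of_set P2) U"
    have 1: "openin (top_of_set {0..1}) {t \<in> {0..1}. edge_path C D t \<in> {p \<in> sal_points H. sal_map cell_img p \<in> U}}"
      if e: "(C, D) \<in> sal_edges H" for C D
    proof -
      have "{t \<in> {0..1}. edge_path C D t \<in> {p \<in> sal_points H. sal_map cell_img p \<in> U}} = {t \<in> topspace (top_of_set {0..1}). edge_img C D t \<in> U}"
        using sal_map_edge_path[OF e] edge_path_points[OF e] by auto
      thus ?thesis using openin_continuous_map_preimage[OF edge[OF e] U] by simp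
    qed
    have 2: "openin (top_of_set (cball 0 1)) {z \<in> cball 0 1. cell_map H F C z \<in> {p \<in> sal_points H. sal_map cell_img p \<in> U}}"
      if e: "(F, C) \<in> sal_cells H" for F C
    proof -
      obtain i where i: "F = \<Inter>H" "C = R i" using e unfolding sal_cells_iff by blast
      have "{z \<in> cball 0 1. cell_map H F C z \<in> {p \<in> sal_points H. sal_map cell_img p \<in> U}} = {z \<in> topspace (top_of_set (cball 0 1)). cell_img (R i) z \<in> U}"
        unfolding i using sal_map_cell cell_map_points by auto
      thus ?thesis using openin_continuous_map_preimage[OF cell[of i] U] by simp
    qed
    show "openin (salvetti H) {p \<in> topspace (salvetti H). sal_map cell_img p \<in> U}"
      unfolding topspace_salvetti openin_salvetti salvetti_open_def using 1 2 by auto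
  qed
qed

text \<open>The homomorphism induced by \<open>sal_map cell_img\<close> does it: a generator is an
  edge closed up along the tree, the tree parts have trivial image, and the edge goes to its
  prescribed label.\<close>

lemma universal: "\<exists>\<phi>\<in>hom SG plane2. \<forall>i<m. \<phi> (xg i) = x' i \<and> \<phi> (yg i) = y' i"
proof -
  obtain \<phi> where hom: "\<phi> \<in> hom SG plane2" and \<phi>: "\<And>p. p \<in> loops (salvetti H) (Vertex B) \<Longrightarrow>
      \<phi> (loop_class (salvetti H) (Vertex B) p) = loop_class (top_of_set P2) 2 (sal_map cell_img \<circ> p)"
    using fundamental_group_induced[OF continuous_sal_map, of "Vertex B" 2] by (auto simp: sal_map_def)
  have rev1: "img_loop (path_reverse p) \<and> img_class (path_reverse p) = \<one>\<^bsub>plane2\<^esub>"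
    if p: "img_loop p" "img_class p = \<one>\<^bsub>plane2\<^esub>" for p
  proof -
    let ?q = "sal_map (\<lambda>_ _. 2) \<circ> p"
    have r: "sal_map (\<lambda>_ _. 2) \<circ> path_reverse p = path_reverse ?q" by (auto simp: path_reverse_def)
    have q1: "?q \<in> loops (top_of_set P2) 2" using p(1) by (simp add: img_loop_def)
    note q = q1 reverse_loops[OF q1]
    have "pathin (top_of_set P2) ?q" "?q 0 = 2" using q by (auto simp: loops_def)
    hence "path_hom (top_of_set P2) (?q \<cdot> path_reverse ?q) (\<lambda>_. 2)" using path_hom_inverse_right by metis
    hence "loop_class (top_of_set P2) 2 (?q \<cdot> path_reverse ?q) = \<one>\<^bsub>plane2\<^esub>"
      unfolding fundamental_group_one using q by (subst loop_class_eq_iff) (auto simp: concat_loops const_loops)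
    hence "loop_class (top_of_set P2) 2 ?q \<otimes>\<^bsub>plane2\<^esub> loop_class (top_of_set P2) 2 (path_reverse ?q) = \<one>\<^bsub>plane2\<^esub>"
      using q by (simp add: loop_class_mult)
    moreover have "loop_class (top_of_set P2) 2 (path_reverse ?q) \<in> carrier plane2" by (rule loop_class_carrier[OF q(2)])
    ultimately show ?thesis using p(2) q unfolding img_loop_def img_class_def r by simp
  qed
  have edge: "\<phi> (T.closed_up (edge_path (R i) (R k))) = img_class (edge_path (R i) (R k))" if ik: "k = i + 1 \<or> k = i - 1" for i k
  proof -
    let ?p = "tree (Vertex (R i)) \<cdot> (edge_path (R i) (R k) \<cdot> path_reverse (tree (Vertex (R k))))"
    note e = walk_edges[OF ik]
    have l: "?p \<in> loops (salvetti H) (Vertex B)" using T.closed_up_loop[OF pathin_edge_path[OF e]] by simp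
    have g: "sal_map cell_img (tree (Vertex (R j)) t) = sal_map (\<lambda>_ _. 2) (tree (Vertex (R j)) t)" for j t
      unfolding tree_R by (rule sal_map_gallery) (simp add: tree_word_facts)
    have ee: "sal_map cell_img (edge_path C D t) = sal_map (\<lambda>_ _. 2) (edge_path C D t)" for C D t
      by (simp add: sal_map_def edge_path_def)
    have "sal_map cell_img \<circ> ?p = sal_map (\<lambda>_ _. 2) \<circ> ?p"
      by (rule ext) (simp add: path_concat_def path_reverse_def g ee)
    hence "\<phi> (T.closed_up (edge_path (R i) (R k))) = img_class ?p"
      unfolding T.closed_up_def using \<phi>[OF l] by (simp add: img_class_def)
    also have "\<dots> = img_class (edge_path (R i) (R k))"
    proof -
      note E = img_edge[OF e]
      have c: "img_class (edge_path (R i) (R k)) \<in> carrier plane2"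
        unfolding E(2) by (rule loop_class_carrier[OF edge_img_loop[OF e]])
      note r = rev1[OF img_tree[of k]]
      note a = img_concat[OF E(1) r[THEN conjunct1]]
      show ?thesis using img_concat[OF img_tree(1)[of i] a(1)] a(2) r img_tree(2)[of i] c by simp
    qed
    finally show ?thesis .
  qed
  have "\<phi> (xg i) = x' i \<and> \<phi> (yg i) = y' i" if "i < m" for i
  proof
    show "\<phi> (xg i) = x' i" unfolding xg_def down_class_def
      using edge[of "int i" "int i + 1"] img_edge_down label_values(3)[of "int i" m] that by simp
    show "\<phi> (yg i) = y' i" unfolding yg_def up_class_def
      using edge[of "int m + int i + 1" "int m + int i"] img_edge_up label_values(2)[of "int i" m] that by simp
  qed
  thus ?thesis using hom by blast
qed

end

end

section \<open>The shard interval\<close>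

context rank2_arrangement
begin

text \<open>After unfolding, the shard interval and its length function are literally those of the
  abstract pencil group with generators \<open>xg\<close> and \<open>yg\<close>.\<close>

lemma twist_interval_structure:
  "lattice (twist_interval H B)" "planar_poset (twist_interval H B)"
  "\<And>p. p \<in> carrier (twist_interval H B) \<Longrightarrow> \<exists>!k. is_word_length H B p k"
  "\<And>p q. covers (twist_interval H B) p q \<Longrightarrow> shard_length H B q = shard_length H B p + 1"
  "rank_gen_fun (twist_interval H B) (shard_length H B)
     = 1 + (\<Sum>k=1..m-1. monom (2 * int (m choose k) - 2) k) + monom 1 m"
  "card (max_chains (twist_interval H B)) = m * 2 ^ (m - 2)"
proof -
  obtain \<alpha> \<gamma> \<nu> where \<alpha>\<gamma>: "\<alpha> \<in> carrier plane2" "\<gamma> \<in> carrier plane2"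
      "\<alpha> \<otimes>\<^bsub>plane2\<^esub> \<gamma> \<noteq> \<gamma> \<otimes>\<^bsub>plane2\<^esub> \<alpha>"
      and \<nu>: "\<nu> \<alpha> = (1 :: complex)"
      "\<And>P Q. P \<in> carrier plane2 \<Longrightarrow> Q \<in> carrier plane2 \<Longrightarrow> \<nu> (P \<otimes>\<^bsub>plane2\<^esub> Q) = \<nu> P + \<nu> Q"
    by (rule plane2_noncommuting) blast
  interpret P: pencil_group SG plane2 xg yg m \<alpha> \<gamma> \<nu>
  proof (intro pencil_group.intro pencil_group_axioms.intro)
    show "group SG" "group plane2" by (rule group_SG group_plane2)+
    show "3 \<le> m" by (rule m3)
    show "pencil_rel SG m xg yg" by (rule pencil_rel_SG)
    show "\<exists>\<phi>\<in>hom SG plane2. \<forall>i<m. \<phi> (xg i) = x' i \<and> \<phi> (yg i) = y' i"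
      if "pencil_rel plane2 m x' y'" for x' y' by (rule universal[OF that])
  qed (rule \<alpha>\<gamma> \<nu>; assumption?)+
  have tw: "full_twist H B = P.twist"
    by (simp add: full_twist_eq P.twist_def P.X_def P.val_def P.xs_def P.sorted_list_lessThan o_def P.letter_def)
  have int: "twist_interval H B = P.interval"
    unfolding twist_interval_def P.interval_def pure_shard_order_def P.mon_ord_def pure_shard_monoid_def
      P.mon_def shard_generators_eq tw ..
  have wl: "is_word_length H B p k \<longleftrightarrow> (\<exists>w. P.valid w \<and> length w = k \<and> P.val w = p)" for p k
    unfolding is_word_length_def shard_generators_eq by (rule P.word_length)
  have len: "shard_length H B = P.len" unfolding shard_length_def P.len_def wl ..
  show "lattice (twist_interval H B)" "planar_poset (twist_interval H B)"
    "rank_gen_fun (twist_interval H B) (shard_length H B)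
     = 1 + (\<Sum>k=1..m-1. monom (2 * int (m choose k) - 2) k) + monom 1 m"
    "card (max_chains (twist_interval H B)) = m * 2 ^ (m - 2)"
    unfolding int len by (rule P.interval_structure)+
  show "\<exists>!k. is_word_length H B p k" if "p \<in> carrier (twist_interval H B)" for p
    using P.word_length_unique that unfolding int wl .
  show "shard_length H B q = shard_length H B p + 1" if "covers (twist_interval H B) p q" for p q
    using P.interval_structure(5) that unfolding int len .
qed

end

theorem theorem1p3:
  fixes H :: "'a::euclidean_space set set" and B :: "'a set" and m :: nat
  assumes "central_arrangement H"
    and "arrangement_rank H = 2"
    and "card H = m"
    and "m \<ge> 3"
    and "B \<in> regions H"
  shows "lattice (twist_interval H B)
    \<and> planar_poset (twist_interval H B)
    \<and> (\<forall>p\<in>carrier (twist_interval H B). \<exists>!k. is_word_length H B p k)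
    \<and> (\<forall>p p'. covers (twist_interval H B) p p'
          \<longrightarrow> shard_length H B p' = shard_length H B p + 1)
    \<and> rank_gen_fun (twist_interval H B) (shard_length H B)
        = 1 + (\<Sum>k=1..m-1. monom (2 * int (m choose k) - 2) k) + monom 1 m
    \<and> card (max_chains (twist_interval H B)) = m * 2 ^ (m - 2)"
proof -
  have comp: "B \<in> components (- \<Union>H)" using assms(5) by (simp add: regions_def)
  \<comment> \<open>Any point of the base region can serve to normalise the normal vectors.\<close>
  obtain b where b: "b \<in> B" using in_components_nonempty[OF comp] by blast
  have bH: "b \<notin> \<Union>H" using in_components_subset[OF comp] b by blast
  have m2: "2 \<le> m" using assms(4) by simp
  show ?thesis
  proof (rule rank2_normals[OF assms(1,2) bH assms(3) m2])
    fix u v :: 'a and c :: "nat \<Rightarrow> real"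
    assume "H = (\<lambda>j. {x. (u + c j *\<^sub>R v) \<bullet> x = 0}) ` {..<m}"
      "\<And>i j. i < j \<Longrightarrow> j < m \<Longrightarrow> c i < c j" "u \<bullet> b = 1" "v \<bullet> b = 0" "v \<noteq> 0"
    then interpret rank2_arrangement H B m u v b c
      by (intro rank2_arrangement.intro assms b)
    show ?thesis by (intro conjI ballI allI impI twist_interval_structure)
  qed
qed

end
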